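(* Let $k$ be a commutative ring, $A$ a dg algebra over $k$, and $A_t$ a cdg deformation of $A$ over $k[[t]]$. The torsion $A_t$-modules $\Gamma_0,\Gamma_1,\Gamma_2,\dots$ are homotopy projective compact generators of $D^t(A_t)^{\mathrm{tor}}$. That is: $\mathrm{Hom}_{\mathrm{Hot}(A_t)^{\mathrm{tor}}}(\Gamma_i,N)=0$ for every $t$-acyclic torsion module $N$ and every $i\ge 0$; each $\Gamma_i$ is compact in $D^t(A_t)^{\mathrm{tor}}$; and an object $M\in D^t(A_t)^{\mathrm{tor}}$ is zero if and only if $\mathrm{Hom}_{D^t(A_t)^{\mathrm{tor}}}(\Gamma_i,M[l])=0$ for all $i\ge 0$ and $l\in\mathbb Z$.
   Context: Graded objects are $\mathbb Z$-graded with cohomological differentials; algebras are associative and unital. A cdg algebra over a commutative ring $R$ is a graded $R$-algebra $\mathcal A$ with a degree $1$ derivation $d$ and a curvature $c\in\mathcal A^2$ with $d(c)=0$, $d^2=[c,-]$; a dg algebra is a cdg algebra with $c=0$. A (left) cdg $\mathcal A$-module is a graded left $\mathcal A$-module $M$ with a degree $1$ derivation $d_M$ over $d$ with $d_M^2m=cm$. The cdg modules form a dg category $\mathcal A\text{-Mod}$: the degree $p$ morphisms are the degree $p$ graded $\mathcal A$-linear maps, with differential $(df)(m)=d_N(f(m))-(-1)^pf(d_Mm)$; its $H^0$ is triangulated. A cdg deformation $A_t$ of $A$ over $k[[t]]$ is a cdg algebra structure over $k[[t]]$ on the graded module $A[[t]]$ (with degree $i$ component $A^i[[t]]$) which reduces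 modulo $t$ to the dg algebra $A$; its curvature $c$ lies in $tA_t$. Put $A_i=A_t/t^{i+1}A_t$ for $i\ge0$ and $A_{-1}=0$. A cdg $A_t$-module is torsion if each of its elements is annihilated by some power of $t$; $\mathrm{Hot}(A_t)^{\mathrm{tor}}$ is the homotopy category of the full dg subcategory of torsion $A_t$-modules. For a torsion module $M$ with $t$-action $t_M$, the quotients $\ker t_M^{i+1}/\ker t_M^i$, $i\ge0$, are dg $A$-modules; $M$ is $t$-acyclic if all of them are acyclic. $D^t(A_t)^{\mathrm{tor}}$ is the Verdier quotient of $\mathrm{Hot}(A_t)^{\mathrm{tor}}$ by the $t$-acyclic modules; it has small coproducts. The modules $\Gamma_i$: let $\frac ct\in A_t^2$ be such that $t\cdot\frac ct=c$. Let $\pi:A_i\to A_{i-1}$ be the projection and $t:A_{i-1}\to A_i$ the map induced by multiplication by $t$. For $i\ge 0$, $\Gamma_i$ is the graded left $A_t$-module $A_i\oplus A_{i-1}[1]$ (with the usual sign convention for the shift of left modules) with predifferential $d_{\Gamma_i}(\alpha,a)=(d_{A_i}\alpha+ta,\,-d_{A_{i-1}}a+\pi(\alpha\frac ct))$; it is a torsion cdg $A_t$-module. *)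

theory Defs
  imports "HOL-Algebra.Module" "HOL-Algebra.AbelCoset" "HOL-Algebra.Free_Abelian_Groups"
begin

section \<open>Power series\<close>

definition pser :: "('k, 'z) ring_scheme \<Rightarrow> (nat \<Rightarrow> 'k) ring" where
  "pser k = \<lparr>carrier = {f. \<forall>n. f n \<in> carrier k},
     monoid.mult = (\<lambda>f g n. \<Oplus>\<^bsub>k\<^esub>i\<in>{..n}. f i \<otimes>\<^bsub>k\<^esub> g (n - i)),
     one = (\<lambda>n. if n = 0 then \<one>\<^bsub>k\<^esub> else \<zero>\<^bsub>k\<^esub>),
     ring.zero = (\<lambda>n. \<zero>\<^bsub>k\<^esub>),
     add = (\<lambda>f g n. f n \<oplus>\<^bsub>k\<^esub> g n)\<rparr>"

definition tvar :: "('k, 'z) ring_scheme \<Rightarrow> nat \<Rightarrow> 'k" where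
  "tvar k = (\<lambda>n. if n = 1 then \<one>\<^bsub>k\<^esub> else \<zero>\<^bsub>k\<^esub>)"

text \<open>The ring-multiplication fields inherited by the library's record of modules play no role;
  they are set to \<open>undefined\<close> throughout.\<close>

definition pser_module :: "('k, 'v) module \<Rightarrow> (nat \<Rightarrow> 'k, nat \<Rightarrow> 'v) module" where
  "pser_module V = \<lparr>carrier = {f. \<forall>n. f n \<in> carrier V},
     monoid.mult = undefined, one = undefined,
     ring.zero = (\<lambda>n. \<zero>\<^bsub>V\<^esub>),
     add = (\<lambda>f g n. f n \<oplus>\<^bsub>V\<^esub> g n),
     smult = (\<lambda>r f n. \<Oplus>\<^bsub>V\<^esub>i\<in>{..n}. r i \<odot>\<^bsub>V\<^esub> f (n - i))\<rparr>"

section \<open>Cdg algebras and cdg modules\<close>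

text \<open>A graded object is the \<open>\<int>\<close>-indexed family \<open>gr\<close> of its homogeneous components, and only
  homogeneous elements occur: \<open>act M p q a m\<close> is \<open>a m\<close> for \<open>a\<close> of degree \<open>p\<close> and \<open>m\<close> of degree \<open>q\<close>,
  and \<open>dif M n\<close> is the predifferential on the component of degree \<open>n\<close>. An algebra is recorded as a
  left module over itself, so \<open>act A\<close> is the multiplication of \<open>A\<close>, together with its unit and
  its curvature.\<close>

record ('r, 'a, 'm) cdgm =
  gr :: "int \<Rightarrow> ('r, 'm) module"
  act :: "int \<Rightarrow> int \<Rightarrow> 'a \<Rightarrow> 'm \<Rightarrow> 'm"
  dif :: "int \<Rightarrow> 'm \<Rightarrow> 'm"

record ('r, 'a) cdga = "('r, 'a, 'a) cdgm" +
  unit :: 'a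
  curv :: 'a

text \<open>\<open>psgn V p x = (-1)\<^sup>p x\<close>\<close>

definition psgn :: "('m, 'z) ring_scheme \<Rightarrow> int \<Rightarrow> 'm \<Rightarrow> 'm" where
  "psgn V p x = (if even p then x else \<ominus>\<^bsub>V\<^esub> x)"

definition lin_maps ::
  "('r, 'z) ring_scheme \<Rightarrow> ('r, 'v) module \<Rightarrow> ('r, 'w) module \<Rightarrow> ('v \<Rightarrow> 'w) set" where
  "lin_maps R V W = {f \<in> hom (add_monoid V) (add_monoid W).
     \<forall>r\<in>carrier R. \<forall>x\<in>carrier V. f (r \<odot>\<^bsub>V\<^esub> x) = r \<odot>\<^bsub>W\<^esub> f x}"

locale graded_module_derivation = cring R
  for R :: "('r, 'z) ring_scheme" (structure)
    and A :: "('r, 'a, 'ax) cdga_scheme"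
    and M :: "('r, 'a, 'm, 'mx) cdgm_scheme" +
  assumes gr_module: "module R (gr M n)"
    and act_lin_right: "a \<in> carrier (gr A p) \<Longrightarrow>
          act M p q a \<in> lin_maps R (gr M q) (gr M (p + q))"
    and act_lin_left: "x \<in> carrier (gr M q) \<Longrightarrow>
          (\<lambda>a. act M p q a x) \<in> lin_maps R (gr A p) (gr M (p + q))"
    and act_assoc: "a \<in> carrier (gr A p) \<Longrightarrow> b \<in> carrier (gr A q) \<Longrightarrow> x \<in> carrier (gr M s) \<Longrightarrow>
          act M p (q + s) a (act M q s b x) = act M (p + q) s (act A p q a b) x"
    and unit_closed: "unit A \<in> carrier (gr A 0)"
    and act_unit: "x \<in> carrier (gr M n) \<Longrightarrow> act M 0 n (unit A) x = x"
    and dif_lin: "dif M n \<in> lin_maps R (gr M n) (gr M (n + 1))"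
    and dif_act: "a \<in> carrier (gr A p) \<Longrightarrow> x \<in> carrier (gr M q) \<Longrightarrow>
          dif M (p + q) (act M p q a x) =
          act M (p + 1) q (dif A p a) x
            \<oplus>\<^bsub>gr M (p + q + 1)\<^esub> psgn (gr M (p + q + 1)) p (act M p (q + 1) a (dif M q x))"

text \<open>Since \<open>c\<close> has even degree, the graded commutator \<open>[c, x]\<close> is \<open>c x - x c\<close>.\<close>

locale cdg_algebra = graded_module_derivation R A A
  for R :: "('r, 'z) ring_scheme" (structure) and A :: "('r, 'a) cdga" +
  assumes mult_unit: "x \<in> carrier (gr A n) \<Longrightarrow> act A n 0 x (unit A) = x"
    and curv_closed: "curv A \<in> carrier (gr A 2)"
    and dif_curv: "dif A 2 (curv A) = \<zero>\<^bsub>gr A 3\<^esub>"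
    and dif_dif: "x \<in> carrier (gr A n) \<Longrightarrow>
          dif A (n + 1) (dif A n x) =
          act A 2 n (curv A) x \<ominus>\<^bsub>gr A (n + 2)\<^esub> act A n 2 x (curv A)"

locale dg_algebra = cdg_algebra +
  assumes curv_zero: "curv A = \<zero>\<^bsub>gr A 2\<^esub>"

locale cdg_module = cdg_algebra R A + M: graded_module_derivation R A M
  for R :: "('r, 'z) ring_scheme" (structure)
    and A :: "('r, 'a) cdga" and M :: "('r, 'a, 'm) cdgm" +
  assumes dif_dif_module: "x \<in> carrier (gr M n) \<Longrightarrow>
          dif M (n + 1) (dif M n x) = act M 2 n (curv A) x"

text \<open>The coefficient at \<open>0\<close> of a power series is its reduction modulo \<open>t\<close>.\<close>

locale cdg_deformation = dg_algebra k A + At: cdg_algebra "pser k" At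
  for k :: "('k, 'z) ring_scheme"
    and A :: "('k, 'a) cdga" and At :: "(nat \<Rightarrow> 'k, nat \<Rightarrow> 'a) cdga" +
  assumes gr_deformation: "gr At n = pser_module (gr A n)"
    and act_reduction: "x \<in> carrier (gr At p) \<Longrightarrow> y \<in> carrier (gr At q) \<Longrightarrow>
          act At p q x y 0 = act A p q (x 0) (y 0)"
    and dif_reduction: "x \<in> carrier (gr At n) \<Longrightarrow> dif At n x 0 = dif A n (x 0)"
    and unit_reduction: "unit At 0 = unit A"
    and curv_reduction: "curv At 0 = curv A"

section \<open>Constructions on graded modules\<close>

definition shift :: "int \<Rightarrow> ('r, 'a, 'm) cdgm \<Rightarrow> ('r, 'a, 'm) cdgm" where
  "shift l M = \<lparr>gr = (\<lambda>n. gr M (n + l)),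
     act = (\<lambda>p q a x. psgn (gr M (p + q + l)) (l * p) (act M p (q + l) a x)),
     dif = (\<lambda>n x. psgn (gr M (n + l + 1)) l (dif M (n + l) x))\<rparr>"

definition dsum_module :: "('r, 'm) module \<Rightarrow> ('r, 'n) module \<Rightarrow> ('r, 'm \<times> 'n) module" where
  "dsum_module V W = \<lparr>carrier = carrier V \<times> carrier W,
     monoid.mult = undefined, one = undefined,
     ring.zero = (\<zero>\<^bsub>V\<^esub>, \<zero>\<^bsub>W\<^esub>),
     add = (\<lambda>(v, w) (v', w'). (v \<oplus>\<^bsub>V\<^esub> v', w \<oplus>\<^bsub>W\<^esub> w')),
     smult = (\<lambda>r (v, w). (r \<odot>\<^bsub>V\<^esub> v, r \<odot>\<^bsub>W\<^esub> w))\<rparr>"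

definition dsum :: "('r, 'a, 'm) cdgm \<Rightarrow> ('r, 'a, 'n) cdgm \<Rightarrow> ('r, 'a, 'm \<times> 'n) cdgm" where
  "dsum M N = \<lparr>gr = (\<lambda>n. dsum_module (gr M n) (gr N n)),
     act = (\<lambda>p q a (x, y). (act M p q a x, act N p q a y)),
     dif = (\<lambda>n (x, y). (dif M n x, dif N n y))\<rparr>"

text \<open>The cone \<open>N \<oplus> M[1]\<close> of a closed morphism \<open>f : M \<rightarrow> N\<close> of degree \<open>0\<close>\<close>

definition cone :: "('r, 'a, 'm) cdgm \<Rightarrow> ('r, 'a, 'n) cdgm \<Rightarrow> (int \<Rightarrow> 'm \<Rightarrow> 'n)
    \<Rightarrow> ('r, 'a, 'n \<times> 'm) cdgm" where
  "cone M N f = dsum N (shift 1 M) \<lparr>dif := (\<lambda>n (y, x).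
     (dif N n y \<oplus>\<^bsub>gr N (n + 1)\<^esub> f (n + 1) x, dif (shift 1 M) n x))\<rparr>"

definition submod :: "('r, 'a, 'm) cdgm \<Rightarrow> (int \<Rightarrow> 'm set) \<Rightarrow> ('r, 'a, 'm) cdgm" where
  "submod M K = M \<lparr>gr := (\<lambda>n. (gr M n)\<lparr>carrier := K n\<rparr>)\<rparr>"

text \<open>\<open>coset_map W H f X\<close> is the image of the coset \<open>X\<close> under the map to \<open>W/H\<close> induced by \<open>f\<close>:
  the union has a single member whenever the induced map is well defined.\<close>

definition coset_map :: "('w, 'z) ring_scheme \<Rightarrow> 'w set \<Rightarrow> ('v \<Rightarrow> 'w) \<Rightarrow> 'v set \<Rightarrow> 'w set" where
  "coset_map W H f X = (\<Union>x\<in>X. H +>\<^bsub>W\<^esub> f x)"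

definition quot_module :: "('r, 'm) module \<Rightarrow> 'm set \<Rightarrow> ('r, 'm set) module" where
  "quot_module V H = \<lparr>carrier = a_rcosets\<^bsub>V\<^esub> H,
     monoid.mult = undefined, one = undefined,
     ring.zero = H,
     add = (\<lambda>X Y. X <+>\<^bsub>V\<^esub> Y),
     smult = (\<lambda>r. coset_map V H (\<lambda>x. r \<odot>\<^bsub>V\<^esub> x))\<rparr>"

definition quot :: "('r, 'a, 'm) cdgm \<Rightarrow> (int \<Rightarrow> 'm set) \<Rightarrow> ('r, 'a, 'm set) cdgm" where
  "quot M H = \<lparr>gr = (\<lambda>n. quot_module (gr M n) (H n)),
     act = (\<lambda>p q a. coset_map (gr M (p + q)) (H (p + q)) (act M p q a)),
     dif = (\<lambda>n. coset_map (gr M (n + 1)) (H (n + 1)) (dif M n))\<rparr>"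

definition acyclic :: "('r, 'a, 'm) cdgm \<Rightarrow> bool" where
  "acyclic M \<longleftrightarrow> (\<forall>n. \<forall>x\<in>carrier (gr M n). dif M n x = \<zero>\<^bsub>gr M (n + 1)\<^esub> \<longrightarrow>
     (\<exists>y\<in>carrier (gr M (n - 1)). dif M (n - 1) y = x))"

text \<open>Transport of structure along a map \<open>e\<close> that is injective on every component\<close>

definition transport :: "('m \<Rightarrow> 'n) \<Rightarrow> ('r, 'a, 'm) cdgm \<Rightarrow> ('r, 'a, 'n) cdgm" where
  "transport e M = (let r = (\<lambda>n. inv_into (carrier (gr M n)) e) in
     \<lparr>gr = (\<lambda>n. \<lparr>carrier = e ` carrier (gr M n),
          monoid.mult = undefined, one = undefined,
          ring.zero = e \<zero>\<^bsub>gr M n\<^esub>,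
          add = (\<lambda>x y. e (r n x \<oplus>\<^bsub>gr M n\<^esub> r n y)),
          smult = (\<lambda>s x. e (s \<odot>\<^bsub>gr M n\<^esub> r n x))\<rparr>),
      act = (\<lambda>p q a x. e (act M p q a (r q x))),
      dif = (\<lambda>n x. e (dif M n (r n x)))\<rparr>)"

section \<open>Torsion modules and the modules \<open>\<Gamma>\<^sub>i\<close>\<close>

definition tpow :: "('k, 'z) ring_scheme \<Rightarrow> nat \<Rightarrow> nat \<Rightarrow> 'k" where
  "tpow k i = tvar k [^]\<^bsub>pser k\<^esub> i"

definition torsion :: "('k, 'z) ring_scheme \<Rightarrow> (nat \<Rightarrow> 'k, 'a, 'm) cdgm \<Rightarrow> bool" where
  "torsion k M \<longleftrightarrow>
     (\<forall>n. \<forall>x\<in>carrier (gr M n). \<exists>i. tpow k i \<odot>\<^bsub>gr M n\<^esub> x = \<zero>\<^bsub>gr M n\<^esub>)"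

definition ker_t :: "('k, 'z) ring_scheme \<Rightarrow> (nat \<Rightarrow> 'k, 'a, 'm) cdgm \<Rightarrow> nat \<Rightarrow> int \<Rightarrow> 'm set" where
  "ker_t k M i n = {x \<in> carrier (gr M n). tpow k i \<odot>\<^bsub>gr M n\<^esub> x = \<zero>\<^bsub>gr M n\<^esub>}"

text \<open>The quotients \<open>ker t\<^sup>i\<^sup>+\<^sup>1 / ker t\<^sup>i\<close> are kept as modules over \<open>A\<^sub>t\<close>; as \<open>t\<close> acts by zero on
  them, their module structure is that of a dg module over \<open>A = A\<^sub>t / t A\<^sub>t\<close>.\<close>

definition t_acyclic :: "('k, 'z) ring_scheme \<Rightarrow> (nat \<Rightarrow> 'k, 'a, 'm) cdgm \<Rightarrow> bool" where
  "t_acyclic k M \<longleftrightarrow> (\<forall>i. acyclic (quot (submod M (ker_t k M (i + 1))) (ker_t k M i)))"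

definition tideal ::
  "('k, 'z) ring_scheme \<Rightarrow> (nat \<Rightarrow> 'k, nat \<Rightarrow> 'a) cdga \<Rightarrow> nat \<Rightarrow> int \<Rightarrow> (nat \<Rightarrow> 'a) set" where
  "tideal k At i n = (\<lambda>x. tpow k i \<odot>\<^bsub>gr At n\<^esub> x) ` carrier (gr At n)"

text \<open>The index is off by one from the usual \<open>A\<^sub>i = A\<^sub>t / t\<^sup>i\<^sup>+\<^sup>1 A\<^sub>t\<close>, so that \<open>A\<^sub>-\<^sub>1 = 0\<close> is covered:
  \<open>A_quot k At i = A\<^sub>t / t\<^sup>i A\<^sub>t = A\<^sub>i\<^sub>-\<^sub>1\<close>.\<close>

definition A_quot :: "('k, 'z) ring_scheme \<Rightarrow> (nat \<Rightarrow> 'k, nat \<Rightarrow> 'a) cdga \<Rightarrow> nat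
    \<Rightarrow> (nat \<Rightarrow> 'k, nat \<Rightarrow> 'a, (nat \<Rightarrow> 'a) set) cdgm" where
  "A_quot k At i = quot (cdgm.truncate At) (tideal k At i)"

definition Gamma :: "('k, 'z) ring_scheme \<Rightarrow> (nat \<Rightarrow> 'k, nat \<Rightarrow> 'a) cdga \<Rightarrow> (nat \<Rightarrow> 'a) \<Rightarrow> nat
    \<Rightarrow> (nat \<Rightarrow> 'k, nat \<Rightarrow> 'a, (nat \<Rightarrow> 'a) set \<times> (nat \<Rightarrow> 'a) set) cdgm" where
  "Gamma k At ct i =
     (let P = A_quot k At (i + 1);
          Q = A_quot k At i;
          t_map = (\<lambda>n. coset_map (gr At n) (tideal k At (i + 1) n) (\<lambda>x. tvar k \<odot>\<^bsub>gr At n\<^esub> x));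
          pi_ct = (\<lambda>n. coset_map (gr At (n + 2)) (tideal k At i (n + 2)) (\<lambda>x. act At n 2 x ct))
      in dsum P (shift 1 Q) \<lparr>dif := (\<lambda>n (\<alpha>, a).
           (dif P n \<alpha> \<oplus>\<^bsub>gr P (n + 1)\<^esub> t_map (n + 1) a,
            dif (shift 1 Q) n a \<oplus>\<^bsub>gr Q (n + 2)\<^esub> pi_ct n \<alpha>))\<rparr>)"

section \<open>Preadditive categories, Verdier localisation and compactness\<close>

text \<open>The Hom groups are abelian groups in the multiplicative notation of the library's groups, so
  \<open>\<otimes>\<close> is addition of morphisms and \<open>\<one>\<close> is the zero morphism. \<open>Comp C X Y Z g f\<close> is \<open>g \<circ> f\<close>
  for \<open>f : X \<rightarrow> Y\<close> and \<open>g : Y \<rightarrow> Z\<close>.\<close>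

record ('o, 'f) acat =
  Ob :: "'o set"
  Hom :: "'o \<Rightarrow> 'o \<Rightarrow> 'f monoid"
  Comp :: "'o \<Rightarrow> 'o \<Rightarrow> 'o \<Rightarrow> 'f \<Rightarrow> 'f \<Rightarrow> 'f"
  Idm :: "'o \<Rightarrow> 'f"

definition zero_object :: "('o, 'f) acat \<Rightarrow> 'o \<Rightarrow> bool" where
  "zero_object C X \<longleftrightarrow> X \<in> Ob C \<and>
     (\<forall>Y\<in>Ob C. carrier (Hom C X Y) = {\<one>\<^bsub>Hom C X Y\<^esub>} \<and>
               carrier (Hom C Y X) = {\<one>\<^bsub>Hom C Y X\<^esub>})"

definition is_coproduct ::
  "('o, 'f) acat \<Rightarrow> 'i set \<Rightarrow> ('i \<Rightarrow> 'o) \<Rightarrow> 'o \<Rightarrow> ('i \<Rightarrow> 'f) \<Rightarrow> bool" where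
  "is_coproduct C J M P \<iota> \<longleftrightarrow> P \<in> Ob C \<and>
     (\<forall>j\<in>J. M j \<in> Ob C \<and> \<iota> j \<in> carrier (Hom C (M j) P)) \<and>
     (\<forall>Z\<in>Ob C. \<forall>\<phi>. (\<forall>j\<in>J. \<phi> j \<in> carrier (Hom C (M j) Z)) \<longrightarrow>
        (\<exists>!f. f \<in> carrier (Hom C P Z) \<and> (\<forall>j\<in>J. Comp C (M j) P Z f (\<iota> j) = \<phi> j)))"

text \<open>\<open>X\<close> is compact if \<open>Hom(X, -)\<close> commutes with small coproducts, where small means indexed by a
  subset of the type \<open>'i\<close>: the canonical map \<open>\<Oplus>\<^sub>j Hom(X, M\<^sub>j) \<rightarrow> Hom(X, \<Coprod>\<^sub>j M\<^sub>j)\<close>,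
  \<open>(x\<^sub>j) \<mapsto> \<Sum>\<^sub>j \<iota>\<^sub>j x\<^sub>j\<close>, is an isomorphism. Here \<open>gfinprod\<close> is the sum of a finitely supported family.\<close>

definition compact_object :: "'i itself \<Rightarrow> ('o, 'f) acat \<Rightarrow> 'o \<Rightarrow> bool" where
  "compact_object TI C X \<longleftrightarrow> X \<in> Ob C \<and>
     (\<forall>(J :: 'i set) M P \<iota>. is_coproduct C J M P \<iota> \<longrightarrow>
        (\<lambda>x. gfinprod (Hom C X P) (\<lambda>j. Comp C X (M j) P (\<iota> j) (x j)) J)
          \<in> iso (sum_group J (\<lambda>j. Hom C X (M j))) (Hom C X P))"

text \<open>The localisation of \<open>C\<close> at a class \<open>W\<close> of morphisms admitting a calculus of right fractions
  and containing the identities. A morphism \<open>X \<rightarrow> Y\<close> is a class of roofs \<open>X \<leftarrow> L \<rightarrow> Y\<close>, given as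
  \<open>(L, s, f)\<close> with \<open>s\<close> in \<open>W L X\<close>. Two roofs are equivalent if they are dominated by a third one.
  Sums are formed over a common denominator.\<close>

type_synonym ('o, 'f) roof = "'o \<times> 'f \<times> 'f"

definition roofs ::
  "('o, 'f) acat \<Rightarrow> ('o \<Rightarrow> 'o \<Rightarrow> 'f set) \<Rightarrow> 'o \<Rightarrow> 'o \<Rightarrow> ('o, 'f) roof set" where
  "roofs C W X Y = {(L, s, f). L \<in> Ob C \<and> s \<in> W L X \<and> f \<in> carrier (Hom C L Y)}"

definition roof_rel ::
  "('o, 'f) acat \<Rightarrow> ('o \<Rightarrow> 'o \<Rightarrow> 'f set) \<Rightarrow> 'o \<Rightarrow> 'o \<Rightarrow> (('o, 'f) roof \<times> ('o, 'f) roof) set" where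
  "roof_rel C W X Y = {((L, s, f), (L', s', f')).
     (L, s, f) \<in> roofs C W X Y \<and> (L', s', f') \<in> roofs C W X Y \<and>
     (\<exists>K\<in>Ob C. \<exists>u\<in>carrier (Hom C K L). \<exists>u'\<in>carrier (Hom C K L').
        Comp C K L X s u = Comp C K L' X s' u' \<and> Comp C K L X s u \<in> W K X \<and>
        Comp C K L Y f u = Comp C K L' Y f' u')}"

definition localisation ::
  "('o, 'f) acat \<Rightarrow> ('o \<Rightarrow> 'o \<Rightarrow> 'f set) \<Rightarrow> ('o, ('o, 'f) roof set) acat" where
  "localisation C W = \<lparr>
     Ob = Ob C,
     Hom = (\<lambda>X Y. \<lparr>carrier = roofs C W X Y // roof_rel C W X Y,
        monoid.mult = (\<lambda>\<phi> \<psi>. \<Union>{roof_rel C W X Y `` {(L, s, f \<otimes>\<^bsub>Hom C L Y\<^esub> g)} | L s f g.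
          (L, s, f) \<in> \<phi> \<and> (L, s, g) \<in> \<psi>}),
        one = roof_rel C W X Y `` {(X, Idm C X, \<one>\<^bsub>Hom C X Y\<^esub>)}\<rparr>),
     Comp = (\<lambda>X Y Z \<psi> \<phi>. \<Union>{roof_rel C W X Z `` {(K, Comp C K L X s w, Comp C K L' Z g h)}
        | K L L' s f s' g w h.
          (L, s, f) \<in> \<phi> \<and> (L', s', g) \<in> \<psi> \<and> K \<in> Ob C \<and> w \<in> W K L \<and>
          h \<in> carrier (Hom C K L') \<and> Comp C K L Y f w = Comp C K L' Y s' h}),
     Idm = (\<lambda>X. roof_rel C W X X `` {(X, Idm C X, Idm C X)})\<rparr>"

section \<open>The homotopy category and its Verdier quotient\<close>

text \<open>The group of graded \<open>A\<close>-linear maps of degree \<open>p\<close>: \<open>f (a x) = (-1)\<^bsup>p |a|\<^esup> a f(x)\<close>. Maps are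
  extensional on every component, so that they form a group. Linearity over the ground ring
  follows from linearity over \<open>A\<close>.\<close>

definition hom_complex :: "('r, 'a) cdga \<Rightarrow> ('r, 'a, 'm) cdgm \<Rightarrow> ('r, 'a, 'n) cdgm \<Rightarrow> int
    \<Rightarrow> (int \<Rightarrow> 'm \<Rightarrow> 'n) monoid" where
  "hom_complex A M N p = \<lparr>
     carrier = {f. \<forall>n.
       f n \<in> extensional (carrier (gr M n)) \<and>
       f n \<in> hom (add_monoid (gr M n)) (add_monoid (gr N (n + p))) \<and>
       (\<forall>q. \<forall>a\<in>carrier (gr A q). \<forall>x\<in>carrier (gr M n).
          f (q + n) (act M q n a x) =
          psgn (gr N (q + n + p)) (p * q) (act N q (n + p) a (f n x)))},
     monoid.mult = (\<lambda>f g n. \<lambda>x\<in>carrier (gr M n). f n x \<oplus>\<^bsub>gr N (n + p)\<^esub> g n x),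
     one = (\<lambda>n. \<lambda>x\<in>carrier (gr M n). \<zero>\<^bsub>gr N (n + p)\<^esub>)\<rparr>"

definition hom_dif :: "('r, 'a, 'm) cdgm \<Rightarrow> ('r, 'a, 'n) cdgm \<Rightarrow> int
    \<Rightarrow> (int \<Rightarrow> 'm \<Rightarrow> 'n) \<Rightarrow> (int \<Rightarrow> 'm \<Rightarrow> 'n)" where
  "hom_dif M N p f = (\<lambda>n. \<lambda>x\<in>carrier (gr M n).
     dif N (n + p) (f n x) \<ominus>\<^bsub>gr N (n + p + 1)\<^esub>
     psgn (gr N (n + p + 1)) p (f (n + 1) (dif M n x)))"

definition closed_maps :: "('r, 'a) cdga \<Rightarrow> ('r, 'a, 'm) cdgm \<Rightarrow> ('r, 'a, 'n) cdgm
    \<Rightarrow> (int \<Rightarrow> 'm \<Rightarrow> 'n) monoid" where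
  "closed_maps A M N = (hom_complex A M N 0)
     \<lparr>carrier := {f \<in> carrier (hom_complex A M N 0).
        hom_dif M N 0 f = \<one>\<^bsub>hom_complex A M N 1\<^esub>}\<rparr>"

definition exact_maps :: "('r, 'a) cdga \<Rightarrow> ('r, 'a, 'm) cdgm \<Rightarrow> ('r, 'a, 'n) cdgm
    \<Rightarrow> (int \<Rightarrow> 'm \<Rightarrow> 'n) set" where
  "exact_maps A M N = hom_dif M N (-1) ` carrier (hom_complex A M N (-1))"

text \<open>\<open>Hot(A\<^sub>t)\<^sup>t\<^sup>o\<^sup>r\<close>, on the modules whose components have their underlying sets inside the
  type \<open>'u\<close>, which plays the role of the universe of small sets. If \<open>'u\<close> is infinite, these modules
  are closed, up to isomorphism, under cones and under direct sums indexed by subsets of \<open>'u\<close>.\<close>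

definition Hot_tor :: "('k, 'z) ring_scheme \<Rightarrow> (nat \<Rightarrow> 'k, nat \<Rightarrow> 'a) cdga
    \<Rightarrow> ((nat \<Rightarrow> 'k, nat \<Rightarrow> 'a, 'u) cdgm, (int \<Rightarrow> 'u \<Rightarrow> 'u) set) acat" where
  "Hot_tor k At = \<lparr>
     Ob = {M. cdg_module (pser k) At M \<and> torsion k M},
     Hom = (\<lambda>M N. closed_maps At M N Mod exact_maps At M N),
     Comp = (\<lambda>L M N G F. \<Union>g\<in>G. \<Union>f\<in>F.
        exact_maps At L N #>\<^bsub>closed_maps At L N\<^esub>
          (\<lambda>n. compose (carrier (gr L n)) (g n) (f n))),
     Idm = (\<lambda>M. exact_maps At M M #>\<^bsub>closed_maps At M M\<^esub> (\<lambda>n. \<lambda>x\<in>carrier (gr M n). x))\<rparr>"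

definition t_isos :: "('k, 'z) ring_scheme \<Rightarrow> (nat \<Rightarrow> 'k, nat \<Rightarrow> 'a) cdga
    \<Rightarrow> (nat \<Rightarrow> 'k, nat \<Rightarrow> 'a, 'u) cdgm \<Rightarrow> (nat \<Rightarrow> 'k, nat \<Rightarrow> 'a, 'u) cdgm
    \<Rightarrow> (int \<Rightarrow> 'u \<Rightarrow> 'u) set set" where
  "t_isos k At M N = {F \<in> carrier (Hom (Hot_tor k At) M N). \<exists>f\<in>F. t_acyclic k (cone M N f)}"

text \<open>The Verdier quotient by the \<open>t\<close>-acyclic modules: morphisms with \<open>t\<close>-acyclic cone are inverted.\<close>

definition Dt_tor :: "('k, 'z) ring_scheme \<Rightarrow> (nat \<Rightarrow> 'k, nat \<Rightarrow> 'a) cdga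
    \<Rightarrow> ((nat \<Rightarrow> 'k, nat \<Rightarrow> 'a, 'u) cdgm,
        ((nat \<Rightarrow> 'k, nat \<Rightarrow> 'a, 'u) cdgm, (int \<Rightarrow> 'u \<Rightarrow> 'u) set) roof set) acat" where
  "Dt_tor k At = localisation (Hot_tor k At) (t_isos k At)"

end

theory Submission
  imports Defs "HOL-Algebra.Generated_Groups"
begin

text \<open>Closed maps \<open>\<Gamma>\<^sub>i \<rightarrow> N\<close> are determined by the images \<open>x\<close>, \<open>y\<close> of the two generators, which are
  subject to \<open>t\<^sup>i\<^sup>+\<^sup>1 x = 0\<close>, \<open>t\<^sup>i y = 0\<close>, \<open>d x = (c/t) y\<close> and \<open>d y = t x\<close>; the null-homotopic ones are the pairs
  \<open>(d u + (c/t) v, d v + t u)\<close>. A \<open>t\<close>-acyclic module is exactly one for which every such pair, in every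
  degree, is of the latter form: both directions are inductions on \<open>i\<close> through the filtration by the
  kernels of \<open>t\<^sup>i\<close>. So the groups \<open>Hom(\<Gamma>\<^sub>i, N[l])\<close> detect \<open>t\<close>-acyclicity, and morphisms with \<open>t\<close>-acyclic
  cone are those inducing bijections on them; hence \<open>\<Gamma>\<^sub>i\<close> is homotopy projective and morphisms out of it
  are the same in the Verdier quotient. For compactness, a coproduct \<open>P\<close> of \<open>L\<^sub>j\<close> in the quotient is
  compared with the cone of \<open>\<Oplus>\<^sub>j L\<^sub>j \<rightarrow> P\<close>: it receives only the zero map from \<open>P\<close>, and a map \<open>\<Gamma>\<^sub>i \<rightarrow> P\<close>
  that dies in it factors through finitely many \<open>L\<^sub>j\<close>, since it is given by two elements.\<close>

section \<open>Right fractions in preadditive categories\<close>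

text \<open>With its own differential \<open>A_i\<close> is in general no cdg module: there
  \<open>d^2\<close> is the commutator with \<open>c\<close>, not left multiplication by
  \<open>c\<close>. The summand \<open>A_(i-1)[1]\<close>, glued on by \<open>t\<close> and
  \<open>c/t\<close>, supplies the missing \<open>x c = t (x (c/t))\<close>; hence two generators
  and the coupled equations on pairs. Two obstacles shape the rest. A coproduct in the quotient is
  known only through its universal property, and its coprojections are roofs. So \<open>P\<close> is
  compared with the direct sum of the apexes of these roofs, whose numerators are honest maps, and
  not with a direct sum of the given objects. Moreover, all objects of the homotopy category live on
  one type \<open>'u\<close>, whereas fibres, direct sums and the modules \<open>\<Gamma>_i\<close>
  are built on products, function types and sets of cosets. They are treated in their natural types
  and then moved into \<open>'u\<close> along an injection, which cardinality provides for fibres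
  and cofibres. Triangles are avoided throughout: the morphisms to be inverted are handled as maps
  that are bijective on pairs modulo boundaries, Ore squares come from homotopy fibres, and long
  exact sequences are replaced by chases in cones.\<close>

locale frac_cat =
  fixes C :: "('o, 'f) acat" and W :: "'o \<Rightarrow> 'o \<Rightarrow> 'f set"
  assumes hom_group: "X \<in> Ob C \<Longrightarrow> Y \<in> Ob C \<Longrightarrow> comm_group (Hom C X Y)"
    and comp_closed: "\<lbrakk>X \<in> Ob C; Y \<in> Ob C; Z \<in> Ob C; f \<in> carrier (Hom C X Y); g \<in> carrier (Hom C Y Z)\<rbrakk>
      \<Longrightarrow> Comp C X Y Z g f \<in> carrier (Hom C X Z)"
    and comp_assoc: "\<lbrakk>X \<in> Ob C; Y \<in> Ob C; Z \<in> Ob C; V \<in> Ob C; f \<in> carrier (Hom C X Y);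
      g \<in> carrier (Hom C Y Z); h \<in> carrier (Hom C Z V)\<rbrakk>
      \<Longrightarrow> Comp C X Y V (Comp C Y Z V h g) f = Comp C X Z V h (Comp C X Y Z g f)"
    and id_closed: "X \<in> Ob C \<Longrightarrow> Idm C X \<in> carrier (Hom C X X)"
    and id_left: "\<lbrakk>X \<in> Ob C; Y \<in> Ob C; f \<in> carrier (Hom C X Y)\<rbrakk> \<Longrightarrow> Comp C X Y Y (Idm C Y) f = f"
    and id_right: "\<lbrakk>X \<in> Ob C; Y \<in> Ob C; f \<in> carrier (Hom C X Y)\<rbrakk> \<Longrightarrow> Comp C X X Y f (Idm C X) = f"
    and comp_mult_left: "\<lbrakk>X \<in> Ob C; Y \<in> Ob C; Z \<in> Ob C; f \<in> carrier (Hom C X Y);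
      g \<in> carrier (Hom C Y Z); g' \<in> carrier (Hom C Y Z)\<rbrakk>
      \<Longrightarrow> Comp C X Y Z (g \<otimes>\<^bsub>Hom C Y Z\<^esub> g') f = Comp C X Y Z g f \<otimes>\<^bsub>Hom C X Z\<^esub> Comp C X Y Z g' f"
    and comp_mult_right: "\<lbrakk>X \<in> Ob C; Y \<in> Ob C; Z \<in> Ob C; f \<in> carrier (Hom C X Y);
      f' \<in> carrier (Hom C X Y); g \<in> carrier (Hom C Y Z)\<rbrakk>
      \<Longrightarrow> Comp C X Y Z g (f \<otimes>\<^bsub>Hom C X Y\<^esub> f') = Comp C X Y Z g f \<otimes>\<^bsub>Hom C X Z\<^esub> Comp C X Y Z g f'"
    and W_hom: "\<lbrakk>X \<in> Ob C; Y \<in> Ob C; s \<in> W X Y\<rbrakk> \<Longrightarrow> s \<in> carrier (Hom C X Y)"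
    and W_id: "X \<in> Ob C \<Longrightarrow> Idm C X \<in> W X X"
    and W_comp: "\<lbrakk>X \<in> Ob C; Y \<in> Ob C; Z \<in> Ob C; s \<in> W X Y; u \<in> W Y Z\<rbrakk> \<Longrightarrow> Comp C X Y Z u s \<in> W X Z"
    and W_cancel_left: "\<lbrakk>X \<in> Ob C; Y \<in> Ob C; Z \<in> Ob C; s \<in> W Y Z; u \<in> carrier (Hom C X Y);
      Comp C X Y Z s u \<in> W X Z\<rbrakk> \<Longrightarrow> u \<in> W X Y"
    and W_cancel_right: "\<lbrakk>X \<in> Ob C; Y \<in> Ob C; Z \<in> Ob C; u \<in> W X Y; s \<in> carrier (Hom C Y Z);
      Comp C X Y Z s u \<in> W X Z\<rbrakk> \<Longrightarrow> s \<in> W Y Z"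
    and ore: "\<lbrakk>X \<in> Ob C; Y \<in> Ob C; L \<in> Ob C; f \<in> carrier (Hom C X Y); s \<in> W L Y\<rbrakk>
      \<Longrightarrow> \<exists>K\<in>Ob C. \<exists>w\<in>W K X. \<exists>h\<in>carrier (Hom C K L). Comp C K X Y f w = Comp C K L Y s h"
begin

abbreviation D where "D \<equiv> localisation C W"

abbreviation cls where "cls X Y r \<equiv> roof_rel C W X Y `` {r}"

lemma one_mor: "\<lbrakk>X \<in> Ob C; Y \<in> Ob C\<rbrakk> \<Longrightarrow> \<one>\<^bsub>Hom C X Y\<^esub> \<in> carrier (Hom C X Y)"
  by (meson comm_groupE(2) hom_group)

lemma comp_one_right:
  assumes "X \<in> Ob C" "Y \<in> Ob C" "Z \<in> Ob C" "g \<in> carrier (Hom C Y Z)"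
  shows "Comp C X Y Z g \<one>\<^bsub>Hom C X Y\<^esub> = \<one>\<^bsub>Hom C X Z\<^esub>"
proof -
  interpret A: comm_group "Hom C X Y" using hom_group assms by blast
  interpret B: comm_group "Hom C X Z" using hom_group assms by blast
  have "Comp C X Y Z g \<one>\<^bsub>Hom C X Y\<^esub> = Comp C X Y Z g \<one>\<^bsub>Hom C X Y\<^esub> \<otimes>\<^bsub>Hom C X Z\<^esub> Comp C X Y Z g \<one>\<^bsub>Hom C X Y\<^esub>"
    using comp_mult_right[of X Y Z "\<one>\<^bsub>Hom C X Y\<^esub>" "\<one>\<^bsub>Hom C X Y\<^esub>" g] assms by simp
  then show ?thesis using comp_closed[OF assms(1,2,3) A.one_closed assms(4)]
    by simp
qed

lemma comp_one_left:
  assumes "X \<in> Ob C" "Y \<in> Ob C" "Z \<in> Ob C" "f \<in> carrier (Hom C X Y)"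
  shows "Comp C X Y Z \<one>\<^bsub>Hom C Y Z\<^esub> f = \<one>\<^bsub>Hom C X Z\<^esub>"
proof -
  interpret A: comm_group "Hom C Y Z" using hom_group assms by blast
  interpret B: comm_group "Hom C X Z" using hom_group assms by blast
  have "Comp C X Y Z \<one>\<^bsub>Hom C Y Z\<^esub> f = Comp C X Y Z \<one>\<^bsub>Hom C Y Z\<^esub> f \<otimes>\<^bsub>Hom C X Z\<^esub> Comp C X Y Z \<one>\<^bsub>Hom C Y Z\<^esub> f"
    using comp_mult_left[of X Y Z f "\<one>\<^bsub>Hom C Y Z\<^esub>" "\<one>\<^bsub>Hom C Y Z\<^esub>"] assms by simp
  then show ?thesis using comp_closed[OF assms(1,2,3,4) A.one_closed]
    by simp
qed

lemma in_roofs: "(L, s, f) \<in> roofs C W X Y \<longleftrightarrow> L \<in> Ob C \<and> s \<in> W L X \<and> f \<in> carrier (Hom C L Y)"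
  by (simp add: roofs_def)

lemma roof_relI:
  assumes "(L, s, f) \<in> roofs C W X Y" "(L', s', f') \<in> roofs C W X Y" "K \<in> Ob C"
    "u \<in> carrier (Hom C K L)" "u' \<in> carrier (Hom C K L')"
    "Comp C K L X s u = Comp C K L' X s' u'" "Comp C K L X s u \<in> W K X"
    "Comp C K L Y f u = Comp C K L' Y f' u'"
  shows "((L, s, f), (L', s', f')) \<in> roof_rel C W X Y"
  unfolding roof_rel_def using assms by blast

lemma roof_relE:
  assumes "((L, s, f), (L', s', f')) \<in> roof_rel C W X Y"
  obtains K u u' where "(L, s, f) \<in> roofs C W X Y" "(L', s', f') \<in> roofs C W X Y" "K \<in> Ob C"
    "u \<in> carrier (Hom C K L)" "u' \<in> carrier (Hom C K L')"
    "Comp C K L X s u = Comp C K L' X s' u'" "Comp C K L X s u \<in> W K X"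
    "Comp C K L Y f u = Comp C K L' Y f' u'"
  using assms unfolding roof_rel_def by blast

text \<open>Only transitivity has content: the apexes of the two dominating roofs are joined by an
  Ore square over the apex of the middle roof.\<close>

lemma equiv_roof_rel:
  assumes X: "X \<in> Ob C" and Y: "Y \<in> Ob C"
  shows "equiv (roofs C W X Y) (roof_rel C W X Y)"
proof (rule equivI)
  show "roof_rel C W X Y \<subseteq> roofs C W X Y \<times> roofs C W X Y"
    by (auto simp: roof_rel_def)
  show "refl_on (roofs C W X Y) (roof_rel C W X Y)"
  proof (rule refl_onI)
    fix r assume "r \<in> roofs C W X Y"
    then obtain L s f where r: "r = (L, s, f)" "(L, s, f) \<in> roofs C W X Y"
      by (cases r) auto
    then have L: "L \<in> Ob C" "s \<in> W L X" by (simp_all add: in_roofs)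
    have "((L, s, f), (L, s, f)) \<in> roof_rel C W X Y"
      using r(2) L by (intro roof_relI[of _ _ _ _ _ _ _ _ L "Idm C L" "Idm C L"])
        (auto simp: id_closed id_right W_hom X)
    then show "(r, r) \<in> roof_rel C W X Y" by (simp add: r)
  qed
  show "sym (roof_rel C W X Y)"
  proof (rule symI)
    fix r r' assume 1: "(r, r') \<in> roof_rel C W X Y"
    obtain L s f where r: "r = (L, s, f)" by (cases r)
    obtain L' s' f' where r': "r' = (L', s', f')" by (cases r')
    from 1 show "(r', r) \<in> roof_rel C W X Y" unfolding r r'
      by (elim roof_relE) (rule roof_relI, auto)
  qed
  show "trans (roof_rel C W X Y)"
  proof (rule transI)
    fix r1 r2 r3 assume 1: "(r1, r2) \<in> roof_rel C W X Y" and 2: "(r2, r3) \<in> roof_rel C W X Y"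
    obtain L1 s1 f1 where r1: "r1 = (L1, s1, f1)" by (cases r1)
    obtain L2 s2 f2 where r2: "r2 = (L2, s2, f2)" by (cases r2)
    obtain L3 s3 f3 where r3: "r3 = (L3, s3, f3)" by (cases r3)
    from 1 obtain K u u' where K: "(L1, s1, f1) \<in> roofs C W X Y" "(L2, s2, f2) \<in> roofs C W X Y" "K \<in> Ob C"
      "u \<in> carrier (Hom C K L1)" "u' \<in> carrier (Hom C K L2)"
      "Comp C K L1 X s1 u = Comp C K L2 X s2 u'" "Comp C K L1 X s1 u \<in> W K X"
      "Comp C K L1 Y f1 u = Comp C K L2 Y f2 u'"
      unfolding r1 r2 by (rule roof_relE)
    from 2 obtain M v v' where M: "(L3, s3, f3) \<in> roofs C W X Y" "M \<in> Ob C"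
      "v \<in> carrier (Hom C M L2)" "v' \<in> carrier (Hom C M L3)"
      "Comp C M L2 X s2 v = Comp C M L3 X s3 v'" "Comp C M L2 X s2 v \<in> W M X"
      "Comp C M L2 Y f2 v = Comp C M L3 Y f3 v'"
      unfolding r3 r2 by (rule roof_relE)
    note L = K(1,2)[unfolded in_roofs] M(1)[unfolded in_roofs]
    \<comment> \<open>\<open>s2\<close> and its composite with \<open>v\<close> are in
      \<open>W\<close>, so \<open>v\<close> is too by two-out-of-three; this is what admits the Ore
      square of \<open>u'\<close> against \<open>v\<close>.\<close>
    have vW: "v \<in> W M L2" using W_cancel_left[of M L2 X s2 v] L M X by blast
    obtain N w h where N: "N \<in> Ob C" "w \<in> W N K" "h \<in> carrier (Hom C N M)"
      "Comp C N K L2 u' w = Comp C N M L2 v h"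
      using ore[of K L2 M u' v] K M L vW by blast
    have wh: "w \<in> carrier (Hom C N K)" using N K W_hom by blast
    have s: "s1 \<in> carrier (Hom C L1 X)" "s2 \<in> carrier (Hom C L2 X)" "s3 \<in> carrier (Hom C L3 X)"
      using L W_hom X by auto
    have f: "f1 \<in> carrier (Hom C L1 Y)" "f2 \<in> carrier (Hom C L2 Y)" "f3 \<in> carrier (Hom C L3 Y)"
      using L by auto
    \<comment> \<open>Used twice: for the denominators, with target \<open>X\<close>, and for the
      numerators, with target \<open>Y\<close>.\<close>
    have eq: "Comp C N L1 Z g1 (Comp C N K L1 u w) = Comp C N L3 Z g3 (Comp C N M L3 v' h)"
      if "Z \<in> Ob C" "g1 \<in> carrier (Hom C L1 Z)" "g2 \<in> carrier (Hom C L2 Z)" "g3 \<in> carrier (Hom C L3 Z)"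
        "Comp C K L1 Z g1 u = Comp C K L2 Z g2 u'" "Comp C M L2 Z g2 v = Comp C M L3 Z g3 v'"
      for Z g1 g2 g3
    proof -
      have "Comp C N L1 Z g1 (Comp C N K L1 u w) = Comp C N K Z (Comp C K L1 Z g1 u) w"
        using that L K N wh by (intro comp_assoc[symmetric]) auto
      also have "\<dots> = Comp C N L2 Z g2 (Comp C N K L2 u' w)"
        unfolding that(5) using that L K N wh by (intro comp_assoc) auto
      also have "\<dots> = Comp C N M Z (Comp C M L2 Z g2 v) h"
        unfolding N(4) using that L K M N wh by (intro comp_assoc[symmetric]) auto
      also have "\<dots> = Comp C N L3 Z g3 (Comp C N M L3 v' h)"
        unfolding that(6) using that L K M N wh by (intro comp_assoc) auto
      finally show ?thesis .
    qed
    have "Comp C N L1 X s1 (Comp C N K L1 u w) = Comp C N K X (Comp C K L1 X s1 u) w"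
      using s L K N wh X by (intro comp_assoc[symmetric]) auto
    also have "\<dots> \<in> W N X" using W_comp N K X by blast
    finally have W: "Comp C N L1 X s1 (Comp C N K L1 u w) \<in> W N X" .
    show "(r1, r3) \<in> roof_rel C W X Y" unfolding r1 r3
    proof (rule roof_relI[OF K(1) M(1) N(1) _ _ _ W])
      show "Comp C N K L1 u w \<in> carrier (Hom C N L1)" "Comp C N M L3 v' h \<in> carrier (Hom C N L3)"
        using comp_closed L K M N wh by auto
      show "Comp C N L1 X s1 (Comp C N K L1 u w) = Comp C N L3 X s3 (Comp C N M L3 v' h)"
        using eq[OF X s K(6) M(5)] .
      show "Comp C N L1 Y f1 (Comp C N K L1 u w) = Comp C N L3 Y f3 (Comp C N M L3 v' h)"
        using eq[OF Y f K(8) M(7)] .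
    qed
  qed
qed

lemma cls_eq:
  "\<lbrakk>X \<in> Ob C; Y \<in> Ob C; (r, r') \<in> roof_rel C W X Y\<rbrakk> \<Longrightarrow> cls X Y r = cls X Y r'"
  by (meson equiv_roof_rel equiv_class_eq)

lemma cls_eqD:
  "\<lbrakk>X \<in> Ob C; Y \<in> Ob C; r' \<in> roofs C W X Y; cls X Y r = cls X Y r'\<rbrakk> \<Longrightarrow> (r, r') \<in> roof_rel C W X Y"
  by (meson equiv_roof_rel eq_equiv_class)

lemma cls_self: "\<lbrakk>X \<in> Ob C; Y \<in> Ob C; r \<in> roofs C W X Y\<rbrakk> \<Longrightarrow> r \<in> cls X Y r"
  by (meson equiv_roof_rel equiv_class_self)

lemma Hom_D: "carrier (Hom D X Y) = roofs C W X Y // roof_rel C W X Y"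
  by (simp add: localisation_def)

lemma cls_closed: "(L, s, f) \<in> roofs C W X Y \<Longrightarrow> cls X Y (L, s, f) \<in> carrier (Hom D X Y)"
  by (simp add: Hom_D quotientI)

lemma Hom_D_cases:
  assumes "\<phi> \<in> carrier (Hom D X Y)"
  obtains L s f where "(L, s, f) \<in> roofs C W X Y" "\<phi> = cls X Y (L, s, f)"
  using assms unfolding Hom_D by (elim quotientE) auto

lemma one_D: "\<one>\<^bsub>Hom D X Y\<^esub> = cls X Y (X, Idm C X, \<one>\<^bsub>Hom C X Y\<^esub>)"
  by (simp add: localisation_def)

lemma unit_roof: "\<lbrakk>X \<in> Ob C; f \<in> carrier (Hom C X Y)\<rbrakk> \<Longrightarrow> (X, Idm C X, f) \<in> roofs C W X Y"
  by (simp add: in_roofs W_id)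

lemma roof_rel_post:
  assumes "X \<in> Ob C" "Y \<in> Ob C" "Z \<in> Ob C" "j \<in> carrier (Hom C Y Z)"
    "((L, s, f), (L', s', f')) \<in> roof_rel C W X Y"
  shows "((L, s, Comp C L Y Z j f), (L', s', Comp C L' Y Z j f')) \<in> roof_rel C W X Z"
proof -
  from assms(5) obtain K u u' where K: "(L, s, f) \<in> roofs C W X Y" "(L', s', f') \<in> roofs C W X Y" "K \<in> Ob C"
    "u \<in> carrier (Hom C K L)" "u' \<in> carrier (Hom C K L')"
    "Comp C K L X s u = Comp C K L' X s' u'" "Comp C K L X s u \<in> W K X"
    "Comp C K L Y f u = Comp C K L' Y f' u'"
    by (rule roof_relE)
  note L = K(1,2)[unfolded in_roofs]
  have "Comp C K L Z (Comp C L Y Z j f) u = Comp C K L' Z (Comp C L' Y Z j f') u'"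
    using comp_assoc[of K L Y Z u f j] comp_assoc[of K L' Y Z u' f' j] assms K L by simp
  then show ?thesis
    using K L assms comp_closed by (intro roof_relI[OF _ _ K(3,4,5,6,7)]) (auto simp: in_roofs)
qed

text \<open>\<open>Comp\<close> of the localisation is a union over all representatives of both
  classes and all Ore squares, so it is a class only if every choice yields the same one. For a
  genuine morphism \<open>j\<close> this is forced: after refinement, any roof equivalent to
  \<open>j\<close> has as numerator \<open>j\<close> composed with its denominator.\<close>

lemma comp_post:
  assumes X: "X \<in> Ob C" and Y: "Y \<in> Ob C" and Z: "Z \<in> Ob C" and j: "j \<in> carrier (Hom C Y Z)"
    and r: "(L, s, f) \<in> roofs C W X Y"
  shows "Comp D X Y Z (cls Y Z (Y, Idm C Y, j)) (cls X Y (L, s, f)) = cls X Z (L, s, Comp C L Y Z j f)"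
proof -
  note L = r[unfolded in_roofs]
  have sh: "s \<in> carrier (Hom C L X)" using L W_hom X by blast
  let ?S = "{cls X Z (K, Comp C K L1 X s1 w, Comp C K L' Z g h)
        | K L1 L' s1 f1 s' g w h.
          (L1, s1, f1) \<in> cls X Y (L, s, f) \<and> (L', s', g) \<in> cls Y Z (Y, Idm C Y, j) \<and> K \<in> Ob C \<and> w \<in> W K L1 \<and>
          h \<in> carrier (Hom C K L') \<and> Comp C K L1 Y f1 w = Comp C K L' Y s' h}"
  have sub: "S = cls X Z (L, s, Comp C L Y Z j f)" if "S \<in> ?S" for S
  proof -
    obtain K L1 L' s1 f1 s' g w h where S: "S = cls X Z (K, Comp C K L1 X s1 w, Comp C K L' Z g h)"
      "((L, s, f), (L1, s1, f1)) \<in> roof_rel C W X Y" "((Y, Idm C Y, j), (L', s', g)) \<in> roof_rel C W Y Z"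
      and K: "K \<in> Ob C" "w \<in> W K L1" "h \<in> carrier (Hom C K L')"
      "Comp C K L1 Y f1 w = Comp C K L' Y s' h"
      using \<open>S \<in> ?S\<close> by auto
    obtain M v u where M: "(L', s', g) \<in> roofs C W Y Z" "M \<in> Ob C" "v \<in> carrier (Hom C M Y)"
       "u \<in> carrier (Hom C M L')" "Comp C M Y Y (Idm C Y) v = Comp C M L' Y s' u"
       "Comp C M Y Y (Idm C Y) v \<in> W M Y" "Comp C M Y Z j v = Comp C M L' Z g u"
      using S(3) by (rule roof_relE)
    have r1: "(L1, s1, f1) \<in> roofs C W X Y" using S(2) by (rule roof_relE)
    note L' = r1[unfolded in_roofs] M(1)[unfolded in_roofs]
    \<comment> \<open>The roof of \<open>j\<close> has an identity as denominator, so
      \<open>v\<close> itself is the common denominator. Two-out-of-three then puts \<open>u\<close>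
      into \<open>W\<close>, which permits the Ore square of \<open>h\<close> against
      \<open>u\<close>.\<close>
    have v: "v \<in> W M Y" "v = Comp C M L' Y s' u" using M id_left Y by auto
    have u: "u \<in> W M L'" using v W_cancel_left[of M L' Y s' u] M L' Y by blast
    obtain N p q where N: "N \<in> Ob C" "p \<in> W N K" "q \<in> carrier (Hom C N M)"
        "Comp C N K L' h p = Comp C N M L' u q"
      using ore[of K L' M h u] K M L' u by blast
    have hs: "p \<in> carrier (Hom C N K)" "s1 \<in> carrier (Hom C L1 X)" "w \<in> carrier (Hom C K L1)"
       "s' \<in> carrier (Hom C L' Y)"
      using N K L' W_hom X Y by auto
    have sw: "Comp C K L1 X s1 w \<in> W K X" using W_comp[of K L1 X w s1] K L' X by auto
    have p2: "Comp C N K X (Comp C K L1 X s1 w) p \<in> W N X" using W_comp[of N K X p] N K sw X by auto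
    have wp: "Comp C N K L1 w p \<in> carrier (Hom C N L1)"
      using comp_closed[of N K L1 p w] N K L' hs by auto
    have jf: "Comp C L1 Y Z j f1 \<in> carrier (Hom C L1 Z)" using comp_closed L' j Y Z by auto
    have e: "Comp C N K Z (Comp C K L' Z g h) p = Comp C N L1 Z (Comp C L1 Y Z j f1) (Comp C N K L1 w p)"
    proof -
      have "Comp C N K Z (Comp C K L' Z g h) p = Comp C N L' Z g (Comp C N M L' u q)"
        using comp_assoc[of N K L' Z p h g] N K L' hs Z by auto
      also have "\<dots> = Comp C N M Z (Comp C M Y Z j v) q"
        using comp_assoc[of N M L' Z q u g] N M L' Z by auto
      also have "\<dots> = Comp C N Y Z j (Comp C N M Y v q)"
        using comp_assoc[of N M Y Z q v j] N M Y Z j by auto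
      also have "Comp C N M Y v q = Comp C N L' Y s' (Comp C N K L' h p)"
        unfolding v(2) N(4) using comp_assoc[of N M L' Y q u s'] N M L' Y hs by auto
      also have "\<dots> = Comp C N K Y (Comp C K L1 Y f1 w) p"
        unfolding K(4) using comp_assoc[of N K L' Y p h s'] N K L' Y hs by auto
      also have "\<dots> = Comp C N L1 Y f1 (Comp C N K L1 w p)"
        using comp_assoc[of N K L1 Y p w f1] N K L' Y hs by auto
      also have "Comp C N Y Z j \<dots> = Comp C N L1 Z (Comp C L1 Y Z j f1) (Comp C N K L1 w p)"
        using comp_assoc[of N L1 Y Z "Comp C N K L1 w p" f1 j] N L' Y Z j wp by auto
      finally show ?thesis .
    qed
    have rel1: "((K, Comp C K L1 X s1 w, Comp C K L' Z g h), (L1, s1, Comp C L1 Y Z j f1)) \<in> roof_rel C W X Z"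
    proof (rule roof_relI[OF _ _ N(1) hs(1) wp _ p2 e])
      show "(K, Comp C K L1 X s1 w, Comp C K L' Z g h) \<in> roofs C W X Z"
        using sw comp_closed[of K L' Z h g] K L' Z by (simp add: in_roofs)
      show "(L1, s1, Comp C L1 Y Z j f1) \<in> roofs C W X Z" using L' jf by (simp add: in_roofs)
      show "Comp C N K X (Comp C K L1 X s1 w) p = Comp C N L1 X s1 (Comp C N K L1 w p)"
        using comp_assoc[of N K L1 X p w s1] N K L' X hs by auto
    qed
    show ?thesis unfolding S(1)
      using cls_eq[OF X Z rel1] cls_eq[OF X Z roof_rel_post[OF X Y Z j S(2)]] by simp
  qed
  \<comment> \<open>Taking identities everywhere shows that the union is over a nonempty
    family.\<close>
  have "cls X Z (L, Comp C L L X s (Idm C L), Comp C L Y Z j f) \<in> ?S"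
  proof (intro CollectI exI conjI)
    show "(L, s, f) \<in> cls X Y (L, s, f)" using cls_self[OF X Y r] .
    show "(Y, Idm C Y, j) \<in> cls Y Z (Y, Idm C Y, j)" using cls_self[OF Y Z unit_roof[OF Y j]] .
    show "Idm C L \<in> W L L" using L W_id by auto
    show "Comp C L L Y f (Idm C L) = Comp C L Y Y (Idm C Y) f" using L Y id_left id_right by auto
  qed (use L in auto)
  then have "?S = {cls X Z (L, s, Comp C L Y Z j f)}" using sub by blast
  then show ?thesis by (simp add: localisation_def)
qed

text \<open>If identity and zero are equivalent roofs, the dominating roof has a leg in
  \<open>W\<close> that is a zero map, and cancellation moves this to \<open>M\<close>. Conversely,
  if zero is in \<open>W\<close>, Ore squares against it kill the numerators of roofs into
  \<open>M\<close>, while for roofs out of \<open>M\<close> the zero map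
  \<open>L \<rightarrow> M\<close> is itself an admissible common denominator.\<close>

lemma zero_object_iff:
  assumes M: "M \<in> Ob C"
  shows "zero_object D M \<longleftrightarrow> \<one>\<^bsub>Hom C M M\<^esub> \<in> W M M"
proof
  assume "zero_object D M"
  then have "carrier (Hom D M M) = {\<one>\<^bsub>Hom D M M\<^esub>}" using M by (auto simp: zero_object_def localisation_def)
  moreover have r: "(M, Idm C M, Idm C M) \<in> roofs C W M M" using M unit_roof id_closed by blast
  ultimately have "cls M M (M, Idm C M, Idm C M) = cls M M (M, Idm C M, \<one>\<^bsub>Hom C M M\<^esub>)"
    using cls_closed[OF r] one_D by auto
  then have "((M, Idm C M, Idm C M), (M, Idm C M, \<one>\<^bsub>Hom C M M\<^esub>)) \<in> roof_rel C W M M"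
    using M one_mor by (intro cls_eqD) (auto intro!: unit_roof)
  then obtain K u u' where K: "K \<in> Ob C" "u \<in> carrier (Hom C K M)" "u' \<in> carrier (Hom C K M)"
    "Comp C K M M (Idm C M) u \<in> W K M" "Comp C K M M (Idm C M) u = Comp C K M M \<one>\<^bsub>Hom C M M\<^esub> u'"
    by (rule roof_relE)
  \<comment> \<open>The leg \<open>u\<close> is in \<open>W\<close> and zero at once; composing it
    with the zero endomorphism gives \<open>u\<close> back, so right cancellation applies.\<close>
  have "u \<in> W K M" "u = \<one>\<^bsub>Hom C K M\<^esub>" using K M id_left comp_one_left by auto
  then show "\<one>\<^bsub>Hom C M M\<^esub> \<in> W M M"
    using W_cancel_right[of K M M u "\<one>\<^bsub>Hom C M M\<^esub>"] K M comp_one_left[of K M M u] one_mor by auto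
next
  assume z: "\<one>\<^bsub>Hom C M M\<^esub> \<in> W M M"
  have l: "cls M Y (L, s, f) = \<one>\<^bsub>Hom D M Y\<^esub>" if Y: "Y \<in> Ob C" and r: "(L, s, f) \<in> roofs C W M Y" for L s f Y
  proof -
    note L = r[unfolded in_roofs]
    have s: "s \<in> carrier (Hom C L M)" using L M W_hom by auto
    have zW: "\<one>\<^bsub>Hom C L M\<^esub> \<in> W L M"
      using W_comp[of L M M s "\<one>\<^bsub>Hom C M M\<^esub>"] comp_one_left[of L M M s] L M z s by auto
    have "((L, s, f), (M, Idm C M, \<one>\<^bsub>Hom C M Y\<^esub>)) \<in> roof_rel C W M Y"
      using L M Y s zW by (intro roof_relI[of _ _ _ _ _ _ _ _ L "\<one>\<^bsub>Hom C L L\<^esub>" "\<one>\<^bsub>Hom C L M\<^esub>"] unit_roof r)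
        (auto simp: comp_one_right id_closed one_mor)
    then show ?thesis unfolding one_D by (rule cls_eq[OF M Y])
  qed
  have r: "cls Y M (L, s, f) = \<one>\<^bsub>Hom D Y M\<^esub>" if Y: "Y \<in> Ob C" and r: "(L, s, f) \<in> roofs C W Y M" for L s f Y
  proof -
    note L = r[unfolded in_roofs]
    have s: "s \<in> carrier (Hom C L Y)" using L Y W_hom by auto
    \<comment> \<open>The Ore square against the zero map yields a \<open>w\<close> in
      \<open>W\<close> with \<open>f w\<close> zero.\<close>
    obtain K w h where K: "K \<in> Ob C" "w \<in> W K L" "h \<in> carrier (Hom C K M)"
      "Comp C K L M f w = Comp C K M M \<one>\<^bsub>Hom C M M\<^esub> h"
      using ore[of L M M f "\<one>\<^bsub>Hom C M M\<^esub>"] L M z by blast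
    have w: "w \<in> carrier (Hom C K L)" using K L W_hom by auto
    have sw: "Comp C K L Y s w \<in> carrier (Hom C K Y)" using comp_closed K L w s Y by auto
    have "((L, s, f), (Y, Idm C Y, \<one>\<^bsub>Hom C Y M\<^esub>)) \<in> roof_rel C W Y M"
      using L M Y s K w sw by (intro roof_relI[of _ _ _ _ _ _ _ _ K w "Comp C K L Y s w"] unit_roof r)
        (auto simp: comp_one_left id_left id_closed one_mor W_comp)
    then show ?thesis unfolding one_D by (rule cls_eq[OF Y M])
  qed
  have l': "\<phi> = \<one>\<^bsub>Hom D M Y\<^esub>" if "Y \<in> Ob C" "\<phi> \<in> carrier (Hom D M Y)" for Y \<phi>
    using that(2) l[OF that(1)] by (elim Hom_D_cases) simp
  have r': "\<phi> = \<one>\<^bsub>Hom D Y M\<^esub>" if "Y \<in> Ob C" "\<phi> \<in> carrier (Hom D Y M)" for Y \<phi>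
    using that(2) r[OF that(1)] by (elim Hom_D_cases) simp
  have one: "\<one>\<^bsub>Hom D X Y\<^esub> \<in> carrier (Hom D X Y)" if "X \<in> Ob C" "Y \<in> Ob C" for X Y
    unfolding one_D using that by (intro cls_closed unit_roof one_mor)
  have "carrier (Hom D M Y) = {\<one>\<^bsub>Hom D M Y\<^esub>}" "carrier (Hom D Y M) = {\<one>\<^bsub>Hom D Y M\<^esub>}" if Y: "Y \<in> Ob C" for Y
    using l'[OF Y] r'[OF Y] one[OF M Y] one[OF Y M] by (blast intro: equalityI)+
  then show "zero_object D M" using M by (simp add: zero_object_def localisation_def)
qed

end

section \<open>Homotopy projective objects and compactness in a localisation\<close>

context frac_cat
begin

text \<open>In a category without triangles, orthogonality to the acyclic objects is expressed by
  unique lifting along \<open>W\<close>: \<open>Hom(G, -)\<close> sends \<open>W\<close> to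
  bijections.\<close>

definition homotopy_projective where
  "homotopy_projective G \<longleftrightarrow> G \<in> Ob C \<and> (\<forall>X\<in>Ob C. \<forall>Y\<in>Ob C. \<forall>s\<in>W X Y. \<forall>f\<in>carrier (Hom C G Y).
     \<exists>!l. l \<in> carrier (Hom C G X) \<and> Comp C G X Y s l = f)"

definition lft where
  "lft G X Y s f = (THE l. l \<in> carrier (Hom C G X) \<and> Comp C G X Y s l = f)"

abbreviation emb where "emb G X a \<equiv> cls G X (G, Idm C G, a)"

lemma lft:
  assumes "homotopy_projective G" "X \<in> Ob C" "Y \<in> Ob C" "s \<in> W X Y" "f \<in> carrier (Hom C G Y)"
  shows "lft G X Y s f \<in> carrier (Hom C G X)" "Comp C G X Y s (lft G X Y s f) = f"
proof -
  have "\<exists>!l. l \<in> carrier (Hom C G X) \<and> Comp C G X Y s l = f"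
    using assms unfolding homotopy_projective_def by blast
  from theI'[OF this] show "lft G X Y s f \<in> carrier (Hom C G X)" "Comp C G X Y s (lft G X Y s f) = f"
    by (auto simp: lft_def)
qed

lemma lft_eq:
  assumes "homotopy_projective G" "X \<in> Ob C" "Y \<in> Ob C" "s \<in> W X Y" "l \<in> carrier (Hom C G X)"
  shows "lft G X Y s (Comp C G X Y s l) = l"
proof -
  have G: "G \<in> Ob C" using assms by (simp add: homotopy_projective_def)
  have f: "Comp C G X Y s l \<in> carrier (Hom C G Y)" using assms comp_closed G W_hom by auto
  then have "\<exists>!l'. l' \<in> carrier (Hom C G X) \<and> Comp C G X Y s l' = Comp C G X Y s l"
    using assms unfolding homotopy_projective_def by blast
  then show ?thesis using lft[OF assms(1-4) f] assms(5) by blast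
qed

text \<open>A roof acts on \<open>Hom(G, X)\<close> by lifting along its denominator and then
  applying its numerator. Equivalent roofs act alike, since both lifts are images of one lift to the
  apex of the dominating roof.\<close>

lemma lft_roof:
  assumes G: "homotopy_projective G" and X: "X \<in> Ob C" and Y: "Y \<in> Ob C" and a: "a \<in> carrier (Hom C G X)"
    and r: "((L, s, f), (L', s', f')) \<in> roof_rel C W X Y"
  shows "Comp C G L Y f (lft G L X s a) = Comp C G L' Y f' (lft G L' X s' a)"
proof -
  have G': "G \<in> Ob C" using G by (simp add: homotopy_projective_def)
  from r obtain K u u' where K: "(L, s, f) \<in> roofs C W X Y" "(L', s', f') \<in> roofs C W X Y" "K \<in> Ob C"
    "u \<in> carrier (Hom C K L)" "u' \<in> carrier (Hom C K L')"
    "Comp C K L X s u = Comp C K L' X s' u'" "Comp C K L X s u \<in> W K X"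
    "Comp C K L Y f u = Comp C K L' Y f' u'"
    by (rule roof_relE)
  note L = K(1,2)[unfolded in_roofs]
  define l where "l = lft G K X (Comp C K L X s u) a"
  have l: "l \<in> carrier (Hom C G K)" "Comp C G K X (Comp C K L X s u) l = a"
    unfolding l_def using lft[OF G K(3) X K(7) a] .
  have s: "s \<in> carrier (Hom C L X)" "s' \<in> carrier (Hom C L' X)" using L W_hom X by auto
  have "Comp C G L X s (Comp C G K L u l) = a"
    using comp_assoc[of G K L X l u s] l L K s G' X by simp
  then have 1: "lft G L X s a = Comp C G K L u l"
    using lft_eq[OF G, of L X s "Comp C G K L u l"] comp_closed[of G K L l u] L X K G' l by simp
  have "Comp C G L' X s' (Comp C G K L' u' l) = a"
    using comp_assoc[of G K L' X l u' s'] l L K s G' X by simp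
  then have 2: "lft G L' X s' a = Comp C G K L' u' l"
    using lft_eq[OF G, of L' X s' "Comp C G K L' u' l"] comp_closed[of G K L' l u'] L X K G' l by simp
  show ?thesis unfolding 1 2
    using comp_assoc[of G K L Y l u f] comp_assoc[of G K L' Y l u' f'] K L l G' Y by simp
qed

lemma lft_id: "\<lbrakk>homotopy_projective G; X \<in> Ob C; a \<in> carrier (Hom C G X)\<rbrakk> \<Longrightarrow> lft G X X (Idm C X) a = a"
  using lft_eq[of G X X "Idm C X" a] W_id id_left[of G X a] by (simp add: homotopy_projective_def)

lemma emb_closed: "\<lbrakk>G \<in> Ob C; a \<in> carrier (Hom C G X)\<rbrakk> \<Longrightarrow> emb G X a \<in> carrier (Hom D G X)"
  by (intro cls_closed unit_roof)

text \<open>Lifting the identity of \<open>G\<close> gives a section of the denominator, so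
  \<open>G\<close> itself dominates the roof: fractions out of a homotopy projective object are
  genuine morphisms.\<close>

lemma cls_emb:
  assumes G: "homotopy_projective G" and X: "X \<in> Ob C" and r: "(L, s, f) \<in> roofs C W G X"
  shows "cls G X (L, s, f) = emb G X (Comp C G L X f (lft G L G s (Idm C G)))"
proof -
  have G': "G \<in> Ob C" using G by (simp add: homotopy_projective_def)
  note L = r[unfolded in_roofs]
  define l where "l = lft G L G s (Idm C G)"
  have l: "l \<in> carrier (Hom C G L)" "Comp C G L G s l = Idm C G"
    unfolding l_def using lft[OF G _ G'] L id_closed[OF G'] by auto
  have fl: "Comp C G L X f l \<in> carrier (Hom C G X)" using comp_closed L l X G' by blast
  have "((L, s, f), (G, Idm C G, Comp C G L X f l)) \<in> roof_rel C W G X"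
    using L l X G' fl id_closed[OF G'] W_id[OF G']
    by (intro roof_relI[of _ _ _ _ _ _ _ _ G l "Idm C G"] unit_roof r) (auto simp: id_right)
  then show ?thesis unfolding l_def by (rule cls_eq[OF G' X])
qed

lemma Hom_D_emb:
  assumes "homotopy_projective G" "X \<in> Ob C" "\<phi> \<in> carrier (Hom D G X)"
  obtains a where "a \<in> carrier (Hom C G X)" "\<phi> = emb G X a"
proof -
  have G: "G \<in> Ob C" using assms by (simp add: homotopy_projective_def)
  obtain L s f where r: "(L, s, f) \<in> roofs C W G X" "\<phi> = cls G X (L, s, f)"
    using assms(3) by (rule Hom_D_cases)
  then show ?thesis using that[of "Comp C G L X f (lft G L G s (Idm C G))"] cls_emb[OF assms(1,2) r(1)]
    lft(1)[OF assms(1) _ G, of L s "Idm C G"] comp_closed[of G L X] id_closed[OF G] G assms(2)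
    by (auto simp: in_roofs)
qed

text \<open>Both roofs act on the identity of \<open>G\<close>, with results \<open>a\<close> and
  \<open>b\<close>.\<close>

lemma emb_inj:
  assumes G: "homotopy_projective G" and X: "X \<in> Ob C" and "a \<in> carrier (Hom C G X)" "b \<in> carrier (Hom C G X)"
    "emb G X a = emb G X b"
  shows "a = b"
proof -
  have G': "G \<in> Ob C" using G by (simp add: homotopy_projective_def)
  have "((G, Idm C G, a), (G, Idm C G, b)) \<in> roof_rel C W G X"
    using assms G' by (intro cls_eqD unit_roof)
  from lft_roof[OF G G' X id_closed[OF G'] this] show ?thesis
    using lft_id[OF G G' id_closed[OF G']] assms id_right[OF G' X] by simp
qed

text \<open>The sum of two classes is a union over all common denominators. Precomposing with the
  section of such a denominator brings each choice back to \<open>a\<close> and \<open>b\<close>, by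
  additivity of \<open>Comp\<close>.\<close>

lemma emb_mult:
  assumes G: "homotopy_projective G" and X: "X \<in> Ob C" and a: "a \<in> carrier (Hom C G X)" and b: "b \<in> carrier (Hom C G X)"
  shows "emb G X a \<otimes>\<^bsub>Hom D G X\<^esub> emb G X b = emb G X (a \<otimes>\<^bsub>Hom C G X\<^esub> b)"
proof -
  have G': "G \<in> Ob C" using G by (simp add: homotopy_projective_def)
  interpret H: comm_group "Hom C G X" using hom_group G' X .
  have r: "(G, Idm C G, a) \<in> roofs C W G X" "(G, Idm C G, b) \<in> roofs C W G X"
    using a b G' by (auto intro: unit_roof)
  let ?S = "{cls G X (L, s, f \<otimes>\<^bsub>Hom C L X\<^esub> g) | L s f g. (L, s, f) \<in> emb G X a \<and> (L, s, g) \<in> emb G X b}"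
  have "S = emb G X (a \<otimes>\<^bsub>Hom C G X\<^esub> b)" if S: "S \<in> ?S" for S
  proof -
    obtain L s f g where S: "S = cls G X (L, s, f \<otimes>\<^bsub>Hom C L X\<^esub> g)"
      "((G, Idm C G, a), (L, s, f)) \<in> roof_rel C W G X" "((G, Idm C G, b), (L, s, g)) \<in> roof_rel C W G X"
      using S by auto
    have L: "L \<in> Ob C" "s \<in> W L G" "f \<in> carrier (Hom C L X)" "g \<in> carrier (Hom C L X)"
      using S(2,3) by (auto elim!: roof_relE simp: in_roofs)
    interpret L: comm_group "Hom C L X" using hom_group L(1) X .
    define l where "l = lft G L G s (Idm C G)"
    have l: "l \<in> carrier (Hom C G L)"
      unfolding l_def using lft[OF G _ G'] L id_closed[OF G'] by auto
    have ab: "a = Comp C G L X f l" "b = Comp C G L X g l"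
      using lft_roof[OF G G' X id_closed[OF G'] S(2)] lft_roof[OF G G' X id_closed[OF G'] S(3)]
        lft_id[OF G G' id_closed[OF G']] id_right[OF G' X] a b by (auto simp: l_def)
    have "S = emb G X (Comp C G L X (f \<otimes>\<^bsub>Hom C L X\<^esub> g) l)"
      unfolding S(1) l_def using L by (intro cls_emb[OF G X]) (auto simp: in_roofs)
    then show ?thesis unfolding ab using comp_mult_left[OF G' L(1) X l L(3,4)] by simp
  qed
  moreover have "emb G X (a \<otimes>\<^bsub>Hom C G X\<^esub> b) \<in> ?S"
    using cls_self[OF G' X r(1)] cls_self[OF G' X r(2)] by blast
  ultimately have "?S = {emb G X (a \<otimes>\<^bsub>Hom C G X\<^esub> b)}" by blast
  then show ?thesis by (simp add: localisation_def)
qed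

text \<open>The group laws are carried over from \<open>C\<close> along the additive bijection
  \<open>emb\<close>.\<close>

lemma Hom_D_group:
  assumes G: "homotopy_projective G" and X: "X \<in> Ob C"
  shows "comm_group (Hom D G X)"
proof -
  have G': "G \<in> Ob C" using G by (simp add: homotopy_projective_def)
  interpret H: comm_group "Hom C G X" using hom_group G' X .
  note M = emb_mult[OF G X]
  have one: "\<one>\<^bsub>Hom D G X\<^esub> = emb G X \<one>\<^bsub>Hom C G X\<^esub>" by (rule one_D)
  show ?thesis
  proof (rule comm_groupI)
    show "\<one>\<^bsub>Hom D G X\<^esub> \<in> carrier (Hom D G X)" unfolding one by (rule emb_closed[OF G']) simp
  next
    fix x y assume "x \<in> carrier (Hom D G X)" "y \<in> carrier (Hom D G X)"
    then obtain a b where ab: "a \<in> carrier (Hom C G X)" "x = emb G X a" "b \<in> carrier (Hom C G X)" "y = emb G X b"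
      using Hom_D_emb[OF G X] by metis
    show "x \<otimes>\<^bsub>Hom D G X\<^esub> y \<in> carrier (Hom D G X)" using ab M emb_closed[OF G'] by simp
    show "x \<otimes>\<^bsub>Hom D G X\<^esub> y = y \<otimes>\<^bsub>Hom D G X\<^esub> x" using ab M by (simp add: H.m_comm)
    fix z assume "z \<in> carrier (Hom D G X)"
    then obtain c where c: "c \<in> carrier (Hom C G X)" "z = emb G X c" using Hom_D_emb[OF G X] by metis
    show "x \<otimes>\<^bsub>Hom D G X\<^esub> y \<otimes>\<^bsub>Hom D G X\<^esub> z = x \<otimes>\<^bsub>Hom D G X\<^esub> (y \<otimes>\<^bsub>Hom D G X\<^esub> z)"
      using ab c M by (simp add: H.m_assoc)
  next
    fix x assume "x \<in> carrier (Hom D G X)"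
    then obtain a where a: "a \<in> carrier (Hom C G X)" "x = emb G X a" using Hom_D_emb[OF G X] by metis
    show "\<one>\<^bsub>Hom D G X\<^esub> \<otimes>\<^bsub>Hom D G X\<^esub> x = x" unfolding one using a M by simp
    show "\<exists>y\<in>carrier (Hom D G X). y \<otimes>\<^bsub>Hom D G X\<^esub> x = \<one>\<^bsub>Hom D G X\<^esub>"
      unfolding one using a M emb_closed[OF G'] by (intro bexI[of _ "emb G X (inv\<^bsub>Hom C G X\<^esub> a)"]) auto
  qed
qed

lemma Hom_D_trivial_iff:
  assumes G: "homotopy_projective G" and X: "X \<in> Ob C"
  shows "carrier (Hom D G X) = {\<one>\<^bsub>Hom D G X\<^esub>} \<longleftrightarrow> carrier (Hom C G X) = {\<one>\<^bsub>Hom C G X\<^esub>}"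
proof -
  have G': "G \<in> Ob C" using G by (simp add: homotopy_projective_def)
  have "carrier (Hom D G X) = emb G X ` carrier (Hom C G X)"
  proof
    show "carrier (Hom D G X) \<subseteq> emb G X ` carrier (Hom C G X)"
      by (rule subsetI, erule Hom_D_emb[OF G X]) simp
  qed (use emb_closed[OF G'] in blast)
  moreover have "inj_on (emb G X) (carrier (Hom C G X))"
    using emb_inj[OF G X] by (auto intro: inj_onI)
  moreover have "\<one>\<^bsub>Hom C G X\<^esub> \<in> carrier (Hom C G X)" using one_mor G' X by blast
  ultimately show ?thesis unfolding one_D
    using inj_on_image_eq_iff[of "emb G X" "carrier (Hom C G X)" "carrier (Hom C G X)" "{\<one>\<^bsub>Hom C G X\<^esub>}"] by simp
qed

text \<open>Every Ore square yields the same class: lifting the identity of \<open>G\<close> to its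
  apex expresses both ways round the square through one morphism \<open>m\<close>.\<close>

lemma comp_emb:
  assumes G: "homotopy_projective G" and X: "X \<in> Ob C" and Y: "Y \<in> Ob C" and a: "a \<in> carrier (Hom C G X)"
    and r: "(L, s, f) \<in> roofs C W X Y"
  shows "Comp D G X Y (cls X Y (L, s, f)) (emb G X a) = emb G Y (Comp C G L Y f (lft G L X s a))"
proof -
  have G': "G \<in> Ob C" using G by (simp add: homotopy_projective_def)
  note L = r[unfolded in_roofs]
  define l where "l = lft G L X s a"
  have l: "l \<in> carrier (Hom C G L)" "Comp C G L X s l = a"
    unfolding l_def using lft[OF G _ X _ a] L by auto
  let ?S = "{cls G Y (K, Comp C K L1 G s1 w, Comp C K L' Y g h)
        | K L1 L' s1 f1 s' g w h.
          (L1, s1, f1) \<in> emb G X a \<and> (L', s', g) \<in> cls X Y (L, s, f) \<and> K \<in> Ob C \<and> w \<in> W K L1 \<and>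
          h \<in> carrier (Hom C K L') \<and> Comp C K L1 X f1 w = Comp C K L' X s' h}"
  have "S = emb G Y (Comp C G L Y f l)" if S: "S \<in> ?S" for S
  proof -
    obtain K L1 L' s1 f1 s' g w h where S: "S = cls G Y (K, Comp C K L1 G s1 w, Comp C K L' Y g h)"
      "((G, Idm C G, a), (L1, s1, f1)) \<in> roof_rel C W G X" "((L, s, f), (L', s', g)) \<in> roof_rel C W X Y"
      and K: "K \<in> Ob C" "w \<in> W K L1" "h \<in> carrier (Hom C K L')"
      "Comp C K L1 X f1 w = Comp C K L' X s' h"
      using \<open>S \<in> ?S\<close> by auto
    have L': "L1 \<in> Ob C" "s1 \<in> W L1 G" "f1 \<in> carrier (Hom C L1 X)" "L' \<in> Ob C" "s' \<in> W L' X" "g \<in> carrier (Hom C L' Y)"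
      using S(2,3) by (auto elim!: roof_relE simp: in_roofs)
    have hs: "w \<in> carrier (Hom C K L1)" "s1 \<in> carrier (Hom C L1 G)" "s' \<in> carrier (Hom C L' X)"
      using K L' W_hom G' X by auto
    have sw: "Comp C K L1 G s1 w \<in> W K G" using W_comp[of K L1 G w s1] K L' G' by auto
    have gh: "Comp C K L' Y g h \<in> carrier (Hom C K Y)" using comp_closed K L' Y by blast
    \<comment> \<open>\<open>m\<close> splits the denominator of the composite roof. It follows that
      \<open>w m\<close> is the lift of the identity along \<open>s1\<close>, and \<open>h m\<close>
      the lift of \<open>a\<close> along \<open>s'\<close>.\<close>
    define m where "m = lft G K G (Comp C K L1 G s1 w) (Idm C G)"
    have m: "m \<in> carrier (Hom C G K)" "Comp C G K G (Comp C K L1 G s1 w) m = Idm C G"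
      unfolding m_def using lft[OF G K(1) G' sw id_closed[OF G']] .
    have wm: "Comp C G K L1 w m \<in> carrier (Hom C G L1)" "Comp C G L1 G s1 (Comp C G K L1 w m) = Idm C G"
      using comp_closed[OF G' K(1) L'(1) m(1) hs(1)] comp_assoc[OF G' K(1) L'(1) G' m(1) hs(1,2)] m by auto
    have hm: "Comp C G K L' h m \<in> carrier (Hom C G L')"
      using comp_closed[OF G' K(1) L'(4) m(1) K(3)] .
    have "a = Comp C G L1 X f1 (lft G L1 G s1 (Idm C G))"
      using lft_roof[OF G G' X id_closed[OF G'] S(2)] lft_id[OF G G' id_closed[OF G']] id_right[OF G' X a] by simp
    also have "lft G L1 G s1 (Idm C G) = Comp C G K L1 w m"
      using lft_eq[OF G L'(1) G' L'(2) wm(1)] wm(2) by simp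
    also have "Comp C G L1 X f1 (Comp C G K L1 w m) = Comp C G L' X s' (Comp C G K L' h m)"
      using comp_assoc[OF G' K(1) L'(1) X m(1) hs(1) L'(3)] comp_assoc[OF G' K(1) L'(4) X m(1) K(3) hs(3)] K(4)
      by simp
    finally have "lft G L' X s' a = Comp C G K L' h m"
      using lft_eq[OF G L'(4) X L'(5) hm] by simp
    then have "Comp C G L Y f l = Comp C G K Y (Comp C K L' Y g h) m"
      using lft_roof[OF G X Y a S(3)] comp_assoc[OF G' K(1) L'(4) Y m(1) K(3) L'(6)] by (simp add: l_def)
    then show ?thesis unfolding S(1) m_def
      using cls_emb[OF G Y, of K "Comp C K L1 G s1 w" "Comp C K L' Y g h"] sw K gh by (simp add: in_roofs)
  qed
  moreover have "cls G Y (G, Comp C G G G (Idm C G) (Idm C G), Comp C G L Y f l) \<in> ?S"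
  proof (intro CollectI exI conjI)
    show "(G, Idm C G, a) \<in> emb G X a" using cls_self[OF G' X unit_roof[OF G' a]] .
    show "(L, s, f) \<in> cls X Y (L, s, f)" using cls_self[OF X Y r] .
    show "Idm C G \<in> W G G" using W_id G' .
    show "Comp C G G X a (Idm C G) = Comp C G L X s l" using l id_right[OF G' X a] by simp
  qed (use G' l in auto)
  ultimately have "?S = {emb G Y (Comp C G L Y f l)}" by blast
  then show ?thesis by (simp add: localisation_def l_def)
qed

lemma comp_emb_closed:
  assumes G: "homotopy_projective G" and X: "X \<in> Ob C" and Y: "Y \<in> Ob C"
    and \<psi>: "\<psi> \<in> carrier (Hom D X Y)"
  shows "Comp D G X Y \<psi> \<in> hom (Hom D G X) (Hom D G Y)"
proof (rule homI)
  have G': "G \<in> Ob C" using G by (simp add: homotopy_projective_def)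
  obtain L s f where r: "(L, s, f) \<in> roofs C W X Y" "\<psi> = cls X Y (L, s, f)"
    using \<psi> by (rule Hom_D_cases)
  note L = r(1)[unfolded in_roofs]
  have s: "s \<in> carrier (Hom C L X)" using L W_hom X by blast
  have l: "lft G L X s a \<in> carrier (Hom C G L)" "Comp C G L X s (lft G L X s a) = a"
    if "a \<in> carrier (Hom C G X)" for a
    using lft[OF G _ X _ that] L by auto
  fix x assume x: "x \<in> carrier (Hom D G X)"
  then obtain a where a: "a \<in> carrier (Hom C G X)" "x = emb G X a" using Hom_D_emb[OF G X] by metis
  then show "Comp D G X Y \<psi> x \<in> carrier (Hom D G Y)"
    using comp_emb[OF G X Y a(1) r(1)] r(2) emb_closed[OF G'] comp_closed[OF G' _ Y l(1)] L by simp
  fix y assume y: "y \<in> carrier (Hom D G X)"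
  then obtain b where b: "b \<in> carrier (Hom C G X)" "y = emb G X b" using Hom_D_emb[OF G X] by metis
  interpret GX: comm_group "Hom C G X" using hom_group G' X .
  interpret GL: comm_group "Hom C G L" using hom_group G' L by blast
  have "lft G L X s (a \<otimes>\<^bsub>Hom C G X\<^esub> b) = lft G L X s a \<otimes>\<^bsub>Hom C G L\<^esub> lft G L X s b"
    using lft_eq[OF G _ X _ GL.m_closed[OF l(1)[OF a(1)] l(1)[OF b(1)]], of s]
      comp_mult_right[OF G' _ X l(1)[OF a(1)] l(1)[OF b(1)] s] l a b L by simp
  then show "Comp D G X Y \<psi> (x \<otimes>\<^bsub>Hom D G X\<^esub> y) = Comp D G X Y \<psi> x \<otimes>\<^bsub>Hom D G Y\<^esub> Comp D G X Y \<psi> y"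
    using comp_emb[OF G X Y _ r(1)] a b emb_mult[OF G X] emb_mult[OF G Y] r(2) comp_closed[OF G' _ Y l(1)] L
      comp_mult_right[OF G' _ Y l(1)[OF a(1)] l(1)[OF b(1)], of f] by simp
qed

lemma Hom_D_member:
  assumes X: "X \<in> Ob C" and Y: "Y \<in> Ob C" and \<phi>: "\<phi> \<in> carrier (Hom D X Y)" and r: "r \<in> \<phi>"
  shows "r \<in> roofs C W X Y" "\<phi> = cls X Y r"
proof -
  obtain L s f where "\<phi> = cls X Y (L, s, f)" using \<phi> by (rule Hom_D_cases)
  then have rel: "((L, s, f), r) \<in> roof_rel C W X Y" using r by simp
  then show "r \<in> roofs C W X Y" using equiv_roof_rel[OF X Y] by (auto simp: roof_rel_def)
  show "\<phi> = cls X Y r" using cls_eq[OF X Y rel] \<open>\<phi> = cls X Y (L, s, f)\<close> by simp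
qed

text \<open>No uniqueness of composites is used here: any member of the composite class determines its
  action on \<open>Hom(G, -)\<close>.\<close>

lemma comp_emb_comp:
  assumes G: "homotopy_projective G" and X: "X \<in> Ob C" and Y: "Y \<in> Ob C" and Z: "Z \<in> Ob C"
    and \<phi>: "\<phi> \<in> carrier (Hom D X Y)" and \<psi>: "\<psi> \<in> carrier (Hom D Y Z)"
    and \<chi>: "Comp D X Y Z \<psi> \<phi> \<in> carrier (Hom D X Z)" and x: "x \<in> carrier (Hom D G X)"
  shows "Comp D G Y Z \<psi> (Comp D G X Y \<phi> x) = Comp D G X Z (Comp D X Y Z \<psi> \<phi>) x"
proof -
  have G': "G \<in> Ob C" using G by (simp add: homotopy_projective_def)
  obtain a where a: "a \<in> carrier (Hom C G X)" "x = emb G X a" using Hom_D_emb[OF G X x] by metis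
  obtain N q p where q: "(N, q, p) \<in> roofs C W X Z" "Comp D X Y Z \<psi> \<phi> = cls X Z (N, q, p)"
    using \<chi> by (rule Hom_D_cases)
  \<comment> \<open>Membership in the union exhibits an actual Ore square whose roof is equivalent
    to \<open>(N, q, p)\<close>.\<close>
  have "(N, q, p) \<in> Comp D X Y Z \<psi> \<phi>" unfolding q(2) using cls_self[OF X Z q(1)] .
  then obtain K L L' s f s' g w h where
    Q: "((K, Comp C K L X s w, Comp C K L' Z g h), (N, q, p)) \<in> roof_rel C W X Z"
    and *: "(L, s, f) \<in> \<phi>" "(L', s', g) \<in> \<psi>" and K: "K \<in> Ob C" "w \<in> W K L"
      "h \<in> carrier (Hom C K L')" "Comp C K L Y f w = Comp C K L' Y s' h"
    unfolding localisation_def by auto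
  have r: "(L, s, f) \<in> roofs C W X Y" "\<phi> = cls X Y (L, s, f)"
    using Hom_D_member[OF X Y \<phi> *(1)] by auto
  have r': "(L', s', g) \<in> roofs C W Y Z" "\<psi> = cls Y Z (L', s', g)"
    using Hom_D_member[OF Y Z \<psi> *(2)] by auto
  note L = r(1)[unfolded in_roofs] r'(1)[unfolded in_roofs]
  have hs: "w \<in> carrier (Hom C K L)" "s \<in> carrier (Hom C L X)" "s' \<in> carrier (Hom C L' Y)"
    using K L W_hom X Y by auto
  have sw: "Comp C K L X s w \<in> W K X" using W_comp[of K L X w s] K L X by auto
  define m where "m = lft G K X (Comp C K L X s w) a"
  have m: "m \<in> carrier (Hom C G K)" "Comp C G K X (Comp C K L X s w) m = a"
    unfolding m_def using lft[OF G K(1) X sw a(1)] .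
  have "lft G L X s a = Comp C G K L w m"
    using lft_eq[OF G _ X, of L s "Comp C G K L w m"] comp_closed[OF G' K(1) _ m(1) hs(1)] L
      comp_assoc[OF G' K(1) _ X m(1) hs(1,2)] m(2) by simp
  then have 1: "Comp D G X Y \<phi> x = emb G Y (Comp C G L Y f (Comp C G K L w m))"
    using comp_emb[OF G X Y a(1) r(1)] a(2) r(2) by simp
  have "Comp C G L Y f (Comp C G K L w m) = Comp C G L' Y s' (Comp C G K L' h m)"
    using comp_assoc[OF G' K(1) _ Y m(1) hs(1), of f] comp_assoc[OF G' K(1) _ Y m(1) K(3) hs(3)] K(4) L by simp
  moreover have hm: "Comp C G K L' h m \<in> carrier (Hom C G L')" using comp_closed[OF G' K(1) _ m(1) K(3)] L by simp
  ultimately have "Comp D G Y Z \<psi> (Comp D G X Y \<phi> x) = emb G Z (Comp C G L' Z g (Comp C G K L' h m))"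
    using 1 comp_emb[OF G Y Z _ r'(1), of "Comp C G L' Y s' (Comp C G K L' h m)"] r'(2)
      comp_closed[OF G' _ Y hm hs(3)] L lft_eq[OF G _ Y _ hm, of s'] by simp
  also have "Comp C G L' Z g (Comp C G K L' h m) = Comp C G K Z (Comp C K L' Z g h) m"
    using comp_assoc[OF G' K(1) _ Z m(1) K(3)] L by simp
  also have "\<dots> = Comp C G N Z p (lft G N X q a)"
    using lft_roof[OF G X Z a(1) Q] by (simp add: m_def)
  also have "emb G Z \<dots> = Comp D G X Z (Comp D X Y Z \<psi> \<phi>) x"
    unfolding q(2) using comp_emb[OF G X Z a(1) q(1)] a(2) by simp
  finally show ?thesis .
qed

text \<open>\<open>cofibre\<close> is the part of a long exact sequence that remains without
  triangles: \<open>q\<close> kills every \<open>f j\<close>, and on \<open>Hom(G, -)\<close> its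
  kernel is contained in what the \<open>f j\<close> generate. Elements of a generated subgroup are
  finite sums, which is how finiteness enters.\<close>

theorem compact_objectI:
  assumes G: "homotopy_projective G"
    and cofibre: "\<And>(J :: 'i set) L f P. \<lbrakk>P \<in> Ob C; \<And>j. j \<in> J \<Longrightarrow> L j \<in> Ob C \<and> f j \<in> carrier (Hom C (L j) P)\<rbrakk> \<Longrightarrow>
      \<exists>Z\<in>Ob C. \<exists>q\<in>carrier (Hom C P Z). (\<forall>j\<in>J. Comp C (L j) P Z q (f j) = \<one>\<^bsub>Hom C (L j) Z\<^esub>) \<and>
        (\<forall>\<phi>\<in>carrier (Hom C G P). Comp C G P Z q \<phi> = \<one>\<^bsub>Hom C G Z\<^esub> \<longrightarrow>
          \<phi> \<in> generate (Hom C G P) (\<Union>j\<in>J. Comp C G (L j) P (f j) ` carrier (Hom C G (L j))))"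
  shows "compact_object TYPE('i) D G"
  unfolding compact_object_def
proof (intro conjI allI impI)
  have G': "G \<in> Ob C" using G by (simp add: homotopy_projective_def)
  then show "G \<in> Ob D" by (simp add: localisation_def)
  fix J :: "'i set" and M P \<iota>
  assume cop: "is_coproduct D J M P \<iota>"
  have P: "P \<in> Ob C" and M: "\<And>j. j \<in> J \<Longrightarrow> M j \<in> Ob C" and \<iota>: "\<And>j. j \<in> J \<Longrightarrow> \<iota> j \<in> carrier (Hom D (M j) P)"
    and univ: "\<And>Z \<phi>. \<lbrakk>Z \<in> Ob C; \<forall>j\<in>J. \<phi> j \<in> carrier (Hom D (M j) Z)\<rbrakk> \<Longrightarrow>
       \<exists>!f. f \<in> carrier (Hom D P Z) \<and> (\<forall>j\<in>J. Comp D (M j) P Z f (\<iota> j) = \<phi> j)"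
    using cop by (auto simp: is_coproduct_def localisation_def)
  let ?H = "Hom D G P" and ?S = "sum_group J (\<lambda>j. Hom D G (M j))"
  let ?F = "\<lambda>x. gfinprod ?H (\<lambda>j. Comp D G (M j) P (\<iota> j) (x j)) J"
  interpret H: comm_group ?H using Hom_D_group[OF G P] .
  have gM: "group (Hom D G (M j))" "comm_group (Hom D G (M j))" if "j \<in> J" for j
    using Hom_D_group[OF G M[OF that]] by (auto simp: comm_group_def)
  have \<iota>_hom: "Comp D G (M j) P (\<iota> j) \<in> hom (Hom D G (M j)) ?H" if "j \<in> J" for j
    using comp_emb_closed[OF G M[OF that] P \<iota>[OF that]] .
  have S: "group ?S" using gM by simp
  have F_hom: "?F \<in> hom ?S ?H" by (rule H.hom_group_sum) (auto intro: \<iota>_hom gM)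
  interpret F: group_hom ?S ?H ?F using S F_hom by (simp add: group_hom_def group_hom_axioms_def)
  have carS: "x \<in> carrier ?S \<longleftrightarrow> x \<in> (\<Pi>\<^sub>E j\<in>J. carrier (Hom D G (M j))) \<and> finite {j \<in> J. x j \<noteq> \<one>\<^bsub>Hom D G (M j)\<^esub>}" for x
    using gM by (simp add: carrier_sum_group)
  have inj: "x = \<one>\<^bsub>?S\<^esub>" if x: "x \<in> carrier ?S" and F1: "?F x = \<one>\<^bsub>?H\<^esub>" for x
  proof -
    have "x i = \<one>\<^bsub>Hom D G (M i)\<^esub>" if i: "i \<in> J" for i
    proof -
      \<comment> \<open>The universal property supplies a projection of \<open>P\<close> onto
        \<open>M i\<close>, the identity on the \<open>i\<close>-th summand and zero on the others;
        it recovers \<open>x i\<close> from the sum.\<close>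
      define \<delta> where "\<delta> j = cls (M j) (M i) (M j, Idm C (M j), if j = i then Idm C (M i) else \<one>\<^bsub>Hom C (M j) (M i)\<^esub>)" for j
      have r: "(M j, Idm C (M j), if j = i then Idm C (M i) else \<one>\<^bsub>Hom C (M j) (M i)\<^esub>) \<in> roofs C W (M j) (M i)" if "j \<in> J" for j
        using M[OF that] M[OF i] by (intro unit_roof) (auto simp: id_closed one_mor)
      have \<delta>: "\<delta> j \<in> carrier (Hom D (M j) (M i))" if "j \<in> J" for j
        unfolding \<delta>_def by (rule cls_closed[OF r[OF that]])
      obtain f where f: "f \<in> carrier (Hom D P (M i))" "\<And>j. j \<in> J \<Longrightarrow> Comp D (M j) P (M i) f (\<iota> j) = \<delta> j"
        using univ[OF M[OF i], of \<delta>] \<delta> by blast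
      let ?p = "Comp D G P (M i) f"
      have p: "?p \<in> hom ?H (Hom D G (M i))" using comp_emb_closed[OF G P M[OF i] f(1)] .
      interpret p: group_hom ?H "Hom D G (M i)" ?p
        using p gM[OF i] by (simp add: group_hom_def group_hom_axioms_def H.is_group)
      interpret Mi: comm_group "Hom D G (M i)" using gM[OF i] by blast
      have pj: "?p (Comp D G (M j) P (\<iota> j) y) = (if j = i then y else \<one>\<^bsub>Hom D G (M i)\<^esub>)"
        if j: "j \<in> J" and y: "y \<in> carrier (Hom D G (M j))" for j y
      proof -
        obtain a where a: "a \<in> carrier (Hom C G (M j))" "y = emb G (M j) a" using Hom_D_emb[OF G M[OF j] y] by metis
        have "?p (Comp D G (M j) P (\<iota> j) y) = Comp D G (M j) (M i) (\<delta> j) y"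
          using comp_emb_comp[OF G M[OF j] P M[OF i] \<iota>[OF j] f(1) _ y] f(2)[OF j] \<delta>[OF j] by simp
        also have "\<dots> = (if j = i then y else \<one>\<^bsub>Hom D G (M i)\<^esub>)"
          unfolding \<delta>_def a(2) comp_emb[OF G M[OF j] M[OF i] a(1) r[OF j]] lft_id[OF G M[OF j] a(1)]
          using id_left[OF G' M[OF i]] comp_one_left[OF G' M[OF j] M[OF i] a(1)] a(1) by (auto simp: one_D)
        finally show ?thesis .
      qed
      let ?y = "\<lambda>j. Comp D G (M j) P (\<iota> j) (x j)"
      have y: "?y j \<in> carrier ?H" if "j \<in> J" for j
        using \<iota>_hom[OF that] x that unfolding carS by (auto simp: hom_def)
      \<comment> \<open>\<open>gfinprod\<close> runs over the support of the images, which a priori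
        is only contained in that of \<open>x\<close>; hence the case distinction on
        \<open>i \<in> A\<close> below.\<close>
      define A where "A = {j \<in> J. ?y j \<noteq> \<one>\<^bsub>?H\<^esub>}"
      have "finite {j \<in> J. x j \<noteq> \<one>\<^bsub>Hom D G (M j)\<^esub>}" using x carS by blast
      moreover have "A \<subseteq> {j \<in> J. x j \<noteq> \<one>\<^bsub>Hom D G (M j)\<^esub>}"
        unfolding A_def using hom_one[OF \<iota>_hom gM(1) H.is_group] by auto
      ultimately have A: "finite A" "A \<subseteq> J" using finite_subset by (auto simp: A_def)
      have fp: "?p (finprod ?H ?y B) = finprod (Hom D G (M i)) (\<lambda>j. ?p (?y j)) B" if "finite B" "B \<subseteq> J" for B
        using that
      proof (induction B)
        case (insert j B)
        then have "?y \<in> B \<rightarrow> carrier ?H" "(\<lambda>j. ?p (?y j)) \<in> B \<rightarrow> carrier (Hom D G (M i))" using y by auto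
        with insert y show ?case by simp
      qed simp
      have "?p (?F x) = finprod (Hom D G (M i)) (\<lambda>j. ?p (?y j)) A"
        using fp[OF A] A by (simp add: gfinprod_def A_def)
      also have "\<dots> = x i"
      proof (cases "i \<in> A")
        case True
        have "finprod (Hom D G (M i)) (\<lambda>j. ?p (?y j)) A = finprod (Hom D G (M i)) (\<lambda>j. if i = j then x i else \<one>\<^bsub>Hom D G (M i)\<^esub>) A"
          using A x by (intro Mi.finprod_cong') (auto simp: pj carS PiE_iff)
        also have "\<dots> = x i" using True A(1,2) x by (subst Mi.finprod_singleton[where f="\<lambda>_. x i"]) (auto simp: carS PiE_iff)
        finally show ?thesis .
      next
        case False
        then have "?y i = \<one>\<^bsub>?H\<^esub>" using i by (simp add: A_def)
        then have "x i = \<one>\<^bsub>Hom D G (M i)\<^esub>" using pj[OF i, of "x i"] x i by (auto simp: carS PiE_iff)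
        moreover have "finprod (Hom D G (M i)) (\<lambda>j. ?p (?y j)) A = \<one>\<^bsub>Hom D G (M i)\<^esub>"
        proof (rule Mi.finprod_one_eqI)
          fix j assume j: "j \<in> A"
          then have "j \<in> J" "j \<noteq> i" using A False by auto
          then show "?p (?y j) = \<one>\<^bsub>Hom D G (M i)\<^esub>"
            using x pj[of j "x j"] by (simp add: carS PiE_iff)
        qed
        ultimately show ?thesis by simp
      qed
      finally show ?thesis using F1 by simp
    qed
    then show ?thesis using x unfolding carS by (auto simp: PiE_iff extensional_def fun_eq_iff)
  qed
  \<comment> \<open>Each coprojection is a roof with apex \<open>L j\<close>. The cofibre is taken
    for the numerators \<open>f j\<close>, which are morphisms of \<open>C\<close>; the denominators
    only exchange \<open>L j\<close> for \<open>M j\<close>.\<close>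
  have surj: "z \<in> ?F ` carrier ?S" if z: "z \<in> carrier ?H" for z
  proof -
    have "\<forall>j\<in>J. \<exists>r. r \<in> roofs C W (M j) P \<and> \<iota> j = cls (M j) P r"
      using \<iota> by (metis Hom_D_cases)
    then obtain r where r: "\<And>j. j \<in> J \<Longrightarrow> r j \<in> roofs C W (M j) P \<and> \<iota> j = cls (M j) P (r j)" by metis
    define L s f where "L j = fst (r j)" and "s j = fst (snd (r j))" and "f j = snd (snd (r j))" for j
    have r': "(L j, s j, f j) \<in> roofs C W (M j) P" "\<iota> j = cls (M j) P (L j, s j, f j)" if "j \<in> J" for j
      using r[OF that] by (auto simp: L_def s_def f_def)
    have L: "L j \<in> Ob C" "s j \<in> W (L j) (M j)" "f j \<in> carrier (Hom C (L j) P)" if "j \<in> J" for j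
      using r'(1)[OF that] by (auto simp: in_roofs)
    obtain Z q where Z: "Z \<in> Ob C" "q \<in> carrier (Hom C P Z)"
      and qf: "\<And>j. j \<in> J \<Longrightarrow> Comp C (L j) P Z q (f j) = \<one>\<^bsub>Hom C (L j) Z\<^esub>"
      and ker: "\<And>\<phi>. \<lbrakk>\<phi> \<in> carrier (Hom C G P); Comp C G P Z q \<phi> = \<one>\<^bsub>Hom C G Z\<^esub>\<rbrakk> \<Longrightarrow>
          \<phi> \<in> generate (Hom C G P) (\<Union>j\<in>J. Comp C G (L j) P (f j) ` carrier (Hom C G (L j)))"
      using cofibre[of P J L f] P L by blast
    let ?q = "emb P Z q" and ?o = "emb P Z \<one>\<^bsub>Hom C P Z\<^esub>"
    have qo: "?q \<in> carrier (Hom D P Z)" "?o \<in> carrier (Hom D P Z)"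
      using Z P by (auto intro!: cls_closed unit_roof one_mor)
    have comp: "Comp D (M j) P Z ?q (\<iota> j) = cls (M j) Z (L j, s j, \<one>\<^bsub>Hom C (L j) Z\<^esub>)"
      "Comp D (M j) P Z ?o (\<iota> j) = cls (M j) Z (L j, s j, \<one>\<^bsub>Hom C (L j) Z\<^esub>)" if j: "j \<in> J" for j
      using comp_post[OF M[OF j] P Z(1) Z(2) r'(1)[OF j]] qf[OF j] r'(2)[OF j]
        comp_post[OF M[OF j] P Z(1) one_mor[OF P Z(1)] r'(1)[OF j]]
        comp_one_left[OF L(1)[OF j] P Z(1) L(3)[OF j]] by simp_all
    have "cls (M j) Z (L j, s j, \<one>\<^bsub>Hom C (L j) Z\<^esub>) \<in> carrier (Hom D (M j) Z)" if "j \<in> J" for j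
      using L[OF that] Z(1) by (intro cls_closed) (auto simp: in_roofs one_mor)
    \<comment> \<open>\<open>q\<close> and zero have the same composite with every coprojection, so
      they agree in the localisation by uniqueness in the universal property.\<close>
    then have "?q = ?o"
      using univ[OF Z(1), of "\<lambda>j. cls (M j) Z (L j, s j, \<one>\<^bsub>Hom C (L j) Z\<^esub>)"] comp qo by blast
    obtain \<phi> where \<phi>: "\<phi> \<in> carrier (Hom C G P)" "z = emb G P \<phi>" using Hom_D_emb[OF G P z] by metis
    have "emb G Z (Comp C G P Z q \<phi>) = emb G Z (Comp C G P Z \<one>\<^bsub>Hom C P Z\<^esub> \<phi>)"
      using comp_emb[OF G P Z(1) \<phi>(1) unit_roof[OF P Z(2)]] comp_emb[OF G P Z(1) \<phi>(1) unit_roof[OF P one_mor[OF P Z(1)]]]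
        \<open>?q = ?o\<close> lft_id[OF G P \<phi>(1)] by simp
    then have "Comp C G P Z q \<phi> = \<one>\<^bsub>Hom C G Z\<^esub>"
      using emb_inj[OF G Z(1) comp_closed[OF G' P Z(1) \<phi>(1) Z(2)] comp_closed[OF G' P Z(1) \<phi>(1) one_mor[OF P Z(1)]]]
        comp_one_left[OF G' P Z(1) \<phi>(1)] by simp
    note gen = ker[OF \<phi>(1) this]
    interpret GP: comm_group "Hom C G P" using hom_group[OF G' P] .
    interpret E: group_hom "Hom C G P" ?H "emb G P"
      using emb_closed[OF G'] emb_mult[OF G P]
      by (auto simp: group_hom_def group_hom_axioms_def GP.is_group H.is_group hom_def)
    interpret I: subgroup "?F ` carrier ?S" ?H using F.img_is_subgroup .
    \<comment> \<open>The \<open>j\<close>-th numerator applied to \<open>\<psi>\<close> is the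
      coprojection applied to \<open>s j\<close> after \<open>\<psi>\<close>, hence the image of a
      family supported at \<open>j\<close>.\<close>
    have base: "h \<in> carrier (Hom C G P) \<and> emb G P h \<in> ?F ` carrier ?S"
      if "h \<in> (\<Union>j\<in>J. Comp C G (L j) P (f j) ` carrier (Hom C G (L j)))" for h
    proof -
      from that obtain j \<psi> where j: "j \<in> J" "\<psi> \<in> carrier (Hom C G (L j))" "h = Comp C G (L j) P (f j) \<psi>" by auto
      have h: "h \<in> carrier (Hom C G P)" unfolding j(3) using comp_closed[OF G' _ P j(2)] L[OF j(1)] by simp
      have s\<psi>: "Comp C G (L j) (M j) (s j) \<psi> \<in> carrier (Hom C G (M j))"
        using comp_closed[OF G' _ M[OF j(1)] j(2)] L[OF j(1)] W_hom M[OF j(1)] by simp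
      define y where "y = emb G (M j) (Comp C G (L j) (M j) (s j) \<psi>)"
      have y: "y \<in> carrier (Hom D G (M j))" unfolding y_def using emb_closed[OF G' s\<psi>] .
      define x where "x = (\<lambda>i\<in>J. if i = j then y else \<one>\<^bsub>Hom D G (M i)\<^esub>)"
      have x: "x \<in> carrier ?S"
        using y group.is_monoid[OF gM(1)] unfolding carS x_def
        by (auto simp: PiE_iff monoid.one_closed intro: finite_subset[of _ "{j}"])
      have Y: "Comp D G (M i) P (\<iota> i) (x i) = (if i = j then emb G P h else \<one>\<^bsub>?H\<^esub>)" if "i \<in> J" for i
      proof (cases "i = j")
        case True
        then show ?thesis using comp_emb[OF G M[OF j(1)] P s\<psi> r'(1)[OF j(1)]] r'(2)[OF j(1)] j L[OF j(1)]
            lft_eq[OF G _ M[OF j(1)] _ j(2)] by (simp add: x_def y_def)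
      next
        case False
        then show ?thesis using that hom_one[OF \<iota>_hom gM(1) H.is_group] by (simp add: x_def)
      qed
      have "?F x = gfinprod ?H (\<lambda>i. emb G P h) {j}"
        using h j(1) Y by (intro H.gfinprod_mono_neutral_cong_right) auto
      then have "?F x = emb G P h" using h by simp
      then have "emb G P h \<in> ?F ` carrier ?S" by (rule image_eqI[OF sym x])
      with h show ?thesis ..
    qed
    from gen have "\<phi> \<in> carrier (Hom C G P) \<and> emb G P \<phi> \<in> ?F ` carrier ?S"
    proof (induction rule: generate.induct)
      case one
      show ?case using I.one_closed by simp
    next
      case (incl h)
      then show ?case by (rule base)
    next
      case (inv h)
      then show ?case using base[OF inv] I.m_inv_closed by simp
    next
      case (eng h1 h2)
      then show ?case using I.m_closed by simp
    qed
    then show ?thesis using \<phi>(2) by simp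
  qed
  show "?F \<in> iso ?S ?H"
  proof (rule isoI[OF F_hom])
    have "inj_on ?F (carrier ?S)"
      by (rule F.inj_on_one_iff[THEN iffD2]) (use inj in blast)
    moreover have "?F ` carrier ?S = carrier ?H"
      using surj F.hom_closed by blast
    ultimately show "bij_betw ?F (carrier ?S) (carrier ?H)" by (simp add: bij_betw_def)
  qed
qed

end

section \<open>Graded modules\<close>

text \<open>Linear identities in an abelian group are verified by writing both sides as integer combinations
  of the same elements.\<close>

definition lincomb :: "('a, 'z) ring_scheme \<Rightarrow> 'a \<Rightarrow> ('a \<Rightarrow> int) \<Rightarrow> bool" where
  "lincomb G x c \<longleftrightarrow> (\<exists>S. finite S \<and> S \<subseteq> carrier G \<and> (\<forall>a. a \<notin> S \<longrightarrow> c a = 0) \<and>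
     x = finsum G (\<lambda>a. add_pow G (c a) a) S)"

definition kdelta :: "'a \<Rightarrow> 'a \<Rightarrow> int" where "kdelta x a = (if a = x then 1 else 0)"

definition sg :: "int \<Rightarrow> int" where "sg p = (if even p then 1 else - 1)"

lemma sg_simps [simp]: "sg (p + q) = sg p * sg q" "sg (p - q) = sg p * sg q" "sg (- p) = sg p"
  "sg 0 = 1" "sg 1 = - 1" "sg (numeral n) = (if even (numeral n :: int) then 1 else - 1)" "sg p * sg p = 1"
  "sg p * (sg p * z) = z" "sg (2 * p) = 1"
  by (auto simp: sg_def)

context abelian_group
begin

lemma add_pow_zero: "add_pow G (0::int) a = \<zero>"
  by (simp add: add_pow_def)

lemma lincomb_extend:
  assumes "finite S" "S \<subseteq> T" "finite T" "T \<subseteq> carrier G" "\<forall>a. a \<notin> S \<longrightarrow> c a = (0::int)"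
  shows "finsum G (\<lambda>a. add_pow G (c a) a) S = finsum G (\<lambda>a. add_pow G (c a) a) T"
  using assms by (intro add.finprod_mono_neutral_cong_left) (auto simp: add_pow_zero)

lemma lincomb_add:
  assumes "lincomb G x c" "lincomb G y d"
  shows "lincomb G (x \<oplus> y) (\<lambda>a. c a + d a)"
proof -
  obtain S where S: "finite S" "S \<subseteq> carrier G" "\<forall>a. a \<notin> S \<longrightarrow> c a = 0"
    "x = finsum G (\<lambda>a. add_pow G (c a) a) S" using assms by (auto simp: lincomb_def)
  obtain T where T: "finite T" "T \<subseteq> carrier G" "\<forall>a. a \<notin> T \<longrightarrow> d a = 0"
    "y = finsum G (\<lambda>a. add_pow G (d a) a) T" using assms by (auto simp: lincomb_def)
  have "x \<oplus> y = finsum G (\<lambda>a. add_pow G (c a) a) (S \<union> T) \<oplus> finsum G (\<lambda>a. add_pow G (d a) a) (S \<union> T)"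
    using lincomb_extend[of S "S \<union> T" c] lincomb_extend[of T "S \<union> T" d] S T by auto
  also have "\<dots> = finsum G (\<lambda>a. add_pow G (c a) a \<oplus> add_pow G (d a) a) (S \<union> T)"
    using S T by (intro finsum_addf[symmetric]) auto
  also have "\<dots> = finsum G (\<lambda>a. add_pow G (c a + d a) a) (S \<union> T)"
    using S T by (intro finsum_cong') (auto simp: add.int_pow_mult)
  finally show ?thesis using S T unfolding lincomb_def by (intro exI[of _ "S \<union> T"]) auto
qed

lemma lincomb_neg:
  assumes "lincomb G x c"
  shows "lincomb G (\<ominus> x) (\<lambda>a. - c a)"
proof -
  obtain S where S: "finite S" "S \<subseteq> carrier G" "\<forall>a. a \<notin> S \<longrightarrow> c a = 0"
    "x = finsum G (\<lambda>a. add_pow G (c a) a) S" using assms by (auto simp: lincomb_def)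
  have "finsum G (\<lambda>a. add_pow G (- c a) a) S \<oplus> x = finsum G (\<lambda>a. add_pow G (- c a) a \<oplus> add_pow G (c a) a) S"
    using S by (auto intro!: finsum_addf[symmetric])
  also have "\<dots> = \<zero>"
    using S by (intro add.finprod_one_eqI) (auto simp: add.int_pow_neg l_neg)
  finally have "\<ominus> x = finsum G (\<lambda>a. add_pow G (- c a) a) S"
    using S by (intro add.inv_equality) (auto intro!: finsum_closed)
  then show ?thesis using S unfolding lincomb_def by (intro exI[of _ S]) auto
qed

lemma lincomb_zero: "lincomb G \<zero> (\<lambda>a. 0)"
  unfolding lincomb_def by (intro exI[of _ "{}"]) auto

lemma lincomb_atom: "x \<in> carrier G \<Longrightarrow> lincomb G x (kdelta x)"
  unfolding lincomb_def kdelta_def by (intro exI[of _ "{x}"]) (auto simp: finsum_insert)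

lemma lincomb_minus:
  assumes "lincomb G x c" "lincomb G y d"
  shows "lincomb G (x \<ominus> y) (\<lambda>a. c a - d a)"
  using lincomb_add[OF assms(1) lincomb_neg[OF assms(2)]] by (simp add: a_minus_def)

lemma lincomb_psgn:
  assumes "lincomb G x c"
  shows "lincomb G (psgn G p x) (\<lambda>a. sg p * c a)"
  using assms lincomb_neg[OF assms] by (simp add: psgn_def sg_def)

text \<open>Linear identities below are closed by this rule: the introduction rules compute the
  coefficient functions of both sides, and an identity of integers remains. Torsion in the group
  does no harm, since equality is only inferred from equal coefficients.\<close>

lemma lincomb_unique:
  assumes "lincomb G x c" "lincomb G y d" "\<And>a. c a = d a"
  shows "x = y"
proof -
  obtain S where S: "finite S" "S \<subseteq> carrier G" "\<forall>a. a \<notin> S \<longrightarrow> c a = 0"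
    "x = finsum G (\<lambda>a. add_pow G (c a) a) S" using assms by (auto simp: lincomb_def)
  obtain T where T: "finite T" "T \<subseteq> carrier G" "\<forall>a. a \<notin> T \<longrightarrow> d a = 0"
    "y = finsum G (\<lambda>a. add_pow G (d a) a) T" using assms by (auto simp: lincomb_def)
  show ?thesis
    using lincomb_extend[of S "S \<union> T" c] lincomb_extend[of T "S \<union> T" d] S T assms(3) by auto
qed

text \<open>\<open>lincomb_atom\<close> matches every term, so it comes last: sums, differences and
  signs are to be decomposed first.\<close>

lemmas lincomb_intros = lincomb_add lincomb_minus lincomb_neg lincomb_psgn lincomb_zero lincomb_atom

lemma psgn_closed [simp]: "x \<in> carrier G \<Longrightarrow> psgn G p x \<in> carrier G"
  by (simp add: psgn_def)

lemma psgn_psgn: "x \<in> carrier G \<Longrightarrow> psgn G p (psgn G q x) = psgn G (p + q) x"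
  by (simp add: psgn_def)

end

lemma lin_mapsI:
  assumes "\<And>x. x \<in> carrier V \<Longrightarrow> f x \<in> carrier W"
    "\<And>x y. x \<in> carrier V \<Longrightarrow> y \<in> carrier V \<Longrightarrow> f (x \<oplus>\<^bsub>V\<^esub> y) = f x \<oplus>\<^bsub>W\<^esub> f y"
    "\<And>r x. r \<in> carrier R \<Longrightarrow> x \<in> carrier V \<Longrightarrow> f (r \<odot>\<^bsub>V\<^esub> x) = r \<odot>\<^bsub>W\<^esub> f x"
  shows "f \<in> lin_maps R V W"
  using assms by (auto simp: lin_maps_def hom_def)

lemma lin_mapsD:
  assumes "f \<in> lin_maps R V W"
  shows "x \<in> carrier V \<Longrightarrow> f x \<in> carrier W"
    "x \<in> carrier V \<Longrightarrow> y \<in> carrier V \<Longrightarrow> f (x \<oplus>\<^bsub>V\<^esub> y) = f x \<oplus>\<^bsub>W\<^esub> f y"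
    "r \<in> carrier R \<Longrightarrow> x \<in> carrier V \<Longrightarrow> f (r \<odot>\<^bsub>V\<^esub> x) = r \<odot>\<^bsub>W\<^esub> f x"
  using assms by (auto simp: lin_maps_def hom_def)

text \<open>Both groups are packed into the predicate, so that preservation of zero, negatives and
  signs follows from a single premise.\<close>

definition addhom :: "('a, 'x) ring_scheme \<Rightarrow> ('b, 'y) ring_scheme \<Rightarrow> ('a \<Rightarrow> 'b) \<Rightarrow> bool" where
  "addhom V W f \<longleftrightarrow> abelian_group V \<and> abelian_group W \<and> (\<forall>x\<in>carrier V. f x \<in> carrier W) \<and>
     (\<forall>x\<in>carrier V. \<forall>y\<in>carrier V. f (x \<oplus>\<^bsub>V\<^esub> y) = f x \<oplus>\<^bsub>W\<^esub> f y)"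

lemma addhomI:
  assumes "abelian_group V" "abelian_group W" "\<And>x. x \<in> carrier V \<Longrightarrow> f x \<in> carrier W"
    "\<And>x y. x \<in> carrier V \<Longrightarrow> y \<in> carrier V \<Longrightarrow> f (x \<oplus>\<^bsub>V\<^esub> y) = f x \<oplus>\<^bsub>W\<^esub> f y"
  shows "addhom V W f"
  using assms by (simp add: addhom_def)

context
  fixes V :: "('a, 'x) ring_scheme" and W :: "('b, 'y) ring_scheme" and f
  assumes f: "addhom V W f"
begin

lemma addhom_closed: "x \<in> carrier V \<Longrightarrow> f x \<in> carrier W"
  and addhom_add: "x \<in> carrier V \<Longrightarrow> y \<in> carrier V \<Longrightarrow> f (x \<oplus>\<^bsub>V\<^esub> y) = f x \<oplus>\<^bsub>W\<^esub> f y"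
  using f by (auto simp: addhom_def)

lemma addhom_zero: "f \<zero>\<^bsub>V\<^esub> = \<zero>\<^bsub>W\<^esub>"
proof -
  interpret V: abelian_group V using f by (simp add: addhom_def)
  interpret W: abelian_group W using f by (simp add: addhom_def)
  have "f \<zero>\<^bsub>V\<^esub> \<oplus>\<^bsub>W\<^esub> f \<zero>\<^bsub>V\<^esub> = f \<zero>\<^bsub>V\<^esub>"
    using addhom_add[of "\<zero>\<^bsub>V\<^esub>" "\<zero>\<^bsub>V\<^esub>"] by simp
  then show ?thesis using addhom_closed[of "\<zero>\<^bsub>V\<^esub>"] by simp
qed

lemma addhom_neg: "x \<in> carrier V \<Longrightarrow> f (\<ominus>\<^bsub>V\<^esub> x) = \<ominus>\<^bsub>W\<^esub> f x"
proof -
  assume x: "x \<in> carrier V"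
  interpret V: abelian_group V using f by (simp add: addhom_def)
  interpret W: abelian_group W using f by (simp add: addhom_def)
  have "f (\<ominus>\<^bsub>V\<^esub> x) \<oplus>\<^bsub>W\<^esub> f x = \<zero>\<^bsub>W\<^esub>"
    using addhom_add[of "\<ominus>\<^bsub>V\<^esub> x" x] addhom_zero x by (simp add: V.l_neg)
  then show ?thesis using W.minus_equality addhom_closed x by simp
qed

lemma addhom_minus: "x \<in> carrier V \<Longrightarrow> y \<in> carrier V \<Longrightarrow> f (x \<ominus>\<^bsub>V\<^esub> y) = f x \<ominus>\<^bsub>W\<^esub> f y"
proof -
  assume x: "x \<in> carrier V" "y \<in> carrier V"
  interpret V: abelian_group V using f by (simp add: addhom_def)
  show ?thesis using x by (simp add: a_minus_def addhom_add addhom_neg)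
qed

lemma addhom_psgn: "x \<in> carrier V \<Longrightarrow> f (psgn V p x) = psgn W p (f x)"
  by (simp add: psgn_def addhom_neg)

end

lemma lin_maps_addhom:
  "\<lbrakk>abelian_group V; abelian_group W; f \<in> lin_maps R V W\<rbrakk> \<Longrightarrow> addhom V W f"
  by (auto intro!: addhomI dest: lin_mapsD)

section \<open>Graded modules with derivation: shifts, images, direct sums and twists\<close>

lemma gmdI:
  fixes A :: "('r, 'a, 'ax) cdga_scheme" and M :: "('r, 'a, 'm, 'mx) cdgm_scheme"
  assumes "cring R" "\<And>n. module R (gr M n)" "unit A \<in> carrier (gr A 0)"
    and "\<And>p q a x. \<lbrakk>a \<in> carrier (gr A p); x \<in> carrier (gr M q)\<rbrakk> \<Longrightarrow> act M p q a x \<in> carrier (gr M (p + q))"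
    and "\<And>p q a x y. \<lbrakk>a \<in> carrier (gr A p); x \<in> carrier (gr M q); y \<in> carrier (gr M q)\<rbrakk> \<Longrightarrow>
       act M p q a (x \<oplus>\<^bsub>gr M q\<^esub> y) = act M p q a x \<oplus>\<^bsub>gr M (p + q)\<^esub> act M p q a y"
    and "\<And>p q a b x. \<lbrakk>a \<in> carrier (gr A p); b \<in> carrier (gr A p); x \<in> carrier (gr M q)\<rbrakk> \<Longrightarrow>
       act M p q (a \<oplus>\<^bsub>gr A p\<^esub> b) x = act M p q a x \<oplus>\<^bsub>gr M (p + q)\<^esub> act M p q b x"
    and "\<And>p q a x r. \<lbrakk>a \<in> carrier (gr A p); x \<in> carrier (gr M q); r \<in> carrier R\<rbrakk> \<Longrightarrow>
       act M p q a (r \<odot>\<^bsub>gr M q\<^esub> x) = r \<odot>\<^bsub>gr M (p + q)\<^esub> act M p q a x"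
    and "\<And>p q a x r. \<lbrakk>a \<in> carrier (gr A p); x \<in> carrier (gr M q); r \<in> carrier R\<rbrakk> \<Longrightarrow>
       act M p q (r \<odot>\<^bsub>gr A p\<^esub> a) x = r \<odot>\<^bsub>gr M (p + q)\<^esub> act M p q a x"
    and "\<And>p q s a b x. \<lbrakk>a \<in> carrier (gr A p); b \<in> carrier (gr A q); x \<in> carrier (gr M s)\<rbrakk> \<Longrightarrow>
       act M p (q + s) a (act M q s b x) = act M (p + q) s (act A p q a b) x"
    and "\<And>n x. x \<in> carrier (gr M n) \<Longrightarrow> act M 0 n (unit A) x = x"
    and "\<And>n x. x \<in> carrier (gr M n) \<Longrightarrow> dif M n x \<in> carrier (gr M (n + 1))"
    and "\<And>n x y. \<lbrakk>x \<in> carrier (gr M n); y \<in> carrier (gr M n)\<rbrakk> \<Longrightarrow>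
       dif M n (x \<oplus>\<^bsub>gr M n\<^esub> y) = dif M n x \<oplus>\<^bsub>gr M (n + 1)\<^esub> dif M n y"
    and "\<And>n x r. \<lbrakk>x \<in> carrier (gr M n); r \<in> carrier R\<rbrakk> \<Longrightarrow> dif M n (r \<odot>\<^bsub>gr M n\<^esub> x) = r \<odot>\<^bsub>gr M (n + 1)\<^esub> dif M n x"
    and "\<And>p q a x. \<lbrakk>a \<in> carrier (gr A p); x \<in> carrier (gr M q)\<rbrakk> \<Longrightarrow>
          dif M (p + q) (act M p q a x) =
          act M (p + 1) q (dif A p a) x
            \<oplus>\<^bsub>gr M (p + q + 1)\<^esub> psgn (gr M (p + q + 1)) p (act M p (q + 1) a (dif M q x))"
  shows "graded_module_derivation R A M"
  using assms by (auto simp: graded_module_derivation_def graded_module_derivation_axioms_def intro!: lin_mapsI)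

context graded_module_derivation
begin

lemma ab [simp]: "abelian_group (gr M n)"
  using gr_module[of n] by (simp add: module_def)

text \<open>Degrees are separate variables tied by equations, here and below:
  \<open>p + 1 + q\<close> and \<open>p + q + 1\<close> index the same component without being the
  same term.\<close>

lemma act_closed: "\<lbrakk>a \<in> carrier (gr A p); x \<in> carrier (gr M q); n = p + q\<rbrakk> \<Longrightarrow> act M p q a x \<in> carrier (gr M n)"
  using lin_mapsD(1)[OF act_lin_right] by blast

lemma act_hom: "\<lbrakk>a \<in> carrier (gr A p); n = p + q\<rbrakk> \<Longrightarrow> addhom (gr M q) (gr M n) (act M p q a)"
  using lin_maps_addhom[OF _ _ act_lin_right] by simp

lemma act_smult: "\<lbrakk>a \<in> carrier (gr A p); x \<in> carrier (gr M q); r \<in> carrier R; n = p + q\<rbrakk>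
    \<Longrightarrow> act M p q a (r \<odot>\<^bsub>gr M q\<^esub> x) = r \<odot>\<^bsub>gr M n\<^esub> act M p q a x"
  using lin_mapsD(3)[OF act_lin_right] by blast

lemma act_hom_left: "\<lbrakk>abelian_group (gr A p); x \<in> carrier (gr M q); n = p + q\<rbrakk> \<Longrightarrow> addhom (gr A p) (gr M n) (\<lambda>a. act M p q a x)"
  using lin_maps_addhom[OF _ _ act_lin_left] by simp

lemma act_smult_left: "\<lbrakk>a \<in> carrier (gr A p); x \<in> carrier (gr M q); r \<in> carrier R; n = p + q\<rbrakk>
    \<Longrightarrow> act M p q (r \<odot>\<^bsub>gr A p\<^esub> a) x = r \<odot>\<^bsub>gr M n\<^esub> act M p q a x"
  using lin_mapsD(3)[OF act_lin_left] by blast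

lemma act_act: "\<lbrakk>a \<in> carrier (gr A p); b \<in> carrier (gr A q); x \<in> carrier (gr M s); m = q + s; n = p + q\<rbrakk>
    \<Longrightarrow> act M p m a (act M q s b x) = act M n s (act A p q a b) x"
  using act_assoc by blast

lemma dif_closed: "\<lbrakk>x \<in> carrier (gr M m); n = m + 1\<rbrakk> \<Longrightarrow> dif M m x \<in> carrier (gr M n)"
  using lin_mapsD(1)[OF dif_lin] by blast

lemma dif_hom: "n = m + 1 \<Longrightarrow> addhom (gr M m) (gr M n) (dif M m)"
  using lin_maps_addhom[OF _ _ dif_lin] by simp

lemma dif_smult: "\<lbrakk>x \<in> carrier (gr M m); r \<in> carrier R; n = m + 1\<rbrakk>
    \<Longrightarrow> dif M m (r \<odot>\<^bsub>gr M m\<^esub> x) = r \<odot>\<^bsub>gr M n\<^esub> dif M m x"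
  using lin_mapsD(3)[OF dif_lin] by blast

lemma dif_act': "\<lbrakk>a \<in> carrier (gr A p); x \<in> carrier (gr M q); m = p + q; p' = p + 1; q' = q + 1; n = p + q + 1\<rbrakk> \<Longrightarrow>
   dif M m (act M p q a x) = act M p' q (dif A p a) x \<oplus>\<^bsub>gr M n\<^esub> psgn (gr M n) p (act M p q' a (dif M q x))"
  using dif_act by blast

lemma smult_hom: "r \<in> carrier R \<Longrightarrow> addhom (gr M n) (gr M n) (\<lambda>x. r \<odot>\<^bsub>gr M n\<^esub> x)"
  using module.smult_closed[OF gr_module] module.smult_r_distr[OF gr_module] by (intro addhomI) auto

end

text \<open>The sign \<open>(-1)^(l p)\<close> on the action is forced by the Leibniz rule: the
  differential carries \<open>(-1)^l\<close>, and this is the change of the action sign when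
  \<open>dif A p a\<close> raises the degree from \<open>p\<close> to \<open>p + 1\<close>.\<close>

lemma gmd_shift:
  fixes A :: "('r, 'a, 'ax) cdga_scheme"
  assumes "graded_module_derivation R A M" "graded_module_derivation R A A"
  shows "graded_module_derivation R A (shift l M)"
proof -
  interpret M: graded_module_derivation R A M by fact
  interpret A: graded_module_derivation R A A by fact
  have ag: "abelian_group (gr M n)" for n by simp
  note cl = M.act_closed M.dif_closed A.act_closed A.dif_closed abelian_group.psgn_closed[OF ag]
  note hom = M.act_hom M.act_hom_left[OF A.ab] M.dif_hom M.smult_hom
  show ?thesis
  proof (rule gmdI)
    show "cring R" by (rule M.is_cring)
    show "module R (gr (shift l M) n)" for n using M.gr_module by (simp add: shift_def)
    show "unit A \<in> carrier (gr A 0)" by (rule M.unit_closed)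
  next
    fix p q a x assume [simp]: "a \<in> carrier (gr A p)" and "x \<in> carrier (gr (shift l M) q)"
    then have [simp]: "x \<in> carrier (gr M (q + l))" by (simp add: shift_def)
    have a: "act M p (q + l) a x \<in> carrier (gr M (p + q + l))" by (rule cl; simp)
    then show "act (shift l M) p q a x \<in> carrier (gr (shift l M) (p + q))"
      by (simp add: shift_def cl)
    {
    fix r assume [simp]: "r \<in> carrier R"
    show "act (shift l M) p q a (r \<odot>\<^bsub>gr (shift l M) q\<^esub> x) = r \<odot>\<^bsub>gr (shift l M) (p + q)\<^esub> act (shift l M) p q a x"
      "act (shift l M) p q (r \<odot>\<^bsub>gr A p\<^esub> a) x = r \<odot>\<^bsub>gr (shift l M) (p + q)\<^esub> act (shift l M) p q a x"
      using a by (simp_all add: shift_def M.act_smult[where n="p + q + l"] M.act_smult_left[where n="p + q + l"] addhom_psgn[OF hom(4)])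
    }
    fix y assume "y \<in> carrier (gr (shift l M) q)"
    then have [simp]: "y \<in> carrier (gr M (q + l))" by (simp add: shift_def)
    have "act M p (q + l) a y \<in> carrier (gr M (p + q + l))" by (rule cl; simp)
    moreover have "act M p (q + l) a (x \<oplus>\<^bsub>gr M (q + l)\<^esub> y) = act M p (q + l) a x \<oplus>\<^bsub>gr M (p + q + l)\<^esub> act M p (q + l) a y"
      by (rule addhom_add[OF hom(1)]; simp)
    ultimately show "act (shift l M) p q a (x \<oplus>\<^bsub>gr (shift l M) q\<^esub> y) =
       act (shift l M) p q a x \<oplus>\<^bsub>gr (shift l M) (p + q)\<^esub> act (shift l M) p q a y"
      using a abelian_group.minus_add[OF ag] by (simp add: shift_def psgn_def)
  next
    fix p q a b x assume [simp]: "a \<in> carrier (gr A p)" "b \<in> carrier (gr A p)" and "x \<in> carrier (gr (shift l M) q)"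
    then have [simp]: "x \<in> carrier (gr M (q + l))" by (simp add: shift_def)
    have a: "act M p (q + l) a x \<in> carrier (gr M (p + q + l))" "act M p (q + l) b x \<in> carrier (gr M (p + q + l))" by (rule cl; simp)+
    moreover have "act M p (q + l) (a \<oplus>\<^bsub>gr A p\<^esub> b) x = act M p (q + l) a x \<oplus>\<^bsub>gr M (p + q + l)\<^esub> act M p (q + l) b x"
      by (rule addhom_add[OF hom(2)]; simp)
    ultimately show "act (shift l M) p q (a \<oplus>\<^bsub>gr A p\<^esub> b) x =
       act (shift l M) p q a x \<oplus>\<^bsub>gr (shift l M) (p + q)\<^esub> act (shift l M) p q b x"
      using a abelian_group.minus_add[OF ag] by (simp add: shift_def psgn_def)
  next
    fix p q s a b x assume [simp]: "a \<in> carrier (gr A p)" "b \<in> carrier (gr A q)" and "x \<in> carrier (gr (shift l M) s)"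
    then have [simp]: "x \<in> carrier (gr M (s + l))" by (simp add: shift_def)
    have b: "act M q (s + l) b x \<in> carrier (gr M (q + s + l))" by (rule cl; simp)
    have i: "p + q + s + l = p + (q + s) + l" by simp
    have e: "act M p (q + s + l) a (act M q (s + l) b x) = act M (p + q) (s + l) (act A p q a b) x"
      by (rule M.act_act; simp)
    have c: "act M (p + q) (s + l) (act A p q a b) x \<in> carrier (gr M (p + (q + s) + l))"
      by (rule cl; simp add: A.act_closed)
    show "act (shift l M) p (q + s) a (act (shift l M) q s b x) = act (shift l M) (p + q) s (act A p q a b) x"
      using b c by (simp add: shift_def e i addhom_psgn[OF hom(1)[where n="p + (q + s) + l"]] abelian_group.psgn_psgn[OF ag] distrib_left)
  next
    fix n x assume "x \<in> carrier (gr (shift l M) n)"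
    then have [simp]: "x \<in> carrier (gr M (n + l))" by (simp add: shift_def)
    show "act (shift l M) 0 n (unit A) x = x" by (simp add: shift_def M.act_unit psgn_def)
    have d: "dif M (n + l) x \<in> carrier (gr M (n + l + 1))" by (rule cl; simp)
    have i: "n + 1 + l = n + l + 1" by simp
    show "dif (shift l M) n x \<in> carrier (gr (shift l M) (n + 1))"
      using d by (simp add: shift_def i cl)
    {
    fix r assume [simp]: "r \<in> carrier R"
    show "dif (shift l M) n (r \<odot>\<^bsub>gr (shift l M) n\<^esub> x) = r \<odot>\<^bsub>gr (shift l M) (n + 1)\<^esub> dif (shift l M) n x"
      using d by (simp add: shift_def i M.dif_smult[where n="n + l + 1"] addhom_psgn[OF hom(4)])
    }
    fix y assume "y \<in> carrier (gr (shift l M) n)"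
    then have [simp]: "y \<in> carrier (gr M (n + l))" by (simp add: shift_def)
    have "dif M (n + l) y \<in> carrier (gr M (n + l + 1))" by (rule cl; simp)
    moreover have "dif M (n + l) (x \<oplus>\<^bsub>gr M (n + l)\<^esub> y) = dif M (n + l) x \<oplus>\<^bsub>gr M (n + l + 1)\<^esub> dif M (n + l) y"
      by (rule addhom_add[OF hom(3)]; simp)
    ultimately show "dif (shift l M) n (x \<oplus>\<^bsub>gr (shift l M) n\<^esub> y) = dif (shift l M) n x \<oplus>\<^bsub>gr (shift l M) (n + 1)\<^esub> dif (shift l M) n y"
      using d abelian_group.minus_add[OF ag] by (simp add: shift_def psgn_def i)
  next
    fix p q a x assume [simp]: "a \<in> carrier (gr A p)" and "x \<in> carrier (gr (shift l M) q)"
    then have [simp]: "x \<in> carrier (gr M (q + l))" by (simp add: shift_def)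
    have i: "p + q + 1 + l = p + q + l + 1" "p + 1 + q + l = p + q + l + 1" "p + (q + 1) + l = p + q + l + 1" by simp_all
    have [simp]: "act M p (q + l) a x \<in> carrier (gr M (p + q + l))" by (rule cl; simp)
    have [simp]: "dif M (q + l) x \<in> carrier (gr M (q + l + 1))" "dif M (q + l) x \<in> carrier (gr M (q + 1 + l))" by (rule cl; simp)+
    have [simp]: "act M (p + 1) (q + l) (dif A p a) x \<in> carrier (gr M (p + q + l + 1))"
      "act M p (q + 1 + l) a (dif M (q + l) x) \<in> carrier (gr M (p + q + l + 1))" by (rule cl; simp add: cl)+
    have 1: "dif M (p + q + l) (psgn (gr M (p + q + l)) (l * p) (act M p (q + l) a x)) =
        psgn (gr M (p + q + l + 1)) (l * p) (act M (p + 1) (q + l) (dif A p a) x \<oplus>\<^bsub>gr M (p + q + l + 1)\<^esub> psgn (gr M (p + q + l + 1)) p (act M p (q + 1 + l) a (dif M (q + l) x)))"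
      by (subst addhom_psgn[OF hom(3)], simp_all, subst M.dif_act', auto)
    have 2: "act M p (q + 1 + l) a (psgn (gr M (q + l + 1)) l (dif M (q + l) x)) = psgn (gr M (p + q + l + 1)) l (act M p (q + 1 + l) a (dif M (q + l) x))"
    proof -
      have j: "q + l + 1 = q + 1 + l" by simp
      show ?thesis unfolding j by (rule addhom_psgn[OF hom(1)]) simp_all
    qed
    show "dif (shift l M) (p + q) (act (shift l M) p q a x) =
          act (shift l M) (p + 1) q (dif A p a) x
            \<oplus>\<^bsub>gr (shift l M) (p + q + 1)\<^esub> psgn (gr (shift l M) (p + q + 1)) p (act (shift l M) p (q + 1) a (dif (shift l M) q x))"
      unfolding shift_def cdgm.simps i 1 2
      by (rule abelian_group.lincomb_unique[OF ag], (rule abelian_group.lincomb_intros[OF ag] | assumption | simp; fail)+)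
        (simp add: algebra_simps)
  qed
qed

text \<open>The axioms are closure conditions and equations between operations, so they pass to any
  structure onto which \<open>M\<close> maps compatibly in each degree. This serves quotients, with
  coset maps, and transport of structure, with injections.\<close>

lemma gmd_image:
  fixes A :: "('r, 'a, 'ax) cdga_scheme" and M :: "('r, 'a, 'm, 'mx) cdgm_scheme" and N :: "('r, 'a, 'n, 'nx) cdgm_scheme"
  assumes M: "graded_module_derivation R A M" and A: "graded_module_derivation R A A"
    and img: "\<And>n. carrier (gr N n) = \<pi> n ` carrier (gr M n)"
    and zero: "\<And>n. \<zero>\<^bsub>gr N n\<^esub> = \<pi> n \<zero>\<^bsub>gr M n\<^esub>"
    and add: "\<And>n x y. \<lbrakk>x \<in> carrier (gr M n); y \<in> carrier (gr M n)\<rbrakk> \<Longrightarrow> \<pi> n x \<oplus>\<^bsub>gr N n\<^esub> \<pi> n y = \<pi> n (x \<oplus>\<^bsub>gr M n\<^esub> y)"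
    and smult: "\<And>n r x. \<lbrakk>r \<in> carrier R; x \<in> carrier (gr M n)\<rbrakk> \<Longrightarrow> r \<odot>\<^bsub>gr N n\<^esub> \<pi> n x = \<pi> n (r \<odot>\<^bsub>gr M n\<^esub> x)"
    and act: "\<And>p q a x. \<lbrakk>a \<in> carrier (gr A p); x \<in> carrier (gr M q)\<rbrakk> \<Longrightarrow> act N p q a (\<pi> q x) = \<pi> (p + q) (act M p q a x)"
    and dif: "\<And>n x. x \<in> carrier (gr M n) \<Longrightarrow> dif N n (\<pi> n x) = \<pi> (n + 1) (dif M n x)"
  shows "graded_module_derivation R A N" "\<And>n. addhom (gr M n) (gr N n) (\<pi> n)"
proof -
  interpret M: graded_module_derivation R A M by fact
  interpret A: graded_module_derivation R A A by fact
  have ag: "abelian_group (gr M n)" for n by simp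
  have agN: "abelian_group (gr N n)" for n
  proof -
    interpret abelian_group "gr M n" by simp
    show ?thesis
    proof (rule abelian_groupI)
      fix x assume "x \<in> carrier (gr N n)"
      then obtain x' where x: "x' \<in> carrier (gr M n)" "x = \<pi> n x'" by (auto simp: img)
      have "\<pi> n (\<ominus>\<^bsub>gr M n\<^esub> x') \<oplus>\<^bsub>gr N n\<^esub> x = \<zero>\<^bsub>gr N n\<^esub>" using x by (simp add: add zero l_neg)
      then show "\<exists>y\<in>carrier (gr N n). y \<oplus>\<^bsub>gr N n\<^esub> x = \<zero>\<^bsub>gr N n\<^esub>" using x by (auto simp: img)
    qed (auto simp: img add zero a_assoc, simp add: a_comm)
  qed
  have mN: "module R (gr N n)" for n
  proof -
    interpret module R "gr M n" by (rule M.gr_module)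
    show ?thesis
      by (rule moduleI) (auto simp: img smult add agN smult_l_distr smult_r_distr smult_assoc1 M.is_cring)
  qed
  note cl = M.act_closed M.dif_closed A.act_closed A.dif_closed
  have ps: "psgn (gr N n) p (\<pi> n x) = \<pi> n (psgn (gr M n) p x)" if "x \<in> carrier (gr M n)" for n p x
    using addhom_psgn[of "gr M n" "gr N n" "\<pi> n" x p] that by (simp add: addhom_def agN img add)
  note h = addhom_add[OF M.act_hom[OF _ refl]] addhom_add[OF M.act_hom_left[OF A.ab _ refl]] addhom_add[OF M.dif_hom[OF refl]]
  show "graded_module_derivation R A N"
  proof (rule gmdI)
    fix p q a x assume "a \<in> carrier (gr A p)" "x \<in> carrier (gr N q)"
    then obtain x' where x: "x' \<in> carrier (gr M q)" "x = \<pi> q x'" and a[simp]: "a \<in> carrier (gr A p)" by (auto simp: img)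
    have c: "act M (p + 1) q (dif A p a) x' \<in> carrier (gr M (p + q + 1))"
       "act M p (q + 1) a (dif M q x') \<in> carrier (gr M (p + q + 1))"
      using x by (auto intro!: cl)
    have i: "p + 1 + q = p + q + 1" "p + (q + 1) = p + q + 1" by simp_all
    show "dif N (p + q) (act N p q a x) = act N (p + 1) q (dif A p a) x
            \<oplus>\<^bsub>gr N (p + q + 1)\<^esub> psgn (gr N (p + q + 1)) p (act N p (q + 1) a (dif N q x))"
      using x c by (simp add: act M.act_closed[OF _ _ refl] M.dif_closed[OF _ refl] A.dif_closed[OF _ refl] dif ps add i M.dif_act abelian_group.psgn_closed[OF ag])
  qed (auto simp: add.assoc[symmetric] img act dif smult add cl M.act_unit M.act_assoc M.unit_closed M.is_cring mN M.dif_smult[OF _ _ refl]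
      M.act_smult[OF _ _ _ refl] M.act_smult_left[OF _ _ _ refl] h abelian_monoid.a_closed[OF abelian_group.axioms(1)[OF ag]]
      abelian_monoid.a_closed[OF abelian_group.axioms(1)[OF A.ab]] module.smult_closed[OF M.gr_module] module.smult_closed[OF A.gr_module])
  show "addhom (gr M n) (gr N n) (\<pi> n)" for n
    by (simp add: addhom_def agN img add)
qed

lemma cdg_moduleI:
  assumes "cdg_algebra R A" "graded_module_derivation R A M"
    "\<And>n x. x \<in> carrier (gr M n) \<Longrightarrow> dif M (n + 1) (dif M n x) = act M 2 n (curv A) x"
  shows "cdg_module R A M"
  using assms by (simp add: cdg_module_def cdg_module_axioms_def)

lemma cdg_module_image:
  fixes A :: "('r, 'a) cdga" and M :: "('r, 'a, 'm) cdgm" and N :: "('r, 'a, 'n) cdgm"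
  assumes M: "cdg_module R A M"
    and img: "\<And>n. carrier (gr N n) = \<pi> n ` carrier (gr M n)"
    and zero: "\<And>n. \<zero>\<^bsub>gr N n\<^esub> = \<pi> n \<zero>\<^bsub>gr M n\<^esub>"
    and add: "\<And>n x y. \<lbrakk>x \<in> carrier (gr M n); y \<in> carrier (gr M n)\<rbrakk> \<Longrightarrow> \<pi> n x \<oplus>\<^bsub>gr N n\<^esub> \<pi> n y = \<pi> n (x \<oplus>\<^bsub>gr M n\<^esub> y)"
    and smult: "\<And>n r x. \<lbrakk>r \<in> carrier R; x \<in> carrier (gr M n)\<rbrakk> \<Longrightarrow> r \<odot>\<^bsub>gr N n\<^esub> \<pi> n x = \<pi> n (r \<odot>\<^bsub>gr M n\<^esub> x)"
    and act: "\<And>p q a x. \<lbrakk>a \<in> carrier (gr A p); x \<in> carrier (gr M q)\<rbrakk> \<Longrightarrow> act N p q a (\<pi> q x) = \<pi> (p + q) (act M p q a x)"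
    and dif: "\<And>n x. x \<in> carrier (gr M n) \<Longrightarrow> dif N n (\<pi> n x) = \<pi> (n + 1) (dif M n x)"
  shows "cdg_module R A N"
proof -
  interpret M: cdg_module R A M by fact
  show ?thesis
  proof (rule cdg_moduleI)
    show "cdg_algebra R A" by (rule M.cdg_algebra_axioms)
    show "graded_module_derivation R A N"
      by (rule gmd_image[OF M.M.graded_module_derivation_axioms M.graded_module_derivation_axioms, where \<pi>=\<pi>])
        (rule img zero add smult act dif; assumption)+
    fix n x assume "x \<in> carrier (gr N n)"
    then obtain x' where "x' \<in> carrier (gr M n)" "x = \<pi> n x'" by (auto simp: img)
    moreover have "2 + n = n + 1 + 1" by simp
    ultimately show "dif N (n + 1) (dif N n x) = act N 2 n (curv A) x"
      by (simp add: dif act M.curv_closed M.M.dif_closed M.dif_dif_module)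
  qed
qed

lemma cdg_module_transport:
  assumes M: "cdg_module R A M" and inj: "\<And>n. inj_on e (carrier (gr M n))"
  shows "cdg_module R A (transport e M)"
proof -
  interpret M: cdg_module R A M by fact
  note r = inv_into_f_f[OF inj]
  show ?thesis
    by (rule cdg_module_image[OF M, where \<pi>="\<lambda>n. e"])
      (simp_all add: transport_def Let_def r)
qed

lemma module_dsum:
  assumes "module R V" "module R W"
  shows "module R (dsum_module V W)"
proof -
  interpret V: module R V by fact
  interpret W: module R W by fact
  have "abelian_group (dsum_module V W)"
  proof (rule abelian_groupI)
    fix x assume "x \<in> carrier (dsum_module V W)"
    then show "\<exists>y\<in>carrier (dsum_module V W). y \<oplus>\<^bsub>dsum_module V W\<^esub> x = \<zero>\<^bsub>dsum_module V W\<^esub>"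
      by (intro bexI[of _ "(\<ominus>\<^bsub>V\<^esub> fst x, \<ominus>\<^bsub>W\<^esub> snd x)"]) (auto simp: dsum_module_def V.l_neg W.l_neg)
  qed (auto simp: dsum_module_def V.a_assoc W.a_assoc, auto simp: V.a_comm W.a_comm)
  then show ?thesis
    by (rule moduleI[OF V.is_cring])
      (auto simp: dsum_module_def V.smult_l_distr V.smult_r_distr V.smult_assoc1 W.smult_l_distr W.smult_r_distr W.smult_assoc1)
qed

lemma dsum_module_simps [simp]:
  "carrier (dsum_module V W) = carrier V \<times> carrier W"
  "\<zero>\<^bsub>dsum_module V W\<^esub> = (\<zero>\<^bsub>V\<^esub>, \<zero>\<^bsub>W\<^esub>)"
  "(v, w) \<oplus>\<^bsub>dsum_module V W\<^esub> (v', w') = (v \<oplus>\<^bsub>V\<^esub> v', w \<oplus>\<^bsub>W\<^esub> w')"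
  "r \<odot>\<^bsub>dsum_module V W\<^esub> (v, w) = (r \<odot>\<^bsub>V\<^esub> v, r \<odot>\<^bsub>W\<^esub> w)"
  by (simp_all add: dsum_module_def)

lemma dsum_neg:
  assumes "module R V" "module R W" "v \<in> carrier V" "w \<in> carrier W"
  shows "\<ominus>\<^bsub>dsum_module V W\<^esub> (v, w) = (\<ominus>\<^bsub>V\<^esub> v, \<ominus>\<^bsub>W\<^esub> w)"
proof -
  interpret V: module R V by fact
  interpret W: module R W by fact
  interpret D: module R "dsum_module V W" using assms module_dsum by blast
  show ?thesis using assms by (intro D.minus_equality) (auto simp: V.l_neg W.l_neg)
qed

lemma dsum_psgn:
  assumes "module R V" "module R W" "v \<in> carrier V" "w \<in> carrier W"
  shows "psgn (dsum_module V W) p (v, w) = (psgn V p v, psgn W p w)"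
  using dsum_neg[OF assms] by (simp add: psgn_def)

lemma gmd_dsum:
  fixes A :: "('r, 'a, 'ax) cdga_scheme"
  assumes M: "graded_module_derivation R A M" and N: "graded_module_derivation R A N"
    and A: "graded_module_derivation R A A"
  shows "graded_module_derivation R A (dsum M N)"
proof -
  interpret M: graded_module_derivation R A M by fact
  interpret N: graded_module_derivation R A N by fact
  interpret A: graded_module_derivation R A A by fact
  have m: "module R (gr (dsum M N) n)" for n
    using module_dsum[OF M.gr_module N.gr_module] by (simp add: dsum_def)
  note h = addhom_add[OF M.act_hom[OF _ refl]] addhom_add[OF M.act_hom_left[OF A.ab _ refl]] addhom_add[OF M.dif_hom[OF refl]]
    addhom_add[OF N.act_hom[OF _ refl]] addhom_add[OF N.act_hom_left[OF A.ab _ refl]] addhom_add[OF N.dif_hom[OF refl]]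
  show ?thesis
  proof (rule gmdI)
    fix p q a x assume "a \<in> carrier (gr A p)" "x \<in> carrier (gr (dsum M N) q)"
    then obtain y z where x: "y \<in> carrier (gr M q)" "z \<in> carrier (gr N q)" "x = (y, z)" and [simp]: "a \<in> carrier (gr A p)" by (auto simp: dsum_def)
    have c: "act M p (q + 1) a (dif M q y) \<in> carrier (gr M (p + q + 1))" "act N p (q + 1) a (dif N q z) \<in> carrier (gr N (p + q + 1))"
      using x by (auto intro!: M.act_closed N.act_closed M.dif_closed N.dif_closed)
    show "dif (dsum M N) (p + q) (act (dsum M N) p q a x) = act (dsum M N) (p + 1) q (dif A p a) x
            \<oplus>\<^bsub>gr (dsum M N) (p + q + 1)\<^esub> psgn (gr (dsum M N) (p + q + 1)) p (act (dsum M N) p (q + 1) a (dif (dsum M N) q x))"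
      using x c by (simp add: dsum_def dsum_psgn[OF M.gr_module N.gr_module] M.dif_act N.dif_act)
  qed (auto simp: m dsum_def h M.unit_closed M.is_cring M.act_closed N.act_closed M.act_unit N.act_unit M.act_assoc N.act_assoc
     M.dif_closed N.dif_closed M.act_smult[OF _ _ _ refl] N.act_smult[OF _ _ _ refl] M.act_smult_left[OF _ _ _ refl] N.act_smult_left[OF _ _ _ refl]
     M.dif_smult[OF _ _ refl] N.dif_smult[OF _ _ refl] module_dsum M.gr_module N.gr_module)
qed

text \<open>Cones and the modules \<open>\<Gamma>_i\<close> are direct sums whose differential is
  altered by a map of degree one. Such a \<open>\<theta>\<close> commutes with the action up to
  \<open>(-1)^p\<close> and adds no term in \<open>dif A p a\<close>, so the Leibniz rule
  survives.\<close>

lemma gmd_twist: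
  fixes A :: "('r, 'a, 'ax) cdga_scheme" and M :: "('r, 'a, 'm) cdgm"
  assumes M: "graded_module_derivation R A M" and A: "graded_module_derivation R A A"
    and lin: "\<And>n. \<theta> n \<in> lin_maps R (gr M n) (gr M (n + 1))"
    and sgn: "\<And>p q a x. \<lbrakk>a \<in> carrier (gr A p); x \<in> carrier (gr M q)\<rbrakk> \<Longrightarrow>
      \<theta> (p + q) (act M p q a x) = psgn (gr M (p + q + 1)) p (act M p (q + 1) a (\<theta> q x))"
    and d: "\<And>n x. x \<in> carrier (gr M n) \<Longrightarrow> d n x = dif M n x \<oplus>\<^bsub>gr M (n + 1)\<^esub> \<theta> n x"
  shows "graded_module_derivation R A (M\<lparr>dif := d\<rparr>)"
proof -
  interpret M: graded_module_derivation R A M by fact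
  interpret A: graded_module_derivation R A A by fact
  have ag: "abelian_group (gr M n)" for n by simp
  note cl = M.act_closed M.dif_closed A.act_closed A.dif_closed lin_mapsD(1)[OF lin]
  note h = addhom_add[OF M.act_hom[OF _ refl]] addhom_add[OF M.act_hom_left[OF A.ab _ refl]] addhom_add[OF M.dif_hom[OF refl]]
  note a_closed = abelian_monoid.a_closed[OF abelian_group.axioms(1)[OF ag]]
   abelian_monoid.a_closed[OF abelian_group.axioms(1)[OF A.ab]] module.smult_closed[OF M.gr_module] module.smult_closed[OF A.gr_module]
  show ?thesis
  proof (rule gmdI)
    fix n x y assume "x \<in> carrier (gr (M\<lparr>dif := d\<rparr>) n)" "y \<in> carrier (gr (M\<lparr>dif := d\<rparr>) n)"
    then have x: "x \<in> carrier (gr M n)" "y \<in> carrier (gr M n)" by auto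
    have [simp]: "dif M n x \<in> carrier (gr M (n + 1))" "dif M n y \<in> carrier (gr M (n + 1))"
      "\<theta> n x \<in> carrier (gr M (n + 1))" "\<theta> n y \<in> carrier (gr M (n + 1))" using x by (auto intro: cl)
    have "dif M n x \<oplus>\<^bsub>gr M (n + 1)\<^esub> dif M n y \<oplus>\<^bsub>gr M (n + 1)\<^esub> (\<theta> n x \<oplus>\<^bsub>gr M (n + 1)\<^esub> \<theta> n y)
       = dif M n x \<oplus>\<^bsub>gr M (n + 1)\<^esub> \<theta> n x \<oplus>\<^bsub>gr M (n + 1)\<^esub> (dif M n y \<oplus>\<^bsub>gr M (n + 1)\<^esub> \<theta> n y)"
      by (rule abelian_group.lincomb_unique[OF ag], (rule abelian_group.lincomb_intros[OF ag] | assumption | simp; fail | simp add: algebra_simps; fail)+)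
    then show "dif (M\<lparr>dif := d\<rparr>) n (x \<oplus>\<^bsub>gr (M\<lparr>dif := d\<rparr>) n\<^esub> y) =
      dif (M\<lparr>dif := d\<rparr>) n x \<oplus>\<^bsub>gr (M\<lparr>dif := d\<rparr>) (n + 1)\<^esub> dif (M\<lparr>dif := d\<rparr>) n y"
      using x by (simp add: d a_closed h lin_mapsD(2)[OF lin])
  next
    fix p q a x assume a[simp]: "a \<in> carrier (gr A p)" and "x \<in> carrier (gr (M\<lparr>dif := d\<rparr>) q)"
    then have x: "x \<in> carrier (gr M q)" by auto
    have 1: "act M p q a x \<in> carrier (gr M (p + q))" using x by (auto intro: cl)
    have [simp]: "act M (p + 1) q (dif A p a) x \<in> carrier (gr M (p + q + 1))" using x by (auto intro!: cl)
    have [simp]: "act M p (q + 1) a (dif M q x) \<in> carrier (gr M (p + q + 1))" "act M p (q + 1) a (\<theta> q x) \<in> carrier (gr M (p + q + 1))"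
      using x by (auto intro!: cl M.act_closed)
    have i: "p + (q + 1) = p + q + 1" by simp
    show "dif (M\<lparr>dif := d\<rparr>) (p + q) (act (M\<lparr>dif := d\<rparr>) p q a x) = act (M\<lparr>dif := d\<rparr>) (p + 1) q (dif A p a) x
            \<oplus>\<^bsub>gr (M\<lparr>dif := d\<rparr>) (p + q + 1)\<^esub> psgn (gr (M\<lparr>dif := d\<rparr>) (p + q + 1)) p
              (act (M\<lparr>dif := d\<rparr>) p (q + 1) a (dif (M\<lparr>dif := d\<rparr>) q x))"
      using x 1 apply (simp add: d sgn M.dif_act h[unfolded i] M.dif_closed[OF _ refl] cl(5) i)
      by (rule abelian_group.lincomb_unique[OF ag], (rule abelian_group.lincomb_intros[OF ag] | assumption | simp; fail | simp add: algebra_simps; fail)+)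
  next
    fix n x r assume x: "x \<in> carrier (gr (M\<lparr>dif := d\<rparr>) n)" "r \<in> carrier R"
    then show "dif (M\<lparr>dif := d\<rparr>) n (r \<odot>\<^bsub>gr (M\<lparr>dif := d\<rparr>) n\<^esub> x) = r \<odot>\<^bsub>gr (M\<lparr>dif := d\<rparr>) (n + 1)\<^esub> dif (M\<lparr>dif := d\<rparr>) n x"
      by (simp add: d a_closed M.dif_smult[OF _ _ refl] lin_mapsD(3)[OF lin] module.smult_r_distr[OF M.gr_module] cl)
  qed (auto simp: d cl a_closed M.act_unit M.act_assoc M.unit_closed M.is_cring M.gr_module
      M.act_smult[OF _ _ _ refl] M.act_smult_left[OF _ _ _ refl] h)
qed

lemma (in abelian_group) neg_zero: "\<ominus> \<zero> = \<zero>"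
  by (rule minus_equality) simp_all

lemma (in abelian_group) psgn_zero: "psgn G p \<zero> = \<zero>"
  by (simp add: psgn_def neg_zero)

lemma (in abelian_group) minus_eq_zero_iff: "x \<in> carrier G \<Longrightarrow> y \<in> carrier G \<Longrightarrow> x \<ominus> y = \<zero> \<longleftrightarrow> x = y"
proof
  assume c: "x \<in> carrier G" "y \<in> carrier G" and e: "x \<ominus> y = \<zero>"
  have "x = (x \<ominus> y) \<oplus> y"
    using c by (intro lincomb_unique) (rule lincomb_intros | assumption | simp; fail)+
  then show "x = y" using c e by simp
next
  assume "x \<in> carrier G" "y \<in> carrier G" "x = y"
  then show "x \<ominus> y = \<zero>" by (simp add: a_minus_def r_neg)
qed

section \<open>\<open>t\<close>-acyclic torsion modules\<close>

lemma mem_a_coset: "y \<in> H +>\<^bsub>G\<^esub> x \<longleftrightarrow> (\<exists>h\<in>H. y = h \<oplus>\<^bsub>G\<^esub> x)"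
  by (auto simp: a_r_coset_def')

text \<open>\<open>coset_map\<close> is a union over all representatives. As \<open>f\<close> sends
  \<open>HV\<close> into \<open>HW\<close>, they all contribute the same coset and the union
  collapses.\<close>

lemma coset_map_eq:
  assumes f: "addhom V W f" and HV: "additive_subgroup HV V" and HW: "additive_subgroup HW W"
    and sub: "\<And>x. x \<in> HV \<Longrightarrow> f x \<in> HW" and x: "x \<in> carrier V"
  shows "coset_map W HW f (HV +>\<^bsub>V\<^esub> x) = HW +>\<^bsub>W\<^esub> f x"
proof -
  interpret V: abelian_group V using f by (simp add: addhom_def)
  interpret W: abelian_group W using f by (simp add: addhom_def)
  interpret HV: additive_subgroup HV V by fact
  interpret HV: abelian_subgroup HV V by (rule abelian_subgroupI3) (fact HV, rule V.abelian_group_axioms)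
  interpret HW: additive_subgroup HW W by fact
  interpret HW: abelian_subgroup HW W by (rule abelian_subgroupI3) (fact HW, rule W.abelian_group_axioms)
  have "HW +>\<^bsub>W\<^esub> f y = HW +>\<^bsub>W\<^esub> f x" if y: "y \<in> HV +>\<^bsub>V\<^esub> x" for y
  proof -
    obtain h where h: "h \<in> HV" "y = h \<oplus>\<^bsub>V\<^esub> x" using y unfolding mem_a_coset by blast
    then have "f y = f h \<oplus>\<^bsub>W\<^esub> f x" using addhom_add[OF f] x HV.a_Hcarr by simp
    then have "f y \<in> HW +>\<^bsub>W\<^esub> f x" using sub[OF h(1)] by (auto simp: mem_a_coset)
    then show ?thesis using HW.a_repr_independence'[OF _ addhom_closed[OF f x]] by simp
  qed
  moreover have "x \<in> HV +>\<^bsub>V\<^esub> x" using HV.a_rcos_self x by simp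
  ultimately show ?thesis unfolding coset_map_def by blast
qed

type_synonym ('k, 'a, 'm) tmod = "(nat \<Rightarrow> 'k, nat \<Rightarrow> 'a, 'm) cdgm"

text \<open>What the power series contribute beyond a cdg algebra: the scalar \<open>t\<close>, a
  quotient \<open>ct\<close> of the curvature by \<open>t\<close>, and its closedness. The
  components of \<open>At\<close> are arbitrary modules in this locale.\<close>

locale tors = cdg_algebra "pser k" At
  for k :: "'k ring" and At :: "(nat \<Rightarrow> 'k, nat \<Rightarrow> 'a) cdga" +
  fixes ct :: "nat \<Rightarrow> 'a"
  assumes tvar_closed: "tvar k \<in> carrier (pser k)"
    and ct_closed: "ct \<in> carrier (gr At 2)"
    and t_ct: "tvar k \<odot>\<^bsub>gr At 2\<^esub> ct = curv At"
    and dif_ct: "dif At 2 ct = \<zero>\<^bsub>gr At 3\<^esub>"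
begin

abbreviation tm where "tm M n x \<equiv> tvar k \<odot>\<^bsub>gr M n\<^esub> x"
abbreviation K where "K M i n \<equiv> ker_t k M i n"
abbreviation md where "md M \<equiv> cdg_module (pser k) At M"
abbreviation cta where "cta M n x \<equiv> act M 2 n ct x"

lemma tpow_closed [simp]: "tpow k i \<in> carrier (pser k)"
  by (simp add: tpow_def tvar_closed)

lemma tpow_Suc: "tpow k (Suc i) = tpow k i \<otimes>\<^bsub>pser k\<^esub> tvar k"
  by (simp add: tpow_def)

lemma md_gmd: "md M \<Longrightarrow> graded_module_derivation (pser k) At M"
  by (simp add: cdg_module_def)

lemma md_module: "md M \<Longrightarrow> module (pser k) (gr M n)"
  by (rule graded_module_derivation.gr_module[OF md_gmd])

lemma md_ab: "md M \<Longrightarrow> abelian_group (gr M n)"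
  by (rule graded_module_derivation.ab[OF md_gmd])

lemmas md_a_inv_closed = abelian_group.a_inv_closed[OF md_ab]
  and md_l_neg = abelian_group.l_neg[OF md_ab]
  and md_lincomb_intros = abelian_group.lincomb_intros[OF md_ab]
  and md_minus_add = abelian_group.minus_add[OF md_ab]
  and md_minus_closed = abelian_group.minus_closed[OF md_ab]
  and md_minus_eq_zero_iff = abelian_group.minus_eq_zero_iff[OF md_ab]
  and md_minus_minus = abelian_group.minus_minus[OF md_ab]
  and md_neg_zero = abelian_group.neg_zero[OF md_ab]
  and md_psgn_closed = abelian_group.psgn_closed[OF md_ab]
  and md_psgn_psgn = abelian_group.psgn_psgn[OF md_ab]
  and md_psgn_zero = abelian_group.psgn_zero[OF md_ab]
  and md_a_closed = abelian_monoid.a_closed[OF abelian_group.axioms(1)[OF md_ab]]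
  and md_a_comm = abelian_monoid.a_comm[OF abelian_group.axioms(1)[OF md_ab]]
  and md_l_zero = abelian_monoid.l_zero[OF abelian_group.axioms(1)[OF md_ab]]
  and md_r_zero = abelian_monoid.r_zero[OF abelian_group.axioms(1)[OF md_ab]]
  and md_zero_closed = abelian_monoid.zero_closed[OF abelian_group.axioms(1)[OF md_ab]]

lemmas At_l_zero = abelian_monoid.l_zero[OF abelian_group.axioms(1)[OF ab]]
  and At_r_zero = abelian_monoid.r_zero[OF abelian_group.axioms(1)[OF ab]]

lemma K_in: "x \<in> K M i n \<longleftrightarrow> x \<in> carrier (gr M n) \<and> tpow k i \<odot>\<^bsub>gr M n\<^esub> x = \<zero>\<^bsub>gr M n\<^esub>"
  by (simp add: ker_t_def)

lemma K_carr: "x \<in> K M i n \<Longrightarrow> x \<in> carrier (gr M n)"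
  by (simp add: K_in)

context
  fixes M :: "('k, 'a, 'm) tmod"
  assumes M: "md M"
begin

interpretation M: cdg_module "pser k" At M by (rule M)

lemma dif_cl: "x \<in> carrier (gr M n) \<Longrightarrow> n' = n + 1 \<Longrightarrow> dif M n x \<in> carrier (gr M n')"
  by (rule M.M.dif_closed)

lemma cta_cl: "x \<in> carrier (gr M n) \<Longrightarrow> n' = n + 2 \<Longrightarrow> cta M n x \<in> carrier (gr M n')"
  by (rule M.M.act_closed[OF ct_closed]) simp_all

lemma tm_cl: "x \<in> carrier (gr M n) \<Longrightarrow> tm M n x \<in> carrier (gr M n)"
  using module.smult_closed[OF M.M.gr_module tvar_closed] .

lemma add_cl: "x \<in> carrier (gr M n) \<Longrightarrow> y \<in> carrier (gr M n) \<Longrightarrow> x \<oplus>\<^bsub>gr M n\<^esub> y \<in> carrier (gr M n)"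
  by (rule md_a_closed[OF M])

lemma neg_cl: "x \<in> carrier (gr M n) \<Longrightarrow> \<ominus>\<^bsub>gr M n\<^esub> x \<in> carrier (gr M n)"
  by (rule md_a_inv_closed[OF M])

lemma minus_cl: "x \<in> carrier (gr M n) \<Longrightarrow> y \<in> carrier (gr M n) \<Longrightarrow> x \<ominus>\<^bsub>gr M n\<^esub> y \<in> carrier (gr M n)"
  by (rule md_minus_closed[OF M])

lemma zero_cl: "\<zero>\<^bsub>gr M n\<^esub> \<in> carrier (gr M n)"
  by (rule md_zero_closed[OF M])

lemmas module_cl = dif_cl cta_cl tm_cl add_cl neg_cl minus_cl zero_cl md_psgn_closed[OF M]

lemma tm_hom: "addhom (gr M n) (gr M n) (tm M n)"
  by (rule M.M.smult_hom[OF tvar_closed])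

lemma cta_hom: "n' = n + 2 \<Longrightarrow> addhom (gr M n) (gr M n') (cta M n)"
  by (rule M.M.act_hom[OF ct_closed]) simp

lemma tpow_hom: "addhom (gr M n) (gr M n) (\<lambda>x. tpow k i \<odot>\<^bsub>gr M n\<^esub> x)"
  by (rule M.M.smult_hom) simp

lemmas dif_lin' = addhom_add[OF M.M.dif_hom] addhom_neg[OF M.M.dif_hom] addhom_minus[OF M.M.dif_hom] addhom_zero[OF M.M.dif_hom]
lemmas cta_lin = addhom_add[OF cta_hom] addhom_neg[OF cta_hom] addhom_minus[OF cta_hom] addhom_zero[OF cta_hom]
lemmas tm_lin = addhom_add[OF tm_hom] addhom_neg[OF tm_hom] addhom_minus[OF tm_hom] addhom_zero[OF tm_hom]

lemma dif_tm: "x \<in> carrier (gr M n) \<Longrightarrow> n' = n + 1 \<Longrightarrow> dif M n (tm M n x) = tm M n' (dif M n x)"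
  by (rule M.M.dif_smult[OF _ tvar_closed])

lemma cta_tm: "x \<in> carrier (gr M n) \<Longrightarrow> n' = n + 2 \<Longrightarrow> cta M n (tm M n x) = tm M n' (cta M n x)"
  by (rule M.M.act_smult[OF ct_closed _ tvar_closed]) simp_all

text \<open>Only one term of the Leibniz rule is left: \<open>ct\<close> is closed, and its even
  degree gives no sign.\<close>

lemma dif_cta: "x \<in> carrier (gr M n) \<Longrightarrow> n' = n + 2 \<Longrightarrow> n'' = n + 1 \<Longrightarrow> dif M n' (cta M n x) = cta M n'' (dif M n x)"
proof -
  assume x: "x \<in> carrier (gr M n)" and n: "n' = n + 2" "n'' = n + 1"
  have "dif M n' (cta M n x) = act M 3 n (dif At 2 ct) x \<oplus>\<^bsub>gr M (n + 3)\<^esub> psgn (gr M (n + 3)) 2 (cta M n'' (dif M n x))"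
    by (rule M.M.dif_act'[OF ct_closed x]) (simp_all add: n)
  also have "act M 3 n (dif At 2 ct) x = \<zero>\<^bsub>gr M (n + 3)\<^esub>"
    unfolding dif_ct using addhom_zero[OF M.M.act_hom_left[OF ab x, where n="n + 3"]] by simp
  finally show ?thesis using cta_cl[OF dif_cl[OF x n(2)], of "n + 3"]
    md_l_zero[OF M] by (simp add: n psgn_def)
qed

text \<open>The curvature is \<open>t\<close> times \<open>ct\<close>; that \<open>d^2\<close>
  factors in this way is what makes the equations on pairs consistent.\<close>

lemma dif_dif': "x \<in> carrier (gr M n) \<Longrightarrow> n' = n + 1 \<Longrightarrow> n'' = n + 2 \<Longrightarrow> dif M n' (dif M n x) = tm M n'' (cta M n x)"
proof -
  assume x: "x \<in> carrier (gr M n)" and n: "n' = n + 1" "n'' = n + 2"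
  have "tm M n'' (cta M n x) = act M 2 n (tm At 2 ct) x"
    by (rule M.M.act_smult_left[OF ct_closed x tvar_closed, symmetric]) (simp add: n)
  then show ?thesis using M.dif_dif_module[OF x] by (simp add: n t_ct)
qed

lemmas module_comm = dif_tm cta_tm dif_cta dif_dif'

lemma K_dif: "x \<in> K M i n \<Longrightarrow> n' = n + 1 \<Longrightarrow> dif M n x \<in> K M i n'"
  using M.M.dif_smult[of x n "tpow k i" n'] addhom_zero[OF M.M.dif_hom, of n' n] dif_cl[of x n n'] by (auto simp: K_in)

lemma K_act: "a \<in> carrier (gr At p) \<Longrightarrow> x \<in> K M i n \<Longrightarrow> n' = p + n \<Longrightarrow> act M p n a x \<in> K M i n'"
  using M.M.act_smult[of a p x n "tpow k i" n'] addhom_zero[OF M.M.act_hom, of a p n' n] M.M.act_closed[of a p x n n'] by (auto simp: K_in)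

lemma K_cta: "x \<in> K M i n \<Longrightarrow> n' = n + 2 \<Longrightarrow> cta M n x \<in> K M i n'"
  by (rule K_act[OF ct_closed]) simp_all

lemma K_add: "x \<in> K M i n \<Longrightarrow> y \<in> K M i n \<Longrightarrow> x \<oplus>\<^bsub>gr M n\<^esub> y \<in> K M i n"
  using addhom_add[OF tpow_hom, of x n y i] add_cl[of x n y] zero_cl[of n]
    md_l_zero[OF M] by (auto simp: K_in)

lemma K_zero: "\<zero>\<^bsub>gr M n\<^esub> \<in> K M i n"
  using addhom_zero[OF tpow_hom] zero_cl by (auto simp: K_in)

lemma K_neg: "x \<in> K M i n \<Longrightarrow> \<ominus>\<^bsub>gr M n\<^esub> x \<in> K M i n"
proof -
  assume "x \<in> K M i n"
  moreover interpret abelian_group "gr M n" by (rule md_ab[OF M])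
  have "\<ominus>\<^bsub>gr M n\<^esub> \<zero>\<^bsub>gr M n\<^esub> = \<zero>\<^bsub>gr M n\<^esub>" by (rule minus_equality) simp_all
  ultimately show ?thesis using addhom_neg[OF tpow_hom, of x n i] neg_cl[of x n] by (auto simp: K_in)
qed

lemma K_minus: "x \<in> K M i n \<Longrightarrow> y \<in> K M i n \<Longrightarrow> x \<ominus>\<^bsub>gr M n\<^esub> y \<in> K M i n"
  unfolding a_minus_def by (intro K_add K_neg)

lemma K_tm: "x \<in> K M (Suc i) n \<Longrightarrow> tm M n x \<in> K M i n"
  using module.smult_assoc1[OF md_module[OF M] tpow_closed tvar_closed, of x n i] tm_cl by (simp add: K_in tpow_Suc)

lemma K_Suc: "x \<in> K M i n \<Longrightarrow> x \<in> K M (Suc i) n"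
proof -
  assume x: "x \<in> K M i n"
  interpret m: module "pser k" "gr M n" by (rule md_module[OF M])
  have "tpow k (Suc i) \<odot>\<^bsub>gr M n\<^esub> x = tvar k \<odot>\<^bsub>gr M n\<^esub> (tpow k i \<odot>\<^bsub>gr M n\<^esub> x)"
    using x tvar_closed m.smult_assoc1[of "tvar k" "tpow k i" x] m_comm[of "tvar k" "tpow k i"] by (simp add: K_in tpow_Suc)
  then show ?thesis using x tvar_closed by (simp add: K_in)
qed

lemma K_0: "x \<in> K M 0 n \<longleftrightarrow> x = \<zero>\<^bsub>gr M n\<^esub>"
  using module.smult_one[OF md_module[OF M], of x n] zero_cl by (auto simp: K_in tpow_def)

lemma K_1: "x \<in> K M (Suc 0) n \<Longrightarrow> tm M n x = \<zero>\<^bsub>gr M n\<^esub>"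
  using K_tm[of x 0 n] K_0 by simp

end

lemmas K_cl = K_dif K_cta K_add K_neg K_minus K_zero

text \<open>Cosets of \<open>ker t^i\<close> are traded for representatives, so that
  \<open>t\<close>-acyclicity becomes a lifting condition on elements of \<open>M\<close>.\<close>

lemma t_acyclic_iff:
  fixes M :: "('k, 'a, 'm) tmod"
  assumes M: "md M"
  shows "t_acyclic k M \<longleftrightarrow> (\<forall>i n. \<forall>x\<in>K M (Suc i) n. dif M n x \<in> K M i (n + 1) \<longrightarrow>
    (\<exists>y\<in>K M (Suc i) (n - 1). \<exists>z\<in>K M i n. x = dif M (n - 1) y \<oplus>\<^bsub>gr M n\<^esub> z))"
proof -
  have "acyclic (quot (submod M (K M (i + 1))) (K M i)) \<longleftrightarrow> (\<forall>n. \<forall>x\<in>K M (Suc i) n. dif M n x \<in> K M i (n + 1) \<longrightarrow>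
    (\<exists>y\<in>K M (Suc i) (n - 1). \<exists>z\<in>K M i n. x = dif M (n - 1) y \<oplus>\<^bsub>gr M n\<^esub> z))" (is "?A \<longleftrightarrow> ?B") for i
  proof -
    \<comment> \<open>\<open>quot\<close> forms its cosets inside the submodule
      \<open>ker t^(i+1)\<close>, so the ambient group is this restriction and not
      \<open>gr M n\<close>.\<close>
    define V where "V n = (gr M n)\<lparr>carrier := K M (Suc i) n\<rparr>" for n
    have V[simp]: "carrier (V n) = K M (Suc i) n" "\<zero>\<^bsub>V n\<^esub> = \<zero>\<^bsub>gr M n\<^esub>" "x \<oplus>\<^bsub>V n\<^esub> y = x \<oplus>\<^bsub>gr M n\<^esub> y" for n x y
      by (simp_all add: V_def)
    have ab: "abelian_group (V n)" for n
    proof -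
      interpret abelian_group "gr M n" by (rule md_ab[OF M])
      show ?thesis
      proof (rule abelian_groupI)
        fix x assume "x \<in> carrier (V n)"
        then show "\<exists>y\<in>carrier (V n). y \<oplus>\<^bsub>V n\<^esub> x = \<zero>\<^bsub>V n\<^esub>"
          using K_neg[OF M, of x "Suc i" n] by (intro bexI[of _ "\<ominus>\<^bsub>gr M n\<^esub> x"]) (auto simp: l_neg K_carr)
      qed (auto simp: a_assoc K_carr intro: K_add[OF M] K_zero[OF M] a_comm)
    qed
    have sub: "additive_subgroup (K M i n) (V n)" for n
    proof -
      interpret abelian_group "V n" by (rule ab)
      interpret g: abelian_group "gr M n" by (rule md_ab[OF M])
      have "\<ominus>\<^bsub>V n\<^esub> x = \<ominus>\<^bsub>gr M n\<^esub> x" if "x \<in> K M i n" for x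
        using that K_Suc[OF M that] K_neg[OF M K_Suc[OF M that]] by (intro minus_equality) (auto simp: g.l_neg K_carr)
      then show ?thesis
        by (intro additive_subgroup.intro add.subgroupI)
          (auto intro: K_add[OF M] K_neg[OF M] K_zero[OF M] K_Suc[OF M] simp flip: a_inv_def)
    qed
    have asub: "abelian_subgroup (K M i n) (V n)" for n
      by (rule abelian_subgroupI3[OF sub ab])
    have hom: "addhom (V n) (V (n + 1)) (dif M n)" for n
      using ab K_dif[OF M _ refl] dif_lin'(1)[OF M refl K_carr K_carr] by (intro addhomI) simp_all
    define Q where "Q = quot (submod M (K M (i + 1))) (K M i)"
    have c: "carrier (gr Q n) = {K M i n +>\<^bsub>V n\<^esub> x |x. x \<in> K M (Suc i) n}" for n
      by (auto simp: Q_def quot_def quot_module_def submod_def V_def[symmetric] A_RCOSETS_def')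
    have z: "\<zero>\<^bsub>gr Q n\<^esub> = K M i n" for n by (simp add: Q_def quot_def quot_module_def)
    have d: "dif Q n (K M i n +>\<^bsub>V n\<^esub> x) = K M i (n + 1) +>\<^bsub>V (n + 1)\<^esub> dif M n x" if "x \<in> K M (Suc i) n" for n x
      using coset_map_eq[OF hom[of n] sub sub, of x] K_dif[OF M _ refl] that
      by (simp add: Q_def quot_def submod_def V_def[symmetric])
    have zz: "K M i n +>\<^bsub>V n\<^esub> x = K M i n \<longleftrightarrow> x \<in> K M i n" if "x \<in> K M (Suc i) n" for n x
      using abelian_subgroup.a_rcos_self[OF asub, of x n] abelian_subgroup.a_rcos_const[OF asub, of x n] that by auto
    have e: "K M i n +>\<^bsub>V n\<^esub> y = K M i n +>\<^bsub>V n\<^esub> x \<longleftrightarrow> (\<exists>z\<in>K M i n. x = y \<oplus>\<^bsub>gr M n\<^esub> z)"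
      if "x \<in> K M (Suc i) n" "y \<in> K M (Suc i) n" for n x y
    proof -
      interpret abelian_group "V n" by (rule ab)
      have "K M i n +>\<^bsub>V n\<^esub> y = K M i n +>\<^bsub>V n\<^esub> x \<longleftrightarrow> x \<in> K M i n +>\<^bsub>V n\<^esub> y"
        using abelian_subgroup.a_rcos_self[OF asub, of x n] abelian_subgroup.a_repr_independence'[OF asub, of x n y] that by auto
      also have "\<dots> \<longleftrightarrow> (\<exists>z\<in>K M i n. x = y \<oplus>\<^bsub>gr M n\<^esub> z)"
        using a_comm[of y] that K_Suc[OF M] by (fastforce simp: mem_a_coset)
      finally show ?thesis .
    qed
    have "?A \<longleftrightarrow> (\<forall>n. \<forall>x\<in>K M (Suc i) n. K M i (n + 1) +>\<^bsub>V (n + 1)\<^esub> dif M n x = K M i (n + 1) \<longrightarrow>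
       (\<exists>y\<in>K M (Suc i) (n - 1). K M i n +>\<^bsub>V n\<^esub> dif M (n - 1) y = K M i n +>\<^bsub>V n\<^esub> x))"
    proof -
      have d': "dif Q (n - 1) (K M i (n - 1) +>\<^bsub>V (n - 1)\<^esub> y) = K M i n +>\<^bsub>V n\<^esub> dif M (n - 1) y"
        if "y \<in> K M (Suc i) (n - 1)" for n y
        using d[OF that] by simp
      have ball: "(\<forall>X\<in>{F x |x. x \<in> S}. P X) \<longleftrightarrow> (\<forall>x\<in>S. P (F x))"
        and bex: "(\<exists>X\<in>{F x |x. x \<in> S}. P X) \<longleftrightarrow> (\<exists>x\<in>S. P (F x))" for F :: "'m \<Rightarrow> 'm set" and S P
        by blast+
      show ?thesis
        unfolding acyclic_def Q_def[symmetric] c z ball bex by (simp add: d d' cong: ball_cong bex_cong)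
    qed
    also have "\<dots> \<longleftrightarrow> ?B"
    proof -
      have zz': "K M i (n + 1) +>\<^bsub>V (n + 1)\<^esub> dif M n x = K M i (n + 1) \<longleftrightarrow> dif M n x \<in> K M i (n + 1)"
        if "x \<in> K M (Suc i) n" for n x
        using zz[OF K_dif[OF M that]] by simp
      have e': "K M i n +>\<^bsub>V n\<^esub> dif M (n - 1) y = K M i n +>\<^bsub>V n\<^esub> x \<longleftrightarrow> (\<exists>z\<in>K M i n. x = dif M (n - 1) y \<oplus>\<^bsub>gr M n\<^esub> z)"
        if "x \<in> K M (Suc i) n" "y \<in> K M (Suc i) (n - 1)" for n x y
        using e[OF that(1) K_dif[OF M that(2)]] by simp
      show ?thesis by (simp add: zz' e' cong: ball_cong bex_cong)
    qed
    finally show ?thesis .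
  qed
  then show ?thesis unfolding t_acyclic_def by blast
qed

end

context tors
begin

lemma lincomb_unique':
  "\<lbrakk>md M; lincomb (gr M n) x c; lincomb (gr M n) y d; \<And>a. c a = d a\<rbrakk> \<Longrightarrow> x = y"
  by (rule abelian_group.lincomb_unique[OF md_ab])

text \<open>The conditions on the images of the two generators of \<open>\<Gamma>\<^sub>i\<close> under a closed map to \<open>M[m + 1]\<close>,
  and on the difference of two homotopic ones\<close>

definition cyc where
  "cyc i m M x y \<longleftrightarrow> x \<in> K M (Suc i) (m + 1) \<and> y \<in> K M i m \<and>
     dif M (m + 1) x = cta M m y \<and> dif M m y = tm M (m + 1) x"

definition bdr where
  "bdr i m M x y \<longleftrightarrow> (\<exists>u\<in>K M (Suc i) m. \<exists>v\<in>K M i (m - 1).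
     x = dif M m u \<oplus>\<^bsub>gr M (m + 1)\<^esub> cta M (m - 1) v \<and> y = dif M (m - 1) v \<oplus>\<^bsub>gr M m\<^esub> tm M m u)"

text \<open>Once maps out of \<open>\<Gamma>_i\<close> are identified with pairs, this is the
  vanishing of \<open>Hom(\<Gamma>_i, M[l])\<close> in the homotopy category for all
  \<open>i\<close> and \<open>l\<close>.\<close>

definition exactE where
  "exactE M \<longleftrightarrow> (\<forall>i m x y. cyc i m M x y \<longrightarrow> bdr i m M x y)"

lemma t_acyclicD:
  assumes "md M" "t_acyclic k M" "x \<in> K M (Suc i) (m + 1)" "dif M (m + 1) x \<in> K M i (m + 2)"
  obtains u z where "u \<in> K M (Suc i) m" "z \<in> K M i (m + 1)" "x = dif M m u \<oplus>\<^bsub>gr M (m + 1)\<^esub> z"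
proof -
  have "m + 1 + 1 = m + 2" by simp
  then show ?thesis using assms t_acyclic_iff[OF assms(1)] that by (metis add_diff_cancel_right')
qed

text \<open>In the induction step \<open>x\<close> is lowered by one kernel through acyclicity of
  the top quotient, then \<open>y\<close> through that of the next one. Each reduction subtracts a
  boundary, so what is left is again a pair, for \<open>i\<close> instead of
  \<open>i + 1\<close>.\<close>

lemma t_acyclic_exact:
  assumes M: "md M" and ta: "t_acyclic k M"
  shows "cyc i m M x y \<Longrightarrow> bdr i m M x y"
proof (induction i arbitrary: m x y)
  case 0
  note lcu = lincomb_unique'[OF M] and lci = md_lincomb_intros[OF M]
  have x: "x \<in> K M (Suc 0) (m + 1)" "y = \<zero>\<^bsub>gr M m\<^esub>" "dif M (m + 1) x = cta M m y"
    using 0 K_0[OF M] by (auto simp: cyc_def)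
  have "dif M (m + 1) x \<in> K M 0 (m + 2)" using x K_0[OF M] cta_lin[OF M, of "m + 2" m] by simp
  from t_acyclicD[OF M ta x(1) this] obtain u z where
    u: "u \<in> K M (Suc 0) m" "z \<in> K M 0 (m + 1)" "x = dif M m u \<oplus>\<^bsub>gr M (m + 1)\<^esub> z" .
  have c[simp]: "u \<in> carrier (gr M m)" using K_carr[OF u(1)] .
  have z: "z = \<zero>\<^bsub>gr M (m + 1)\<^esub>" using u K_0[OF M] by simp
  show ?case unfolding bdr_def
  proof (intro bexI conjI)
    show "u \<in> K M (Suc 0) m" by (fact u)
    show "\<zero>\<^bsub>gr M (m - 1)\<^esub> \<in> K M 0 (m - 1)" by (rule K_zero[OF M])
    show "x = dif M m u \<oplus>\<^bsub>gr M (m + 1)\<^esub> cta M (m - 1) \<zero>\<^bsub>gr M (m - 1)\<^esub>"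
      using u z cta_lin(4)[OF M, of "m + 1" "m - 1"] by simp
    show "y = dif M (m - 1) \<zero>\<^bsub>gr M (m - 1)\<^esub> \<oplus>\<^bsub>gr M m\<^esub> tm M m u"
      using x K_1[OF M u(1)] dif_lin'(4)[OF M, where n=m and m="m - 1"] md_r_zero[OF M] zero_cl[OF M] by simp
  qed
next
  case (Suc i)
  note lcu = lincomb_unique'[OF M] and lci = md_lincomb_intros[OF M]
  have i: "1 + m = m + 1" "m + 1 + 1 = m + 2" "m - 1 + 1 = m" by simp_all
  have x: "x \<in> K M (Suc (Suc i)) (m + 1)" "y \<in> K M (Suc i) m" "dif M (m + 1) x = cta M m y" "dif M m y = tm M (m + 1) x"
    using Suc.prems by (auto simp: cyc_def)
  have "dif M (m + 1) x \<in> K M (Suc i) (m + 2)" using x K_cta[OF M x(2)] by simp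
  from t_acyclicD[OF M ta x(1) this] obtain u x' where
    u: "u \<in> K M (Suc (Suc i)) m" "x' \<in> K M (Suc i) (m + 1)" "x = dif M m u \<oplus>\<^bsub>gr M (m + 1)\<^esub> x'" .
  \<comment> \<open>The boundary of \<open>(u, 0)\<close> is \<open>(d u, t u)\<close>: removing
    \<open>d u\<close> from \<open>x\<close> removes \<open>t u\<close> from
    \<open>y\<close>.\<close>
  define y1 where "y1 = y \<ominus>\<^bsub>gr M m\<^esub> tm M m u"
  have y1: "y1 \<in> K M (Suc i) m" unfolding y1_def using x u K_minus[OF M] K_tm[OF M] by blast
  note c1 = x(1,2)[THEN K_carr] u(1,2)[THEN K_carr] y1[THEN K_carr]
  note simps = module_cl[OF M] module_comm[OF M] tm_lin[OF M] i
     dif_lin'[OF M, where n="m + 2"] dif_lin'[OF M, where n="m + 1"] dif_lin'[OF M, where n=m]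
     cta_lin[OF M, where n'="m + 2"] cta_lin[OF M, where n'="m + 1"]
  have "dif M (m + 1) x' = dif M (m + 1) x \<ominus>\<^bsub>gr M (m + 2)\<^esub> tm M (m + 2) (cta M m u)"
    unfolding u(3) using c1 apply (simp add: simps)
    by (rule lcu[of "m + 2"], (rule lci | assumption | simp add: simps; fail)+)
  then have dx': "dif M (m + 1) x' = cta M m y1"
    unfolding x y1_def using c1 by (simp add: simps)
  have "dif M m y1 = tm M (m + 1) x'"
    unfolding y1_def using c1 x(4) apply (simp add: simps u(3))
    by (rule lcu[of "m + 1"], (rule lci | assumption | simp add: simps; fail)+)
  note dy1 = this
  have j: "m - 1 + 1 = m" "m - 1 + 2 = m + 1" by simp_all
  have "dif M m y1 \<in> K M i (m + 1)" unfolding dy1 by (rule K_tm[OF M u(2)])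
  then obtain v y' where v: "v \<in> K M (Suc i) (m - 1)" "y' \<in> K M i m" "y1 = dif M (m - 1) v \<oplus>\<^bsub>gr M m\<^esub> y'"
    using t_acyclicD[OF M ta, of y1 i "m - 1", unfolded j] y1 by blast
  \<comment> \<open>Likewise for the boundary of \<open>(0, v)\<close>: removing \<open>d v\<close>
    from \<open>y1\<close> costs \<open>(c/t) v\<close> in the first component.\<close>
  define x'' where "x'' = x' \<ominus>\<^bsub>gr M (m + 1)\<^esub> cta M (m - 1) v"
  have x'': "x'' \<in> K M (Suc i) (m + 1)" unfolding x''_def by (rule K_minus[OF M u(2) K_cta[OF M v(1)]]) simp
  note c2 = c1 v(1,2)[THEN K_carr] x''[THEN K_carr]
  have "dif M (m + 1) x'' = cta M m y'"
    unfolding x''_def using c2 dx' apply (simp add: simps v(3))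
    by (rule lcu[of "m + 2"], (rule lci | assumption | simp add: simps; fail)+)
  moreover have "dif M m y' = dif M m y1 \<ominus>\<^bsub>gr M (m + 1)\<^esub> tm M (m + 1) (cta M (m - 1) v)"
    unfolding v(3) using c2 apply (simp add: simps)
    by (rule lcu[of "m + 1"], (rule lci | assumption | simp add: simps; fail)+)
  then have "dif M m y' = tm M (m + 1) x''"
    unfolding dy1 x''_def using c2 by (simp add: simps)
  ultimately have "cyc i m M x'' y'" using x'' v by (simp add: cyc_def)
  from Suc.IH[OF this] obtain u' v' where u': "u' \<in> K M (Suc i) m" "v' \<in> K M i (m - 1)"
    "x'' = dif M m u' \<oplus>\<^bsub>gr M (m + 1)\<^esub> cta M (m - 1) v'" "y' = dif M (m - 1) v' \<oplus>\<^bsub>gr M m\<^esub> tm M m u'"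
    by (auto simp: bdr_def)
  note c3 = c2 u'(1,2)[THEN K_carr]
  show ?case unfolding bdr_def
  proof (intro bexI conjI)
    show "u \<oplus>\<^bsub>gr M m\<^esub> u' \<in> K M (Suc (Suc i)) m" using u u' K_add[OF M] K_Suc[OF M] by blast
    show "v \<oplus>\<^bsub>gr M (m - 1)\<^esub> v' \<in> K M (Suc i) (m - 1)" using v u' K_add[OF M] K_Suc[OF M] by blast
    have "x' = x'' \<oplus>\<^bsub>gr M (m + 1)\<^esub> cta M (m - 1) v"
      unfolding x''_def using c3 by (intro lcu[of "m + 1"]) (rule lci | assumption | simp add: simps; fail)+
    then show "x = dif M m (u \<oplus>\<^bsub>gr M m\<^esub> u') \<oplus>\<^bsub>gr M (m + 1)\<^esub> cta M (m - 1) (v \<oplus>\<^bsub>gr M (m - 1)\<^esub> v')"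
      using c3 apply (simp add: simps u(3) u'(3))
      by (rule lcu[of "m + 1"], (rule lci | assumption | simp add: simps; fail)+)
    have "y = y1 \<oplus>\<^bsub>gr M m\<^esub> tm M m u"
      unfolding y1_def using c3 by (intro lcu[of "m"]) (rule lci | assumption | simp add: simps; fail)+
    then show "y = dif M (m - 1) (v \<oplus>\<^bsub>gr M (m - 1)\<^esub> v') \<oplus>\<^bsub>gr M m\<^esub> tm M m (u \<oplus>\<^bsub>gr M m\<^esub> u')"
      using c3 apply (simp add: simps v(3) u'(4))
      by (rule lcu[of "m"], (rule lci | assumption | simp add: simps; fail)+)
  qed
qed

text \<open>The induction hypothesis is applied to \<open>t x\<close>, which lies one kernel lower.
  The resulting \<open>y'\<close> makes \<open>(x, y')\<close> a cycle up to an error; the error is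
  itself a cycle one degree up, and its primitive, given by \<open>exactE\<close>, is the
  correction.\<close>

lemma exact_t_acyclic:
  assumes M: "md M" and ex: "exactE M"
  shows "\<lbrakk>x \<in> K M (Suc i) (m + 1); dif M (m + 1) x \<in> K M i (m + 2)\<rbrakk> \<Longrightarrow>
    \<exists>u\<in>K M (Suc i) m. \<exists>z\<in>K M i (m + 1). x = dif M m u \<oplus>\<^bsub>gr M (m + 1)\<^esub> z"
proof (induction i arbitrary: m x)
  case 0
  have "cyc 0 m M x \<zero>\<^bsub>gr M m\<^esub>"
    using 0 K_0[OF M] K_1[OF M 0(1)] cta_lin(4)[OF M, of "m + 2" m] dif_lin'(4)[OF M, where n="m + 1" and m=m]
    by (simp add: cyc_def)
  then obtain u v where "u \<in> K M (Suc 0) m" "v \<in> K M 0 (m - 1)" "x = dif M m u \<oplus>\<^bsub>gr M (m + 1)\<^esub> cta M (m - 1) v"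
    using ex unfolding exactE_def bdr_def by blast
  then show ?case using K_cta[OF M, of v 0 "m - 1" "m + 1"] by auto
next
  case (Suc i)
  note lcu = lincomb_unique'[OF M] and lci = md_lincomb_intros[OF M]
  have i: "1 + m = m + 1" "m + 1 + 1 = m + 2" "m - 1 + 1 = m" "m + 1 + 2 = m + 3" "m + 2 + 1 = m + 3" by simp_all
  note x = Suc.prems
  note simps = module_cl[OF M] module_comm[OF M] tm_lin[OF M] i dif_lin'[OF M, where n="m + 3"]
     dif_lin'[OF M, where n="m + 2"] dif_lin'[OF M, where n="m + 1"] dif_lin'[OF M, where n=m]
     cta_lin[OF M, where n'="m + 3"] cta_lin[OF M, where n'="m + 2"] cta_lin[OF M, where n'="m + 1"]
  have "dif M (m + 1) (tm M (m + 1) x) = tm M (m + 2) (dif M (m + 1) x)" using x(1)[THEN K_carr] by (simp add: simps)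
  then obtain y' z' where y': "y' \<in> K M (Suc i) m" "z' \<in> K M i (m + 1)" "tm M (m + 1) x = dif M m y' \<oplus>\<^bsub>gr M (m + 1)\<^esub> z'"
    using Suc.IH[OF K_tm[OF M x(1)]] K_tm[OF M x(2)] by auto
  \<comment> \<open>\<open>(p, z')\<close> is the error of the pair \<open>(x, y')\<close>:
    \<open>p\<close> is the defect of \<open>d x = (c/t) y'\<close>, and \<open>z'\<close> that of
    \<open>d y' = t x\<close>.\<close>
  define p where "p = dif M (m + 1) x \<ominus>\<^bsub>gr M (m + 2)\<^esub> cta M m y'"
  note c1 = x(1)[THEN K_carr] y'(1,2)[THEN K_carr]
  have z': "z' = tm M (m + 1) x \<ominus>\<^bsub>gr M (m + 1)\<^esub> dif M m y'"
    unfolding y'(3) using c1 by (intro lcu[of "m + 1"]) (rule lci | assumption | simp add: simps; fail)+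
  have p: "p \<in> K M (Suc i) (m + 2)" unfolding p_def by (rule K_minus[OF M x(2) K_cta[OF M y'(1)]]) simp
  have "dif M (m + 2) p = cta M (m + 1) z'" unfolding p_def z' using c1 by (simp add: simps)
  moreover have "dif M (m + 1) z' = tm M (m + 2) p" unfolding p_def z' using c1 by (simp add: simps)
  ultimately have "cyc i (m + 1) M p z'" using p y' by (simp add: cyc_def i)
  then obtain u0 v0 where u0: "u0 \<in> K M (Suc i) (m + 1)" "v0 \<in> K M i m"
    "p = dif M (m + 1) u0 \<oplus>\<^bsub>gr M (m + 2)\<^esub> cta M m v0" "z' = dif M m v0 \<oplus>\<^bsub>gr M (m + 1)\<^esub> tm M (m + 1) u0"
    using ex unfolding exactE_def bdr_def by (fastforce simp: i)
  note c2 = c1 p[THEN K_carr] u0(1,2)[THEN K_carr]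
  \<comment> \<open>The corrections have opposite signs because \<open>p\<close> is left minus right
    side of its equation, while \<open>z'\<close> is right minus left.\<close>
  have "cyc (Suc i) m M (x \<ominus>\<^bsub>gr M (m + 1)\<^esub> u0) (y' \<oplus>\<^bsub>gr M m\<^esub> v0)"
    unfolding cyc_def
  proof (intro conjI)
    show "x \<ominus>\<^bsub>gr M (m + 1)\<^esub> u0 \<in> K M (Suc (Suc i)) (m + 1)" using x u0 K_Suc[OF M] K_minus[OF M] by blast
    show "y' \<oplus>\<^bsub>gr M m\<^esub> v0 \<in> K M (Suc i) m" using y' u0 K_Suc[OF M] K_add[OF M] by blast
    have "dif M (m + 1) x = p \<oplus>\<^bsub>gr M (m + 2)\<^esub> cta M m y'"
      unfolding p_def using c2 by (intro lcu[of "m + 2"]) (rule lci | assumption | simp add: simps; fail)+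
    then show "dif M (m + 1) (x \<ominus>\<^bsub>gr M (m + 1)\<^esub> u0) = cta M m (y' \<oplus>\<^bsub>gr M m\<^esub> v0)"
      using c2 apply (simp add: simps u0(3))
      by (rule lcu[of "m + 2"], (rule lci | assumption | simp add: simps; fail)+)
    show "dif M m (y' \<oplus>\<^bsub>gr M m\<^esub> v0) = tm M (m + 1) (x \<ominus>\<^bsub>gr M (m + 1)\<^esub> u0)"
      using c2 apply (simp add: simps y'(3) u0(4))
      by (rule lcu[of "m + 1"], (rule lci | assumption | simp add: simps; fail)+)
  qed
  then obtain u v where u: "u \<in> K M (Suc (Suc i)) m" "v \<in> K M (Suc i) (m - 1)"
    "x \<ominus>\<^bsub>gr M (m + 1)\<^esub> u0 = dif M m u \<oplus>\<^bsub>gr M (m + 1)\<^esub> cta M (m - 1) v"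
    using ex unfolding exactE_def bdr_def by blast
  note c3 = c2 u(1,2)[THEN K_carr]
  have "x = x \<ominus>\<^bsub>gr M (m + 1)\<^esub> u0 \<oplus>\<^bsub>gr M (m + 1)\<^esub> u0"
     using c3 by (intro lcu[of "m + 1"]) (rule lci | assumption | simp add: simps; fail)+
  also have "\<dots> = dif M m u \<oplus>\<^bsub>gr M (m + 1)\<^esub> (u0 \<oplus>\<^bsub>gr M (m + 1)\<^esub> cta M (m - 1) v)"
     unfolding u(3) using c3 by (intro lcu[of "m + 1"]) (rule lci | assumption | simp add: simps; fail)+
  finally show ?case using u(1) K_add[OF M u0(1) K_cta[OF M u(2), of "m + 1", simplified]] by blast
qed

theorem t_acyclic_iff_exact:
  assumes M: "md M"
  shows "t_acyclic k M \<longleftrightarrow> exactE M"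
proof
  show "t_acyclic k M \<Longrightarrow> exactE M" using t_acyclic_exact[OF M] by (simp add: exactE_def)
next
  assume ex: "exactE M"
  show "t_acyclic k M"
    unfolding t_acyclic_iff[OF M]
  proof (intro allI ballI impI)
    fix i n x assume "x \<in> K M (Suc i) n" "dif M n x \<in> K M i (n + 1)"
    then show "\<exists>y\<in>K M (Suc i) (n - 1). \<exists>z\<in>K M i n. x = dif M (n - 1) y \<oplus>\<^bsub>gr M n\<^esub> z"
      using exact_t_acyclic[OF M ex, of x i "n - 1"] by (simp add: algebra_simps)
  qed
qed

end

section \<open>Closed morphisms, cones, and maps bijective on pairs modulo boundaries\<close>

context tors
begin

lemma K_mono: "md M \<Longrightarrow> x \<in> K M i n \<Longrightarrow> i \<le> j \<Longrightarrow> x \<in> K M j n"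
  by (induction j) (auto simp: le_Suc_eq intro: K_Suc)

definition cmap :: "('k, 'a, 'm) tmod \<Rightarrow> ('k, 'a, 'n) tmod \<Rightarrow> (int \<Rightarrow> 'm \<Rightarrow> 'n) \<Rightarrow> bool" where
  "cmap M N f \<longleftrightarrow> (\<forall>n. \<forall>x\<in>carrier (gr M n). f n x \<in> carrier (gr N n)) \<and>
     (\<forall>n. \<forall>x\<in>carrier (gr M n). \<forall>y\<in>carrier (gr M n). f n (x \<oplus>\<^bsub>gr M n\<^esub> y) = f n x \<oplus>\<^bsub>gr N n\<^esub> f n y) \<and>
     (\<forall>p n. \<forall>a\<in>carrier (gr At p). \<forall>x\<in>carrier (gr M n). f (p + n) (act M p n a x) = act N p n a (f n x)) \<and>
     (\<forall>n. \<forall>x\<in>carrier (gr M n). f (n + 1) (dif M n x) = dif N n (f n x))"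

lemma cmapI:
  assumes "\<And>n x. x \<in> carrier (gr M n) \<Longrightarrow> f n x \<in> carrier (gr N n)"
    "\<And>n x y. \<lbrakk>x \<in> carrier (gr M n); y \<in> carrier (gr M n)\<rbrakk> \<Longrightarrow> f n (x \<oplus>\<^bsub>gr M n\<^esub> y) = f n x \<oplus>\<^bsub>gr N n\<^esub> f n y"
    "\<And>p n a x. \<lbrakk>a \<in> carrier (gr At p); x \<in> carrier (gr M n)\<rbrakk> \<Longrightarrow> f (p + n) (act M p n a x) = act N p n a (f n x)"
    "\<And>n x. x \<in> carrier (gr M n) \<Longrightarrow> f (n + 1) (dif M n x) = dif N n (f n x)"
  shows "cmap M N f"
  using assms by (simp add: cmap_def)

context
  fixes M :: "('k, 'a, 'm) tmod" and N :: "('k, 'a, 'n) tmod" and f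
  assumes M: "md M" and N: "md N" and f: "cmap M N f"
begin

lemma cmap_cl: "x \<in> carrier (gr M n) \<Longrightarrow> f n x \<in> carrier (gr N n)"
  using f by (simp add: cmap_def)

lemma cmap_hom: "addhom (gr M n) (gr N n) (f n)"
  using f md_ab[OF M] md_ab[OF N] by (intro addhomI) (auto simp: cmap_def)

lemma cmap_act: "\<lbrakk>a \<in> carrier (gr At p); x \<in> carrier (gr M n); n' = p + n\<rbrakk> \<Longrightarrow> f n' (act M p n a x) = act N p n a (f n x)"
  using f by (simp add: cmap_def)

lemma cmap_dif: "x \<in> carrier (gr M n) \<Longrightarrow> n' = n + 1 \<Longrightarrow> f n' (dif M n x) = dif N n (f n x)"
  using f by (simp add: cmap_def)

text \<open>\<open>r\<close> acts as the element \<open>r\<close> times the unit of degree zero, so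
  linearity over the algebra covers scalars.\<close>

lemma cmap_smult:
  assumes "r \<in> carrier (pser k)" "x \<in> carrier (gr M n)"
  shows "f n (r \<odot>\<^bsub>gr M n\<^esub> x) = r \<odot>\<^bsub>gr N n\<^esub> f n x"
proof -
  interpret M: cdg_module "pser k" At M by (rule M)
  interpret N: cdg_module "pser k" At N by (rule N)
  have "act M 0 n (r \<odot>\<^bsub>gr At 0\<^esub> unit At) x = r \<odot>\<^bsub>gr M n\<^esub> x"
    using M.M.act_smult_left[OF unit_closed assms(2,1), of n] M.M.act_unit assms by simp
  moreover have "act N 0 n (r \<odot>\<^bsub>gr At 0\<^esub> unit At) (f n x) = r \<odot>\<^bsub>gr N n\<^esub> f n x"
    using N.M.act_smult_left[OF unit_closed cmap_cl[OF assms(2)] assms(1), of n] N.M.act_unit cmap_cl assms by simp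
  moreover have "r \<odot>\<^bsub>gr At 0\<^esub> unit At \<in> carrier (gr At 0)"
    using module.smult_closed[OF gr_module assms(1) unit_closed] .
  ultimately show ?thesis using cmap_act[of "r \<odot>\<^bsub>gr At 0\<^esub> unit At" 0 x n n] assms by simp
qed

lemma cmap_tm: "x \<in> carrier (gr M n) \<Longrightarrow> f n (tm M n x) = tm N n (f n x)"
  by (rule cmap_smult[OF tvar_closed])

lemma cmap_cta: "x \<in> carrier (gr M n) \<Longrightarrow> n' = n + 2 \<Longrightarrow> f n' (cta M n x) = cta N n (f n x)"
  by (rule cmap_act[OF ct_closed]) simp_all

lemmas cmap_lin = addhom_add[OF cmap_hom] addhom_neg[OF cmap_hom] addhom_minus[OF cmap_hom] addhom_zero[OF cmap_hom]
lemmas cmap_comm = cmap_dif cmap_tm cmap_cta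

lemma cmap_K: "x \<in> K M i n \<Longrightarrow> f n x \<in> K N i n"
  using cmap_cl[of x n] cmap_smult[OF tpow_closed, of x n i] cmap_lin(4)[of n] by (auto simp: K_in)

lemma cmap_cyc:
  assumes "cyc i m M x y" shows "cyc i m N (f (m + 1) x) (f m y)"
proof -
  have x: "x \<in> K M (Suc i) (m + 1)" "y \<in> K M i m" "dif M (m + 1) x = cta M m y" "dif M m y = tm M (m + 1) x"
    using assms by (auto simp: cyc_def)
  show ?thesis
    using cmap_K[OF x(1)] cmap_K[OF x(2)] cmap_dif[OF x(1)[THEN K_carr], of "m + 2"] cmap_cta[OF x(2)[THEN K_carr], of "m + 2"]
      cmap_dif[OF x(2)[THEN K_carr], of "m + 1"] cmap_tm[OF x(1)[THEN K_carr]] x(3,4)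
    by (simp add: cyc_def)
qed

lemma cmap_bdr:
  assumes "bdr i m M x y" shows "bdr i m N (f (m + 1) x) (f m y)"
proof -
  obtain u v where u: "u \<in> K M (Suc i) m" "v \<in> K M i (m - 1)"
     "x = dif M m u \<oplus>\<^bsub>gr M (m + 1)\<^esub> cta M (m - 1) v" "y = dif M (m - 1) v \<oplus>\<^bsub>gr M m\<^esub> tm M m u"
    using assms by (auto simp: bdr_def)
  show ?thesis unfolding bdr_def
    using cmap_K[OF u(1)] cmap_K[OF u(2)] K_carr[OF u(1)] K_carr[OF u(2)]
    by (intro bexI[of _ "f m u"] bexI[of _ "f (m - 1) v"]) (simp_all add: u cmap_lin cmap_comm module_cl[OF M])
qed

lemma cone_simps:
  "carrier (gr (cone M N f) n) = carrier (gr N n) \<times> carrier (gr M (n + 1))"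
  "\<zero>\<^bsub>gr (cone M N f) n\<^esub> = (\<zero>\<^bsub>gr N n\<^esub>, \<zero>\<^bsub>gr M (n + 1)\<^esub>)"
  "(y, x) \<oplus>\<^bsub>gr (cone M N f) n\<^esub> (y', x') = (y \<oplus>\<^bsub>gr N n\<^esub> y', x \<oplus>\<^bsub>gr M (n + 1)\<^esub> x')"
  "r \<odot>\<^bsub>gr (cone M N f) n\<^esub> (y, x) = (r \<odot>\<^bsub>gr N n\<^esub> y, r \<odot>\<^bsub>gr M (n + 1)\<^esub> x)"
  "act (cone M N f) p n a (y, x) = (act N p n a y, psgn (gr M (p + n + 1)) p (act M p (n + 1) a x))"
  "dif (cone M N f) n (y, x) = (dif N n y \<oplus>\<^bsub>gr N (n + 1)\<^esub> f (n + 1) x, \<ominus>\<^bsub>gr M (n + 1 + 1)\<^esub> dif M (n + 1) x)"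
  by (simp_all add: cone_def dsum_def shift_def) (simp add: psgn_def)

text \<open>The mixed terms of \<open>d^2\<close> are \<open>d f\<close> and \<open>- f d\<close>,
  the sign being that of the shifted differential. They cancel as \<open>f\<close> is closed, and
  each summand retains its own curvature action.\<close>

lemma md_cone: "md (cone M N f)"
proof (rule cdg_moduleI)
  interpret M: cdg_module "pser k" At M by (rule M)
  interpret N: cdg_module "pser k" At N by (rule N)
  show "cdg_algebra (pser k) At" by (rule cdg_algebra_axioms)
  have S: "graded_module_derivation (pser k) At (shift 1 M)"
    by (rule gmd_shift[OF M.M.graded_module_derivation_axioms graded_module_derivation_axioms])
  have D: "graded_module_derivation (pser k) At (dsum N (shift 1 M))"
    by (rule gmd_dsum[OF N.M.graded_module_derivation_axioms S graded_module_derivation_axioms])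
  note z = zero_cl[OF M] md_l_zero[OF M]
    md_r_zero[OF M] module.smult_r_null[OF md_module[OF M]]
  show "graded_module_derivation (pser k) At (cone M N f)"
    unfolding cone_def
  proof (rule gmd_twist[OF D graded_module_derivation_axioms, where \<theta>="\<lambda>n (y, x). (f (n + 1) x, \<zero>\<^bsub>gr M (n + 1 + 1)\<^esub>)"])
    fix n
    show "(\<lambda>(y, x). (f (n + 1) x, \<zero>\<^bsub>gr M (n + 1 + 1)\<^esub>)) \<in> lin_maps (pser k) (gr (dsum N (shift 1 M)) n) (gr (dsum N (shift 1 M)) (n + 1))"
    proof (rule lin_mapsI)
      interpret m: module "pser k" "gr M (n + 1 + 1)" by (rule M.M.gr_module)
      fix v w r assume v: "v \<in> carrier (gr (dsum N (shift 1 M)) n)"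
      then show "(case v of (y, x) \<Rightarrow> (f (n + 1) x, \<zero>\<^bsub>gr M (n + 1 + 1)\<^esub>)) \<in> carrier (gr (dsum N (shift 1 M)) (n + 1))"
        by (auto simp: dsum_def shift_def cmap_cl z)
      { assume "w \<in> carrier (gr (dsum N (shift 1 M)) n)"
        with v show "(case v \<oplus>\<^bsub>gr (dsum N (shift 1 M)) n\<^esub> w of (y, x) \<Rightarrow> (f (n + 1) x, \<zero>\<^bsub>gr M (n + 1 + 1)\<^esub>)) =
          (case v of (y, x) \<Rightarrow> (f (n + 1) x, \<zero>\<^bsub>gr M (n + 1 + 1)\<^esub>)) \<oplus>\<^bsub>gr (dsum N (shift 1 M)) (n + 1)\<^esub>
          (case w of (y, x) \<Rightarrow> (f (n + 1) x, \<zero>\<^bsub>gr M (n + 1 + 1)\<^esub>))"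
          by (auto simp: dsum_def shift_def cmap_lin z) }
      assume "r \<in> carrier (pser k)"
      with v show "(case r \<odot>\<^bsub>gr (dsum N (shift 1 M)) n\<^esub> v of (y, x) \<Rightarrow> (f (n + 1) x, \<zero>\<^bsub>gr M (n + 1 + 1)\<^esub>)) =
          r \<odot>\<^bsub>gr (dsum N (shift 1 M)) (n + 1)\<^esub> (case v of (y, x) \<Rightarrow> (f (n + 1) x, \<zero>\<^bsub>gr M (n + 1 + 1)\<^esub>))"
        by (auto simp: dsum_def shift_def cmap_smult z)
    qed
  next
    fix p q a v assume a: "a \<in> carrier (gr At p)" and "v \<in> carrier (gr (dsum N (shift 1 M)) q)"
    then obtain y x where v: "v = (y, x)" "y \<in> carrier (gr N q)" "x \<in> carrier (gr M (q + 1))" by (auto simp: dsum_def shift_def)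
    have i: "p + q + 1 + 1 = p + (q + 1 + 1)" "p + q + 1 = p + (q + 1)" and j: "2 + (p + q) = p + (2 + q)" by simp_all
    have ax: "act M p (q + 1) a x \<in> carrier (gr M (p + (q + 1)))" using M.M.act_closed[OF a v(3)] by simp
    have "f (p + (q + 1)) (psgn (gr M (p + (q + 1))) p (act M p (q + 1) a x)) = psgn (gr N (p + (q + 1))) p (act N p (q + 1) a (f (q + 1) x))"
      using addhom_psgn[OF cmap_hom ax] cmap_act[OF a v(3) refl] by simp
    moreover have "act N p (q + 1) a (f (q + 1) x) \<in> carrier (gr N (p + (q + 1)))" using N.M.act_closed[OF a cmap_cl[OF v(3)]] by simp
    moreover have "act M p (q + 1 + 1) a \<zero>\<^bsub>gr M (q + 1 + 1)\<^esub> = \<zero>\<^bsub>gr M (p + (q + 1 + 1))\<^esub>"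
      using addhom_zero[OF M.M.act_hom[OF a refl]] .
    moreover have "psgn (gr M (p + (q + 1 + 1))) s \<zero>\<^bsub>gr M (p + (q + 1 + 1))\<^esub> = \<zero>\<^bsub>gr M (p + (q + 1 + 1))\<^esub>" for s
      by (rule abelian_group.psgn_zero) simp
    moreover have "\<zero>\<^bsub>gr M (p + (q + 1 + 1))\<^esub> \<in> carrier (gr M (p + (q + 1 + 1)))" by (rule zero_cl[OF M])
    ultimately show "(case act (dsum N (shift 1 M)) p q a v of (y, x) \<Rightarrow> (f (p + q + 1) x, \<zero>\<^bsub>gr M (p + q + 1 + 1)\<^esub>)) =
       psgn (gr (dsum N (shift 1 M)) (p + q + 1)) p (act (dsum N (shift 1 M)) p (q + 1) a (case v of (y, x) \<Rightarrow> (f (q + 1) x, \<zero>\<^bsub>gr M (q + 1 + 1)\<^esub>)))"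
      using v unfolding dsum_def shift_def cdgm.simps i by (simp add: j dsum_psgn[OF N.M.gr_module M.M.gr_module])
  next
    fix n v assume "v \<in> carrier (gr (dsum N (shift 1 M)) n)"
    then obtain y x where v: "v = (y, x)" "y \<in> carrier (gr N n)" "x \<in> carrier (gr M (n + 1))" by (auto simp: dsum_def shift_def)
    interpret m: abelian_group "gr M (n + 1 + 1)" by simp
    have "dif M (n + 1) x \<in> carrier (gr M (n + 1 + 1))" by (rule M.M.dif_closed[OF v(3) refl])
    then show "(case v of (y, x) \<Rightarrow> (dif N n y \<oplus>\<^bsub>gr N (n + 1)\<^esub> f (n + 1) x, dif (shift 1 M) n x)) =
      dif (dsum N (shift 1 M)) n v \<oplus>\<^bsub>gr (dsum N (shift 1 M)) (n + 1)\<^esub> (case v of (y, x) \<Rightarrow> (f (n + 1) x, \<zero>\<^bsub>gr M (n + 1 + 1)\<^esub>))"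
      using v by (simp add: dsum_def shift_def z psgn_def neg_cl[OF M])
  qed
  fix n v assume "v \<in> carrier (gr (cone M N f) n)"
  then obtain y x where v: "v = (y, x)" and [simp]: "y \<in> carrier (gr N n)" "x \<in> carrier (gr M (n + 1))" by (auto simp: cone_simps)
  have i: "n + 1 + 1 = n + 2" "n + 1 + 1 + 1 = n + 3" "2 + n + 1 = n + 3" "n + 2 + 1 = n + 3" by simp_all
  have "dif N (n + 1) (dif N n y \<oplus>\<^bsub>gr N (n + 1)\<^esub> f (n + 1) x) \<oplus>\<^bsub>gr N (n + 2)\<^esub> f (n + 2) (\<ominus>\<^bsub>gr M (n + 2)\<^esub> dif M (n + 1) x) = act N 2 n (curv At) y"
    apply (simp add: cmap_lin cmap_comm dif_lin'[OF N, where n="n + 2"] module_cl[OF N] module_cl[OF M] cmap_cl N.dif_dif_module)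
    apply (rule lincomb_unique'[OF N, of "n + 2"])
    apply (rule md_lincomb_intros[OF N] | assumption | simp add: module_cl[OF N] cmap_cl N.M.act_closed[OF curv_closed]; fail)+
    done
  moreover have "\<ominus>\<^bsub>gr M (n + 3)\<^esub> dif M (n + 2) (\<ominus>\<^bsub>gr M (n + 2)\<^esub> dif M (n + 1) x) = act M 2 (n + 1) (curv At) x"
  proof -
    interpret m: abelian_group "gr M (n + 3)" by simp
    have "act M 2 (n + 1) (curv At) x \<in> carrier (gr M (n + 3))" by (rule M.M.act_closed[OF curv_closed]) simp_all
    then show ?thesis using M.dif_dif_module[of x "n + 1"]
      by (simp add: dif_lin'[OF M, where n="n + 3"] module_cl[OF M] i)
  qed
  ultimately show "dif (cone M N f) (n + 1) (dif (cone M N f) n v) = act (cone M N f) 2 n (curv At) v"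
    unfolding v cone_simps i by (simp add: psgn_def)
qed

lemma K_cone: "(y, x) \<in> K (cone M N f) i n \<longleftrightarrow> y \<in> K N i n \<and> x \<in> K M i (n + 1)"
  by (auto simp: K_in cone_simps)

lemma torsion_cone: "torsion k M \<Longrightarrow> torsion k N \<Longrightarrow> torsion k (cone M N f)"
  unfolding torsion_def
proof (intro allI ballI)
  assume t: "\<forall>n. \<forall>x\<in>carrier (gr M n). \<exists>i. tpow k i \<odot>\<^bsub>gr M n\<^esub> x = \<zero>\<^bsub>gr M n\<^esub>"
    "\<forall>n. \<forall>x\<in>carrier (gr N n). \<exists>i. tpow k i \<odot>\<^bsub>gr N n\<^esub> x = \<zero>\<^bsub>gr N n\<^esub>"
  fix n v assume "v \<in> carrier (gr (cone M N f) n)"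
  then obtain y x where v: "v = (y, x)" "y \<in> carrier (gr N n)" "x \<in> carrier (gr M (n + 1))" by (auto simp: cone_simps)
  then obtain i j where "y \<in> K N i n" "x \<in> K M j (n + 1)" using t unfolding K_in by blast
  then have "(y, x) \<in> K (cone M N f) (i + j) n"
    using K_mono[OF N, of y i n "i + j"] K_mono[OF M, of x j "n + 1" "i + j"] by (simp add: K_cone)
  then show "\<exists>i. tpow k i \<odot>\<^bsub>gr (cone M N f) n\<^esub> v = \<zero>\<^bsub>gr (cone M N f) n\<^esub>" unfolding v K_in by blast
qed

lemma cyc_cone: "cyc i m (cone M N f) (n, p) (n', p') \<longleftrightarrow>
   n \<in> K N (Suc i) (m + 1) \<and> p \<in> K M (Suc i) (m + 2) \<and> n' \<in> K N i m \<and> p' \<in> K M i (m + 1) \<and>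
   dif N (m + 1) n \<oplus>\<^bsub>gr N (m + 2)\<^esub> f (m + 2) p = cta N m n' \<and> \<ominus>\<^bsub>gr M (m + 3)\<^esub> dif M (m + 2) p = cta M (m + 1) p' \<and>
   dif N m n' \<oplus>\<^bsub>gr N (m + 1)\<^esub> f (m + 1) p' = tm N (m + 1) n \<and> \<ominus>\<^bsub>gr M (m + 2)\<^esub> dif M (m + 1) p' = tm M (m + 2) p"
proof -
  have i: "m + 1 + 1 = m + 2" "m + 2 + 1 = m + 3" by simp_all
  show ?thesis by (simp add: cyc_def K_cone cone_simps i) (auto simp: psgn_def)
qed

lemma bdr_cone: "bdr i m (cone M N f) (n, p) (n', p') \<longleftrightarrow>
   (\<exists>a\<in>K N (Suc i) m. \<exists>b\<in>K M (Suc i) (m + 1). \<exists>a'\<in>K N i (m - 1). \<exists>b'\<in>K M i m.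
     n = dif N m a \<oplus>\<^bsub>gr N (m + 1)\<^esub> f (m + 1) b \<oplus>\<^bsub>gr N (m + 1)\<^esub> cta N (m - 1) a' \<and>
     p = \<ominus>\<^bsub>gr M (m + 2)\<^esub> dif M (m + 1) b \<oplus>\<^bsub>gr M (m + 2)\<^esub> cta M m b' \<and>
     n' = dif N (m - 1) a' \<oplus>\<^bsub>gr N m\<^esub> f m b' \<oplus>\<^bsub>gr N m\<^esub> tm N m a \<and>
     p' = \<ominus>\<^bsub>gr M (m + 1)\<^esub> dif M m b' \<oplus>\<^bsub>gr M (m + 1)\<^esub> tm M (m + 1) b)"
proof -
  have i: "m + 1 + 1 = m + 2" "m - 1 + 1 = m" by simp_all
  have "(\<exists>v\<in>K (cone M N f) i n. P v) \<longleftrightarrow> (\<exists>a\<in>K N i n. \<exists>b\<in>K M i (n + 1). P (a, b))" for i n P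
    using K_cone by (metis surj_pair)
  then show ?thesis by (simp add: bdr_def cone_simps i psgn_def)
qed

end

text \<open>Bijectivity on pairs modulo boundaries, for all \<open>i\<close> and all degrees,
  spelled out on representatives: first surjectivity, then injectivity.\<close>

definition qi where
  "qi M N f \<longleftrightarrow> (\<forall>i m.
     (\<forall>x y. cyc i m N x y \<longrightarrow> (\<exists>a b. cyc i m M a b \<and>
        bdr i m N (x \<ominus>\<^bsub>gr N (m + 1)\<^esub> f (m + 1) a) (y \<ominus>\<^bsub>gr N m\<^esub> f m b))) \<and>
     (\<forall>x y. cyc i m M x y \<longrightarrow> bdr i m N (f (m + 1) x) (f m y) \<longrightarrow> bdr i m M x y))"

text \<open>The \<open>M\<close>-part of a cycle of the cone becomes a boundary in \<open>N\<close>,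
  hence is one in \<open>M\<close> by injectivity. After it is removed, the \<open>N\<close>-part is
  a cycle, which comes from \<open>M\<close> up to a boundary by surjectivity.\<close>

lemma qi_exact_cone:
  assumes M: "md M" and N: "md N" and f: "cmap M N f" and q: "qi M N f"
  shows "exactE (cone M N f)"
  unfolding exactE_def
proof (intro allI impI)
  fix i m w w' assume c: "cyc i m (cone M N f) w w'"
  obtain n p where w: "w = (n, p)" by (cases w)
  obtain n' p' where w': "w' = (n', p')" by (cases w')
  note lcuN = lincomb_unique'[OF N] and lciN = md_lincomb_intros[OF N]
  note lcuM = lincomb_unique'[OF M] and lciM = md_lincomb_intros[OF M]
  have j: "1 + m = m + 1" "2 + m = m + 2" "m + 1 + 1 = m + 2" "m - 1 + 1 = m" "m + 1 + 2 = m + 3" "m + 2 + 1 = m + 3" by simp_all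
  have K: "n \<in> K N (Suc i) (m + 1)" "p \<in> K M (Suc i) (m + 2)" "n' \<in> K N i m" "p' \<in> K M i (m + 1)"
   and e: "dif N (m + 1) n \<oplus>\<^bsub>gr N (m + 2)\<^esub> f (m + 2) p = cta N m n'" "\<ominus>\<^bsub>gr M (m + 3)\<^esub> dif M (m + 2) p = cta M (m + 1) p'"
     "dif N m n' \<oplus>\<^bsub>gr N (m + 1)\<^esub> f (m + 1) p' = tm N (m + 1) n" "\<ominus>\<^bsub>gr M (m + 2)\<^esub> dif M (m + 1) p' = tm M (m + 2) p"
    using c unfolding w w' cyc_cone[OF M N f] by auto
  note c1[simp] = K[THEN K_carr]
  note cf = cmap_cl[OF M N f]
  note simps = module_cl[OF M] module_cl[OF N] cf module_comm[OF M] module_comm[OF N] tm_lin[OF M] tm_lin[OF N] j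
     dif_lin'[OF M, where n="m + 3"] dif_lin'[OF M, where n="m + 2"] dif_lin'[OF M, where n="m + 1"] dif_lin'[OF M, where n=m]
     cta_lin[OF M, where n'="m + 3"] cta_lin[OF M, where n'="m + 2"] cta_lin[OF M, where n'="m + 1"]
     dif_lin'[OF N, where n="m + 2"] dif_lin'[OF N, where n="m + 1"] dif_lin'[OF N, where n=m]
     cta_lin[OF N, where n'="m + 2"] cta_lin[OF N, where n'="m + 1"]
     cmap_lin[OF M N f] cmap_comm[OF M N f]
  have dn: "dif N (m + 1) n = cta N m n' \<ominus>\<^bsub>gr N (m + 2)\<^esub> f (m + 2) p"
    unfolding e(1)[symmetric] by (intro lcuN[of "m + 2"]) (rule lciN | assumption | simp add: simps; fail)+
  have dn': "dif N m n' = tm N (m + 1) n \<ominus>\<^bsub>gr N (m + 1)\<^esub> f (m + 1) p'"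
    unfolding e(3)[symmetric] by (intro lcuN[of "m + 1"]) (rule lciN | assumption | simp add: simps; fail)+
  have dp: "dif M (m + 2) p = \<ominus>\<^bsub>gr M (m + 3)\<^esub> cta M (m + 1) p'"
    unfolding e(2)[symmetric] by (intro lcuM[of "m + 3"]) (rule lciM | assumption | simp add: simps; fail)+
  \<comment> \<open>The shifted summand has differential \<open>- d\<close>; negating
    \<open>p'\<close> absorbs this sign.\<close>
  have "cyc i (m + 1) M p (\<ominus>\<^bsub>gr M (m + 1)\<^esub> p')"
    using K K_neg[OF M] dp e(4) by (simp add: cyc_def simps)
  moreover have "bdr i (m + 1) N (f (m + 1 + 1) p) (f (m + 1) (\<ominus>\<^bsub>gr M (m + 1)\<^esub> p'))"
    unfolding bdr_def
  proof (intro bexI conjI)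
    show "\<ominus>\<^bsub>gr N (m + 1)\<^esub> n \<in> K N (Suc i) (m + 1)" by (rule K_neg[OF N K(1)])
    show "n' \<in> K N i (m + 1 - 1)" using K(3) by simp
    show "f (m + 1 + 1) p = dif N (m + 1) (\<ominus>\<^bsub>gr N (m + 1)\<^esub> n) \<oplus>\<^bsub>gr N (m + 1 + 1)\<^esub> cta N (m + 1 - 1) n'"
      apply (simp add: simps dn)
      by (intro lcuN[of "m + 2"]) (rule lciN | assumption | simp add: simps; fail)+
    show "f (m + 1) (\<ominus>\<^bsub>gr M (m + 1)\<^esub> p') = dif N (m + 1 - 1) n' \<oplus>\<^bsub>gr N (m + 1)\<^esub> tm N (m + 1) (\<ominus>\<^bsub>gr N (m + 1)\<^esub> n)"
      apply (simp add: simps dn')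
      by (intro lcuN[of "m + 1"]) (rule lciN | assumption | simp add: simps; fail)+
  qed
  ultimately have "bdr i (m + 1) M p (\<ominus>\<^bsub>gr M (m + 1)\<^esub> p')"
    using q unfolding qi_def by blast
  then obtain u v where u: "u \<in> K M (Suc i) (m + 1)" "v \<in> K M i m"
    "p = dif M (m + 1) u \<oplus>\<^bsub>gr M (m + 2)\<^esub> cta M m v" "\<ominus>\<^bsub>gr M (m + 1)\<^esub> p' = dif M m v \<oplus>\<^bsub>gr M (m + 1)\<^esub> tm M (m + 1) u"
    unfolding bdr_def by (auto simp: j)
  note c2[simp] = u(1,2)[THEN K_carr]
  have p'_eq: "p' = \<ominus>\<^bsub>gr M (m + 1)\<^esub> (dif M m v \<oplus>\<^bsub>gr M (m + 1)\<^esub> tm M (m + 1) u)"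
    unfolding u(4)[symmetric] by (intro lcuM[of "m + 1"]) (rule lciM | assumption | simp add: simps; fail)+
  \<comment> \<open>The image of the primitive \<open>(u, v)\<close>, with signs from the shift,
    cancels what \<open>p\<close> and \<open>p'\<close> contribute, and a cycle of \<open>N\<close>
    remains.\<close>
  have "cyc i m N (n \<oplus>\<^bsub>gr N (m + 1)\<^esub> f (m + 1) u) (n' \<ominus>\<^bsub>gr N m\<^esub> f m v)"
    unfolding cyc_def
  proof (intro conjI)
    show "n \<oplus>\<^bsub>gr N (m + 1)\<^esub> f (m + 1) u \<in> K N (Suc i) (m + 1)" using K_add[OF N K(1) cmap_K[OF M N f u(1)]] .
    show "n' \<ominus>\<^bsub>gr N m\<^esub> f m v \<in> K N i m" using K_minus[OF N K(3) cmap_K[OF M N f u(2)]] .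
    show "dif N (m + 1) (n \<oplus>\<^bsub>gr N (m + 1)\<^esub> f (m + 1) u) = cta N m (n' \<ominus>\<^bsub>gr N m\<^esub> f m v)"
      apply (simp add: simps dn u(3))
      by (intro lcuN[of "m + 2"]) (rule lciN | assumption | simp add: simps; fail)+
    show "dif N m (n' \<ominus>\<^bsub>gr N m\<^esub> f m v) = tm N (m + 1) (n \<oplus>\<^bsub>gr N (m + 1)\<^esub> f (m + 1) u)"
      apply (simp add: simps dn' p'_eq)
      by (intro lcuN[of "m + 1"]) (rule lciN | assumption | simp add: simps; fail)+
  qed
  then obtain a b where ab: "cyc i m M a b"
     "bdr i m N (n \<oplus>\<^bsub>gr N (m + 1)\<^esub> f (m + 1) u \<ominus>\<^bsub>gr N (m + 1)\<^esub> f (m + 1) a) (n' \<ominus>\<^bsub>gr N m\<^esub> f m v \<ominus>\<^bsub>gr N m\<^esub> f m b)"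
    using q unfolding qi_def by blast
  have aK: "a \<in> K M (Suc i) (m + 1)" "b \<in> K M i m" and ae: "dif M (m + 1) a = cta M m b" "dif M m b = tm M (m + 1) a"
    using ab(1) by (auto simp: cyc_def)
  obtain P Q where P: "P \<in> K N (Suc i) m" "Q \<in> K N i (m - 1)"
    "n \<oplus>\<^bsub>gr N (m + 1)\<^esub> f (m + 1) u \<ominus>\<^bsub>gr N (m + 1)\<^esub> f (m + 1) a = dif N m P \<oplus>\<^bsub>gr N (m + 1)\<^esub> cta N (m - 1) Q"
    "n' \<ominus>\<^bsub>gr N m\<^esub> f m v \<ominus>\<^bsub>gr N m\<^esub> f m b = dif N (m - 1) Q \<oplus>\<^bsub>gr N m\<^esub> tm N m P"
    using ab(2) by (auto simp: bdr_def)
  note c3[simp] = aK[THEN K_carr] P(1,2)[THEN K_carr]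
  show "bdr i m (cone M N f) w w'"
    unfolding w w' bdr_cone[OF M N f]
  proof (intro bexI conjI)
    show "P \<in> K N (Suc i) m" "Q \<in> K N i (m - 1)" by fact+
    show "a \<ominus>\<^bsub>gr M (m + 1)\<^esub> u \<in> K M (Suc i) (m + 1)" using aK u K_minus[OF M] by blast
    show "b \<oplus>\<^bsub>gr M m\<^esub> v \<in> K M i m" using aK u K_add[OF M] by blast
    have "n = (n \<oplus>\<^bsub>gr N (m + 1)\<^esub> f (m + 1) u \<ominus>\<^bsub>gr N (m + 1)\<^esub> f (m + 1) a) \<oplus>\<^bsub>gr N (m + 1)\<^esub> f (m + 1) (a \<ominus>\<^bsub>gr M (m + 1)\<^esub> u)"
      apply (simp add: simps)
      by (intro lcuN[of "m + 1"]) (rule lciN | assumption | simp add: simps; fail)+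
    then show "n = dif N m P \<oplus>\<^bsub>gr N (m + 1)\<^esub> f (m + 1) (a \<ominus>\<^bsub>gr M (m + 1)\<^esub> u) \<oplus>\<^bsub>gr N (m + 1)\<^esub> cta N (m - 1) Q"
      unfolding P(3) apply (elim ssubst)
      by (intro lcuN[of "m + 1"]) (rule lciN | assumption | simp add: simps; fail)+
    show "p = \<ominus>\<^bsub>gr M (m + 2)\<^esub> dif M (m + 1) (a \<ominus>\<^bsub>gr M (m + 1)\<^esub> u) \<oplus>\<^bsub>gr M (m + 2)\<^esub> cta M m (b \<oplus>\<^bsub>gr M m\<^esub> v)"
      apply (simp add: simps u(3) ae)
      by (intro lcuM[of "m + 2"]) (rule lciM | assumption | simp add: simps; fail)+
    have "n' = (n' \<ominus>\<^bsub>gr N m\<^esub> f m v \<ominus>\<^bsub>gr N m\<^esub> f m b) \<oplus>\<^bsub>gr N m\<^esub> f m (b \<oplus>\<^bsub>gr M m\<^esub> v)"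
      apply (simp add: simps)
      by (intro lcuN[of m]) (rule lciN | assumption | simp add: simps; fail)+
    then show "n' = dif N (m - 1) Q \<oplus>\<^bsub>gr N m\<^esub> f m (b \<oplus>\<^bsub>gr M m\<^esub> v) \<oplus>\<^bsub>gr N m\<^esub> tm N m P"
      unfolding P(4) apply (elim ssubst)
      by (intro lcuN[of m]) (rule lciN | assumption | simp add: simps; fail)+
    show "p' = \<ominus>\<^bsub>gr M (m + 1)\<^esub> dif M m (b \<oplus>\<^bsub>gr M m\<^esub> v) \<oplus>\<^bsub>gr M (m + 1)\<^esub> tm M (m + 1) (a \<ominus>\<^bsub>gr M (m + 1)\<^esub> u)"
      apply (simp add: simps p'_eq ae)
      by (intro lcuM[of "m + 1"]) (rule lciM | assumption | simp add: simps; fail)+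
  qed
qed

text \<open>Exactness is applied to two kinds of cycles of the cone: a cycle of \<open>N\<close>
  completed by zero gives surjectivity, and a cycle of \<open>M\<close> together with a primitive of
  its image gives injectivity.\<close>

lemma exact_cone_qi:
  assumes M: "md M" and N: "md N" and f: "cmap M N f" and ex: "exactE (cone M N f)"
  shows "qi M N f"
proof -
  have surj: "\<exists>a b. cyc i m M a b \<and> bdr i m N (x \<ominus>\<^bsub>gr N (m + 1)\<^esub> f (m + 1) a) (y \<ominus>\<^bsub>gr N m\<^esub> f m b)"
    if c: "cyc i m N x y" for i m x y
  proof -
    note lcuN = lincomb_unique'[OF N] and lciN = md_lincomb_intros[OF N]
    note lcuM = lincomb_unique'[OF M] and lciM = md_lincomb_intros[OF M]
    have j: "1 + m = m + 1" "2 + m = m + 2" "m + 1 + 1 = m + 2" "m - 1 + 1 = m" "m + 1 + 2 = m + 3" "m + 2 + 1 = m + 3" by simp_all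
    have xK: "x \<in> K N (Suc i) (m + 1)" "y \<in> K N i m" and xe: "dif N (m + 1) x = cta N m y" "dif N m y = tm N (m + 1) x"
      using c by (auto simp: cyc_def)
    note c1[simp] = xK[THEN K_carr]
    note z = md_neg_zero[OF M] md_r_zero[OF N]
    have "cyc i m (cone M N f) (x, \<zero>\<^bsub>gr M (m + 2)\<^esub>) (y, \<zero>\<^bsub>gr M (m + 1)\<^esub>)"
      unfolding cyc_cone[OF M N f] using xK K_zero[OF M] xe
      by (simp add: dif_lin'[OF M, where n="m + 3"] dif_lin'[OF M, where n="m + 2"] cta_lin[OF M, where n'="m + 3"] cmap_lin[OF M N f] tm_lin[OF M] z
         module_cl[OF N])
    then have "bdr i m (cone M N f) (x, \<zero>\<^bsub>gr M (m + 2)\<^esub>) (y, \<zero>\<^bsub>gr M (m + 1)\<^esub>)" using ex unfolding exactE_def by blast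
    then obtain a b a' b' where K: "a\<in>K N (Suc i) m" "b\<in>K M (Suc i) (m + 1)" "a'\<in>K N i (m - 1)" "b'\<in>K M i m"
     and e: "x = dif N m a \<oplus>\<^bsub>gr N (m + 1)\<^esub> f (m + 1) b \<oplus>\<^bsub>gr N (m + 1)\<^esub> cta N (m - 1) a'"
     "\<zero>\<^bsub>gr M (m + 2)\<^esub> = \<ominus>\<^bsub>gr M (m + 2)\<^esub> dif M (m + 1) b \<oplus>\<^bsub>gr M (m + 2)\<^esub> cta M m b'"
     "y = dif N (m - 1) a' \<oplus>\<^bsub>gr N m\<^esub> f m b' \<oplus>\<^bsub>gr N m\<^esub> tm N m a"
     "\<zero>\<^bsub>gr M (m + 1)\<^esub> = \<ominus>\<^bsub>gr M (m + 1)\<^esub> dif M m b' \<oplus>\<^bsub>gr M (m + 1)\<^esub> tm M (m + 1) b"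
      unfolding bdr_cone[OF M N f] by blast
    note c2[simp] = K[THEN K_carr]
    note simps = module_cl[OF M] module_cl[OF N] cmap_cl[OF M N f] j
    have "dif M (m + 1) b = dif M (m + 1) b \<oplus>\<^bsub>gr M (m + 2)\<^esub> \<zero>\<^bsub>gr M (m + 2)\<^esub>"
      by (intro lcuM[of "m + 2"]) (rule lciM | assumption | simp add: simps; fail)+
    also have "\<dots> = cta M m b'"
      unfolding e(2) by (intro lcuM[of "m + 2"]) (rule lciM | assumption | simp add: simps; fail)+
    finally have b: "dif M (m + 1) b = cta M m b'" .
    have "dif M m b' = dif M m b' \<oplus>\<^bsub>gr M (m + 1)\<^esub> \<zero>\<^bsub>gr M (m + 1)\<^esub>"
      by (intro lcuM[of "m + 1"]) (rule lciM | assumption | simp add: simps; fail)+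
    also have "\<dots> = tm M (m + 1) b"
      unfolding e(4) by (intro lcuM[of "m + 1"]) (rule lciM | assumption | simp add: simps; fail)+
    finally have b': "dif M m b' = tm M (m + 1) b" .
    show ?thesis
    proof (intro exI conjI)
      show "cyc i m M b b'" using K b b' by (simp add: cyc_def)
      show "bdr i m N (x \<ominus>\<^bsub>gr N (m + 1)\<^esub> f (m + 1) b) (y \<ominus>\<^bsub>gr N m\<^esub> f m b')"
        unfolding bdr_def
      proof (intro bexI conjI)
        show "a \<in> K N (Suc i) m" "a' \<in> K N i (m - 1)" by fact+
        show "x \<ominus>\<^bsub>gr N (m + 1)\<^esub> f (m + 1) b = dif N m a \<oplus>\<^bsub>gr N (m + 1)\<^esub> cta N (m - 1) a'"
          unfolding e(1) by (intro lcuN[of "m + 1"]) (rule lciN | assumption | simp add: simps; fail)+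
        show "y \<ominus>\<^bsub>gr N m\<^esub> f m b' = dif N (m - 1) a' \<oplus>\<^bsub>gr N m\<^esub> tm N m a"
          unfolding e(3) by (intro lcuN[of m]) (rule lciN | assumption | simp add: simps; fail)+
      qed
    qed
  qed
  \<comment> \<open>Proved one degree up, so that the degrees in the cone involve fewer
    subtractions; the general case is a renaming of \<open>m\<close>.\<close>
  have inj': "bdr i (m + 1) M x y" if c: "cyc i (m + 1) M x y" and b: "bdr i (m + 1) N (f (m + 1 + 1) x) (f (m + 1) y)" for i m x y
  proof -
    note lcuN = lincomb_unique'[OF N] and lciN = md_lincomb_intros[OF N]
    note lcuM = lincomb_unique'[OF M] and lciM = md_lincomb_intros[OF M]
    have j: "1 + m = m + 1" "2 + m = m + 2" "m + 1 + 1 = m + 2" "m - 1 + 1 = m" "m + 1 + 2 = m + 3" "m + 2 + 1 = m + 3" by simp_all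
    have xK: "x \<in> K M (Suc i) (m + 2)" "y \<in> K M i (m + 1)" and xe: "dif M (m + 2) x = cta M (m + 1) y" "dif M (m + 1) y = tm M (m + 2) x"
      using c by (auto simp: cyc_def j)
    obtain U V where U: "U \<in> K N (Suc i) (m + 1)" "V \<in> K N i m"
      "f (m + 2) x = dif N (m + 1) U \<oplus>\<^bsub>gr N (m + 2)\<^esub> cta N m V" "f (m + 1) y = dif N m V \<oplus>\<^bsub>gr N (m + 1)\<^esub> tm N (m + 1) U"
      using b by (auto simp: bdr_def j)
    note c1[simp] = xK[THEN K_carr] U(1,2)[THEN K_carr]
    note simps = module_cl[OF M] module_cl[OF N] cmap_cl[OF M N f] j cmap_lin[OF M N f] tm_lin[OF M] tm_lin[OF N]
      dif_lin'[OF M, where n="m + 2"] dif_lin'[OF M, where n="m + 1"] dif_lin'[OF N, where n="m + 2"] cta_lin[OF M, where n'="m + 3"]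
    \<comment> \<open>The cycle \<open>(x, y)\<close> and the primitive \<open>(U, V)\<close> of its
      image make up a cycle of the cone; \<open>U\<close> and \<open>y\<close> are negated to match
      the signs of the cone differential.\<close>
    have "cyc i m (cone M N f) (\<ominus>\<^bsub>gr N (m + 1)\<^esub> U, x) (V, \<ominus>\<^bsub>gr M (m + 1)\<^esub> y)"
      unfolding cyc_cone[OF M N f]
    proof (intro conjI)
      show "\<ominus>\<^bsub>gr N (m + 1)\<^esub> U \<in> K N (Suc i) (m + 1)" by (rule K_neg[OF N U(1)])
      show "\<ominus>\<^bsub>gr M (m + 1)\<^esub> y \<in> K M i (m + 1)" by (rule K_neg[OF M xK(2)])
      show "dif N (m + 1) (\<ominus>\<^bsub>gr N (m + 1)\<^esub> U) \<oplus>\<^bsub>gr N (m + 2)\<^esub> f (m + 2) x = cta N m V"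
        apply (simp add: simps U(3))
        by (intro lcuN[of "m + 2"]) (rule lciN | assumption | simp add: simps; fail)+
      show "\<ominus>\<^bsub>gr M (m + 3)\<^esub> dif M (m + 2) x = cta M (m + 1) (\<ominus>\<^bsub>gr M (m + 1)\<^esub> y)"
        by (simp add: simps xe)
      show "dif N m V \<oplus>\<^bsub>gr N (m + 1)\<^esub> f (m + 1) (\<ominus>\<^bsub>gr M (m + 1)\<^esub> y) = tm N (m + 1) (\<ominus>\<^bsub>gr N (m + 1)\<^esub> U)"
        apply (simp add: simps U(4))
        by (intro lcuN[of "m + 1"]) (rule lciN | assumption | simp add: simps; fail)+
      have "\<ominus>\<^bsub>gr M (m + 2)\<^esub> (\<ominus>\<^bsub>gr M (m + 2)\<^esub> dif M (m + 1) y) = dif M (m + 1) y"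
        by (intro lcuM[of "m + 2"]) (rule lciM | assumption | simp add: simps; fail)+
      then show "\<ominus>\<^bsub>gr M (m + 2)\<^esub> dif M (m + 1) (\<ominus>\<^bsub>gr M (m + 1)\<^esub> y) = tm M (m + 2) x"
        by (simp add: simps xe)
    qed (use xK U in auto)
    then have "bdr i m (cone M N f) (\<ominus>\<^bsub>gr N (m + 1)\<^esub> U, x) (V, \<ominus>\<^bsub>gr M (m + 1)\<^esub> y)" using ex unfolding exactE_def by blast
    then obtain b b' where K: "b\<in>K M (Suc i) (m + 1)" "b'\<in>K M i m"
     and e: "x = \<ominus>\<^bsub>gr M (m + 2)\<^esub> dif M (m + 1) b \<oplus>\<^bsub>gr M (m + 2)\<^esub> cta M m b'"
     "\<ominus>\<^bsub>gr M (m + 1)\<^esub> y = \<ominus>\<^bsub>gr M (m + 1)\<^esub> dif M m b' \<oplus>\<^bsub>gr M (m + 1)\<^esub> tm M (m + 1) b"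
      unfolding bdr_cone[OF M N f] by blast
    note c2[simp] = K[THEN K_carr]
    show ?thesis unfolding bdr_def
    proof (intro bexI conjI)
      show "\<ominus>\<^bsub>gr M (m + 1)\<^esub> b \<in> K M (Suc i) (m + 1)" by (rule K_neg[OF M K(1)])
      show "b' \<in> K M i (m + 1 - 1)" using K(2) by simp
      show "x = dif M (m + 1) (\<ominus>\<^bsub>gr M (m + 1)\<^esub> b) \<oplus>\<^bsub>gr M (m + 1 + 1)\<^esub> cta M (m + 1 - 1) b'"
        by (simp add: simps e(1))
      have "y = \<ominus>\<^bsub>gr M (m + 1)\<^esub> (\<ominus>\<^bsub>gr M (m + 1)\<^esub> y)"
        by (intro lcuM[of "m + 1"]) (rule lciM | assumption | simp add: simps; fail)+
      also have "\<dots> = dif M m b' \<oplus>\<^bsub>gr M (m + 1)\<^esub> \<ominus>\<^bsub>gr M (m + 1)\<^esub> tm M (m + 1) b"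
        unfolding e(2) by (intro lcuM[of "m + 1"]) (rule lciM | assumption | simp add: simps; fail)+
      finally show "y = dif M (m + 1 - 1) b' \<oplus>\<^bsub>gr M (m + 1)\<^esub> tm M (m + 1) (\<ominus>\<^bsub>gr M (m + 1)\<^esub> b)"
        by (simp add: simps)
    qed
  qed
  have inj: "bdr i m M x y" if "cyc i m M x y" "bdr i m N (f (m + 1) x) (f m y)" for i m x y
    using inj'[of i "m - 1" x y] that by simp
  show ?thesis unfolding qi_def using surj inj by blast
qed

theorem qi_iff_t_acyclic_cone:
  assumes "md M" "md N" "cmap M N f"
  shows "t_acyclic k (cone M N f) \<longleftrightarrow> qi M N f"
  using t_acyclic_iff_exact[OF md_cone[OF assms]] qi_exact_cone[OF assms] exact_cone_qi[OF assms] by blast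

end

lemma dsum_minus:
  assumes "module R V" "module R W" "v \<in> carrier V" "w \<in> carrier W" "v' \<in> carrier V" "w' \<in> carrier W"
  shows "(v, w) \<ominus>\<^bsub>dsum_module V W\<^esub> (v', w') = (v \<ominus>\<^bsub>V\<^esub> v', w \<ominus>\<^bsub>W\<^esub> w')"
  using dsum_neg[OF assms(1,2,5,6)] by (simp add: a_minus_def)

section \<open>Groups of pairs, and two-out-of-three\<close>

context tors
begin

text \<open>The ambient group of pairs. Inside it, \<open>EZ i m N\<close> modulo
  \<open>EB i m N\<close> will be the group of homotopy classes of maps from
  \<open>\<Gamma>_i\<close> to \<open>N[m + 1]\<close>.\<close>

definition EG where "EG N m = dsum_module (gr N (m + 1)) (gr N m)"
definition EZ where "EZ i m N = {(x, y). cyc i m N x y}"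
definition EB where "EB i m N = {(x, y). bdr i m N x y}"
definition Ef :: "(int \<Rightarrow> 'm \<Rightarrow> 'n) \<Rightarrow> int \<Rightarrow> 'm \<times> 'm \<Rightarrow> 'n \<times> 'n" where
  "Ef f m = (\<lambda>(x, y). (f (m + 1) x, f m y))"

lemma EG_ab: "md N \<Longrightarrow> abelian_group (EG N m)"
  unfolding EG_def using module_dsum[OF md_module md_module] by (auto simp: module_def)

lemma EG_simps:
  "carrier (EG N m) = carrier (gr N (m + 1)) \<times> carrier (gr N m)"
  "\<zero>\<^bsub>EG N m\<^esub> = (\<zero>\<^bsub>gr N (m + 1)\<^esub>, \<zero>\<^bsub>gr N m\<^esub>)"
  "(x, y) \<oplus>\<^bsub>EG N m\<^esub> (x', y') = (x \<oplus>\<^bsub>gr N (m + 1)\<^esub> x', y \<oplus>\<^bsub>gr N m\<^esub> y')"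
  by (simp_all add: EG_def)

lemma EG_minus: "\<lbrakk>md N; x \<in> carrier (gr N (m + 1)); y \<in> carrier (gr N m); x' \<in> carrier (gr N (m + 1)); y' \<in> carrier (gr N m)\<rbrakk> \<Longrightarrow>
  (x, y) \<ominus>\<^bsub>EG N m\<^esub> (x', y') = (x \<ominus>\<^bsub>gr N (m + 1)\<^esub> x', y \<ominus>\<^bsub>gr N m\<^esub> y')"
  unfolding EG_def by (rule dsum_minus[OF md_module md_module])

lemma EG_neg: "\<lbrakk>md N; x \<in> carrier (gr N (m + 1)); y \<in> carrier (gr N m)\<rbrakk> \<Longrightarrow>
  \<ominus>\<^bsub>EG N m\<^esub> (x, y) = (\<ominus>\<^bsub>gr N (m + 1)\<^esub> x, \<ominus>\<^bsub>gr N m\<^esub> y)"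
  unfolding EG_def by (rule dsum_neg[OF md_module md_module])

lemma EZ_carr: "z \<in> EZ i m N \<Longrightarrow> z \<in> carrier (EG N m)"
  by (auto simp: EZ_def EG_simps cyc_def K_in)

context
  fixes N :: "('k, 'a, 'n) tmod"
  assumes N: "md N"
begin

text \<open>As \<open>d^2\<close> is \<open>t (c/t)\<close>, the term \<open>d d u\<close> matches
  \<open>(c/t) (t u)\<close> in the first equation, and \<open>d d v\<close> matches
  \<open>t ((c/t) v)\<close> in the second.\<close>

lemma EB_EZ: "z \<in> EB i m N \<Longrightarrow> z \<in> EZ i m N"
proof -
  assume "z \<in> EB i m N"
  then obtain u v where u: "u \<in> K N (Suc i) m" "v \<in> K N i (m - 1)" and z: "z = (dif N m u \<oplus>\<^bsub>gr N (m + 1)\<^esub> cta N (m - 1) v, dif N (m - 1) v \<oplus>\<^bsub>gr N m\<^esub> tm N m u)"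
    by (auto simp: EB_def bdr_def)
  note c[simp] = u[THEN K_carr]
  have j: "1 + m = m + 1" "2 + m = m + 2" "m + 1 + 1 = m + 2" "m - 1 + 1 = m" by simp_all
  note simps = module_cl[OF N] module_comm[OF N] tm_lin[OF N] j dif_lin'[OF N, where n="m + 2"] dif_lin'[OF N, where n="m + 1"]
     cta_lin[OF N, where n'="m + 2"]
  show ?thesis unfolding z EZ_def cyc_def
  proof (simp, intro conjI)
    show "dif N m u \<oplus>\<^bsub>gr N (m + 1)\<^esub> cta N (m - 1) v \<in> K N (Suc i) (m + 1)"
      by (intro K_cl[OF N] u K_Suc[OF N]) simp_all
    show "dif N (m - 1) v \<oplus>\<^bsub>gr N m\<^esub> tm N m u \<in> K N i m"
      by (intro K_cl[OF N] u K_tm[OF N]) simp_all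
    show "dif N (m + 1) (dif N m u \<oplus>\<^bsub>gr N (m + 1)\<^esub> cta N (m - 1) v) = cta N m (dif N (m - 1) v \<oplus>\<^bsub>gr N m\<^esub> tm N m u)"
      apply (simp add: simps)
      by (intro lincomb_unique'[OF N, of "m + 2"]) (rule md_lincomb_intros[OF N] | assumption | simp add: simps; fail)+
    show "dif N m (dif N (m - 1) v \<oplus>\<^bsub>gr N m\<^esub> tm N m u) = tm N (m + 1) (dif N m u \<oplus>\<^bsub>gr N (m + 1)\<^esub> cta N (m - 1) v)"
      apply (simp add: simps)
      by (intro lincomb_unique'[OF N, of "m + 1"]) (rule md_lincomb_intros[OF N] | assumption | simp add: simps; fail)+
  qed
qed

lemma EZ_subgroup: "additive_subgroup (EZ i m N) (EG N m)"
proof -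
  interpret abelian_group "EG N m" by (rule EG_ab[OF N])
  have j: "m + 1 + 1 = m + 2" by simp
  note simps = K_cl[OF N] dif_lin'[OF N, where n="m + 2"] dif_lin'[OF N, where n="m + 1"] cta_lin[OF N, where n'="m + 2"] tm_lin[OF N] K_carr
  have z: "\<zero>\<^bsub>EG N m\<^esub> \<in> EZ i m N" by (simp add: EZ_def cyc_def EG_simps simps)
  have a: "z \<oplus>\<^bsub>EG N m\<^esub> w \<in> EZ i m N" if "z \<in> EZ i m N" "w \<in> EZ i m N" for z w
    using that EZ_carr[OF that(1)] EZ_carr[OF that(2)] by (cases z, cases w) (simp add: EZ_def cyc_def EG_simps simps)
  have n: "\<ominus>\<^bsub>EG N m\<^esub> z \<in> EZ i m N" if "z \<in> EZ i m N" for z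
    using that EZ_carr[OF that] by (cases z) (simp add: EZ_def cyc_def EG_simps EG_neg[OF N] simps)
  show ?thesis
    by (intro additive_subgroup.intro add.subgroupI) (use EZ_carr z a n in \<open>auto simp flip: a_inv_def\<close>)
qed

lemma EB_subgroup: "additive_subgroup (EB i m N) (EG N m)"
proof -
  interpret abelian_group "EG N m" by (rule EG_ab[OF N])
  have j: "1 + m = m + 1" "2 + m = m + 2" "m + 1 + 1 = m + 2" "m - 1 + 1 = m" by simp_all
  note simps = module_cl[OF N] K_cl[OF N] tm_lin[OF N] j dif_lin'[OF N, where n="m + 1"] dif_lin'[OF N, where n=m] cta_lin[OF N, where n'="m + 1"]
  have z: "\<zero>\<^bsub>EG N m\<^esub> \<in> EB i m N"
    unfolding EB_def bdr_def EG_simps mem_Collect_eq prod.case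
    by (rule bexI[of _ "\<zero>\<^bsub>gr N m\<^esub>"], rule bexI[of _ "\<zero>\<^bsub>gr N (m - 1)\<^esub>"])
      (simp_all add: simps md_l_zero[OF N])
  have a: "z \<oplus>\<^bsub>EG N m\<^esub> w \<in> EB i m N" if zw: "z \<in> EB i m N" "w \<in> EB i m N" for z w
  proof -
    obtain u v where u: "u \<in> K N (Suc i) m" "v \<in> K N i (m - 1)" and z: "z = (dif N m u \<oplus>\<^bsub>gr N (m + 1)\<^esub> cta N (m - 1) v, dif N (m - 1) v \<oplus>\<^bsub>gr N m\<^esub> tm N m u)"
      using zw(1) by (auto simp: EB_def bdr_def)
    obtain u' v' where u': "u' \<in> K N (Suc i) m" "v' \<in> K N i (m - 1)" and w: "w = (dif N m u' \<oplus>\<^bsub>gr N (m + 1)\<^esub> cta N (m - 1) v', dif N (m - 1) v' \<oplus>\<^bsub>gr N m\<^esub> tm N m u')"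
      using zw(2) by (auto simp: EB_def bdr_def)
    note c[simp] = u[THEN K_carr] u'[THEN K_carr]
    show ?thesis unfolding EB_def bdr_def z w EG_simps
    proof (unfold mem_Collect_eq prod.case, rule bexI[of _ "u \<oplus>\<^bsub>gr N m\<^esub> u'"], rule bexI[of _ "v \<oplus>\<^bsub>gr N (m - 1)\<^esub> v'"], rule conjI)
      show "dif N m u \<oplus>\<^bsub>gr N (m + 1)\<^esub> cta N (m - 1) v \<oplus>\<^bsub>gr N (m + 1)\<^esub> (dif N m u' \<oplus>\<^bsub>gr N (m + 1)\<^esub> cta N (m - 1) v') =
        dif N m (u \<oplus>\<^bsub>gr N m\<^esub> u') \<oplus>\<^bsub>gr N (m + 1)\<^esub> cta N (m - 1) (v \<oplus>\<^bsub>gr N (m - 1)\<^esub> v')"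
        apply (simp add: simps)
        by (intro lincomb_unique'[OF N, of "m + 1"]) (rule md_lincomb_intros[OF N] | assumption | simp add: simps; fail)+
      show "dif N (m - 1) v \<oplus>\<^bsub>gr N m\<^esub> tm N m u \<oplus>\<^bsub>gr N m\<^esub> (dif N (m - 1) v' \<oplus>\<^bsub>gr N m\<^esub> tm N m u') =
        dif N (m - 1) (v \<oplus>\<^bsub>gr N (m - 1)\<^esub> v') \<oplus>\<^bsub>gr N m\<^esub> tm N m (u \<oplus>\<^bsub>gr N m\<^esub> u')"
        apply (simp add: simps)
        by (intro lincomb_unique'[OF N, of m]) (rule md_lincomb_intros[OF N] | assumption | simp add: simps; fail)+
    qed (use u u' in \<open>auto intro: K_cl[OF N]\<close>)
  qed
  have n: "\<ominus>\<^bsub>EG N m\<^esub> z \<in> EB i m N" if zw: "z \<in> EB i m N" for z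
  proof -
    obtain u v where u: "u \<in> K N (Suc i) m" "v \<in> K N i (m - 1)" and z: "z = (dif N m u \<oplus>\<^bsub>gr N (m + 1)\<^esub> cta N (m - 1) v, dif N (m - 1) v \<oplus>\<^bsub>gr N m\<^esub> tm N m u)"
      using zw(1) by (auto simp: EB_def bdr_def)
    note c[simp] = u[THEN K_carr]
    have e: "\<ominus>\<^bsub>EG N m\<^esub> z = (\<ominus>\<^bsub>gr N (m + 1)\<^esub> (dif N m u \<oplus>\<^bsub>gr N (m + 1)\<^esub> cta N (m - 1) v), \<ominus>\<^bsub>gr N m\<^esub> (dif N (m - 1) v \<oplus>\<^bsub>gr N m\<^esub> tm N m u))"
      unfolding z by (rule EG_neg[OF N]) (simp_all add: simps)
    show ?thesis unfolding EB_def bdr_def e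
    proof (unfold mem_Collect_eq prod.case, rule bexI[of _ "\<ominus>\<^bsub>gr N m\<^esub> u"], rule bexI[of _ "\<ominus>\<^bsub>gr N (m - 1)\<^esub> v"], rule conjI)
      show "\<ominus>\<^bsub>gr N (m + 1)\<^esub> (dif N m u \<oplus>\<^bsub>gr N (m + 1)\<^esub> cta N (m - 1) v) =
        dif N m (\<ominus>\<^bsub>gr N m\<^esub> u) \<oplus>\<^bsub>gr N (m + 1)\<^esub> cta N (m - 1) (\<ominus>\<^bsub>gr N (m - 1)\<^esub> v)"
        apply (simp add: simps)
        by (intro lincomb_unique'[OF N, of "m + 1"]) (rule md_lincomb_intros[OF N] | assumption | simp add: simps; fail)+
      show "\<ominus>\<^bsub>gr N m\<^esub> (dif N (m - 1) v \<oplus>\<^bsub>gr N m\<^esub> tm N m u) =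
        dif N (m - 1) (\<ominus>\<^bsub>gr N (m - 1)\<^esub> v) \<oplus>\<^bsub>gr N m\<^esub> tm N m (\<ominus>\<^bsub>gr N m\<^esub> u)"
        apply (simp add: simps)
        by (intro lincomb_unique'[OF N, of m]) (rule md_lincomb_intros[OF N] | assumption | simp add: simps; fail)+
    qed (use u in \<open>auto intro: K_cl[OF N]\<close>)
  qed
  show ?thesis
    by (intro additive_subgroup.intro add.subgroupI) (use EZ_carr[OF EB_EZ] z a n in \<open>auto simp flip: a_inv_def\<close>)
qed

lemma EZ_minus: "z \<in> EZ i m N \<Longrightarrow> w \<in> EZ i m N \<Longrightarrow> z \<ominus>\<^bsub>EG N m\<^esub> w \<in> EZ i m N"
  and EB_minus: "z \<in> EB i m N \<Longrightarrow> w \<in> EB i m N \<Longrightarrow> z \<ominus>\<^bsub>EG N m\<^esub> w \<in> EB i m N"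
  and EZ_add: "z \<in> EZ i m N \<Longrightarrow> w \<in> EZ i m N \<Longrightarrow> z \<oplus>\<^bsub>EG N m\<^esub> w \<in> EZ i m N"
  and EB_add: "z \<in> EB i m N \<Longrightarrow> w \<in> EB i m N \<Longrightarrow> z \<oplus>\<^bsub>EG N m\<^esub> w \<in> EB i m N"
  and EZ_zero: "\<zero>\<^bsub>EG N m\<^esub> \<in> EZ i m N"
  and EB_zero: "\<zero>\<^bsub>EG N m\<^esub> \<in> EB i m N"
  using additive_subgroup.a_subgroup[OF EZ_subgroup] additive_subgroup.a_subgroup[OF EB_subgroup]
  by (auto simp: a_minus_def a_inv_def subgroup.m_closed subgroup.m_inv_closed additive_subgroup.zero_closed[OF EZ_subgroup]
    additive_subgroup.zero_closed[OF EB_subgroup] additive_subgroup.a_closed[OF EZ_subgroup] additive_subgroup.a_closed[OF EB_subgroup])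

lemma EB_trans:
  assumes "z \<ominus>\<^bsub>EG N m\<^esub> w \<in> EB i m N" "w \<ominus>\<^bsub>EG N m\<^esub> v \<in> EB i m N"
    "z \<in> EZ i m N" "w \<in> EZ i m N" "v \<in> EZ i m N"
  shows "z \<ominus>\<^bsub>EG N m\<^esub> v \<in> EB i m N"
proof -
  have "z \<ominus>\<^bsub>EG N m\<^esub> v = (z \<ominus>\<^bsub>EG N m\<^esub> w) \<oplus>\<^bsub>EG N m\<^esub> (w \<ominus>\<^bsub>EG N m\<^esub> v)"
    using assms(3-5)[THEN EZ_carr]
    by (intro abelian_group.lincomb_unique[OF EG_ab[OF N, of m]]) (rule abelian_group.lincomb_intros[OF EG_ab[OF N]] | assumption | simp; fail)+
  then show ?thesis using EB_add[OF assms(1,2)] by simp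
qed

lemma EB_diff:
  assumes "z \<ominus>\<^bsub>EG N m\<^esub> w \<in> EB i m N" "z \<in> EZ i m N" "w \<in> EZ i m N"
  shows "z \<in> EB i m N \<longleftrightarrow> w \<in> EB i m N"
proof -
  have "z = (z \<ominus>\<^bsub>EG N m\<^esub> w) \<oplus>\<^bsub>EG N m\<^esub> w" "w = z \<ominus>\<^bsub>EG N m\<^esub> (z \<ominus>\<^bsub>EG N m\<^esub> w)"
    using assms(2-3)[THEN EZ_carr]
    by - (intro abelian_group.lincomb_unique[OF EG_ab[OF N, of m]], (rule abelian_group.lincomb_intros[OF EG_ab[OF N]] | assumption | simp; fail)+)+
  then show ?thesis using EB_add[OF assms(1)] EB_minus[OF _ assms(1)] by metis
qed

end

context
  fixes M :: "('k, 'a, 'm) tmod" and N :: "('k, 'a, 'n) tmod" and f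
  assumes M: "md M" and N: "md N" and f: "cmap M N f"
begin

lemma Ef_EZ: "z \<in> EZ i m M \<Longrightarrow> Ef f m z \<in> EZ i m N"
  using cmap_cyc[OF M N f] by (auto simp: EZ_def Ef_def)

lemma Ef_EB: "z \<in> EB i m M \<Longrightarrow> Ef f m z \<in> EB i m N"
  using cmap_bdr[OF M N f] by (auto simp: EB_def Ef_def)

lemma Ef_hom: "addhom (EG M m) (EG N m) (Ef f m)"
  using EG_ab[OF M] EG_ab[OF N] cmap_cl[OF M N f] cmap_lin[OF M N f]
  by (intro addhomI) (auto simp: EG_simps Ef_def)

lemma qi_iff:
  "qi M N f \<longleftrightarrow> (\<forall>i m. (\<forall>z\<in>EZ i m N. \<exists>w\<in>EZ i m M. z \<ominus>\<^bsub>EG N m\<^esub> Ef f m w \<in> EB i m N) \<and>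
     (\<forall>z\<in>EZ i m M. Ef f m z \<in> EB i m N \<longrightarrow> z \<in> EB i m M))"
proof -
  have 1: "(\<forall>z\<in>EZ i m N. \<exists>w\<in>EZ i m M. z \<ominus>\<^bsub>EG N m\<^esub> Ef f m w \<in> EB i m N) \<longleftrightarrow>
    (\<forall>x y. cyc i m N x y \<longrightarrow> (\<exists>a b. cyc i m M a b \<and> bdr i m N (x \<ominus>\<^bsub>gr N (m + 1)\<^esub> f (m + 1) a) (y \<ominus>\<^bsub>gr N m\<^esub> f m b)))" for i m
  proof -
    have "(x, y) \<ominus>\<^bsub>EG N m\<^esub> Ef f m (a, b) = (x \<ominus>\<^bsub>gr N (m + 1)\<^esub> f (m + 1) a, y \<ominus>\<^bsub>gr N m\<^esub> f m b)"
      if "cyc i m N x y" "cyc i m M a b" for x y a b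
    proof -
      have "x \<in> carrier (gr N (m + 1))" "y \<in> carrier (gr N m)" "a \<in> carrier (gr M (m + 1))" "b \<in> carrier (gr M m)"
        using that by (auto simp: cyc_def K_in)
      then show ?thesis using cmap_cl[OF M N f] by (simp add: Ef_def EG_minus[OF N])
    qed
    then show ?thesis by (simp add: EZ_def EB_def cong: conj_cong)
  qed
  show ?thesis unfolding qi_def 1 by (auto simp: EZ_def EB_def Ef_def)
qed

end

context
  fixes L :: "('k, 'a, 'l) tmod" and M :: "('k, 'a, 'm) tmod" and N :: "('k, 'a, 'n) tmod" and f g
  assumes L: "md L" and M: "md M" and N: "md N" and f: "cmap L M f" and g: "cmap M N g"
begin

lemma cmap_comp: "cmap L N (\<lambda>n x. g n (f n x))"
  using f g unfolding cmap_def by simp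

lemma Ef_comp: "Ef (\<lambda>n x. g n (f n x)) m z = Ef g m (Ef f m z)"
  by (simp add: Ef_def split: prod.split)

text \<open>Here and in the two cancellation lemmas the argument is that for bijections, chased on
  representatives because the quotients of \<open>EZ\<close> by \<open>EB\<close> are never
  formed.\<close>

lemma qi_comp:
  assumes "qi L M f" "qi M N g" shows "qi L N (\<lambda>n x. g n (f n x))"
  unfolding qi_iff[OF L N cmap_comp] Ef_comp
proof (intro allI conjI ballI impI)
  note qf = assms(1)[unfolded qi_iff[OF L M f]] and qg = assms(2)[unfolded qi_iff[OF M N g]]
  fix i m z
  { assume z: "z \<in> EZ i m N"
    obtain w where w: "w \<in> EZ i m M" "z \<ominus>\<^bsub>EG N m\<^esub> Ef g m w \<in> EB i m N" using qg z by blast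
    obtain v where v: "v \<in> EZ i m L" "w \<ominus>\<^bsub>EG M m\<^esub> Ef f m v \<in> EB i m M" using qf w by blast
    have "Ef g m w \<ominus>\<^bsub>EG N m\<^esub> Ef g m (Ef f m v) \<in> EB i m N"
      using Ef_EB[OF M N g v(2)] addhom_minus[OF Ef_hom[OF M N g], of w m "Ef f m v"] w v Ef_EZ[OF L M f] EZ_carr by metis
    then have "z \<ominus>\<^bsub>EG N m\<^esub> Ef g m (Ef f m v) \<in> EB i m N"
      using EB_trans[OF N w(2)] z w v Ef_EZ[OF L M f] Ef_EZ[OF M N g] by blast
    then show "\<exists>w\<in>EZ i m L. z \<ominus>\<^bsub>EG N m\<^esub> Ef g m (Ef f m w) \<in> EB i m N" using v by blast }
  { assume "z \<in> EZ i m L" "Ef g m (Ef f m z) \<in> EB i m N"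
    then show "z \<in> EB i m L" using qf qg Ef_EZ[OF L M f] by blast }
qed

lemma qi_cancel_left:
  assumes "qi M N g" "qi L N (\<lambda>n x. g n (f n x))" shows "qi L M f"
  unfolding qi_iff[OF L M f]
proof (intro allI conjI ballI impI)
  note qg = assms(1)[unfolded qi_iff[OF M N g]] and qgf = assms(2)[unfolded qi_iff[OF L N cmap_comp] Ef_comp]
  fix i m z
  { assume z: "z \<in> EZ i m M"
    obtain w where w: "w \<in> EZ i m L" "Ef g m z \<ominus>\<^bsub>EG N m\<^esub> Ef g m (Ef f m w) \<in> EB i m N"
      using qgf z Ef_EZ[OF M N g] by blast
    have "Ef g m (z \<ominus>\<^bsub>EG M m\<^esub> Ef f m w) \<in> EB i m N"
      using w(2) addhom_minus[OF Ef_hom[OF M N g], of z m "Ef f m w"] z w Ef_EZ[OF L M f] EZ_carr by metis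
    then have "z \<ominus>\<^bsub>EG M m\<^esub> Ef f m w \<in> EB i m M"
      using qg EZ_minus[OF M z Ef_EZ[OF L M f w(1)]] by blast
    then show "\<exists>w\<in>EZ i m L. z \<ominus>\<^bsub>EG M m\<^esub> Ef f m w \<in> EB i m M" using w by blast }
  { assume "z \<in> EZ i m L" "Ef f m z \<in> EB i m M"
    then show "z \<in> EB i m L" using qgf Ef_EB[OF M N g] by blast }
qed

lemma qi_cancel_right:
  assumes "qi L M f" "qi L N (\<lambda>n x. g n (f n x))" shows "qi M N g"
  unfolding qi_iff[OF M N g]
proof (intro allI conjI ballI impI)
  note qf = assms(1)[unfolded qi_iff[OF L M f]] and qgf = assms(2)[unfolded qi_iff[OF L N cmap_comp] Ef_comp]
  fix i m z
  { assume "z \<in> EZ i m N"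
    then show "\<exists>w\<in>EZ i m M. z \<ominus>\<^bsub>EG N m\<^esub> Ef g m w \<in> EB i m N" using qgf Ef_EZ[OF L M f] by blast }
  { assume z: "z \<in> EZ i m M" "Ef g m z \<in> EB i m N"
    obtain w where w: "w \<in> EZ i m L" "z \<ominus>\<^bsub>EG M m\<^esub> Ef f m w \<in> EB i m M" using qf z by blast
    have fw: "Ef f m w \<in> EZ i m M" using Ef_EZ[OF L M f w(1)] .
    have "Ef g m z \<ominus>\<^bsub>EG N m\<^esub> Ef g m (Ef f m w) \<in> EB i m N"
      using Ef_EB[OF M N g w(2)] addhom_minus[OF Ef_hom[OF M N g], of z m "Ef f m w"] z fw EZ_carr by metis
    then have "Ef g m (Ef f m w) \<in> EB i m N"
      using EB_diff[OF N] z(2) Ef_EZ[OF M N g z(1)] Ef_EZ[OF M N g fw] by blast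
    then have "Ef f m w \<in> EB i m M" using qgf w Ef_EB[OF L M f] by blast
    then show "z \<in> EB i m M" using EB_diff[OF M w(2) z(1) fw] by blast }
qed

end

lemma cmap_id: "cmap M M (\<lambda>n x. x)"
  by (simp add: cmap_def)

lemma qi_id:
  fixes M :: "('k, 'a, 'm) tmod"
  assumes "md M" shows "qi M M (\<lambda>n x. x)"
proof -
  have "Ef (\<lambda>n x. x) m z = z" for m and z :: "'m \<times> 'm" by (simp add: Ef_def split: prod.split)
  moreover have "z \<ominus>\<^bsub>EG M m\<^esub> z \<in> EB i m M" if "z \<in> EZ i m M" for z i m
    using EB_zero[OF assms] abelian_group.r_neg[OF EG_ab[OF assms] EZ_carr[OF that]] by (simp add: a_minus_def)
  ultimately show ?thesis unfolding qi_iff[OF assms assms cmap_id] by (simp, blast)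
qed

lemma exactE_iff: "exactE M \<longleftrightarrow> (\<forall>i m. EZ i m M \<subseteq> EB i m M)"
  by (auto simp: exactE_def EZ_def EB_def)

text \<open>A zero map is bijective only between trivial groups. This will identify the objects that
  vanish in the Verdier quotient.\<close>

lemma qi_zero_iff:
  assumes M: "md M"
  shows "qi M M (\<lambda>n x. \<zero>\<^bsub>gr M n\<^esub>) \<longleftrightarrow> exactE M"
proof -
  have z: "cmap M M (\<lambda>n x. \<zero>\<^bsub>gr M n\<^esub>)"
  proof (rule cmapI)
    interpret M: cdg_module "pser k" At M by (rule M)
    show "\<zero>\<^bsub>gr M (p + n)\<^esub> = act M p n a \<zero>\<^bsub>gr M n\<^esub>" if "a \<in> carrier (gr At p)" for p n a
      using addhom_zero[OF M.M.act_hom[OF that refl]] by simp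
    show "\<zero>\<^bsub>gr M (n + 1)\<^esub> = dif M n \<zero>\<^bsub>gr M n\<^esub>" for n using dif_lin'(4)[OF M refl] by simp
  qed (use zero_cl[OF M] md_l_zero[OF M] in auto)
  have E: "Ef (\<lambda>n x. \<zero>\<^bsub>gr M n\<^esub>) m w = \<zero>\<^bsub>EG M m\<^esub>" for m w by (simp add: Ef_def EG_simps split: prod.split)
  have m: "z \<ominus>\<^bsub>EG M m\<^esub> \<zero>\<^bsub>EG M m\<^esub> = z" if "z \<in> EZ i m M" for z i m
  proof -
    interpret abelian_group "EG M m" by (rule EG_ab[OF M])
    show ?thesis using EZ_carr[OF that] by (simp add: a_minus_def neg_zero)
  qed
  show ?thesis unfolding qi_iff[OF M M z] E exactE_iff using m EZ_zero[OF M] EB_zero[OF M] by fastforce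
qed

end

context tors
begin

section \<open>The homotopy category of torsion modules\<close>

text \<open>Members of the degree \<open>p\<close> part of the morphism complex, again without
  extensionality. No compatibility with the differentials is asked, since homotopies are among these
  maps.\<close>

definition lmap :: "int \<Rightarrow> ('k, 'a, 'm) tmod \<Rightarrow> ('k, 'a, 'n) tmod \<Rightarrow> (int \<Rightarrow> 'm \<Rightarrow> 'n) \<Rightarrow> bool" where
  "lmap p M N f \<longleftrightarrow> (\<forall>n. \<forall>x\<in>carrier (gr M n). f n x \<in> carrier (gr N (n + p))) \<and>
     (\<forall>n. \<forall>x\<in>carrier (gr M n). \<forall>y\<in>carrier (gr M n). f n (x \<oplus>\<^bsub>gr M n\<^esub> y) = f n x \<oplus>\<^bsub>gr N (n + p)\<^esub> f n y) \<and>
     (\<forall>q n. \<forall>a\<in>carrier (gr At q). \<forall>x\<in>carrier (gr M n). f (q + n) (act M q n a x) =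
        psgn (gr N (q + n + p)) (p * q) (act N q (n + p) a (f n x)))"

definition hom_d where
  "hom_d p M N f n x = dif N (n + p) (f n x) \<ominus>\<^bsub>gr N (n + p + 1)\<^esub> psgn (gr N (n + p + 1)) p (f (n + 1) (dif M n x))"

text \<open>The differential \<open>hom_d\<close> of a map of degree \<open>-1\<close>, its two
  minus signs combined into a sum.\<close>

definition null_map where
  "null_map M N h n x = dif N (n - 1) (h n x) \<oplus>\<^bsub>gr N n\<^esub> h (n + 1) (dif M n x)"

definition homotopic where
  "homotopic M N f g \<longleftrightarrow> (\<exists>h. lmap (- 1) M N h \<and> (\<forall>n. \<forall>x\<in>carrier (gr M n). f n x = g n x \<oplus>\<^bsub>gr N n\<^esub> null_map M N h n x))"

lemma psgn_add:
  assumes "md N" "x \<in> carrier (gr N n)" "y \<in> carrier (gr N n)"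
  shows "psgn (gr N n) p (x \<oplus>\<^bsub>gr N n\<^esub> y) = psgn (gr N n) p x \<oplus>\<^bsub>gr N n\<^esub> psgn (gr N n) p y"
  using md_minus_add[OF assms(1)] assms by (simp add: psgn_def)

context
  fixes M :: "('k, 'a, 'm) tmod" and N :: "('k, 'a, 'n) tmod"
  assumes M: "md M" and N: "md N"
begin

interpretation M: cdg_module "pser k" At M by (rule M)
interpretation N: cdg_module "pser k" At N by (rule N)

lemma lmapD:
  assumes "lmap p M N f"
  shows "x \<in> carrier (gr M n) \<Longrightarrow> n' = n + p \<Longrightarrow> f n x \<in> carrier (gr N n')"
    "n' = n + p \<Longrightarrow> addhom (gr M n) (gr N n') (f n)"
    "\<lbrakk>a \<in> carrier (gr At q); x \<in> carrier (gr M n); m = q + n; n' = n + p; m' = q + n + p\<rbrakk> \<Longrightarrow>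
       f m (act M q n a x) = psgn (gr N m') (p * q) (act N q n' a (f n x))"
  using assms unfolding lmap_def by (auto intro!: addhomI)

lemma lmap_smult:
  assumes f: "lmap p M N f" and r: "r \<in> carrier (pser k)" and x: "x \<in> carrier (gr M n)" and n': "n' = n + p"
  shows "f n (r \<odot>\<^bsub>gr M n\<^esub> x) = r \<odot>\<^bsub>gr N n'\<^esub> f n x"
proof -
  have fx: "f n x \<in> carrier (gr N n')" using lmapD(1)[OF f x n'] .
  have "act M 0 n (r \<odot>\<^bsub>gr At 0\<^esub> unit At) x = r \<odot>\<^bsub>gr M n\<^esub> x"
    using M.M.act_smult_left[OF unit_closed x r, of n] M.M.act_unit x by simp
  moreover have "act N 0 n' (r \<odot>\<^bsub>gr At 0\<^esub> unit At) (f n x) = r \<odot>\<^bsub>gr N n'\<^esub> f n x"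
    using N.M.act_smult_left[OF unit_closed fx r, of n'] N.M.act_unit fx by simp
  moreover have "r \<odot>\<^bsub>gr At 0\<^esub> unit At \<in> carrier (gr At 0)"
    using module.smult_closed[OF gr_module r unit_closed] .
  ultimately show ?thesis using lmapD(3)[OF f, of "r \<odot>\<^bsub>gr At 0\<^esub> unit At" 0 x n n n' n'] x n' by (simp add: psgn_def)
qed

lemma lmap_K: "\<lbrakk>lmap p M N f; x \<in> K M i n; n' = n + p\<rbrakk> \<Longrightarrow> f n x \<in> K N i n'"
  using lmap_smult[of p f "tpow k i" x n n'] lmapD(1)[of p f x n n'] addhom_zero[OF lmapD(2)[of p f n' n]] by (auto simp: K_in)

lemma lmap_0_cmap: "cmap M N f \<longleftrightarrow> lmap 0 M N f \<and> (\<forall>n. \<forall>x\<in>carrier (gr M n). f (n + 1) (dif M n x) = dif N n (f n x))"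
  by (auto simp: cmap_def lmap_def psgn_def)

lemma lmap_add:
  assumes f: "lmap p M N f" and g: "lmap p M N g"
  shows "lmap p M N (\<lambda>n x. f n x \<oplus>\<^bsub>gr N (n + p)\<^esub> g n x)"
  unfolding lmap_def
proof (intro conjI allI ballI)
  fix n x assume x: "x \<in> carrier (gr M n)"
  note fc[simp] = lmapD(1)[OF f _ refl] lmapD(1)[OF g _ refl]
  show "f n x \<oplus>\<^bsub>gr N (n + p)\<^esub> g n x \<in> carrier (gr N (n + p))" using x by (simp add: module_cl[OF N])
  { fix y assume y: "y \<in> carrier (gr M n)"
    show "f n (x \<oplus>\<^bsub>gr M n\<^esub> y) \<oplus>\<^bsub>gr N (n + p)\<^esub> g n (x \<oplus>\<^bsub>gr M n\<^esub> y) =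
      f n x \<oplus>\<^bsub>gr N (n + p)\<^esub> g n x \<oplus>\<^bsub>gr N (n + p)\<^esub> (f n y \<oplus>\<^bsub>gr N (n + p)\<^esub> g n y)"
      unfolding addhom_add[OF lmapD(2)[OF f refl] x y] addhom_add[OF lmapD(2)[OF g refl] x y]
      using x y by (intro lincomb_unique'[OF N, of "n + p"]) (rule md_lincomb_intros[OF N] | assumption | simp; fail)+ }
  fix q a assume a: "a \<in> carrier (gr At q)"
  show "f (q + n) (act M q n a x) \<oplus>\<^bsub>gr N (q + n + p)\<^esub> g (q + n) (act M q n a x) =
       psgn (gr N (q + n + p)) (p * q) (act N q (n + p) a (f n x \<oplus>\<^bsub>gr N (n + p)\<^esub> g n x))"
    using x a N.M.act_closed[OF a lmapD(1)[OF f x refl], of "q + n + p"] N.M.act_closed[OF a lmapD(1)[OF g x refl], of "q + n + p"]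
      addhom_add[OF N.M.act_hom[OF a, of "q + n + p" "n + p"]]
    by (simp add: lmapD(3)[OF f a x refl refl refl] lmapD(3)[OF g a x refl refl refl] psgn_add[OF N])
qed

lemma lmap_neg:
  assumes f: "lmap p M N f"
  shows "lmap p M N (\<lambda>n x. \<ominus>\<^bsub>gr N (n + p)\<^esub> f n x)"
  unfolding lmap_def
proof (intro conjI allI ballI)
  fix n x assume x: "x \<in> carrier (gr M n)"
  note fc[simp] = lmapD(1)[OF f _ refl]
  show "\<ominus>\<^bsub>gr N (n + p)\<^esub> f n x \<in> carrier (gr N (n + p))" using x by (simp add: module_cl[OF N])
  { fix y assume y: "y \<in> carrier (gr M n)"
    show "\<ominus>\<^bsub>gr N (n + p)\<^esub> f n (x \<oplus>\<^bsub>gr M n\<^esub> y) = \<ominus>\<^bsub>gr N (n + p)\<^esub> f n x \<oplus>\<^bsub>gr N (n + p)\<^esub> \<ominus>\<^bsub>gr N (n + p)\<^esub> f n y"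
      unfolding addhom_add[OF lmapD(2)[OF f refl] x y]
      using x y by (intro lincomb_unique'[OF N, of "n + p"]) (rule md_lincomb_intros[OF N] | assumption | simp; fail)+ }
  fix q a assume a: "a \<in> carrier (gr At q)"
  show "\<ominus>\<^bsub>gr N (q + n + p)\<^esub> f (q + n) (act M q n a x) =
       psgn (gr N (q + n + p)) (p * q) (act N q (n + p) a (\<ominus>\<^bsub>gr N (n + p)\<^esub> f n x))"
    using x a addhom_neg[OF N.M.act_hom[OF a, of "q + n + p" "n + p"]]
    by (simp add: lmapD(3)[OF f a x refl refl refl] psgn_def)
qed

lemma lmap_zero: "lmap p M N (\<lambda>n x. \<zero>\<^bsub>gr N (n + p)\<^esub>)"
  unfolding lmap_def
proof (intro conjI allI ballI)
  fix q n a x assume a: "a \<in> carrier (gr At q)"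
  show "\<zero>\<^bsub>gr N (q + n + p)\<^esub> = psgn (gr N (q + n + p)) (p * q) (act N q (n + p) a \<zero>\<^bsub>gr N (n + p)\<^esub>)"
    using addhom_zero[OF N.M.act_hom[OF a, of "q + n + p" "n + p"]] md_psgn_zero[OF N] by simp
qed (use zero_cl[OF N] md_l_zero[OF N] in auto)

text \<open>The terms containing \<open>dif At q a\<close> arise from \<open>d f\<close> and from
  \<open>f d\<close> with the same sign and cancel in the difference; what remains carries the sign
  for degree \<open>p + 1\<close>.\<close>

lemma lmap_hom_d:
  assumes f: "lmap p M N f"
  shows "lmap (p + 1) M N (hom_d p M N f)"
  unfolding lmap_def
proof (intro conjI allI ballI)
  note fc = lmapD(1)[OF f]
  note lc = lincomb_unique'[OF N] and li = md_lincomb_intros[OF N]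
  fix n x assume x: "x \<in> carrier (gr M n)"
  have i: "n + (p + 1) = n + p + 1" by simp
  have dx: "dif M n x \<in> carrier (gr M (n + 1))" by (rule dif_cl[OF M x refl])
  have c1: "dif N (n + p) (f n x) \<in> carrier (gr N (n + p + 1))" "f (n + 1) (dif M n x) \<in> carrier (gr N (n + p + 1))"
    by (auto intro!: dif_cl[OF N] fc x dx)
  show "hom_d p M N f n x \<in> carrier (gr N (n + (p + 1)))" unfolding i hom_d_def using c1 by (simp add: module_cl[OF N])
  { fix y assume y: "y \<in> carrier (gr M n)"
    have dy: "dif M n y \<in> carrier (gr M (n + 1))" by (rule dif_cl[OF M y refl])
    have c2: "dif N (n + p) (f n y) \<in> carrier (gr N (n + p + 1))" "f (n + 1) (dif M n y) \<in> carrier (gr N (n + p + 1))"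
      by (auto intro!: dif_cl[OF N] fc y dy)
    have e: "dif N (n + p) (f n (x \<oplus>\<^bsub>gr M n\<^esub> y)) = dif N (n + p) (f n x) \<oplus>\<^bsub>gr N (n + p + 1)\<^esub> dif N (n + p) (f n y)"
      "f (n + 1) (dif M n (x \<oplus>\<^bsub>gr M n\<^esub> y)) = f (n + 1) (dif M n x) \<oplus>\<^bsub>gr N (n + p + 1)\<^esub> f (n + 1) (dif M n y)"
      unfolding addhom_add[OF lmapD(2)[OF f refl] x y] dif_lin'(1)[OF N refl fc[OF x refl] fc[OF y refl]]
        dif_lin'(1)[OF M refl x y] by (rule refl) (rule addhom_add[OF lmapD(2)[OF f] dx dy], simp)
    show "hom_d p M N f n (x \<oplus>\<^bsub>gr M n\<^esub> y) = hom_d p M N f n x \<oplus>\<^bsub>gr N (n + (p + 1))\<^esub> hom_d p M N f n y"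
      unfolding i hom_d_def e using c1 c2
      by (intro lc[of "n + p + 1"]) (rule li | assumption | simp; fail | simp add: algebra_simps; fail)+ }
  fix q a assume a: "a \<in> carrier (gr At q)"
  have da: "dif At q a \<in> carrier (gr At (q + 1))" by (rule dif_closed[OF a refl])
  define G where "G = gr N (q + n + p + 1)"
  define A where "A = act N (q + 1) (n + p) (dif At q a) (f n x)"
  define B where "B = act N q (n + p + 1) a (dif N (n + p) (f n x))"
  define E where "E = act N q (n + p + 1) a (f (n + 1) (dif M n x))"
  have c: "A \<in> carrier G" "B \<in> carrier G" "E \<in> carrier G"
    unfolding A_def B_def E_def G_def by (auto intro!: N.M.act_closed a da fc x dif_cl[OF N] c1)
  have ax: "act M q n a x \<in> carrier (gr M (q + n))" by (rule M.M.act_closed[OF a x refl])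
  have afx: "act N q (n + p) a (f n x) \<in> carrier (gr N (q + n + p))" by (rule N.M.act_closed[OF a fc[OF x refl]]) simp
  have 1: "dif N (q + n + p) (f (q + n) (act M q n a x)) = psgn G (p * q) (A \<oplus>\<^bsub>G\<^esub> psgn G q B)"
    unfolding lmapD(3)[OF f a x refl refl refl] G_def A_def B_def
    by (subst addhom_psgn[OF N.M.dif_hom[OF refl] afx], subst N.M.dif_act'[OF a fc[OF x refl]]) (auto simp: algebra_simps)
  have k1: "act M (q + 1) n (dif At q a) x \<in> carrier (gr M (q + n + 1))" by (rule M.M.act_closed[OF da x]) simp
  have k2: "act M q (n + 1) a (dif M n x) \<in> carrier (gr M (q + n + 1))" by (rule M.M.act_closed[OF a dx]) simp
  have fh: "addhom (gr M (q + n + 1)) G (f (q + n + 1))" unfolding G_def by (rule lmapD(2)[OF f]) simp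
  have "f (q + n + 1) (dif M (q + n) (act M q n a x)) = f (q + n + 1) (act M (q + 1) n (dif At q a) x) \<oplus>\<^bsub>G\<^esub>
     psgn G q (f (q + n + 1) (act M q (n + 1) a (dif M n x)))"
    unfolding M.M.dif_act[OF a x] using k1 k2 md_psgn_closed[OF M]
    by (simp add: addhom_add[OF fh] addhom_psgn[OF fh])
  also have "f (q + n + 1) (act M (q + 1) n (dif At q a) x) = psgn G (p * (q + 1)) A"
    unfolding G_def A_def by (rule lmapD(3)[OF f da x]) simp_all
  also have "f (q + n + 1) (act M q (n + 1) a (dif M n x)) = psgn G (p * q) E"
    unfolding G_def E_def by (rule lmapD(3)[OF f a dx]) simp_all
  finally have 2: "f (q + n + 1) (dif M (q + n) (act M q n a x)) = psgn G (p * (q + 1)) A \<oplus>\<^bsub>G\<^esub> psgn G q (psgn G (p * q) E)" .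
  have ah: "addhom (gr N (n + p + 1)) G (act N q (n + p + 1) a)" unfolding G_def by (rule N.M.act_hom[OF a]) simp
  have 3: "act N q (n + (p + 1)) a (hom_d p M N f n x) = B \<ominus>\<^bsub>G\<^esub> psgn G p E"
    unfolding i hom_d_def B_def E_def using c1 by (simp add: addhom_minus[OF ah] addhom_psgn[OF ah] md_psgn_closed[OF N])
  have G: "abelian_group G" unfolding G_def by (rule md_ab[OF N])
  have g: "gr N (q + n + (p + 1)) = G" unfolding G_def by (simp add: algebra_simps)
  show "hom_d p M N f (q + n) (act M q n a x) = psgn (gr N (q + n + (p + 1))) ((p + 1) * q) (act N q (n + (p + 1)) a (hom_d p M N f n x))"
    unfolding 3 g unfolding hom_d_def 1 2 G_def[symmetric] using c
    by (intro abelian_group.lincomb_unique[OF G])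
      (rule abelian_group.lincomb_intros[OF G] | assumption | simp; fail | simp add: algebra_simps; fail)+
qed

lemma null_map_hom_d:
  assumes "lmap (- 1) M N h" "x \<in> carrier (gr M n)"
  shows "hom_d (- 1) M N h n x = null_map M N h n x"
proof -
  have "h (n + 1) (dif M n x) \<in> carrier (gr N n)" by (rule lmapD(1)[OF assms(1) dif_cl[OF M assms(2) refl]]) simp
  then show ?thesis using md_minus_minus[OF N] by (simp add: hom_d_def null_map_def psgn_def a_minus_def)
qed

text \<open>As \<open>d^2\<close> need not be zero, closedness is not formal. It rests on
  \<open>h\<close> commuting with the curvature, whose even degree gives no sign.\<close>

lemma null_map_cmap:
  assumes h: "lmap (- 1) M N h"
  shows "cmap M N (null_map M N h)"
  unfolding lmap_0_cmap
proof (intro conjI allI ballI)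
  show "lmap 0 M N (null_map M N h)"
    using lmap_hom_d[OF h] null_map_hom_d[OF h] M.M.act_closed[OF _ _ refl] unfolding lmap_def by (simp add: add_cl[OF M])
  fix n x assume x: "x \<in> carrier (gr M n)"
  have j: "1 + n = n + 1" "2 + n = n + 2" "n + 1 + 1 = n + 2" "n - 1 + 1 = n" "n + 1 - 1 = n" by simp_all
  have hc: "y \<in> carrier (gr M m) \<Longrightarrow> m' = m - 1 \<Longrightarrow> h m y \<in> carrier (gr N m')" for y m m'
    by (rule lmapD(1)[OF h]) simp_all
  have e: "h (n + 2) (dif M (n + 1) (dif M n x)) = dif N n (dif N (n - 1) (h n x))"
  proof -
    have "dif M (n + 1) (dif M n x) = act M 2 n (curv At) x" using M.dif_dif_module[OF x] .
    also have "h (n + 2) \<dots> = act N 2 (n - 1) (curv At) (h n x)"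
      using lmapD(3)[OF h curv_closed x, of "n + 2" "n - 1" "n + 1"] by (simp add: psgn_def)
    also have "\<dots> = dif N n (dif N (n - 1) (h n x))" using N.dif_dif_module[of "h n x" "n - 1"] hc[OF x refl] by simp
    finally show ?thesis .
  qed
  have c: "dif M n x \<in> carrier (gr M (n + 1))" "h n x \<in> carrier (gr N (n - 1))" "h (n + 1) (dif M n x) \<in> carrier (gr N n)"
    by (auto intro!: hc dif_cl[OF M] x)
  have d: "dif N (n - 1) (h n x) \<in> carrier (gr N n)" by (rule dif_cl[OF N c(2)]) simp
  have c': "dif N n (h (n + 1) (dif M n x)) \<in> carrier (gr N (n + 1))" "dif N n (dif N (n - 1) (h n x)) \<in> carrier (gr N (n + 1))"
    by (rule dif_cl[OF N c(3) refl], rule dif_cl[OF N d refl])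
  show "null_map M N h (n + 1) (dif M n x) = dif N n (null_map M N h n x)"
    unfolding null_map_def j e dif_lin'(1)[OF N refl d c(3)]
    using c' by (intro lincomb_unique'[OF N, of "n + 1"]) (rule md_lincomb_intros[OF N] | assumption | simp; fail)+
qed

lemma cmap_add: assumes "cmap M N f" "cmap M N g" shows "cmap M N (\<lambda>n x. f n x \<oplus>\<^bsub>gr N n\<^esub> g n x)"
  using lmap_add[of 0 f g] assms unfolding lmap_0_cmap
  by (auto simp: dif_lin'(1)[OF N refl] lmapD(1)[where p=0])

lemma cmap_neg: assumes "cmap M N f" shows "cmap M N (\<lambda>n x. \<ominus>\<^bsub>gr N n\<^esub> f n x)"
  using lmap_neg[of 0 f] assms unfolding lmap_0_cmap
  by (auto simp: dif_lin'(2)[OF N refl] lmapD(1)[where p=0])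

lemma cmap_zero: "cmap M N (\<lambda>n x. \<zero>\<^bsub>gr N n\<^esub>)"
  using lmap_zero[of 0] unfolding lmap_0_cmap
  by (auto simp: dif_lin'(4)[OF N refl])

lemma null_map_add:
  assumes "lmap (- 1) M N h" "lmap (- 1) M N h'" "x \<in> carrier (gr M n)"
  shows "null_map M N (\<lambda>n x. h n x \<oplus>\<^bsub>gr N (n + - 1)\<^esub> h' n x) n x = null_map M N h n x \<oplus>\<^bsub>gr N n\<^esub> null_map M N h' n x"
proof -
  have c: "h n x \<in> carrier (gr N (n - 1))" "h' n x \<in> carrier (gr N (n - 1))"
    "h (n + 1) (dif M n x) \<in> carrier (gr N n)" "h' (n + 1) (dif M n x) \<in> carrier (gr N n)"
    using assms by (auto intro!: lmapD(1)[where p="- 1"] dif_cl[OF M])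
  have j: "n + 1 + - 1 = n" "n + - 1 = n - 1" by simp_all
  have d: "dif N (n - 1) (h n x) \<in> carrier (gr N n)" "dif N (n - 1) (h' n x) \<in> carrier (gr N n)" using c by (auto intro!: dif_cl[OF N])
  have e: "dif N (n - 1) (h n x \<oplus>\<^bsub>gr N (n - 1)\<^esub> h' n x) = dif N (n - 1) (h n x) \<oplus>\<^bsub>gr N n\<^esub> dif N (n - 1) (h' n x)"
    by (rule dif_lin'(1)[OF N _ c(1,2)]) simp
  show ?thesis unfolding null_map_def j e
    using c d by (intro lincomb_unique'[OF N, of n]) (rule md_lincomb_intros[OF N] | assumption | simp; fail)+
qed

lemma null_map_neg:
  assumes "lmap (- 1) M N h" "x \<in> carrier (gr M n)"
  shows "null_map M N (\<lambda>n x. \<ominus>\<^bsub>gr N (n + - 1)\<^esub> h n x) n x = \<ominus>\<^bsub>gr N n\<^esub> null_map M N h n x"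
proof -
  have c: "h n x \<in> carrier (gr N (n - 1))" "h (n + 1) (dif M n x) \<in> carrier (gr N n)"
    using assms by (auto intro!: lmapD(1)[where p="- 1"] dif_cl[OF M])
  have j: "n + 1 + - 1 = n" "n + - 1 = n - 1" by simp_all
  have d: "dif N (n - 1) (h n x) \<in> carrier (gr N n)" using c by (auto intro!: dif_cl[OF N])
  have e: "dif N (n - 1) (\<ominus>\<^bsub>gr N (n - 1)\<^esub> h n x) = \<ominus>\<^bsub>gr N n\<^esub> dif N (n - 1) (h n x)"
    by (rule dif_lin'(2)[OF N _ c(1)]) simp
  show ?thesis unfolding null_map_def j e
    using c d by (intro lincomb_unique'[OF N, of n]) (rule md_lincomb_intros[OF N] | assumption | simp; fail)+
qed

lemma null_map_zero: "null_map M N (\<lambda>n x. \<zero>\<^bsub>gr N (n + - 1)\<^esub>) n x = \<zero>\<^bsub>gr N n\<^esub>"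
  using dif_lin'(4)[OF N, where n=n and m="n - 1"] md_l_zero[OF N] zero_cl[OF N]
  by (simp add: null_map_def)

text \<open>The homotopy supplies the witness: \<open>h x\<close> and \<open>h y\<close> bound the
  difference, because \<open>h\<close> commutes with \<open>t\<close> and \<open>ct\<close> and the
  pair satisfies the cycle equations.\<close>

lemma homotopic_EB:
  assumes f: "cmap M N f" and g: "cmap M N g" and h: "homotopic M N f g" and z: "z \<in> EZ i m M"
  shows "Ef f m z \<ominus>\<^bsub>EG N m\<^esub> Ef g m z \<in> EB i m N"
proof -
  obtain h where h: "lmap (- 1) M N h" "\<And>n x. x \<in> carrier (gr M n) \<Longrightarrow> f n x = g n x \<oplus>\<^bsub>gr N n\<^esub> null_map M N h n x"
    using h by (auto simp: homotopic_def)
  obtain x y where xy: "z = (x, y)" by (cases z)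
  have x: "x \<in> K M (Suc i) (m + 1)" "y \<in> K M i m" "dif M (m + 1) x = cta M m y" "dif M m y = tm M (m + 1) x"
    using z by (auto simp: EZ_def cyc_def xy)
  note c = x(1,2)[THEN K_carr]
  have hK: "h (m + 1) x \<in> K N (Suc i) m" "h m y \<in> K N i (m - 1)"
    by (rule lmap_K[OF h(1) x(1)], simp, rule lmap_K[OF h(1) x(2)], simp)
  have j: "m + 1 - 1 = m" "m + 1 + 1 = m + 2" by simp_all
  have "h (m + 2) (cta M m y) = cta N (m - 1) (h m y)"
    using lmapD(3)[OF h(1) ct_closed c(2), of "m + 2" "m - 1" "m + 1"] by (simp add: psgn_def)
  then have 1: "null_map M N h (m + 1) x = dif N m (h (m + 1) x) \<oplus>\<^bsub>gr N (m + 1)\<^esub> cta N (m - 1) (h m y)"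
    unfolding null_map_def j x(3) by simp
  have "h (m + 1) (tm M (m + 1) x) = tm N m (h (m + 1) x)" by (rule lmap_smult[OF h(1) tvar_closed c(1)]) simp
  then have 2: "null_map M N h m y = dif N (m - 1) (h m y) \<oplus>\<^bsub>gr N m\<^esub> tm N m (h (m + 1) x)"
    unfolding null_map_def x(4) by simp
  note cc = cmap_cl[OF M N f] cmap_cl[OF M N g] cmap_cl[OF M N null_map_cmap[OF h(1)]]
  have s: "f n v \<ominus>\<^bsub>gr N n\<^esub> g n v = null_map M N h n v" if "v \<in> carrier (gr M n)" for n v
    unfolding h(2)[OF that] using cc(2,3)[OF that]
    by (intro lincomb_unique'[OF N, of n]) (rule md_lincomb_intros[OF N] | assumption | simp; fail)+
  have "Ef f m z \<ominus>\<^bsub>EG N m\<^esub> Ef g m z = (f (m + 1) x \<ominus>\<^bsub>gr N (m + 1)\<^esub> g (m + 1) x, f m y \<ominus>\<^bsub>gr N m\<^esub> g m y)"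
    unfolding xy Ef_def prod.case using EG_minus[OF N] cc c by simp
  also have "\<dots> \<in> EB i m N" unfolding s[OF c(1)] s[OF c(2)] 1 2 EB_def bdr_def mem_Collect_eq prod.case
    using hK by blast
  finally show ?thesis .
qed

lemma homotopic_sym: assumes f: "cmap M N f" and g: "cmap M N g" and h: "homotopic M N f g" shows "homotopic M N g f"
proof -
  obtain h where h: "lmap (- 1) M N h" "\<And>n x. x \<in> carrier (gr M n) \<Longrightarrow> f n x = g n x \<oplus>\<^bsub>gr N n\<^esub> null_map M N h n x"
    using h by (auto simp: homotopic_def)
  have "g n x = f n x \<oplus>\<^bsub>gr N n\<^esub> \<ominus>\<^bsub>gr N n\<^esub> null_map M N h n x" if x: "x \<in> carrier (gr M n)" for n x
    unfolding h(2)[OF x] using cmap_cl[OF M N g x] cmap_cl[OF M N null_map_cmap[OF h(1)] x]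
    by (intro lincomb_unique'[OF N, of n]) (rule md_lincomb_intros[OF N] | assumption | simp; fail)+
  then show ?thesis unfolding homotopic_def using lmap_neg[OF h(1)] null_map_neg[OF h(1)]
    by (intro exI[of _ "\<lambda>n x. \<ominus>\<^bsub>gr N (n + - 1)\<^esub> h n x"] conjI allI ballI) simp_all
qed

lemma homotopic_trans:
  assumes f: "cmap M N f" and g: "cmap M N g" and g': "cmap M N g'" and h: "homotopic M N f g" "homotopic M N g g'"
  shows "homotopic M N f g'"
proof -
  obtain h where h: "lmap (- 1) M N h" "\<And>n x. x \<in> carrier (gr M n) \<Longrightarrow> f n x = g n x \<oplus>\<^bsub>gr N n\<^esub> null_map M N h n x"
    using h by (auto simp: homotopic_def)
  obtain h' where h': "lmap (- 1) M N h'" "\<And>n x. x \<in> carrier (gr M n) \<Longrightarrow> g n x = g' n x \<oplus>\<^bsub>gr N n\<^esub> null_map M N h' n x"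
    using assms(5) by (auto simp: homotopic_def)
  have "f n x = g' n x \<oplus>\<^bsub>gr N n\<^esub> (null_map M N h n x \<oplus>\<^bsub>gr N n\<^esub> null_map M N h' n x)" if x: "x \<in> carrier (gr M n)" for n x
    unfolding h(2)[OF x] h'(2)[OF x]
    using cmap_cl[OF M N g' x] cmap_cl[OF M N null_map_cmap[OF h(1)] x] cmap_cl[OF M N null_map_cmap[OF h'(1)] x]
    by (intro lincomb_unique'[OF N, of n]) (rule md_lincomb_intros[OF N] | assumption | simp; fail)+
  then show ?thesis unfolding homotopic_def using lmap_add[OF h(1) h'(1)] null_map_add[OF h(1) h'(1)]
    by (intro exI[of _ "\<lambda>n x. h n x \<oplus>\<^bsub>gr N (n + - 1)\<^esub> h' n x"] conjI allI ballI) simp_all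
qed

lemma qi_homotopic:
  assumes f: "cmap M N f" and g: "cmap M N g" and h: "homotopic M N f g" and q: "qi M N g"
  shows "qi M N f"
  unfolding qi_iff[OF M N f]
proof (intro allI conjI ballI impI)
  note qg = q[unfolded qi_iff[OF M N g]] and hs = homotopic_sym[OF f g h]
  fix i m z
  { assume z: "z \<in> EZ i m N"
    obtain w where w: "w \<in> EZ i m M" "z \<ominus>\<^bsub>EG N m\<^esub> Ef g m w \<in> EB i m N" using qg z by blast
    show "\<exists>w\<in>EZ i m M. z \<ominus>\<^bsub>EG N m\<^esub> Ef f m w \<in> EB i m N"
      using EB_trans[OF N w(2) homotopic_EB[OF g f hs w(1)] z] w Ef_EZ[OF M N f] Ef_EZ[OF M N g] by blast }
  { assume z: "z \<in> EZ i m M" "Ef f m z \<in> EB i m N"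
    then have "Ef g m z \<in> EB i m N" using EB_diff[OF N homotopic_EB[OF f g h z(1)]] Ef_EZ[OF M N f z(1)] Ef_EZ[OF M N g z(1)] by blast
    then show "z \<in> EB i m M" using qg z by blast }
qed

end

context
  fixes L :: "('k, 'a, 'l) tmod" and M :: "('k, 'a, 'm) tmod" and N :: "('k, 'a, 'n) tmod"
  assumes L: "md L" and M: "md M" and N: "md N"
begin

lemma homotopic_post:
  assumes f: "cmap L M f" and f': "cmap L M f'" and g: "cmap M N g" and h: "homotopic L M f f'"
  shows "homotopic L N (\<lambda>n x. g n (f n x)) (\<lambda>n x. g n (f' n x))"
proof -
  obtain h where h: "lmap (- 1) L M h" "\<And>n x. x \<in> carrier (gr L n) \<Longrightarrow> f n x = f' n x \<oplus>\<^bsub>gr M n\<^esub> null_map L M h n x"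
    using h by (auto simp: homotopic_def)
  have gh: "addhom (gr M n) (gr N n) (g n)" for n by (rule cmap_hom[OF M N g])
  have hc: "x \<in> carrier (gr L n) \<Longrightarrow> h n x \<in> carrier (gr M (n - 1))" for n x by (rule lmapD(1)[OF L M h(1)]) simp_all
  have l: "lmap (- 1) L N (\<lambda>n x. g (n - 1) (h n x))"
    unfolding lmap_def
  proof (intro conjI allI ballI)
    fix n x assume x: "x \<in> carrier (gr L n)"
    show "g (n - 1) (h n x) \<in> carrier (gr N (n + - 1))" using cmap_cl[OF M N g hc[OF x]] by simp
    { fix y assume "y \<in> carrier (gr L n)"
      then show "g (n - 1) (h n (x \<oplus>\<^bsub>gr L n\<^esub> y)) = g (n - 1) (h n x) \<oplus>\<^bsub>gr N (n + - 1)\<^esub> g (n - 1) (h n y)"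
        using addhom_add[OF lmapD(2)[OF L M h(1)], of "n - 1" n x y] addhom_add[OF gh hc hc, of x n y] x by simp }
    fix q a assume a: "a \<in> carrier (gr At q)"
    have M': "graded_module_derivation (pser k) At M" by (rule md_gmd[OF M])
    have "h (q + n) (act L q n a x) = psgn (gr M (q + n - 1)) (- 1 * q) (act M q (n - 1) a (h n x))"
      by (rule lmapD(3)[OF L M h(1) a x]) simp_all
    moreover have "act M q (n - 1) a (h n x) \<in> carrier (gr M (q + n - 1))"
      by (rule graded_module_derivation.act_closed[OF M' a hc[OF x]]) simp
    ultimately show "g (q + n - 1) (h (q + n) (act L q n a x)) = psgn (gr N (q + n + - 1)) (- 1 * q) (act N q (n + - 1) a (g (n - 1) (h n x)))"
      using addhom_psgn[OF gh] cmap_act[OF M N g a hc[OF x], of "q + n - 1"] by simp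
  qed
  have "null_map L N (\<lambda>n x. g (n - 1) (h n x)) n x = g n (null_map L M h n x)" if x: "x \<in> carrier (gr L n)" for n x
  proof -
    have c: "h (n + 1) (dif L n x) \<in> carrier (gr M n)" using hc[OF dif_cl[OF L x refl]] by simp
    have c': "dif M (n - 1) (h n x) \<in> carrier (gr M n)" by (rule dif_cl[OF M hc[OF x]]) simp
    have "g n (dif M (n - 1) (h n x)) = dif N (n - 1) (g (n - 1) (h n x))" by (rule cmap_dif[OF M N g hc[OF x]]) simp
    then show ?thesis using addhom_add[OF gh c' c] by (simp add: null_map_def)
  qed
  then show ?thesis unfolding homotopic_def
    using l h(2) addhom_add[OF gh] cmap_cl[OF L M f'] cmap_cl[OF L M null_map_cmap[OF L M h(1)]]
    by (intro exI[of _ "\<lambda>n x. g (n - 1) (h n x)"] conjI allI ballI) simp_all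
qed

lemma homotopic_pre:
  assumes f: "cmap L M f" and g: "cmap M N g" and g': "cmap M N g'" and h: "homotopic M N g g'"
  shows "homotopic L N (\<lambda>n x. g n (f n x)) (\<lambda>n x. g' n (f n x))"
proof -
  obtain h where h: "lmap (- 1) M N h" "\<And>n x. x \<in> carrier (gr M n) \<Longrightarrow> g n x = g' n x \<oplus>\<^bsub>gr N n\<^esub> null_map M N h n x"
    using h by (auto simp: homotopic_def)
  have l: "lmap (- 1) L N (\<lambda>n x. h n (f n x))"
    using h(1) f unfolding lmap_def cmap_def by simp
  have "null_map L N (\<lambda>n x. h n (f n x)) n x = null_map M N h n (f n x)" if x: "x \<in> carrier (gr L n)" for n x
    using cmap_dif[OF L M f x refl] by (simp add: null_map_def)
  then show ?thesis unfolding homotopic_def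
    using l h(2) cmap_cl[OF L M f]
    by (intro exI[of _ "\<lambda>n x. h n (f n x)"] conjI allI ballI) simp_all
qed

lemma homotopic_comp:
  assumes "cmap L M f" "cmap L M f'" "cmap M N g" "cmap M N g'" "homotopic L M f f'" "homotopic M N g g'"
  shows "homotopic L N (\<lambda>n x. g n (f n x)) (\<lambda>n x. g' n (f' n x))"
  using homotopic_trans[OF L N cmap_comp[OF L M N assms(1,3)] cmap_comp[OF L M N assms(2,3)] cmap_comp[OF L M N assms(2,4)]
      homotopic_post[OF assms(1-3,5)] homotopic_pre[OF assms(2-4,6)]] .

end

end

section \<open>Homotopy classes as morphisms of the homotopy category\<close>

context tors
begin

definition rs where "rs M f = (\<lambda>n. restrict (f n) (carrier (gr M n)))"

text \<open>Morphisms of the homotopy category are cosets of extensional maps; restricting first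
  allows a class to be named by any closed map.\<close>

definition hclass where "hclass M N f = exact_maps At M N #>\<^bsub>closed_maps At M N\<^esub> rs M f"

context
  fixes M :: "('k, 'a, 'm) tmod" and N :: "('k, 'a, 'n) tmod"
  assumes M: "md M" and N: "md N"
begin

interpretation M: cdg_module "pser k" At M by (rule M)

lemma lmap_cong:
  assumes f: "lmap p M N f" and e: "\<And>n x. x \<in> carrier (gr M n) \<Longrightarrow> g n x = f n x"
  shows "lmap p M N g"
  using f M.M.act_closed[OF _ _ refl] unfolding lmap_def by (simp add: e add_cl[OF M])

lemma cmap_cong:
  assumes f: "cmap M N f" and e: "\<And>n x. x \<in> carrier (gr M n) \<Longrightarrow> g n x = f n x"
  shows "cmap M N g"
  using f M.M.act_closed[OF _ _ refl] dif_cl[OF M _ refl] unfolding cmap_def by (simp add: e add_cl[OF M])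

lemma null_map_cong:
  assumes "\<And>n x. x \<in> carrier (gr M n) \<Longrightarrow> h n x = h' n x" "x \<in> carrier (gr M n)"
  shows "null_map M N h n x = null_map M N h' n x"
  using assms dif_cl[OF M assms(2) refl] by (simp add: null_map_def)

lemma rs_cmap: "cmap M N f \<Longrightarrow> cmap M N (rs M f)"
  by (erule cmap_cong) (simp add: rs_def)

text \<open>In degree zero graded linearity has no signs, and vanishing of \<open>hom_dif\<close>
  unfolds to \<open>d f = f d\<close>.\<close>

lemma closed_iff: "f \<in> carrier (closed_maps At M N) \<longleftrightarrow> cmap M N f \<and> (\<forall>n. f n \<in> extensional (carrier (gr M n)))"
proof -
  have "hom_dif M N 0 f = \<one>\<^bsub>hom_complex At M N 1\<^esub> \<longleftrightarrow> (\<forall>n. \<forall>x\<in>carrier (gr M n). f (n + 1) (dif M n x) = dif N n (f n x))"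
    if f: "lmap 0 M N f"
  proof -
    have "hom_dif M N 0 f = \<one>\<^bsub>hom_complex At M N 1\<^esub> \<longleftrightarrow> (\<forall>n. \<forall>x\<in>carrier (gr M n).
       dif N n (f n x) \<ominus>\<^bsub>gr N (n + 1)\<^esub> f (n + 1) (dif M n x) = \<zero>\<^bsub>gr N (n + 1)\<^esub>)"
      unfolding hom_dif_def hom_complex_def by (simp add: fun_eq_iff restrict_def psgn_def) meson
    also have "\<dots> \<longleftrightarrow> (\<forall>n. \<forall>x\<in>carrier (gr M n). f (n + 1) (dif M n x) = dif N n (f n x))"
    proof -
      have "dif N n (f n x) \<ominus>\<^bsub>gr N (n + 1)\<^esub> f (n + 1) (dif M n x) = \<zero>\<^bsub>gr N (n + 1)\<^esub> \<longleftrightarrow> f (n + 1) (dif M n x) = dif N n (f n x)"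
        if x: "x \<in> carrier (gr M n)" for n x
        using md_minus_eq_zero_iff[OF N dif_cl[OF N lmapD(1)[OF M N f x, of n] refl] lmapD(1)[OF M N f dif_cl[OF M x refl], of "n + 1"]]
        by auto
      then show ?thesis by simp
    qed
    finally show ?thesis .
  qed
  moreover have "f \<in> carrier (hom_complex At M N 0) \<longleftrightarrow> lmap 0 M N f \<and> (\<forall>n. f n \<in> extensional (carrier (gr M n)))"
    unfolding hom_complex_def lmap_def by (auto simp: hom_def)
  ultimately show ?thesis unfolding closed_maps_def lmap_0_cmap[OF M N] by auto
qed

lemma rs_closed: "cmap M N f \<Longrightarrow> rs M f \<in> carrier (closed_maps At M N)"
  unfolding closed_iff by (simp add: rs_cmap) (simp add: rs_def)

lemma rs_id: "f \<in> carrier (closed_maps At M N) \<Longrightarrow> rs M f = f"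
  unfolding closed_iff rs_def by (auto simp: fun_eq_iff restrict_def extensional_def)

lemma closed_mult: "f \<otimes>\<^bsub>closed_maps At M N\<^esub> g = rs M (\<lambda>n x. f n x \<oplus>\<^bsub>gr N n\<^esub> g n x)"
  by (simp add: closed_maps_def hom_complex_def rs_def)

lemma closed_one: "\<one>\<^bsub>closed_maps At M N\<^esub> = rs M (\<lambda>n x. \<zero>\<^bsub>gr N n\<^esub>)"
  by (simp add: closed_maps_def hom_complex_def rs_def)

lemma exact_iff: "g \<in> exact_maps At M N \<longleftrightarrow> (\<exists>h. lmap (- 1) M N h \<and> g = rs M (null_map M N h))"
proof -
  have c: "h \<in> carrier (hom_complex At M N (- 1)) \<longleftrightarrow> lmap (- 1) M N h \<and> (\<forall>n. h n \<in> extensional (carrier (gr M n)))" for h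
    unfolding hom_complex_def lmap_def by (auto simp: hom_def)
  have d: "hom_dif M N (- 1) h = rs M (null_map M N h)" if "lmap (- 1) M N h" for h
  proof -
    have "hom_dif M N (- 1) h = rs M (hom_d (- 1) M N h)" by (auto simp: hom_dif_def rs_def hom_d_def fun_eq_iff restrict_def)
    then show ?thesis using null_map_hom_d[OF M N that] by (auto simp: rs_def fun_eq_iff restrict_def)
  qed
  \<comment> \<open>Restricting a homotopy to the components does not alter the null-homotopic map
    it defines, so an extensional witness can be had.\<close>
  have r: "lmap (- 1) M N (rs M h)" "rs M (null_map M N (rs M h)) = rs M (null_map M N h)" if "lmap (- 1) M N h" for h
  proof -
    show "lmap (- 1) M N (rs M h)" by (rule lmap_cong[OF that]) (simp add: rs_def)
    have "null_map M N (rs M h) n x = null_map M N h n x" if "x \<in> carrier (gr M n)" for n x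
      by (rule null_map_cong) (use that in \<open>simp_all add: rs_def\<close>)
    then show "rs M (null_map M N (rs M h)) = rs M (null_map M N h)" by (auto simp: rs_def fun_eq_iff restrict_def)
  qed
  show ?thesis
  proof
    assume "g \<in> exact_maps At M N"
    then show "\<exists>h. lmap (- 1) M N h \<and> g = rs M (null_map M N h)" unfolding exact_maps_def using c d by blast
  next
    assume "\<exists>h. lmap (- 1) M N h \<and> g = rs M (null_map M N h)"
    then obtain h where h: "lmap (- 1) M N h" "g = rs M (null_map M N h)" by blast
    have "rs M h \<in> carrier (hom_complex At M N (- 1))" unfolding c using r(1)[OF h(1)] by (simp add: rs_def)
    moreover have "g = hom_dif M N (- 1) (rs M h)" using d[OF r(1)[OF h(1)]] r(2)[OF h(1)] h(2) by simp
    ultimately show "g \<in> exact_maps At M N" unfolding exact_maps_def by blast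
  qed
qed

lemma rs_eqI: "(\<And>n x. x \<in> carrier (gr M n) \<Longrightarrow> f n x = g n x) \<Longrightarrow> rs M f = rs M g"
  by (auto simp: rs_def fun_eq_iff restrict_def)

lemma rs_apply [simp]: "x \<in> carrier (gr M n) \<Longrightarrow> rs M f n x = f n x"
  by (simp add: rs_def)

lemma closed_group: "comm_group (closed_maps At M N)"
proof (rule comm_groupI)
  note li = md_lincomb_intros[OF N]
  have cc: "f \<in> carrier (closed_maps At M N) \<Longrightarrow> x \<in> carrier (gr M n) \<Longrightarrow> f n x \<in> carrier (gr N n)" for f n x
    unfolding closed_iff using cmap_cl[OF M N] by blast
  show "\<one>\<^bsub>closed_maps At M N\<^esub> \<in> carrier (closed_maps At M N)"
    unfolding closed_one using rs_closed[OF cmap_zero[OF M N]] .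
  fix f assume f: "f \<in> carrier (closed_maps At M N)"
  have cf: "cmap M N f" using f by (simp add: closed_iff)
  show "\<one>\<^bsub>closed_maps At M N\<^esub> \<otimes>\<^bsub>closed_maps At M N\<^esub> f = f"
    unfolding closed_one closed_mult using md_l_zero[OF N] cc[OF f]
    by (subst rs_id[OF f, symmetric], intro rs_eqI) simp
  show "\<exists>g\<in>carrier (closed_maps At M N). g \<otimes>\<^bsub>closed_maps At M N\<^esub> f = \<one>\<^bsub>closed_maps At M N\<^esub>"
    unfolding closed_one closed_mult using md_l_neg[OF N] cc[OF f]
    by (intro bexI[OF _ rs_closed[OF cmap_neg[OF M N cf]]] rs_eqI) simp
  fix g assume g: "g \<in> carrier (closed_maps At M N)"
  have cg: "cmap M N g" using g by (simp add: closed_iff)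
  show "f \<otimes>\<^bsub>closed_maps At M N\<^esub> g \<in> carrier (closed_maps At M N)"
    unfolding closed_mult by (rule rs_closed[OF cmap_add[OF M N cf cg]])
  show "f \<otimes>\<^bsub>closed_maps At M N\<^esub> g = g \<otimes>\<^bsub>closed_maps At M N\<^esub> f"
    unfolding closed_mult
  proof (rule rs_eqI)
    fix n x assume x: "x \<in> carrier (gr M n)"
    show "f n x \<oplus>\<^bsub>gr N n\<^esub> g n x = g n x \<oplus>\<^bsub>gr N n\<^esub> f n x"
      using cc[OF f x] cc[OF g x] by (intro lincomb_unique'[OF N, of n]) (rule li | assumption | simp; fail)+
  qed
  fix h assume h: "h \<in> carrier (closed_maps At M N)"
  show "f \<otimes>\<^bsub>closed_maps At M N\<^esub> g \<otimes>\<^bsub>closed_maps At M N\<^esub> h = f \<otimes>\<^bsub>closed_maps At M N\<^esub> (g \<otimes>\<^bsub>closed_maps At M N\<^esub> h)"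
    unfolding closed_mult
  proof (rule rs_eqI)
    fix n x assume x: "x \<in> carrier (gr M n)"
    show "rs M (\<lambda>n x. f n x \<oplus>\<^bsub>gr N n\<^esub> g n x) n x \<oplus>\<^bsub>gr N n\<^esub> h n x = f n x \<oplus>\<^bsub>gr N n\<^esub> rs M (\<lambda>n x. g n x \<oplus>\<^bsub>gr N n\<^esub> h n x) n x"
      using cc[OF f x] cc[OF g x] cc[OF h x] x by (simp, intro lincomb_unique'[OF N, of n]) (rule li | assumption | simp; fail)+
  qed
qed

lemma exact_subgroup: "subgroup (exact_maps At M N) (closed_maps At M N)"
proof -
  interpret comm_group "closed_maps At M N" by (rule closed_group)
  have ec: "g \<in> carrier (closed_maps At M N)" if "g \<in> exact_maps At M N" for g
    using that rs_closed null_map_cmap[OF M N] by (auto simp: exact_iff)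
  show ?thesis
  proof (rule subgroupI)
    show "exact_maps At M N \<subseteq> carrier (closed_maps At M N)" using ec by blast
    show "exact_maps At M N \<noteq> {}" using exact_iff lmap_zero[OF M N] by blast
    fix a assume a: "a \<in> exact_maps At M N"
    then obtain h where h: "lmap (- 1) M N h" "a = rs M (null_map M N h)" by (auto simp: exact_iff)
    have ag: "comm_group (closed_maps At M N)" by (rule closed_group)
    let ?b = "rs M (null_map M N (\<lambda>n x. \<ominus>\<^bsub>gr N (n + - 1)\<^esub> h n x))"
    have b: "?b \<in> exact_maps At M N" unfolding exact_iff using lmap_neg[OF M N h(1)] by blast
    have "?b \<otimes>\<^bsub>closed_maps At M N\<^esub> a = \<one>\<^bsub>closed_maps At M N\<^esub>"
      unfolding closed_mult closed_one h(2) using null_map_neg[OF M N h(1)] cmap_cl[OF M N null_map_cmap[OF M N h(1)]]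
        md_l_neg[OF N] by (intro rs_eqI) simp
    then have "inv\<^bsub>closed_maps At M N\<^esub> a = ?b" using inv_equality ec[OF a] ec[OF b] by simp
    then show "inv\<^bsub>closed_maps At M N\<^esub> a \<in> exact_maps At M N" using b by simp
    fix a' assume "a' \<in> exact_maps At M N"
    then obtain h' where h': "lmap (- 1) M N h'" "a' = rs M (null_map M N h')" by (auto simp: exact_iff)
    have "a \<otimes>\<^bsub>closed_maps At M N\<^esub> a' = rs M (null_map M N (\<lambda>n x. h n x \<oplus>\<^bsub>gr N (n + - 1)\<^esub> h' n x))"
      unfolding closed_mult h(2) h'(2) using null_map_add[OF M N h(1) h'(1)] by (intro rs_eqI) simp
    then show "a \<otimes>\<^bsub>closed_maps At M N\<^esub> a' \<in> exact_maps At M N"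
      unfolding exact_iff using lmap_add[OF M N h(1) h'(1)] by blast
  qed
qed

lemma hclass_mem: assumes f: "cmap M N f" shows "g \<in> hclass M N f \<longleftrightarrow> g \<in> carrier (closed_maps At M N) \<and> homotopic M N g f"
proof
  assume "g \<in> hclass M N f"
  then obtain h where h: "lmap (- 1) M N h" "g = rs M (\<lambda>n x. rs M (null_map M N h) n x \<oplus>\<^bsub>gr N n\<^esub> rs M f n x)"
    by (auto simp: hclass_def r_coset_def exact_iff closed_mult)
  have "g \<in> carrier (closed_maps At M N)"
    unfolding h(2) using rs_cmap[OF null_map_cmap[OF M N h(1)]] rs_cmap[OF f] by (intro rs_closed cmap_add[OF M N])
  moreover have "homotopic M N g f"
    unfolding homotopic_def h(2) using h(1) md_a_comm[OF N]
      cmap_cl[OF M N null_map_cmap[OF M N h(1)]] cmap_cl[OF M N f] by (intro exI[of _ h]) simp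
  ultimately show "g \<in> carrier (closed_maps At M N) \<and> homotopic M N g f" ..
next
  assume g: "g \<in> carrier (closed_maps At M N) \<and> homotopic M N g f"
  then obtain h where h: "lmap (- 1) M N h" "\<And>n x. x \<in> carrier (gr M n) \<Longrightarrow> g n x = f n x \<oplus>\<^bsub>gr N n\<^esub> null_map M N h n x"
    by (auto simp: homotopic_def)
  have "g = rs M g" using g rs_id by simp
  also have "\<dots> = rs M (null_map M N h) \<otimes>\<^bsub>closed_maps At M N\<^esub> rs M f"
    unfolding closed_mult using h(2) md_a_comm[OF N]
      cmap_cl[OF M N null_map_cmap[OF M N h(1)]] cmap_cl[OF M N f] by (intro rs_eqI) simp
  finally show "g \<in> hclass M N f" unfolding hclass_def r_coset_def using h(1) exact_iff by blast
qed

lemma homotopic_rs: assumes f: "cmap M N f" shows "homotopic M N (rs M f) f"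
  unfolding homotopic_def using lmap_zero[OF M N, of "- 1"] null_map_zero[OF M N] cmap_cl[OF M N f] md_r_zero[OF N]
  by (intro exI[of _ "\<lambda>n x. \<zero>\<^bsub>gr N (n + - 1)\<^esub>"] conjI allI ballI) simp_all

lemma homotopic_cong: assumes f: "cmap M N f" and e: "\<And>n x. x \<in> carrier (gr M n) \<Longrightarrow> g n x = f n x" shows "homotopic M N g f"
  unfolding homotopic_def using lmap_zero[OF M N, of "- 1"] null_map_zero[OF M N] cmap_cl[OF M N f] md_r_zero[OF N] e
  by (intro exI[of _ "\<lambda>n x. \<zero>\<^bsub>gr N (n + - 1)\<^esub>"] conjI allI ballI) simp_all

lemma hclass_eq_iff: assumes f: "cmap M N f" and g: "cmap M N g" shows "hclass M N f = hclass M N g \<longleftrightarrow> homotopic M N f g"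
proof
  assume "hclass M N f = hclass M N g"
  moreover have "rs M f \<in> hclass M N f" unfolding hclass_mem[OF f] using rs_closed[OF f] homotopic_rs[OF f] by blast
  ultimately have "homotopic M N (rs M f) g" using hclass_mem[OF g] by blast
  then show "homotopic M N f g" using homotopic_trans[OF M N f rs_cmap[OF f] g homotopic_sym[OF M N rs_cmap[OF f] f homotopic_rs[OF f]]] by blast
next
  assume h: "homotopic M N f g"
  have "x \<in> hclass M N f \<longleftrightarrow> x \<in> hclass M N g" for x
    unfolding hclass_mem[OF f] hclass_mem[OF g] closed_iff
    using homotopic_trans[OF M N _ f g _ h] homotopic_trans[OF M N _ g f _ homotopic_sym[OF M N f g h]] by blast
  then show "hclass M N f = hclass M N g" by blast
qed

lemma hclass_cong: assumes f: "cmap M N f" and e: "\<And>n x. x \<in> carrier (gr M n) \<Longrightarrow> g n x = f n x" shows "hclass M N g = hclass M N f"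
  using hclass_eq_iff[OF cmap_cong[OF f e] f] homotopic_cong[OF f e] by simp

lemma Mod_carrier: "carrier (closed_maps At M N Mod exact_maps At M N) = hclass M N ` {f. cmap M N f}"
proof -
  have "carrier (closed_maps At M N Mod exact_maps At M N) = {exact_maps At M N #>\<^bsub>closed_maps At M N\<^esub> f |f. f \<in> carrier (closed_maps At M N)}"
    by (auto simp: FactGroup_def RCOSETS_def)
  also have "\<dots> = hclass M N ` {f. cmap M N f}"
  proof
    show "{exact_maps At M N #>\<^bsub>closed_maps At M N\<^esub> f |f. f \<in> carrier (closed_maps At M N)} \<subseteq> hclass M N ` {f. cmap M N f}"
    proof safe
      fix f assume f: "f \<in> carrier (closed_maps At M N)"
      then have "exact_maps At M N #>\<^bsub>closed_maps At M N\<^esub> f = hclass M N f" by (simp add: hclass_def rs_id)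
      then show "exact_maps At M N #>\<^bsub>closed_maps At M N\<^esub> f \<in> hclass M N ` {f. cmap M N f}"
        using f closed_iff by blast
    qed
  qed (use rs_closed in \<open>auto simp: hclass_def\<close>)
  finally show ?thesis .
qed

lemma Mod_one: "\<one>\<^bsub>closed_maps At M N Mod exact_maps At M N\<^esub> = hclass M N (\<lambda>n x. \<zero>\<^bsub>gr N n\<^esub>)"
  using group.coset_mult_one[of "closed_maps At M N" "exact_maps At M N"] comm_group.axioms(2)[OF closed_group]
    subgroup.subset[OF exact_subgroup] by (simp add: hclass_def closed_one[symmetric] FactGroup_def)

lemma Mod_mult: assumes f: "cmap M N f" and g: "cmap M N g"
  shows "hclass M N f \<otimes>\<^bsub>closed_maps At M N Mod exact_maps At M N\<^esub> hclass M N g = hclass M N (\<lambda>n x. f n x \<oplus>\<^bsub>gr N n\<^esub> g n x)"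
proof -
  have n: "exact_maps At M N \<lhd> closed_maps At M N"
    using comm_group.subgroup_imp_normal[OF closed_group exact_subgroup] .
  have "hclass M N f \<otimes>\<^bsub>closed_maps At M N Mod exact_maps At M N\<^esub> hclass M N g =
    exact_maps At M N #>\<^bsub>closed_maps At M N\<^esub> (rs M f \<otimes>\<^bsub>closed_maps At M N\<^esub> rs M g)"
    using normal.rcos_sum[OF n rs_closed[OF f] rs_closed[OF g]] by (simp add: hclass_def FactGroup_def)
  also have "rs M f \<otimes>\<^bsub>closed_maps At M N\<^esub> rs M g = rs M (\<lambda>n x. f n x \<oplus>\<^bsub>gr N n\<^esub> g n x)"
    unfolding closed_mult by (intro rs_eqI) simp
  finally show ?thesis by (simp add: hclass_def)
qed

lemma Mod_group: "comm_group (closed_maps At M N Mod exact_maps At M N)"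
  using comm_group.abelian_FactGroup[OF closed_group exact_subgroup] .

end

text \<open>\<open>Comp\<close> is a union over representatives of both classes. Homotopies are
  preserved by composition on either side, so all of them contribute one class.\<close>

lemma Hot_Comp:
  assumes L: "md L" and M: "md M" and N: "md N" and f: "cmap L M f" and g: "cmap M N g"
  shows "Comp (Hot_tor k At) L M N (hclass M N g) (hclass L M f) = hclass L N (\<lambda>n x. g n (f n x))"
proof -
  have "exact_maps At L N #>\<^bsub>closed_maps At L N\<^esub> (\<lambda>n. compose (carrier (gr L n)) (g' n) (f' n)) = hclass L N (\<lambda>n x. g n (f n x))"
    if "g' \<in> hclass M N g" "f' \<in> hclass L M f" for g' f'
  proof -
    have g': "cmap M N g'" "homotopic M N g' g" using that(1) hclass_mem[OF M N g] closed_iff[OF M N] by auto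
    have f': "cmap L M f'" "homotopic L M f' f" using that(2) hclass_mem[OF L M f] closed_iff[OF L M] by auto
    have "exact_maps At L N #>\<^bsub>closed_maps At L N\<^esub> (\<lambda>n. compose (carrier (gr L n)) (g' n) (f' n)) = hclass L N (\<lambda>n x. g' n (f' n x))"
      by (simp add: hclass_def rs_def compose_def)
    also have "\<dots> = hclass L N (\<lambda>n x. g n (f n x))"
      using hclass_eq_iff[OF L N cmap_comp[OF L M N f'(1) g'(1)] cmap_comp[OF L M N f g]]
        homotopic_comp[OF L M N f'(1) f g'(1) g f'(2) g'(2)] by simp
    finally show ?thesis .
  qed
  moreover have "rs M g \<in> hclass M N g" "rs L f \<in> hclass L M f"
    using hclass_mem[OF M N g] hclass_mem[OF L M f] rs_closed[OF M N g] rs_closed[OF L M f] homotopic_rs[OF M N g] homotopic_rs[OF L M f] by auto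
  ultimately show ?thesis unfolding Hot_tor_def by (simp, blast)
qed

text \<open>\<open>t_isos\<close> asks for some representative with \<open>t\<close>-acyclic cone.
  The equivalent condition \<open>qi\<close> is homotopy invariant, so it can be tested on any
  representative.\<close>

lemma t_isos_iff:
  assumes M: "md M" and N: "md N" and f: "cmap M N f"
  shows "hclass M N f \<in> t_isos k At M N \<longleftrightarrow> qi M N f"
proof
  assume "hclass M N f \<in> t_isos k At M N"
  then obtain g where g: "g \<in> hclass M N f" "t_acyclic k (cone M N g)" by (auto simp: t_isos_def)
  then have g': "cmap M N g" "homotopic M N g f" using hclass_mem[OF M N f] closed_iff[OF M N] by auto
  then have "qi M N g" using qi_iff_t_acyclic_cone[OF M N] g by blast
  then show "qi M N f" using qi_homotopic[OF M N f g'(1) homotopic_sym[OF M N g'(1) f g'(2)]] by blast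
next
  assume q: "qi M N f"
  have "qi M N (rs M f)" by (rule qi_homotopic[OF M N rs_cmap[OF M N f] f homotopic_rs[OF M N f] q])
  then have "t_acyclic k (cone M N (rs M f))" using qi_iff_t_acyclic_cone[OF M N rs_cmap[OF M N f]] by simp
  moreover have "rs M f \<in> hclass M N f" using hclass_mem[OF M N f] rs_closed[OF M N f] homotopic_rs[OF M N f] by auto
  moreover have "hclass M N f \<in> carrier (Hom (Hot_tor k At) M N)" using Mod_carrier[OF M N] f by (simp add: Hot_tor_def)
  ultimately show "hclass M N f \<in> t_isos k At M N" unfolding t_isos_def by blast
qed

lemma md_shift: assumes M: "md M" shows "md (shift l M)"
proof (rule cdg_moduleI)
  interpret M: cdg_module "pser k" At M by (rule M)
  show "cdg_algebra (pser k) At" by (rule cdg_algebra_axioms)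
  show "graded_module_derivation (pser k) At (shift l M)"
    by (rule gmd_shift[OF M.M.graded_module_derivation_axioms graded_module_derivation_axioms])
  fix n x assume "x \<in> carrier (gr (shift l M) n)"
  then have x: "x \<in> carrier (gr M (n + l))" by (simp add: shift_def)
  have d: "dif M (n + l) x \<in> carrier (gr M (n + l + 1))" by (rule dif_cl[OF M x refl])
  have d2: "dif M (n + l + 1) (dif M (n + l) x) \<in> carrier (gr M (n + l + 1 + 1))" by (rule dif_cl[OF M d refl])
  have i: "n + 1 + l = n + l + 1" "n + l + 1 + 1 = 2 + (n + l)" "2 + n + l = 2 + (n + l)" by simp_all
  show "dif (shift l M) (n + 1) (dif (shift l M) n x) = act (shift l M) 2 n (curv At) x"
    using M.dif_dif_module[OF x] d2 addhom_psgn[OF M.M.dif_hom[OF refl] d, of l]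
    by (simp add: shift_def i md_psgn_psgn[OF M] del: add_2_eq_Suc) (simp add: psgn_def)
qed

lemma torsion_shift: "torsion k M \<Longrightarrow> torsion k (shift l M)"
  by (simp add: torsion_def shift_def)

lemma qi_iso:
  assumes M: "md M" and N: "md N" and f: "cmap M N f" and g: "cmap N M g"
    and gf: "\<And>n x. x \<in> carrier (gr M n) \<Longrightarrow> g n (f n x) = x"
    and fg: "\<And>n x. x \<in> carrier (gr N n) \<Longrightarrow> f n (g n x) = x"
  shows "qi M N f"
proof -
  have 1: "Ef f m (Ef g m z) = z" if "z \<in> EZ i m N" for z i m
    using EZ_carr[OF that] by (cases z) (simp add: Ef_def EG_simps fg)
  have 2: "Ef g m (Ef f m z) = z" if "z \<in> EZ i m M" for z i m
    using EZ_carr[OF that] by (cases z) (simp add: Ef_def EG_simps gf)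
  have 3: "z \<ominus>\<^bsub>EG N m\<^esub> z \<in> EB i m N" if "z \<in> EZ i m N" for z i m
    using EB_zero[OF N] abelian_group.r_neg[OF EG_ab[OF N] EZ_carr[OF that]] by (simp add: a_minus_def)
  show ?thesis unfolding qi_iff[OF M N f]
    using 1 2 3 Ef_EZ[OF N M g] Ef_EB[OF N M g] by metis
qed

lemma transport_iso:
  assumes M: "md M" and inj: "\<And>n. inj_on e (carrier (gr M n))"
  shows "md (transport e M)" "cmap M (transport e M) (\<lambda>n. e)" "cmap (transport e M) M (\<lambda>n. inv_into (carrier (gr M n)) e)"
    "torsion k M \<Longrightarrow> torsion k (transport e M)" "carrier (gr (transport e M) n) = e ` carrier (gr M n)"
proof -
  interpret M: cdg_module "pser k" At M by (rule M)
  note r = inv_into_f_f[OF inj]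
  have c: "carrier (gr (transport e M) n) = e ` carrier (gr M n)" for n by (simp add: transport_def Let_def)
  show "carrier (gr (transport e M) n) = e ` carrier (gr M n)" by (rule c)
  show T: "md (transport e M)" by (rule cdg_module_transport[OF M inj])
  have ac: "a \<in> carrier (gr At p) \<Longrightarrow> x \<in> carrier (gr M n) \<Longrightarrow> act M p n a x \<in> carrier (gr M (p + n))" for a p x n
    by (rule M.M.act_closed[OF _ _ refl])
  show f: "cmap M (transport e M) (\<lambda>n. e)"
    by (rule cmapI) (simp_all add: transport_def Let_def r)
  show "cmap (transport e M) M (\<lambda>n. inv_into (carrier (gr M n)) e)"
    by (rule cmapI) (auto simp: transport_def Let_def r dif_cl[OF M _ refl] add_cl[OF M] ac)
  assume t: "torsion k M"
  show "torsion k (transport e M)"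
    unfolding torsion_def c
  proof (intro allI ballI)
    fix n y assume "y \<in> e ` carrier (gr M n)"
    then obtain x where x: "x \<in> carrier (gr M n)" "y = e x" by auto
    then obtain i where "x \<in> K M i n" using t by (auto simp: torsion_def K_in)
    then have "e x \<in> K (transport e M) i n" by (rule cmap_K[OF M T f])
    then show "\<exists>i. tpow k i \<odot>\<^bsub>gr (transport e M) n\<^esub> y = \<zero>\<^bsub>gr (transport e M) n\<^esub>" unfolding x(2) K_in by blast
  qed
qed

lemma transport_qi:
  assumes M: "md M" and inj: "\<And>n. inj_on e (carrier (gr M n))"
  shows "qi (transport e M) M (\<lambda>n. inv_into (carrier (gr M n)) e)"
  using M transport_iso[OF assms]
  by (intro qi_iso[where g="\<lambda>n. e"]) (auto simp: transport_iso(5)[OF assms] inv_into_f_f[OF inj])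

end

section \<open>Homotopy fibres and the Ore condition\<close>

context tors
begin

context
  fixes X :: "('k, 'a, 'm) tmod" and C :: "('k, 'a, 'n) tmod" and a
  assumes X: "md X" and C: "md C" and a: "cmap X C a"
begin

interpretation X: cdg_module "pser k" At X by (rule X)
interpretation C: cdg_module "pser k" At C by (rule C)

text \<open>The homotopy fibre of \<open>a\<close>: an element of \<open>X\<close> together with an
  element of \<open>C\<close> one degree lower.\<close>

abbreviation "fib \<equiv> shift (- 1) (cone X C a)"

lemma cone_gr: "gr (cone X C a) n = dsum_module (gr C n) (gr X (n + 1))"
  by (simp add: cone_def dsum_def shift_def)

lemma fib_gr: "gr fib n = dsum_module (gr C (n - 1)) (gr X n)"
  using cone_gr[of "n - 1"] by (simp add: shift_def)

text \<open>The shift by \<open>-1\<close> negates the whole cone differential; on \<open>X\<close>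
  this undoes the sign that the cone had introduced.\<close>

lemma fib_dif:
  assumes "U \<in> carrier (gr C (n - 1))" "x \<in> carrier (gr X n)"
  shows "dif fib n (U, x) = (\<ominus>\<^bsub>gr C n\<^esub> (dif C (n - 1) U \<oplus>\<^bsub>gr C n\<^esub> a n x), dif X n x)"
proof -
  have dx: "dif X n x \<in> carrier (gr X (n + 1))" by (rule dif_cl[OF X assms(2) refl])
  have 1: "dif C (n - 1) U \<oplus>\<^bsub>gr C n\<^esub> a n x \<in> carrier (gr C n)"
    using add_cl[OF C dif_cl[OF C assms(1), of n] cmap_cl[OF X C a assms(2)]] by simp
  have "dif fib n (U, x) = \<ominus>\<^bsub>gr (cone X C a) n\<^esub> (dif C (n - 1) U \<oplus>\<^bsub>gr C n\<^esub> a n x, \<ominus>\<^bsub>gr X (n + 1)\<^esub> dif X n x)"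
    using cone_simps(6)[OF X C a, of "n - 1" U x] by (simp add: shift_def psgn_def)
  also have "\<dots> = (\<ominus>\<^bsub>gr C n\<^esub> (dif C (n - 1) U \<oplus>\<^bsub>gr C n\<^esub> a n x), dif X n x)"
    unfolding cone_gr using dsum_neg[OF C.M.gr_module X.M.gr_module 1 neg_cl[OF X dx]]
      md_minus_minus[OF X dx] by simp
  finally show ?thesis .
qed

lemma fib_act:
  assumes "b \<in> carrier (gr At p)" "U \<in> carrier (gr C (n - 1))" "x \<in> carrier (gr X n)"
  shows "act fib p n b (U, x) = (psgn (gr C (p + n - 1)) p (act C p (n - 1) b U), act X p n b x)"
proof -
  have 1: "act C p (n - 1) b U \<in> carrier (gr C (p + n - 1))" by (rule C.M.act_closed[OF assms(1,2)]) simp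
  have 2: "act X p n b x \<in> carrier (gr X (p + n))" by (rule X.M.act_closed[OF assms(1,3) refl])
  have i: "p + n - 1 + 1 = p + n" "p + (n - 1) + 1 = p + n" "n + - 1 = n - 1" "p + n + - 1 = p + n - 1" "n - 1 + 1 = n" by simp_all
  have "act fib p n b (U, x) = psgn (gr (cone X C a) (p + n - 1)) (- p) (act C p (n - 1) b U, psgn (gr X (p + n)) p (act X p n b x))"
    using cone_simps(5)[OF X C a, of p "n - 1" b U x] by (simp add: shift_def i)
  also have "\<dots> = (psgn (gr C (p + n - 1)) p (act C p (n - 1) b U), act X p n b x)"
    unfolding cone_gr i using dsum_psgn[OF C.M.gr_module X.M.gr_module 1 md_psgn_closed[OF X 2]]
      md_psgn_psgn[OF X 2] by (simp add: psgn_def)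
  finally show ?thesis .
qed

lemma fib_cta:
  assumes "U \<in> carrier (gr C (n - 1))" "x \<in> carrier (gr X n)"
  shows "cta fib n (U, x) = (cta C (n - 1) U, cta X n x)"
  using fib_act[OF ct_closed assms] by (simp add: psgn_def)

lemma md_fib: "md fib"
  by (rule md_shift[OF md_cone[OF X C a]])

lemma K_fib: "(U, x) \<in> K fib i n \<longleftrightarrow> U \<in> K C i (n - 1) \<and> x \<in> K X i n"
  unfolding K_in fib_gr by auto

lemma fib_cmap: "cmap fib X (\<lambda>n. snd)"
  by (rule cmapI) (auto simp: fib_gr fib_dif fib_act)

text \<open>Lifting a cycle of \<open>X\<close> to the fibre requires a primitive of its image in
  \<open>C\<close>, and injectivity requires that two such primitives differ by a boundary.
  Exactness of \<open>C\<close> gives both.\<close>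

lemma fib_qi:
  assumes ex: "exactE C"
  shows "qi fib X (\<lambda>n. snd)"
proof -
  note lc = lincomb_unique'[OF C] and li = md_lincomb_intros[OF C]
  have surj: "\<exists>w\<in>EZ i m fib. z \<ominus>\<^bsub>EG X m\<^esub> Ef (\<lambda>n. snd) m w \<in> EB i m X" if z: "z \<in> EZ i m X" for i m z
  proof -
    obtain x x' where xx: "z = (x, x')" by (cases z)
    have x: "x \<in> K X (Suc i) (m + 1)" "x' \<in> K X i m" "dif X (m + 1) x = cta X m x'" "dif X m x' = tm X (m + 1) x"
      using z by (auto simp: EZ_def cyc_def xx)
    have "Ef a m z \<in> EB i m C" using Ef_EZ[OF X C a z] ex unfolding exactE_iff by blast
    then obtain U V where U: "U \<in> K C (Suc i) m" "V \<in> K C i (m - 1)"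
      "a (m + 1) x = dif C m U \<oplus>\<^bsub>gr C (m + 1)\<^esub> cta C (m - 1) V" "a m x' = dif C (m - 1) V \<oplus>\<^bsub>gr C m\<^esub> tm C m U"
      by (auto simp: EB_def bdr_def Ef_def xx)
    note c[simp] = x(1,2)[THEN K_carr] U(1,2)[THEN K_carr]
    have j: "1 + m = m + 1" "m - 1 + 1 = m" "m + 1 - 1 = m" "m - 1 + 2 = m + 1" by simp_all
    note simps = module_cl[OF C] j dif_lin'[OF C, where n="m + 1"] dif_lin'[OF C, where n=m] cta_lin[OF C, where n'="m + 1"] tm_lin[OF C]
    \<comment> \<open>The lift adjoins the negated primitive of the image under \<open>a\<close>;
      the minus sign answers the one in \<open>fib_dif\<close>.\<close>
    have "cyc i m fib (\<ominus>\<^bsub>gr C m\<^esub> U, x) (\<ominus>\<^bsub>gr C (m - 1)\<^esub> V, x')"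
      unfolding cyc_def
    proof (intro conjI)
      show "(\<ominus>\<^bsub>gr C m\<^esub> U, x) \<in> K fib (Suc i) (m + 1)" unfolding K_fib using x(1) K_neg[OF C U(1)] by simp
      show "(\<ominus>\<^bsub>gr C (m - 1)\<^esub> V, x') \<in> K fib i m" unfolding K_fib using x(2) K_neg[OF C U(2)] by simp
      have "\<ominus>\<^bsub>gr C (m + 1)\<^esub> (dif C m (\<ominus>\<^bsub>gr C m\<^esub> U) \<oplus>\<^bsub>gr C (m + 1)\<^esub> a (m + 1) x) = cta C (m - 1) (\<ominus>\<^bsub>gr C (m - 1)\<^esub> V)"
        unfolding U(3) apply (simp add: simps)
        by (intro lc[of "m + 1"]) (rule li | assumption | simp add: simps; fail)+
      then show "dif fib (m + 1) (\<ominus>\<^bsub>gr C m\<^esub> U, x) = cta fib m (\<ominus>\<^bsub>gr C (m - 1)\<^esub> V, x')"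
        using x(3) by (simp add: fib_dif fib_cta neg_cl[OF C])
      have "\<ominus>\<^bsub>gr C m\<^esub> (dif C (m - 1) (\<ominus>\<^bsub>gr C (m - 1)\<^esub> V) \<oplus>\<^bsub>gr C m\<^esub> a m x') = tm C m (\<ominus>\<^bsub>gr C m\<^esub> U)"
        unfolding U(4) apply (simp add: simps)
        by (intro lc[of m]) (rule li | assumption | simp add: simps; fail)+
      then show "dif fib m (\<ominus>\<^bsub>gr C (m - 1)\<^esub> V, x') = tm fib (m + 1) (\<ominus>\<^bsub>gr C m\<^esub> U, x)"
        using x(4) unfolding fib_gr by (simp add: fib_dif neg_cl[OF C])
    qed
    moreover have "z \<ominus>\<^bsub>EG X m\<^esub> Ef (\<lambda>n. snd) m ((\<ominus>\<^bsub>gr C m\<^esub> U, x), (\<ominus>\<^bsub>gr C (m - 1)\<^esub> V, x')) \<in> EB i m X"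
      using EB_zero[OF X] abelian_group.r_neg[OF EG_ab[OF X] EZ_carr[OF z]] by (simp add: a_minus_def Ef_def xx)
    ultimately show ?thesis unfolding EZ_def by blast
  qed
  have inj': "z \<in> EB i (n + 1) fib" if z: "z \<in> EZ i (n + 1) fib" and b: "Ef (\<lambda>n. snd) (n + 1) z \<in> EB i (n + 1) X" for i n z
  proof -
    obtain U x V x' where xx: "z = ((U, x), (V, x'))" by (metis prod.exhaust)
    have j: "n + 1 + 1 = n + 2" "n + 2 - 1 = n + 1" "n + 1 - 1 = n" "1 + n = n + 1" "2 + n = n + 2" "n - 1 + 1 = n" by simp_all
    have "(U, x) \<in> K fib (Suc i) (n + 1 + 1)" "(V, x') \<in> K fib i (n + 1)" and
      d: "dif fib (n + 1 + 1) (U, x) = cta fib (n + 1) (V, x')" "dif fib (n + 1) (V, x') = tm fib (n + 1 + 1) (U, x)"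
      using z by (auto simp: EZ_def cyc_def xx)
    then have KU: "U \<in> K C (Suc i) (n + 1)" "x \<in> K X (Suc i) (n + 2)" "V \<in> K C i n" "x' \<in> K X i (n + 1)"
      unfolding K_fib by (simp_all add: j)
    note c1[simp] = KU[THEN K_carr]
    have e: "\<ominus>\<^bsub>gr C (n + 2)\<^esub> (dif C (n + 1) U \<oplus>\<^bsub>gr C (n + 2)\<^esub> a (n + 2) x) = cta C n V"
      "\<ominus>\<^bsub>gr C (n + 1)\<^esub> (dif C n V \<oplus>\<^bsub>gr C (n + 1)\<^esub> a (n + 1) x') = tm C (n + 1) U"
      using d fib_dif[of U "n + 2" x] fib_dif[of V "n + 1" x'] fib_cta[of V "n + 1" x'] unfolding fib_gr j by (simp_all add: j)
    obtain p q where p: "p \<in> K X (Suc i) (n + 1)" "q \<in> K X i n"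
      "x = dif X (n + 1) p \<oplus>\<^bsub>gr X (n + 2)\<^esub> cta X n q" "x' = dif X n q \<oplus>\<^bsub>gr X (n + 1)\<^esub> tm X (n + 1) p"
      using b by (auto simp: EB_def bdr_def Ef_def xx j)
    note c2[simp] = p(1,2)[THEN K_carr]
    note simps = module_cl[OF C] module_cl[OF X] module_comm[OF C] module_comm[OF X] cmap_cl[OF X C a] cmap_lin[OF X C a] cmap_comm[OF X C a] j
      dif_lin'[OF C, where n="n + 2"] dif_lin'[OF C, where n="n + 1"] dif_lin'[OF C, where n=n] cta_lin[OF C, where n'="n + 2"] cta_lin[OF C, where n'="n + 1"] tm_lin[OF C]
    \<comment> \<open>\<open>(U, V)\<close> and the image under \<open>a\<close> of the primitive
      \<open>(p, q)\<close> solve the same equations up to sign. Their combination is therefore a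
      cycle of \<open>C\<close>, and it bounds.\<close>
    let ?A = "U \<oplus>\<^bsub>gr C (n + 1)\<^esub> a (n + 1) p" and ?B = "\<ominus>\<^bsub>gr C n\<^esub> (V \<oplus>\<^bsub>gr C n\<^esub> a n q)"
    have "cyc i n C ?A ?B"
      unfolding cyc_def
    proof (intro conjI)
      show "?A \<in> K C (Suc i) (n + 1)" using K_add[OF C KU(1) cmap_K[OF X C a p(1)]] .
      show "?B \<in> K C i n" using K_neg[OF C K_add[OF C KU(3) cmap_K[OF X C a p(2)]]] .
      have "dif C (n + 1) U = \<ominus>\<^bsub>gr C (n + 2)\<^esub> cta C n V \<ominus>\<^bsub>gr C (n + 2)\<^esub> a (n + 2) x"
        unfolding e(1)[symmetric] by (intro lc[of "n + 2"]) (rule li | assumption | simp add: simps; fail)+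
      then show "dif C (n + 1) ?A = cta C n ?B"
        apply (simp add: simps p(3))
        by (intro lc[of "n + 2"]) (rule li | assumption | simp add: simps; fail)+
      have "dif C n V = \<ominus>\<^bsub>gr C (n + 1)\<^esub> tm C (n + 1) U \<ominus>\<^bsub>gr C (n + 1)\<^esub> a (n + 1) x'"
        unfolding e(2)[symmetric] by (intro lc[of "n + 1"]) (rule li | assumption | simp add: simps; fail)+
      then show "dif C n ?B = tm C (n + 1) ?A"
        apply (simp add: simps p(4))
        by (intro lc[of "n + 1"]) (rule li | assumption | simp add: simps; fail)+
    qed
    then have "bdr i n C ?A ?B" using ex unfolding exactE_def by blast
    then obtain P Q where P: "P \<in> K C (Suc i) n" "Q \<in> K C i (n - 1)"
      "?A = dif C n P \<oplus>\<^bsub>gr C (n + 1)\<^esub> cta C (n - 1) Q" "?B = dif C (n - 1) Q \<oplus>\<^bsub>gr C n\<^esub> tm C n P"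
      by (auto simp: bdr_def)
    note c3[simp] = P(1,2)[THEN K_carr]
    have "U = ?A \<ominus>\<^bsub>gr C (n + 1)\<^esub> a (n + 1) p" by (intro lc[of "n + 1"]) (rule li | assumption | simp add: simps; fail)+
    then have U: "U = \<ominus>\<^bsub>gr C (n + 1)\<^esub> (dif C n (\<ominus>\<^bsub>gr C n\<^esub> P) \<oplus>\<^bsub>gr C (n + 1)\<^esub> a (n + 1) p) \<oplus>\<^bsub>gr C (n + 1)\<^esub> cta C (n - 1) Q"
      unfolding P(3) apply (elim ssubst) apply (simp add: simps)
      by (intro lc[of "n + 1"]) (rule li | assumption | simp add: simps; fail)+
    have "V = \<ominus>\<^bsub>gr C n\<^esub> ?B \<ominus>\<^bsub>gr C n\<^esub> a n q" by (intro lc[of n]) (rule li | assumption | simp add: simps; fail)+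
    then have V: "V = \<ominus>\<^bsub>gr C n\<^esub> (dif C (n - 1) Q \<oplus>\<^bsub>gr C n\<^esub> a n q) \<oplus>\<^bsub>gr C n\<^esub> tm C n (\<ominus>\<^bsub>gr C n\<^esub> P)"
      unfolding P(4) apply (elim ssubst) apply (simp add: simps)
      by (intro lc[of n]) (rule li | assumption | simp add: simps; fail)+
    have nP: "\<ominus>\<^bsub>gr C n\<^esub> P \<in> carrier (gr C n)" by (rule neg_cl[OF C c3(1)])
    show ?thesis unfolding EB_def bdr_def xx mem_Collect_eq prod.case
    proof (rule bexI[of _ "(\<ominus>\<^bsub>gr C n\<^esub> P, p)"], rule bexI[of _ "(Q, q)"], rule conjI)
      show "(U, x) = dif fib (n + 1) (\<ominus>\<^bsub>gr C n\<^esub> P, p) \<oplus>\<^bsub>gr fib (n + 1 + 1)\<^esub> cta fib (n + 1 - 1) (Q, q)"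
        unfolding fib_gr j using U p(3) fib_dif[of "\<ominus>\<^bsub>gr C n\<^esub> P" "n + 1" p, unfolded j] fib_cta[of Q n q] nP by simp
      show "(V, x') = dif fib (n + 1 - 1) (Q, q) \<oplus>\<^bsub>gr fib (n + 1)\<^esub> tm fib (n + 1) (\<ominus>\<^bsub>gr C n\<^esub> P, p)"
        unfolding fib_gr j using V p(4) fib_dif[of Q n q] by simp
      show "(\<ominus>\<^bsub>gr C n\<^esub> P, p) \<in> K fib (Suc i) (n + 1)" unfolding K_fib j using K_neg[OF C P(1)] p by simp
      show "(Q, q) \<in> K fib i (n + 1 - 1)" unfolding K_fib j using P p by simp
    qed
  qed
  have inj: "z \<in> EB i m fib" if "z \<in> EZ i m fib" and "Ef (\<lambda>n. snd) m z \<in> EB i m X" for i m z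
    using inj'[of z i "m - 1"] that by simp
  show ?thesis unfolding qi_iff[OF md_fib X fib_cmap] using surj inj by blast
qed

end

text \<open>The fraction is completed by the fibre of \<open>X \<rightarrow> Y \<rightarrow> cone(s)\<close>, whose map to \<open>X\<close> has \<open>t\<close>-acyclic cone.\<close>

lemma ore_chain:
  fixes X :: "('k, 'a, 'm) tmod" and Y :: "('k, 'a, 'n) tmod" and L :: "('k, 'a, 'l) tmod"
  assumes X: "md X" "torsion k X" and Y: "md Y" "torsion k Y" and L: "md L" "torsion k L"
    and f: "cmap X Y f" and s: "cmap L Y s" and q: "qi L Y s"
  shows "\<exists>(F :: (nat \<Rightarrow> 'k, nat \<Rightarrow> 'a, ('n \<times> 'l) \<times> 'm) cdgm) w h. md F \<and> torsion k F \<and> cmap F X w \<and> qi F X w \<and> cmap F L h \<and>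
    homotopic F Y (\<lambda>n v. f n (w n v)) (\<lambda>n v. s n (h n v))"
proof -
  let ?C = "cone L Y s"
  \<comment> \<open>\<open>f\<close> followed by the inclusion of \<open>Y\<close> into the cone of
    \<open>s\<close>.\<close>
  define a where "a = (\<lambda>n x. (f n x, \<zero>\<^bsub>gr L (n + 1)\<^esub>))"
  interpret L: cdg_module "pser k" At L by (rule L)
  interpret Y: cdg_module "pser k" At Y by (rule Y)
  have C: "md ?C" by (rule md_cone[OF L(1) Y(1) s])
  have ex: "exactE ?C" by (rule qi_exact_cone[OF L(1) Y(1) s q])
  note z = zero_cl[OF L(1)] md_l_zero[OF L(1)] md_neg_zero[OF L(1)]
    md_psgn_zero[OF L(1)] md_r_zero[OF L(1)]
  note cs = cone_simps[OF L(1) Y(1) s]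
  have a: "cmap X ?C a"
  proof (rule cmapI)
    fix n x assume x: "x \<in> carrier (gr X n)"
    show "a n x \<in> carrier (gr ?C n)" using cmap_cl[OF X(1) Y(1) f x] by (simp add: a_def cs z)
    { fix y assume y: "y \<in> carrier (gr X n)"
      show "a n (x \<oplus>\<^bsub>gr X n\<^esub> y) = a n x \<oplus>\<^bsub>gr ?C n\<^esub> a n y" using cmap_lin(1)[OF X(1) Y(1) f x y] by (simp add: a_def cs z) }
    { fix p b assume b: "b \<in> carrier (gr At p)"
      have "act L p (n + 1) b \<zero>\<^bsub>gr L (n + 1)\<^esub> = \<zero>\<^bsub>gr L (p + n + 1)\<^esub>" by (rule addhom_zero[OF L.M.act_hom[OF b]]) simp
      then show "a (p + n) (act X p n b x) = act ?C p n b (a n x)" using cmap_act[OF X(1) Y(1) f b x refl] by (simp add: a_def cs z) }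
    have "dif L (n + 1) \<zero>\<^bsub>gr L (n + 1)\<^esub> = \<zero>\<^bsub>gr L (n + 1 + 1)\<^esub>" by (rule dif_lin'(4)[OF L(1) refl])
    then show "a (n + 1) (dif X n x) = dif ?C n (a n x)"
      using cmap_dif[OF X(1) Y(1) f x refl] cmap_lin(4)[OF L(1) Y(1) s] dif_cl[OF Y(1) cmap_cl[OF X(1) Y(1) f x] refl]
        md_r_zero[OF Y(1)]
      unfolding a_def cs by (simp add: z)
  qed
  let ?F = "shift (- 1) (cone X ?C a)"
  note fs = fib_gr[OF X(1) C a] and fd = fib_dif[OF X(1) C a] and fa = fib_act[OF X(1) C a]
  have C_gr: "gr ?C n = dsum_module (gr Y n) (gr L (n + 1))" for n by (rule cone_gr[OF L(1) Y(1) s])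
  have md: "md ?F" by (rule md_fib[OF X(1) C a])
  have tor: "torsion k ?F" by (intro torsion_shift torsion_cone[OF X(1) C a] torsion_cone[OF L(1) Y(1) s] X Y L)
  \<comment> \<open>On an element \<open>((y, l), x)\<close> of the fibre, the \<open>Y\<close>-part
    of the differential contains \<open>s l + f x\<close> up to sign. So \<open>- l\<close> is taken
    as the map to \<open>L\<close>, and \<open>- y\<close> as the homotopy between
    \<open>f x\<close> and \<open>s (- l)\<close>.\<close>
  define h where "h = (\<lambda>n (v :: ('n \<times> 'l) \<times> 'm). \<ominus>\<^bsub>gr L n\<^esub> snd (fst v))"
  define H where "H = (\<lambda>n (v :: ('n \<times> 'l) \<times> 'm). \<ominus>\<^bsub>gr Y (n - 1)\<^esub> fst (fst v))"
  have car: "carrier (gr ?F n) = (carrier (gr Y (n - 1)) \<times> carrier (gr L n)) \<times> carrier (gr X n)" for n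
    unfolding fs C_gr by simp
  have add: "((y, l), x) \<oplus>\<^bsub>gr ?F n\<^esub> ((y', l'), x') = ((y \<oplus>\<^bsub>gr Y (n - 1)\<^esub> y', l \<oplus>\<^bsub>gr L n\<^esub> l'), x \<oplus>\<^bsub>gr X n\<^esub> x')" for n y l x y' l' x'
    unfolding fs C_gr by simp
  have d: "dif ?F n ((y, l), x) = ((\<ominus>\<^bsub>gr Y n\<^esub> (dif Y (n - 1) y \<oplus>\<^bsub>gr Y n\<^esub> s n l \<oplus>\<^bsub>gr Y n\<^esub> f n x), dif L n l), dif X n x)"
    if v: "y \<in> carrier (gr Y (n - 1))" "l \<in> carrier (gr L n)" "x \<in> carrier (gr X n)" for n y l x
  proof -
    have c: "dif Y (n - 1) y \<in> carrier (gr Y n)" "s n l \<in> carrier (gr Y n)" "f n x \<in> carrier (gr Y n)" "dif L n l \<in> carrier (gr L (n + 1))"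
      using dif_cl[OF Y(1) v(1), of n] cmap_cl[OF L(1) Y(1) s v(2)] cmap_cl[OF X(1) Y(1) f v(3)] dif_cl[OF L(1) v(2) refl] by simp_all
    have "(y, l) \<in> carrier (gr ?C (n - 1))" unfolding C_gr using v by simp
    then have "dif ?F n ((y, l), x) = (\<ominus>\<^bsub>gr ?C n\<^esub> (dif ?C (n - 1) (y, l) \<oplus>\<^bsub>gr ?C n\<^esub> a n x), dif X n x)" using fd v(3) by simp
    also have "dif ?C (n - 1) (y, l) \<oplus>\<^bsub>gr ?C n\<^esub> a n x = (dif Y (n - 1) y \<oplus>\<^bsub>gr Y n\<^esub> s n l \<oplus>\<^bsub>gr Y n\<^esub> f n x, \<ominus>\<^bsub>gr L (n + 1)\<^esub> dif L n l)"
      unfolding C_gr cs a_def using c by (simp add: z neg_cl[OF L(1)])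
    also have "\<ominus>\<^bsub>gr ?C n\<^esub> \<dots> = (\<ominus>\<^bsub>gr Y n\<^esub> (dif Y (n - 1) y \<oplus>\<^bsub>gr Y n\<^esub> s n l \<oplus>\<^bsub>gr Y n\<^esub> f n x), dif L n l)"
      unfolding C_gr using dsum_neg[OF Y.M.gr_module L.M.gr_module] c add_cl[OF Y(1)] neg_cl[OF L(1)]
        md_minus_minus[OF L(1)] by simp
    finally show ?thesis .
  qed
  have ac: "act ?F p n b ((y, l), x) = ((psgn (gr Y (p + n - 1)) p (act Y p (n - 1) b y), act L p n b l), act X p n b x)"
    if b: "b \<in> carrier (gr At p)" and v: "y \<in> carrier (gr Y (n - 1))" "l \<in> carrier (gr L n)" "x \<in> carrier (gr X n)" for p n b y l x
  proof -
    have c: "act Y p (n - 1) b y \<in> carrier (gr Y (p + n - 1))" "act L p n b l \<in> carrier (gr L (p + n))"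
      by (rule Y.M.act_closed[OF b v(1)], simp) (rule L.M.act_closed[OF b v(2) refl])
    have i: "p + (n - 1) + 1 = p + n" "n - 1 + 1 = n" "p + n - 1 + 1 = p + n" by simp_all
    have "(y, l) \<in> carrier (gr ?C (n - 1))" unfolding C_gr using v by simp
    then have "act ?F p n b ((y, l), x) = (psgn (gr ?C (p + n - 1)) p (act ?C p (n - 1) b (y, l)), act X p n b x)" using fa[OF b _ v(3)] by simp
    also have "psgn (gr ?C (p + n - 1)) p (act ?C p (n - 1) b (y, l)) = (psgn (gr Y (p + n - 1)) p (act Y p (n - 1) b y), act L p n b l)"
      unfolding C_gr cs i using dsum_psgn[OF Y.M.gr_module L.M.gr_module c(1) md_psgn_closed[OF L(1) c(2)]]
       md_psgn_psgn[OF L(1) c(2)] by (simp add: psgn_def)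
    finally show ?thesis .
  qed
  have hc: "cmap ?F L h"
  proof (rule cmapI)
    fix n v assume "v \<in> carrier (gr ?F n)"
    then obtain y l x where v: "v = ((y, l), x)" "y \<in> carrier (gr Y (n - 1))" "l \<in> carrier (gr L n)" "x \<in> carrier (gr X n)" unfolding car by auto
    show "h n v \<in> carrier (gr L n)" using v neg_cl[OF L(1)] by (simp add: h_def)
    show "h (n + 1) (dif ?F n v) = dif L n (h n v)" using v by (simp add: h_def d dif_lin'(2)[OF L(1) refl])
    { fix p b assume b: "b \<in> carrier (gr At p)"
      show "h (p + n) (act ?F p n b v) = act L p n b (h n v)" using v b addhom_neg[OF L.M.act_hom[OF b refl] v(3)] by (simp add: h_def ac) }
    fix v' assume "v' \<in> carrier (gr ?F n)"
    then obtain y' l' x' where v': "v' = ((y', l'), x')" "l' \<in> carrier (gr L n)" unfolding car by auto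
    show "h n (v \<oplus>\<^bsub>gr ?F n\<^esub> v') = h n v \<oplus>\<^bsub>gr L n\<^esub> h n v'"
      unfolding v(1) v'(1) add h_def using v v' md_minus_add[OF L(1)] by simp
  qed
  have Hl: "lmap (- 1) ?F Y H"
    unfolding lmap_def
  proof (intro conjI allI ballI)
    fix n v assume "v \<in> carrier (gr ?F n)"
    then obtain y l x where v: "v = ((y, l), x)" "y \<in> carrier (gr Y (n - 1))" "l \<in> carrier (gr L n)" "x \<in> carrier (gr X n)" unfolding car by auto
    show "H n v \<in> carrier (gr Y (n + - 1))" using v neg_cl[OF Y(1)] by (simp add: H_def)
    { fix p b assume b: "b \<in> carrier (gr At p)"
      have c: "act Y p (n - 1) b y \<in> carrier (gr Y (p + n - 1))" by (rule Y.M.act_closed[OF b v(2)]) simp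
      have "act Y p (n - 1) b (\<ominus>\<^bsub>gr Y (n - 1)\<^esub> y) = \<ominus>\<^bsub>gr Y (p + n - 1)\<^esub> act Y p (n - 1) b y"
        by (rule addhom_neg[OF Y.M.act_hom[OF b] v(2)]) simp
      then show "H (p + n) (act ?F p n b v) = psgn (gr Y (p + n + - 1)) (- 1 * p) (act Y p (n + - 1) b (H n v))"
        using v b by (simp add: H_def ac psgn_def) }
    fix v' assume "v' \<in> carrier (gr ?F n)"
    then obtain y' l' x' where v': "v' = ((y', l'), x')" "y' \<in> carrier (gr Y (n - 1))" unfolding car by auto
    show "H n (v \<oplus>\<^bsub>gr ?F n\<^esub> v') = H n v \<oplus>\<^bsub>gr Y (n + - 1)\<^esub> H n v'"
      unfolding v(1) v'(1) add H_def using v v' md_minus_add[OF Y(1)] by simp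
  qed
  have "f n (snd v) = s n (h n v) \<oplus>\<^bsub>gr Y n\<^esub> null_map ?F Y H n v" if vc: "v \<in> carrier (gr ?F n)" for n v
  proof -
    obtain y l x where v: "v = ((y, l), x)" "y \<in> carrier (gr Y (n - 1))" "l \<in> carrier (gr L n)" "x \<in> carrier (gr X n)" using vc unfolding car by auto
    have c: "dif Y (n - 1) y \<in> carrier (gr Y n)" "s n l \<in> carrier (gr Y n)" "f n x \<in> carrier (gr Y n)"
      using dif_cl[OF Y(1) v(2), of n] cmap_cl[OF L(1) Y(1) s v(3)] cmap_cl[OF X(1) Y(1) f v(4)] by simp_all
    have 1: "null_map ?F Y H n v = \<ominus>\<^bsub>gr Y n\<^esub> dif Y (n - 1) y \<oplus>\<^bsub>gr Y n\<^esub> \<ominus>\<^bsub>gr Y n\<^esub> (\<ominus>\<^bsub>gr Y n\<^esub> (dif Y (n - 1) y \<oplus>\<^bsub>gr Y n\<^esub> s n l \<oplus>\<^bsub>gr Y n\<^esub> f n x))"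
      unfolding null_map_def using v by (simp add: d H_def dif_lin'(2)[OF Y(1), where n=n])
    have 2: "s n (h n v) = \<ominus>\<^bsub>gr Y n\<^esub> s n l" using v by (simp add: h_def cmap_lin(2)[OF L(1) Y(1) s])
    have 3: "f n x = \<ominus>\<^bsub>gr Y n\<^esub> s n l \<oplus>\<^bsub>gr Y n\<^esub> (\<ominus>\<^bsub>gr Y n\<^esub> dif Y (n - 1) y \<oplus>\<^bsub>gr Y n\<^esub> \<ominus>\<^bsub>gr Y n\<^esub> (\<ominus>\<^bsub>gr Y n\<^esub> (dif Y (n - 1) y \<oplus>\<^bsub>gr Y n\<^esub> s n l \<oplus>\<^bsub>gr Y n\<^esub> f n x)))"
      using c by (intro lincomb_unique'[OF Y(1), of n]) (rule md_lincomb_intros[OF Y(1)] | assumption | simp; fail)+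
    have 4: "snd v = x" using v(1) by simp
    show ?thesis unfolding 1 2 4 by (rule 3)
  qed
  then have "homotopic ?F Y (\<lambda>n v. f n (snd v)) (\<lambda>n v. s n (h n v))" unfolding homotopic_def using Hl by blast
  then show ?thesis using md tor fib_cmap[OF X(1) C a] fib_qi[OF X(1) C a ex] hc by blast
qed

end

section \<open>Cofibres of maps out of direct sums\<close>

lemma addhom_finsum:
  assumes h: "addhom V W h" and "finite S" "y \<in> S \<rightarrow> carrier V"
  shows "h (finsum V y S) = finsum W (\<lambda>j. h (y j)) S"
  using assms(2,3)
proof (induction S)
  interpret V: abelian_group V using h by (simp add: addhom_def)
  interpret W: abelian_group W using h by (simp add: addhom_def)
  case empty
  show ?case using addhom_zero[OF h] by simp
next
  interpret V: abelian_group V using h by (simp add: addhom_def)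
  interpret W: abelian_group W using h by (simp add: addhom_def)
  case (insert j S)
  then have "y j \<in> carrier V" "y \<in> S \<rightarrow> carrier V" by auto
  moreover have "h (y j) \<in> carrier W" "(\<lambda>j. h (y j)) \<in> S \<rightarrow> carrier W" using insert addhom_closed[OF h] by auto
  ultimately show ?case using insert by (simp add: addhom_add[OF h])
qed

lemma finsum_dsum:
  assumes V: "module R V" and W: "module R W" and "finite S" "y \<in> S \<rightarrow> carrier V" "z \<in> S \<rightarrow> carrier W"
  shows "finsum (dsum_module V W) (\<lambda>j. (y j, z j)) S = (finsum V y S, finsum W z S)"
  using assms(3-5)
proof (induction S)
  interpret D: module R "dsum_module V W" by (rule module_dsum[OF V W])
  interpret V: module R V by fact
  interpret W: module R W by fact
  case empty
  show ?case by simp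
next
  interpret D: module R "dsum_module V W" by (rule module_dsum[OF V W])
  interpret V: module R V by fact
  interpret W: module R W by fact
  case (insert j S)
  then have "y j \<in> carrier V" "y \<in> S \<rightarrow> carrier V" "z j \<in> carrier W" "z \<in> S \<rightarrow> carrier W" by auto
  then have "(\<lambda>j. (y j, z j)) \<in> S \<rightarrow> carrier (dsum_module V W)" "(y j, z j) \<in> carrier (dsum_module V W)" by auto
  with insert show ?case by simp
qed

text \<open>Families with finite support, extensional outside \<open>J\<close>, so that equality of
  elements can be tested on \<open>J\<close>.\<close>

definition DS :: "'i set \<Rightarrow> ('i \<Rightarrow> ('r, 'a, 'm) cdgm) \<Rightarrow> ('r, 'a, 'i \<Rightarrow> 'm) cdgm" where
  "DS J L = \<lparr>gr = (\<lambda>n. \<lparr>carrier = {v \<in> \<Pi>\<^sub>E j\<in>J. carrier (gr (L j) n). finite {j \<in> J. v j \<noteq> \<zero>\<^bsub>gr (L j) n\<^esub>}},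
       monoid.mult = undefined, one = undefined,
       ring.zero = (\<lambda>j\<in>J. \<zero>\<^bsub>gr (L j) n\<^esub>),
       add = (\<lambda>v w. \<lambda>j\<in>J. v j \<oplus>\<^bsub>gr (L j) n\<^esub> w j),
       smult = (\<lambda>r v. \<lambda>j\<in>J. r \<odot>\<^bsub>gr (L j) n\<^esub> v j)\<rparr>),
     act = (\<lambda>p q a v. \<lambda>j\<in>J. act (L j) p q a (v j)),
     dif = (\<lambda>n v. \<lambda>j\<in>J. dif (L j) n (v j))\<rparr>"

lemma DS_simps:
  "v \<in> carrier (gr (DS J L) n) \<longleftrightarrow> (\<forall>j\<in>J. v j \<in> carrier (gr (L j) n)) \<and> v \<in> extensional J \<and> finite {j \<in> J. v j \<noteq> \<zero>\<^bsub>gr (L j) n\<^esub>}"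
  "\<zero>\<^bsub>gr (DS J L) n\<^esub> = (\<lambda>j\<in>J. \<zero>\<^bsub>gr (L j) n\<^esub>)"
  "v \<oplus>\<^bsub>gr (DS J L) n\<^esub> w = (\<lambda>j\<in>J. v j \<oplus>\<^bsub>gr (L j) n\<^esub> w j)"
  "r \<odot>\<^bsub>gr (DS J L) n\<^esub> v = (\<lambda>j\<in>J. r \<odot>\<^bsub>gr (L j) n\<^esub> v j)"
  "act (DS J L) p n a v = (\<lambda>j\<in>J. act (L j) p n a (v j))"
  "dif (DS J L) n v = (\<lambda>j\<in>J. dif (L j) n (v j))"
  by (auto simp: DS_def PiE_iff)

context tors
begin

context
  fixes J :: "'i set" and L :: "'i \<Rightarrow> ('k, 'a, 'm) tmod"
  assumes L: "\<And>j. j \<in> J \<Longrightarrow> md (L j)"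
begin

text \<open>Additive maps fix zero and so preserve finite support; one lemma thus covers scalars,
  differentials, the action and negation.\<close>

lemma DS_map:
  assumes "v \<in> carrier (gr (DS J L) n)" "\<And>j. j \<in> J \<Longrightarrow> addhom (gr (L j) n) (gr (L j) n') (\<phi> j)"
  shows "(\<lambda>j\<in>J. \<phi> j (v j)) \<in> carrier (gr (DS J L) n')"
proof -
  have "{j \<in> J. (\<lambda>j\<in>J. \<phi> j (v j)) j \<noteq> \<zero>\<^bsub>gr (L j) n'\<^esub>} \<subseteq> {j \<in> J. v j \<noteq> \<zero>\<^bsub>gr (L j) n\<^esub>}"
    using addhom_zero[OF assms(2)] by auto
  then have "finite {j \<in> J. (\<lambda>j\<in>J. \<phi> j (v j)) j \<noteq> \<zero>\<^bsub>gr (L j) n'\<^esub>}"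
    using assms(1) unfolding DS_simps(1) by (elim finite_subset) simp
  then show ?thesis using assms(1) addhom_closed[OF assms(2)] unfolding DS_simps(1) by simp
qed

lemma DS_add_closed:
  assumes "v \<in> carrier (gr (DS J L) n)" "w \<in> carrier (gr (DS J L) n)"
  shows "v \<oplus>\<^bsub>gr (DS J L) n\<^esub> w \<in> carrier (gr (DS J L) n)"
proof -
  have "{j \<in> J. (v \<oplus>\<^bsub>gr (DS J L) n\<^esub> w) j \<noteq> \<zero>\<^bsub>gr (L j) n\<^esub>} \<subseteq> {j \<in> J. v j \<noteq> \<zero>\<^bsub>gr (L j) n\<^esub>} \<union> {j \<in> J. w j \<noteq> \<zero>\<^bsub>gr (L j) n\<^esub>}"
    using md_l_zero[OF L] zero_cl[OF L] by (auto simp: DS_simps)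
  then have "finite {j \<in> J. (v \<oplus>\<^bsub>gr (DS J L) n\<^esub> w) j \<noteq> \<zero>\<^bsub>gr (L j) n\<^esub>}"
    using assms unfolding DS_simps(1) by (elim finite_subset) simp
  then show ?thesis using assms add_cl[OF L] unfolding DS_simps(1) by (auto simp: DS_simps(3))
qed

lemma DS_eqI: "v \<in> carrier (gr (DS J L) n) \<Longrightarrow> (\<And>j. j \<in> J \<Longrightarrow> w j = v j) \<Longrightarrow> (\<lambda>j\<in>J. w j) = v"
  by (auto simp: DS_simps extensional_def restrict_def fun_eq_iff)

lemma md_DS: "md (DS J L)"
proof -
  have g: "graded_module_derivation (pser k) At (L j)" if "j \<in> J" for j by (rule md_gmd[OF L[OF that]])
  have c: "v \<in> carrier (gr (DS J L) n) \<Longrightarrow> j \<in> J \<Longrightarrow> v j \<in> carrier (gr (L j) n)" for v n j by (simp add: DS_simps)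
  note ab = md_ab[OF L]
  have A: "abelian_group (gr (DS J L) n)" for n
  proof (rule abelian_groupI)
    fix v w assume v: "v \<in> carrier (gr (DS J L) n)" and w: "w \<in> carrier (gr (DS J L) n)"
    show "v \<oplus>\<^bsub>gr (DS J L) n\<^esub> w \<in> carrier (gr (DS J L) n)" by (rule DS_add_closed[OF v w])
    show "v \<oplus>\<^bsub>gr (DS J L) n\<^esub> w = w \<oplus>\<^bsub>gr (DS J L) n\<^esub> v"
      unfolding DS_simps by (intro restrict_ext) (simp add: abelian_monoid.a_comm[OF abelian_group.axioms(1)[OF ab]] c[OF v] c[OF w])
    fix u assume u: "u \<in> carrier (gr (DS J L) n)"
    show "v \<oplus>\<^bsub>gr (DS J L) n\<^esub> w \<oplus>\<^bsub>gr (DS J L) n\<^esub> u = v \<oplus>\<^bsub>gr (DS J L) n\<^esub> (w \<oplus>\<^bsub>gr (DS J L) n\<^esub> u)"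
      unfolding DS_simps by (intro restrict_ext) (simp add: abelian_monoid.a_assoc[OF abelian_group.axioms(1)[OF ab]] c[OF v] c[OF w] c[OF u])
  next
    show "\<zero>\<^bsub>gr (DS J L) n\<^esub> \<in> carrier (gr (DS J L) n)" using zero_cl[OF L] by (simp add: DS_simps)
    fix v assume v: "v \<in> carrier (gr (DS J L) n)"
    show "\<zero>\<^bsub>gr (DS J L) n\<^esub> \<oplus>\<^bsub>gr (DS J L) n\<^esub> v = v"
      unfolding DS_simps by (rule DS_eqI[OF v]) (simp add: c[OF v] abelian_monoid.l_zero[OF abelian_group.axioms(1)[OF ab]])
    have "addhom (gr (L j) n) (gr (L j) n) (\<lambda>x. \<ominus>\<^bsub>gr (L j) n\<^esub> x)" if "j \<in> J" for j
      using ab[OF that] neg_cl[OF L[OF that]] abelian_group.minus_add[OF ab[OF that]] by (intro addhomI) auto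
    then have "(\<lambda>j\<in>J. \<ominus>\<^bsub>gr (L j) n\<^esub> v j) \<in> carrier (gr (DS J L) n)" by (rule DS_map[OF v])
    moreover have "(\<lambda>j\<in>J. \<ominus>\<^bsub>gr (L j) n\<^esub> v j) \<oplus>\<^bsub>gr (DS J L) n\<^esub> v = \<zero>\<^bsub>gr (DS J L) n\<^esub>"
      unfolding DS_simps by (intro restrict_ext) (simp add: abelian_group.l_neg[OF ab] c[OF v])
    ultimately show "\<exists>w\<in>carrier (gr (DS J L) n). w \<oplus>\<^bsub>gr (DS J L) n\<^esub> v = \<zero>\<^bsub>gr (DS J L) n\<^esub>" by blast
  qed
  have m: "module (pser k) (gr (L j) n)" if "j \<in> J" for j n by (rule md_module[OF L[OF that]])
  have sc: "r \<in> carrier (pser k) \<Longrightarrow> v \<in> carrier (gr (DS J L) n) \<Longrightarrow> r \<odot>\<^bsub>gr (DS J L) n\<^esub> v \<in> carrier (gr (DS J L) n)" for r v n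
    unfolding DS_simps(4) by (rule DS_map, assumption, rule graded_module_derivation.smult_hom[OF g])
  have dc: "v \<in> carrier (gr (DS J L) n) \<Longrightarrow> dif (DS J L) n v \<in> carrier (gr (DS J L) (n + 1))" for v n
    unfolding DS_simps(6) by (rule DS_map, assumption, rule graded_module_derivation.dif_hom[OF g refl])
  have acl: "a \<in> carrier (gr At p) \<Longrightarrow> v \<in> carrier (gr (DS J L) n) \<Longrightarrow> act (DS J L) p n a v \<in> carrier (gr (DS J L) (p + n))" for a v p n
    unfolding DS_simps(5) by (rule DS_map, assumption, rule graded_module_derivation.act_hom[OF g _ refl])
  have M: "module (pser k) (gr (DS J L) n)" for n
  proof (rule moduleI[OF is_cring A])
    fix r v assume r: "r \<in> carrier (pser k)" and v: "v \<in> carrier (gr (DS J L) n)"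
    show "r \<odot>\<^bsub>gr (DS J L) n\<^esub> v \<in> carrier (gr (DS J L) n)" by (rule sc[OF r v])
    fix r' assume r': "r' \<in> carrier (pser k)"
    show "(r \<oplus>\<^bsub>pser k\<^esub> r') \<odot>\<^bsub>gr (DS J L) n\<^esub> v = r \<odot>\<^bsub>gr (DS J L) n\<^esub> v \<oplus>\<^bsub>gr (DS J L) n\<^esub> r' \<odot>\<^bsub>gr (DS J L) n\<^esub> v"
      unfolding DS_simps by (intro restrict_ext) (simp add: c[OF v] module.smult_l_distr[OF m] r r')
    show "(r \<otimes>\<^bsub>pser k\<^esub> r') \<odot>\<^bsub>gr (DS J L) n\<^esub> v = r \<odot>\<^bsub>gr (DS J L) n\<^esub> (r' \<odot>\<^bsub>gr (DS J L) n\<^esub> v)"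
      unfolding DS_simps by (intro restrict_ext) (simp add: c[OF v] module.smult_assoc1[OF m] r r')
  next
    fix r v w assume r: "r \<in> carrier (pser k)" and v: "v \<in> carrier (gr (DS J L) n)" and w: "w \<in> carrier (gr (DS J L) n)"
    show "r \<odot>\<^bsub>gr (DS J L) n\<^esub> (v \<oplus>\<^bsub>gr (DS J L) n\<^esub> w) = r \<odot>\<^bsub>gr (DS J L) n\<^esub> v \<oplus>\<^bsub>gr (DS J L) n\<^esub> r \<odot>\<^bsub>gr (DS J L) n\<^esub> w"
      unfolding DS_simps by (intro restrict_ext) (simp add: c[OF v] c[OF w] module.smult_r_distr[OF m] r)
  next
    fix v assume v: "v \<in> carrier (gr (DS J L) n)"
    show "\<one>\<^bsub>pser k\<^esub> \<odot>\<^bsub>gr (DS J L) n\<^esub> v = v"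
      unfolding DS_simps by (rule DS_eqI[OF v]) (simp add: c[OF v] module.smult_one[OF m])
  qed
  have neg: "(\<ominus>\<^bsub>gr (DS J L) n\<^esub> v) = (\<lambda>j\<in>J. \<ominus>\<^bsub>gr (L j) n\<^esub> v j)" if v: "v \<in> carrier (gr (DS J L) n)" for v n
  proof (rule abelian_group.minus_equality[OF A])
    have "addhom (gr (L j) n) (gr (L j) n) (\<lambda>x. \<ominus>\<^bsub>gr (L j) n\<^esub> x)" if "j \<in> J" for j
      using ab[OF that] neg_cl[OF L[OF that]] abelian_group.minus_add[OF ab[OF that]] by (intro addhomI) auto
    then show "(\<lambda>j\<in>J. \<ominus>\<^bsub>gr (L j) n\<^esub> v j) \<in> carrier (gr (DS J L) n)" by (rule DS_map[OF v])
    show "(\<lambda>j\<in>J. \<ominus>\<^bsub>gr (L j) n\<^esub> v j) \<oplus>\<^bsub>gr (DS J L) n\<^esub> v = \<zero>\<^bsub>gr (DS J L) n\<^esub>"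
      unfolding DS_simps by (intro restrict_ext) (simp add: abelian_group.l_neg[OF ab] c[OF v])
  qed (rule v)
  have ps: "psgn (gr (DS J L) n) p v = (\<lambda>j\<in>J. psgn (gr (L j) n) p (v j))" if v: "v \<in> carrier (gr (DS J L) n)" for v n p
    using neg[OF v] DS_eqI[OF v, of v] by (auto simp: psgn_def)
  have G: "graded_module_derivation (pser k) At (DS J L)"
  proof (rule gmdI[OF is_cring M unit_closed acl _ _ _ _ _ _ dc])
    fix p q a v w assume a: "a \<in> carrier (gr At p)" and v: "v \<in> carrier (gr (DS J L) q)" and w: "w \<in> carrier (gr (DS J L) q)"
    show "act (DS J L) p q a (v \<oplus>\<^bsub>gr (DS J L) q\<^esub> w) = act (DS J L) p q a v \<oplus>\<^bsub>gr (DS J L) (p + q)\<^esub> act (DS J L) p q a w"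
      unfolding DS_simps by (intro restrict_ext) (simp add: c[OF v] c[OF w] addhom_add[OF graded_module_derivation.act_hom[OF g a refl]])
  next
    fix p q a b v assume a: "a \<in> carrier (gr At p)" and b: "b \<in> carrier (gr At p)" and v: "v \<in> carrier (gr (DS J L) q)"
    show "act (DS J L) p q (a \<oplus>\<^bsub>gr At p\<^esub> b) v = act (DS J L) p q a v \<oplus>\<^bsub>gr (DS J L) (p + q)\<^esub> act (DS J L) p q b v"
      unfolding DS_simps by (intro restrict_ext)
        (simp add: c[OF v] a b addhom_add[OF graded_module_derivation.act_hom_left[OF g graded_module_derivation.ab[OF graded_module_derivation_axioms] c[OF v] refl]])
  next
    fix p q a v r assume a: "a \<in> carrier (gr At p)" and v: "v \<in> carrier (gr (DS J L) q)" and r: "r \<in> carrier (pser k)"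
    show "act (DS J L) p q a (r \<odot>\<^bsub>gr (DS J L) q\<^esub> v) = r \<odot>\<^bsub>gr (DS J L) (p + q)\<^esub> act (DS J L) p q a v"
      unfolding DS_simps by (intro restrict_ext) (simp add: graded_module_derivation.act_smult[OF g a c[OF v] r refl])
    show "act (DS J L) p q (r \<odot>\<^bsub>gr At p\<^esub> a) v = r \<odot>\<^bsub>gr (DS J L) (p + q)\<^esub> act (DS J L) p q a v"
      unfolding DS_simps by (intro restrict_ext) (simp add: graded_module_derivation.act_smult_left[OF g a c[OF v] r refl])
  next
    fix p q s a b v assume a: "a \<in> carrier (gr At p)" and b: "b \<in> carrier (gr At q)" and v: "v \<in> carrier (gr (DS J L) s)"
    show "act (DS J L) p (q + s) a (act (DS J L) q s b v) = act (DS J L) (p + q) s (act At p q a b) v"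
      unfolding DS_simps by (intro restrict_ext) (simp add: graded_module_derivation.act_act[OF g a b c[OF v] refl refl])
  next
    fix n v assume v: "v \<in> carrier (gr (DS J L) n)"
    show "act (DS J L) 0 n (unit At) v = v"
      unfolding DS_simps by (rule DS_eqI[OF v]) (simp add: graded_module_derivation.act_unit[OF g c[OF v]])
    { fix w assume w: "w \<in> carrier (gr (DS J L) n)"
      show "dif (DS J L) n (v \<oplus>\<^bsub>gr (DS J L) n\<^esub> w) = dif (DS J L) n v \<oplus>\<^bsub>gr (DS J L) (n + 1)\<^esub> dif (DS J L) n w"
        unfolding DS_simps by (intro restrict_ext) (simp add: c[OF v] c[OF w] addhom_add[OF graded_module_derivation.dif_hom[OF g refl]]) }
    fix r assume r: "r \<in> carrier (pser k)"
    show "dif (DS J L) n (r \<odot>\<^bsub>gr (DS J L) n\<^esub> v) = r \<odot>\<^bsub>gr (DS J L) (n + 1)\<^esub> dif (DS J L) n v"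
      unfolding DS_simps by (intro restrict_ext) (simp add: graded_module_derivation.dif_smult[OF g c[OF v] r refl])
  next
    fix p q a v assume a: "a \<in> carrier (gr At p)" and v: "v \<in> carrier (gr (DS J L) q)"
    have "act (DS J L) p (q + 1) a (dif (DS J L) q v) \<in> carrier (gr (DS J L) (p + q + 1))"
      using acl[OF a dc[OF v]] by (simp add: add.assoc)
    from ps[OF this] have e: "psgn (gr (DS J L) (p + q + 1)) p (act (DS J L) p (q + 1) a (dif (DS J L) q v)) =
      (\<lambda>j\<in>J. psgn (gr (L j) (p + q + 1)) p (act (L j) p (q + 1) a (dif (L j) q (v j))))"
      by (simp add: DS_simps cong: restrict_cong)
    show "dif (DS J L) (p + q) (act (DS J L) p q a v) = act (DS J L) (p + 1) q (dif At p a) v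
            \<oplus>\<^bsub>gr (DS J L) (p + q + 1)\<^esub> psgn (gr (DS J L) (p + q + 1)) p (act (DS J L) p (q + 1) a (dif (DS J L) q v))"
      unfolding e unfolding DS_simps by (intro restrict_ext) (simp add: graded_module_derivation.dif_act[OF g a c[OF v]])
  qed assumption+
  show ?thesis
  proof (rule cdg_moduleI[OF cdg_algebra_axioms G])
    fix n v assume v: "v \<in> carrier (gr (DS J L) n)"
    show "dif (DS J L) (n + 1) (dif (DS J L) n v) = act (DS J L) 2 n (curv At) v"
      unfolding DS_simps by (intro restrict_ext) (simp add: cdg_module.dif_dif_module[OF L c[OF v]])
  qed
qed

lemma torsion_DS:
  assumes "\<And>j. j \<in> J \<Longrightarrow> torsion k (L j)"
  shows "torsion k (DS J L)"
  unfolding torsion_def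
proof (intro allI ballI)
  fix n v assume v: "v \<in> carrier (gr (DS J L) n)"
  have "\<exists>i. v j \<in> K (L j) i n" if "j \<in> J" for j
    using assms[OF that] v that unfolding torsion_def K_in by (auto simp: DS_simps)
  then obtain i where i: "\<And>j. j \<in> J \<Longrightarrow> v j \<in> K (L j) (i j) n" by metis
  define S where "S = {j \<in> J. v j \<noteq> \<zero>\<^bsub>gr (L j) n\<^esub>}"
  have S: "finite S" using v by (simp add: DS_simps S_def)
  \<comment> \<open>One exponent kills all components because only finitely many are nonzero;
    inserting \<open>0\<close> covers empty support.\<close>
  define N where "N = Max (insert 0 (i ` S))"
  have "v j \<in> K (L j) N n" if j: "j \<in> J" for j
  proof (cases "j \<in> S")
    case True
    then have "i j \<le> N" unfolding N_def using S by (intro Max_ge) auto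
    then show ?thesis using K_mono[OF L[OF j] i[OF j]] by blast
  next
    case False
    then show ?thesis using K_zero[OF L[OF j]] j by (simp add: S_def)
  qed
  then have "tpow k N \<odot>\<^bsub>gr (DS J L) n\<^esub> v = \<zero>\<^bsub>gr (DS J L) n\<^esub>"
    unfolding DS_simps by (intro restrict_ext) (simp add: K_in)
  then show "\<exists>i. tpow k i \<odot>\<^bsub>gr (DS J L) n\<^esub> v = \<zero>\<^bsub>gr (DS J L) n\<^esub>" by blast
qed

lemma DS_proj: "j \<in> J \<Longrightarrow> cmap (DS J L) (L j) (\<lambda>n v. v j)"
  by (rule cmapI) (simp_all add: DS_simps)

definition inj_DS where "inj_DS j n x = (\<lambda>i\<in>J. if i = j then x else \<zero>\<^bsub>gr (L i) n\<^esub>)"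

lemma inj_DS: assumes j: "j \<in> J" shows "cmap (L j) (DS J L) (inj_DS j)"
proof (rule cmapI)
  have g: "graded_module_derivation (pser k) At (L j)" if "j \<in> J" for j by (rule md_gmd[OF L[OF that]])
  fix n x assume x: "x \<in> carrier (gr (L j) n)"
  have "{i \<in> J. inj_DS j n x i \<noteq> \<zero>\<^bsub>gr (L i) n\<^esub>} \<subseteq> {j}" by (auto simp: inj_DS_def)
  then have "finite {i \<in> J. inj_DS j n x i \<noteq> \<zero>\<^bsub>gr (L i) n\<^esub>}" by (rule finite_subset) simp
  then show "inj_DS j n x \<in> carrier (gr (DS J L) n)"
    using x zero_cl[OF L] unfolding DS_simps(1) by (simp add: inj_DS_def)
  { fix y assume y: "y \<in> carrier (gr (L j) n)"
    show "inj_DS j n (x \<oplus>\<^bsub>gr (L j) n\<^esub> y) = inj_DS j n x \<oplus>\<^bsub>gr (DS J L) n\<^esub> inj_DS j n y"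
      unfolding DS_simps inj_DS_def
      by (intro restrict_ext) (simp add: zero_cl[OF L] md_l_zero[OF L]) }
  { fix p a assume a: "a \<in> carrier (gr At p)"
    show "inj_DS j (p + n) (act (L j) p n a x) = act (DS J L) p n a (inj_DS j n x)"
      unfolding DS_simps inj_DS_def
      by (intro restrict_ext) (simp add: addhom_zero[OF graded_module_derivation.act_hom[OF g a refl]]) }
  show "inj_DS j (n + 1) (dif (L j) n x) = dif (DS J L) n (inj_DS j n x)"
    unfolding DS_simps inj_DS_def
    by (intro restrict_ext) (simp add: dif_lin'(4)[OF L refl])
qed

context
  fixes P :: "('k, 'a, 'p) tmod" and f
  assumes P: "md P" and f: "\<And>j. j \<in> J \<Longrightarrow> cmap (L j) P (f j)"
begin

definition sum_DS where "sum_DS n v = finsum (gr P n) (\<lambda>j. f j n (v j)) {j \<in> J. v j \<noteq> \<zero>\<^bsub>gr (L j) n\<^esub>}"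

text \<open>Supports change under the operations, so sums are compared over one finite set
  containing all the supports involved.\<close>

lemma sum_DS_eq:
  assumes v: "v \<in> carrier (gr (DS J L) n)" and S: "finite S" "S \<subseteq> J" "{j \<in> J. v j \<noteq> \<zero>\<^bsub>gr (L j) n\<^esub>} \<subseteq> S"
  shows "sum_DS n v = finsum (gr P n) (\<lambda>j. f j n (v j)) S"
proof -
  interpret abelian_group "gr P n" by (rule md_ab[OF P])
  show ?thesis unfolding sum_DS_def
    using S v cmap_lin(4)[OF L P f] cmap_cl[OF L P f]
    by (intro add.finprod_mono_neutral_cong_left) (auto simp: DS_simps)
qed

lemma sum_DS: "cmap (DS J L) P sum_DS"
proof (rule cmapI)
  fix n v assume v: "v \<in> carrier (gr (DS J L) n)"
  define S where "S = {j \<in> J. v j \<noteq> \<zero>\<^bsub>gr (L j) n\<^esub>}"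
  have S: "finite S" "S \<subseteq> J" using v by (auto simp: S_def DS_simps)
  have vc: "v j \<in> carrier (gr (L j) n)" if "j \<in> J" for j using v that by (simp add: DS_simps)
  have fc: "(\<lambda>j. f j n (v j)) \<in> S \<rightarrow> carrier (gr P n)" using S vc cmap_cl[OF L P f] by auto
  interpret abelian_group "gr P n" by (rule md_ab[OF P])
  show "sum_DS n v \<in> carrier (gr P n)" unfolding sum_DS_def S_def[symmetric] by (rule finsum_closed[OF fc])
  have g: "graded_module_derivation (pser k) At P" by (rule md_gmd[OF P])
  { fix p a assume a: "a \<in> carrier (gr At p)"
    have gj: "graded_module_derivation (pser k) At (L j)" if "j \<in> J" for j by (rule md_gmd[OF L[OF that]])
    have av: "act (DS J L) p n a v \<in> carrier (gr (DS J L) (p + n))"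
      by (rule graded_module_derivation.act_closed[OF md_gmd[OF md_DS] a v refl])
    have "{j \<in> J. act (DS J L) p n a v j \<noteq> \<zero>\<^bsub>gr (L j) (p + n)\<^esub>} \<subseteq> S"
      using addhom_zero[OF graded_module_derivation.act_hom[OF gj a refl]] by (auto simp: S_def DS_simps)
    then have "sum_DS (p + n) (act (DS J L) p n a v) = finsum (gr P (p + n)) (\<lambda>j. f j (p + n) (act (DS J L) p n a v j)) S"
      by (rule sum_DS_eq[OF av S])
    also have "\<dots> = finsum (gr P (p + n)) (\<lambda>j. act P p n a (f j n (v j))) S"
    proof (rule abelian_monoid.finsum_cong'[OF abelian_group.axioms(1)[OF md_ab[OF P]] refl])
      show "(\<lambda>j. act P p n a (f j n (v j))) \<in> S \<rightarrow> carrier (gr P (p + n))"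
        using fc graded_module_derivation.act_closed[OF g a _ refl] by auto
      fix j assume "j \<in> S"
      then show "f j (p + n) (act (DS J L) p n a v j) = act P p n a (f j n (v j))"
        using S vc cmap_act[OF L P f a _ refl] by (auto simp: DS_simps)
    qed
    also have "\<dots> = act P p n a (sum_DS n v)"
      unfolding sum_DS_def S_def[symmetric] by (rule addhom_finsum[OF graded_module_derivation.act_hom[OF g a refl] S(1) fc, symmetric])
    finally show "sum_DS (p + n) (act (DS J L) p n a v) = act P p n a (sum_DS n v)" . }
  { have dv: "dif (DS J L) n v \<in> carrier (gr (DS J L) (n + 1))" by (rule dif_cl[OF md_DS v refl])
    have "{j \<in> J. dif (DS J L) n v j \<noteq> \<zero>\<^bsub>gr (L j) (n + 1)\<^esub>} \<subseteq> S"
      using dif_lin'(4)[OF L refl] by (auto simp: S_def DS_simps)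
    then have "sum_DS (n + 1) (dif (DS J L) n v) = finsum (gr P (n + 1)) (\<lambda>j. f j (n + 1) (dif (DS J L) n v j)) S"
      by (rule sum_DS_eq[OF dv S])
    also have "\<dots> = finsum (gr P (n + 1)) (\<lambda>j. dif P n (f j n (v j))) S"
    proof (rule abelian_monoid.finsum_cong'[OF abelian_group.axioms(1)[OF md_ab[OF P]] refl])
      show "(\<lambda>j. dif P n (f j n (v j))) \<in> S \<rightarrow> carrier (gr P (n + 1))"
        using fc dif_cl[OF P _ refl] by auto
      fix j assume "j \<in> S"
      then show "f j (n + 1) (dif (DS J L) n v j) = dif P n (f j n (v j))"
        using S vc cmap_dif[OF L P f _ refl] by (auto simp: DS_simps)
    qed
    also have "\<dots> = dif P n (sum_DS n v)"
      unfolding sum_DS_def S_def[symmetric] by (rule addhom_finsum[OF graded_module_derivation.dif_hom[OF g refl] S(1) fc, symmetric])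
    finally show "sum_DS (n + 1) (dif (DS J L) n v) = dif P n (sum_DS n v)" . }
  fix w assume w: "w \<in> carrier (gr (DS J L) n)"
  define T where "T = S \<union> {j \<in> J. w j \<noteq> \<zero>\<^bsub>gr (L j) n\<^esub>}"
  have T: "finite T" "T \<subseteq> J" using w S by (auto simp: T_def DS_simps)
  have wc: "w j \<in> carrier (gr (L j) n)" if "j \<in> J" for j using w that by (simp add: DS_simps)
  have vw: "v \<oplus>\<^bsub>gr (DS J L) n\<^esub> w \<in> carrier (gr (DS J L) n)" by (rule add_cl[OF md_DS v w])
  have "{j \<in> J. (v \<oplus>\<^bsub>gr (DS J L) n\<^esub> w) j \<noteq> \<zero>\<^bsub>gr (L j) n\<^esub>} \<subseteq> T"
    using md_l_zero[OF L] zero_cl[OF L] by (auto simp: DS_simps T_def S_def)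
  then have "sum_DS n (v \<oplus>\<^bsub>gr (DS J L) n\<^esub> w) = finsum (gr P n) (\<lambda>j. f j n ((v \<oplus>\<^bsub>gr (DS J L) n\<^esub> w) j)) T"
    by (rule sum_DS_eq[OF vw T])
  also have "\<dots> = finsum (gr P n) (\<lambda>j. f j n (v j) \<oplus>\<^bsub>gr P n\<^esub> f j n (w j)) T"
    using T vc wc cmap_lin(1)[OF L P f] cmap_cl[OF L P f] by (intro finsum_cong') (auto simp: DS_simps)
  also have "\<dots> = finsum (gr P n) (\<lambda>j. f j n (v j)) T \<oplus>\<^bsub>gr P n\<^esub> finsum (gr P n) (\<lambda>j. f j n (w j)) T"
    using T vc wc cmap_cl[OF L P f] by (intro finsum_addf) auto
  also have "\<dots> = sum_DS n v \<oplus>\<^bsub>gr P n\<^esub> sum_DS n w"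
    using sum_DS_eq[OF v T] sum_DS_eq[OF w T] by (simp add: T_def S_def)
  finally show "sum_DS n (v \<oplus>\<^bsub>gr (DS J L) n\<^esub> w) = sum_DS n v \<oplus>\<^bsub>gr P n\<^esub> sum_DS n w" .
qed

lemma sum_inj_DS: "j \<in> J \<Longrightarrow> x \<in> carrier (gr (L j) n) \<Longrightarrow> sum_DS n (inj_DS j n x) = f j n x"
proof -
  assume j: "j \<in> J" and x: "x \<in> carrier (gr (L j) n)"
  interpret abelian_group "gr P n" by (rule md_ab[OF P])
  have "sum_DS n (inj_DS j n x) = finsum (gr P n) (\<lambda>i. f i n (inj_DS j n x i)) {j}"
    using j by (intro sum_DS_eq[OF cmap_cl[OF L[OF j] md_DS inj_DS[OF j] x]]) (auto simp: inj_DS_def)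
  also have "\<dots> = f j n x" using cmap_cl[OF L[OF j] P f[OF j] x] j by (simp add: inj_DS_def)
  finally show ?thesis .
qed

definition "cofib = cone (DS J L) P sum_DS"
definition "cofib_map = (\<lambda>n x. (x, \<zero>\<^bsub>gr (DS J L) (n + 1)\<^esub>))"

lemmas cofib_simps = cone_simps[OF md_DS P sum_DS, folded cofib_def]

lemma md_cofib: "md cofib"
  unfolding cofib_def by (rule md_cone[OF md_DS P sum_DS])

lemma torsion_cofib: "\<lbrakk>torsion k P; \<And>j. j \<in> J \<Longrightarrow> torsion k (L j)\<rbrakk> \<Longrightarrow> torsion k cofib"
  unfolding cofib_def by (intro torsion_cone[OF md_DS P sum_DS] torsion_DS)

lemma cofib_cmap: "cmap P cofib cofib_map"
proof (rule cmapI)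
  note z = zero_cl[OF md_DS] md_l_zero[OF md_DS] md_neg_zero[OF md_DS]
    md_psgn_zero[OF md_DS]
  fix n x assume x: "x \<in> carrier (gr P n)"
  show "cofib_map n x \<in> carrier (gr cofib n)" using x by (simp add: cofib_map_def cofib_simps z)
  { fix y assume y: "y \<in> carrier (gr P n)"
    show "cofib_map n (x \<oplus>\<^bsub>gr P n\<^esub> y) = cofib_map n x \<oplus>\<^bsub>gr cofib n\<^esub> cofib_map n y" by (simp add: cofib_map_def cofib_simps z) }
  { fix p b assume b: "b \<in> carrier (gr At p)"
    have "act (DS J L) p (n + 1) b \<zero>\<^bsub>gr (DS J L) (n + 1)\<^esub> = \<zero>\<^bsub>gr (DS J L) (p + n + 1)\<^esub>"
      by (rule addhom_zero[OF graded_module_derivation.act_hom[OF md_gmd[OF md_DS] b]]) simp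
    then show "cofib_map (p + n) (act P p n b x) = act cofib p n b (cofib_map n x)" by (simp add: cofib_map_def cofib_simps z) }
  have "dif (DS J L) (n + 1) \<zero>\<^bsub>gr (DS J L) (n + 1)\<^esub> = \<zero>\<^bsub>gr (DS J L) (n + 1 + 1)\<^esub>" by (rule dif_lin'(4)[OF md_DS refl])
  then show "cofib_map (n + 1) (dif P n x) = dif cofib n (cofib_map n x)"
    using cmap_lin(4)[OF md_DS P sum_DS] dif_cl[OF P x refl]
      md_r_zero[OF P]
    unfolding cofib_map_def cofib_simps by (simp add: z)
qed

text \<open>The null-homotopy includes \<open>L j\<close> into the shifted direct sum inside the
  cone. The cone differential turns it into \<open>f j\<close> in the \<open>P\<close>-part, and the
  terms in the direct sum cancel.\<close>

lemma cofib_null: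
  assumes j: "j \<in> J"
  shows "homotopic (L j) cofib (\<lambda>n x. cofib_map n (f j n x)) (\<lambda>n x. \<zero>\<^bsub>gr cofib n\<^esub>)"
proof -
  define h where "h = (\<lambda>n x. (\<zero>\<^bsub>gr P (n - 1)\<^esub>, inj_DS j n x))"
  note z = zero_cl[OF P] md_l_zero[OF P] md_psgn_zero[OF P]
     md_l_zero[OF md_DS]
  note kc = cmap_cl[OF L[OF j] md_DS inj_DS[OF j]]
  have "lmap (- 1) (L j) cofib h"
    unfolding lmap_def
  proof (intro conjI allI ballI)
    fix n x assume x: "x \<in> carrier (gr (L j) n)"
    show "h n x \<in> carrier (gr cofib (n + - 1))" using kc[OF x] by (simp add: h_def cofib_simps z)
    { fix y assume y: "y \<in> carrier (gr (L j) n)"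
      show "h n (x \<oplus>\<^bsub>gr (L j) n\<^esub> y) = h n x \<oplus>\<^bsub>gr cofib (n + - 1)\<^esub> h n y"
        using cmap_lin(1)[OF L[OF j] md_DS inj_DS[OF j] x y] by (simp add: h_def cofib_simps z) }
    fix p a assume a: "a \<in> carrier (gr At p)"
    have 1: "act P p (n - 1) a \<zero>\<^bsub>gr P (n - 1)\<^esub> = \<zero>\<^bsub>gr P (p + n - 1)\<^esub>"
      by (rule addhom_zero[OF graded_module_derivation.act_hom[OF md_gmd[OF P] a]]) simp
    have 2: "act (DS J L) p n a (inj_DS j n x) \<in> carrier (gr (DS J L) (p + n))"
      by (rule graded_module_derivation.act_closed[OF md_gmd[OF md_DS] a kc[OF x] refl])
    have gr: "gr cofib (p + n - 1) = dsum_module (gr P (p + n - 1)) (gr (DS J L) (p + n))"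
      using cone_gr[OF md_DS P sum_DS, of "p + n - 1"] by (simp add: cofib_def)
    have i: "n + - 1 = n - 1" "p + n + - 1 = p + n - 1" "n - 1 + 1 = n" "p + (n - 1) + 1 = p + n" by simp_all
    show "h (p + n) (act (L j) p n a x) = psgn (gr cofib (p + n + - 1)) (- 1 * p) (act cofib p (n + - 1) a (h n x))"
      unfolding h_def i cofib_simps gr cmap_act[OF L[OF j] md_DS inj_DS[OF j] a x refl] 1
      using dsum_psgn[OF md_module[OF P] md_module[OF md_DS] zero_cl[OF P] md_psgn_closed[OF md_DS 2]]
        md_psgn_psgn[OF md_DS 2] by (simp add: z) (simp add: psgn_def)
  qed
  moreover have "cofib_map n (f j n x) = \<zero>\<^bsub>gr cofib n\<^esub> \<oplus>\<^bsub>gr cofib n\<^esub> null_map (L j) cofib h n x"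
    if x: "x \<in> carrier (gr (L j) n)" for n x
  proof -
    have d: "dif (DS J L) n (inj_DS j n x) \<in> carrier (gr (DS J L) (n + 1))" by (rule dif_cl[OF md_DS kc[OF x] refl])
    have fx: "f j n x \<in> carrier (gr P n)" by (rule cmap_cl[OF L[OF j] P f[OF j] x])
    have i: "n - 1 + 1 = n" "n + 1 - 1 = n" by simp_all
    have "dif P (n - 1) \<zero>\<^bsub>gr P (n - 1)\<^esub> = \<zero>\<^bsub>gr P n\<^esub>" by (rule dif_lin'(4)[OF P]) simp
    then have "null_map (L j) cofib h n x = (f j n x \<oplus>\<^bsub>gr P n\<^esub> \<zero>\<^bsub>gr P n\<^esub>, \<ominus>\<^bsub>gr (DS J L) (n + 1)\<^esub> dif (DS J L) n (inj_DS j n x) \<oplus>\<^bsub>gr (DS J L) (n + 1)\<^esub> dif (DS J L) n (inj_DS j n x))"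
      unfolding null_map_def h_def cofib_simps i cmap_dif[OF L[OF j] md_DS inj_DS[OF j] x refl]
      using sum_inj_DS[OF j x] fx by (simp add: z cofib_simps)
    then show ?thesis using fx d md_l_neg[OF md_DS d] md_r_zero[OF P]
      by (simp add: cofib_simps cofib_map_def z zero_cl[OF md_DS])
  qed
  ultimately show ?thesis unfolding homotopic_def by blast
qed

text \<open>This is the source of compactness. A primitive in the cone has two components
  \<open>b\<close>, \<open>b'\<close> in the direct sum; they form a cycle there and have finite
  support, so up to a boundary \<open>z\<close> is a sum of images of cycles from finitely many
  \<open>L j\<close>.\<close>

lemma cofib_exact:
  assumes z: "z \<in> EZ i m P" and b: "Ef cofib_map m z \<in> EB i m cofib"
  shows "\<exists>S w. finite S \<and> S \<subseteq> J \<and> (\<forall>j\<in>S. w j \<in> EZ i m (L j)) \<and>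
    z \<ominus>\<^bsub>EG P m\<^esub> finsum (EG P m) (\<lambda>j. Ef (f j) m (w j)) S \<in> EB i m P"
proof -
  obtain x x' where xx: "z = (x, x')" by (cases z)
  have i: "m + 1 + 1 = m + 2" by simp
  note li = md_lincomb_intros[OF md_DS] md_lincomb_intros[OF P]
  have x: "x \<in> carrier (gr P (m + 1))" "x' \<in> carrier (gr P m)" using EZ_carr[OF z] by (auto simp: xx EG_simps)
  have "bdr i m cofib (x, \<zero>\<^bsub>gr (DS J L) (m + 2)\<^esub>) (x', \<zero>\<^bsub>gr (DS J L) (m + 1)\<^esub>)"
    using b by (simp add: EB_def Ef_def xx cofib_map_def i)
  then obtain a b a' b' where K: "a\<in>K P (Suc i) m" "b\<in>K (DS J L) (Suc i) (m + 1)" "a'\<in>K P i (m - 1)" "b'\<in>K (DS J L) i m"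
    and e: "x = dif P m a \<oplus>\<^bsub>gr P (m + 1)\<^esub> sum_DS (m + 1) b \<oplus>\<^bsub>gr P (m + 1)\<^esub> cta P (m - 1) a'"
     "\<zero>\<^bsub>gr (DS J L) (m + 2)\<^esub> = \<ominus>\<^bsub>gr (DS J L) (m + 2)\<^esub> dif (DS J L) (m + 1) b \<oplus>\<^bsub>gr (DS J L) (m + 2)\<^esub> cta (DS J L) m b'"
     "x' = dif P (m - 1) a' \<oplus>\<^bsub>gr P m\<^esub> sum_DS m b' \<oplus>\<^bsub>gr P m\<^esub> tm P m a"
     "\<zero>\<^bsub>gr (DS J L) (m + 1)\<^esub> = \<ominus>\<^bsub>gr (DS J L) (m + 1)\<^esub> dif (DS J L) m b' \<oplus>\<^bsub>gr (DS J L) (m + 1)\<^esub> tm (DS J L) (m + 1) b"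
    unfolding cofib_def bdr_cone[OF md_DS P sum_DS] by blast
  note c[simp] = K[THEN K_carr]
  have j: "1 + m = m + 1" "2 + m = m + 2" by simp_all
  note simps = module_cl[OF md_DS] module_cl[OF P] cmap_cl[OF md_DS P sum_DS] i j
  have "dif (DS J L) (m + 1) b = dif (DS J L) (m + 1) b \<oplus>\<^bsub>gr (DS J L) (m + 2)\<^esub> \<zero>\<^bsub>gr (DS J L) (m + 2)\<^esub>"
    by (intro lincomb_unique'[OF md_DS, of "m + 2"]) (rule li | assumption | simp add: simps; fail)+
  also have "\<dots> = cta (DS J L) m b'"
    unfolding e(2) by (intro lincomb_unique'[OF md_DS, of "m + 2"]) (rule li | assumption | simp add: simps; fail)+
  finally have b1: "dif (DS J L) (m + 1) b = cta (DS J L) m b'" .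
  have "dif (DS J L) m b' = dif (DS J L) m b' \<oplus>\<^bsub>gr (DS J L) (m + 1)\<^esub> \<zero>\<^bsub>gr (DS J L) (m + 1)\<^esub>"
    by (intro lincomb_unique'[OF md_DS, of "m + 1"]) (rule li | assumption | simp add: simps; fail)+
  also have "\<dots> = tm (DS J L) (m + 1) b"
    unfolding e(4) by (intro lincomb_unique'[OF md_DS, of "m + 1"]) (rule li | assumption | simp add: simps; fail)+
  finally have b2: "dif (DS J L) m b' = tm (DS J L) (m + 1) b" .
  have bb: "(b, b') \<in> EZ i m (DS J L)" using K b1 b2 by (simp add: EZ_def cyc_def)
  \<comment> \<open>The union of both supports: outside of \<open>S\<close> the pair
    \<open>(b, b')\<close> vanishes.\<close>
  define S where "S = {j \<in> J. b j \<noteq> \<zero>\<^bsub>gr (L j) (m + 1)\<^esub>} \<union> {j \<in> J. b' j \<noteq> \<zero>\<^bsub>gr (L j) m\<^esub>}"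
  have S: "finite S" "S \<subseteq> J" using c(2,4) unfolding S_def DS_simps by auto
  define w where "w j = Ef (\<lambda>n v. v j) m (b, b')" for j
  have w: "w j \<in> EZ i m (L j)" if "j \<in> J" for j
    unfolding w_def by (rule Ef_EZ[OF md_DS L[OF that] DS_proj[OF that] bb])
  have fc: "f j (m + 1) (b j) \<in> carrier (gr P (m + 1))" "f j m (b' j) \<in> carrier (gr P m)" if "j \<in> S" for j
    using that S c(2,4) cmap_cl[OF L P f] unfolding DS_simps by auto
  have "finsum (EG P m) (\<lambda>j. Ef (f j) m (w j)) S = finsum (EG P m) (\<lambda>j. (f j (m + 1) (b j), f j m (b' j))) S"
    by (simp add: Ef_def w_def)
  also have "\<dots> = (finsum (gr P (m + 1)) (\<lambda>j. f j (m + 1) (b j)) S, finsum (gr P m) (\<lambda>j. f j m (b' j)) S)"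
    unfolding EG_def using fc by (intro finsum_dsum[OF md_module[OF P] md_module[OF P] S(1)]) auto
  also have "\<dots> = (sum_DS (m + 1) b, sum_DS m b')"
    using sum_DS_eq[OF c(2) S] sum_DS_eq[OF c(4) S] by (auto simp: S_def)
  finally have s: "finsum (EG P m) (\<lambda>j. Ef (f j) m (w j)) S = (sum_DS (m + 1) b, sum_DS m b')" .
  have "z \<ominus>\<^bsub>EG P m\<^esub> (sum_DS (m + 1) b, sum_DS m b') = (x \<ominus>\<^bsub>gr P (m + 1)\<^esub> sum_DS (m + 1) b, x' \<ominus>\<^bsub>gr P m\<^esub> sum_DS m b')"
    unfolding xx by (rule EG_minus[OF P]) (simp_all add: x simps)
  also have "x \<ominus>\<^bsub>gr P (m + 1)\<^esub> sum_DS (m + 1) b = dif P m a \<oplus>\<^bsub>gr P (m + 1)\<^esub> cta P (m - 1) a'"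
    unfolding e(1) by (intro lincomb_unique'[OF P, of "m + 1"]) (rule li | assumption | simp add: simps; fail)+
  also have "x' \<ominus>\<^bsub>gr P m\<^esub> sum_DS m b' = dif P (m - 1) a' \<oplus>\<^bsub>gr P m\<^esub> tm P m a"
    unfolding e(3) by (intro lincomb_unique'[OF P, of m]) (rule li | assumption | simp add: simps; fail)+
  finally have "z \<ominus>\<^bsub>EG P m\<^esub> (sum_DS (m + 1) b, sum_DS m b') \<in> EB i m P"
    using K by (auto simp: EB_def bdr_def)
  then show ?thesis using S w s by (intro exI[of _ S] exI[of _ w]) auto
qed

end

text \<open>An element is determined by its graph over its support, a finite subset of
  \<open>J\<close> times the universe, and an infinite set has no more finite subsets than
  elements.\<close>

lemma DS_card:
  assumes "infinite (UNIV :: 'm set)" "|J| \<le>o |UNIV :: 'm set|"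
  shows "|carrier (gr (DS J L) n)| \<le>o |UNIV :: 'm set|"
proof -
  define F where "F v = (\<lambda>j. (j, v j)) ` {j \<in> J. v j \<noteq> \<zero>\<^bsub>gr (L j) n\<^esub>}" for v
  have inj: "inj_on F (carrier (gr (DS J L) n))"
  proof (rule inj_onI)
    fix v w assume v: "v \<in> carrier (gr (DS J L) n)" and w: "w \<in> carrier (gr (DS J L) n)" and e: "F v = F w"
    have "v j = w j" if j: "j \<in> J" for j
    proof (rule ccontr)
      assume ne: "v j \<noteq> w j"
      then consider "v j \<noteq> \<zero>\<^bsub>gr (L j) n\<^esub>" | "w j \<noteq> \<zero>\<^bsub>gr (L j) n\<^esub>" by metis
      then show False
      proof cases
        case 1
        then have "(j, v j) \<in> F v" unfolding F_def using j by auto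
        then have "(j, v j) \<in> F w" by (simp only: e)
        then show False using ne by (auto simp: F_def)
      next
        case 2
        then have "(j, w j) \<in> F w" unfolding F_def using j by auto
        then have "(j, w j) \<in> F v" by (simp only: e)
        then show False using ne by (auto simp: F_def)
      qed
    qed
    then show "v = w" using v w unfolding DS_simps by (auto intro: extensionalityI)
  qed
  have "F ` carrier (gr (DS J L) n) \<subseteq> Fpow (J \<times> UNIV)"
    by (auto simp: F_def Fpow_def DS_simps)
  then have "|carrier (gr (DS J L) n)| \<le>o |Fpow (J \<times> (UNIV :: 'm set))|" using inj card_of_ordLeq by blast
  moreover have "|Fpow (J \<times> (UNIV :: 'm set))| \<le>o |UNIV :: 'm set|"
  proof (cases "finite (J \<times> (UNIV :: 'm set))")
    \<comment> \<open>Since the universe is infinite, this case means that \<open>J\<close> is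
      empty.\<close>
    case True
    then have "finite (Fpow (J \<times> (UNIV :: 'm set)))" by (simp add: Fpow_Pow_finite)
    then show ?thesis using assms(1) by (simp add: ordLess_imp_ordLeq finite_ordLess_infinite2)
  next
    case False
    then have "|Fpow (J \<times> (UNIV :: 'm set))| =o |J \<times> (UNIV :: 'm set)|" by (rule card_of_Fpow_infinite)
    moreover have "|J \<times> (UNIV :: 'm set)| \<le>o |UNIV :: 'm set|"
      using card_of_Times_ordLeq_infinite[OF assms(1) assms(2) ordLeq_refl[OF card_of_Card_order]] .
    ultimately show ?thesis by (rule ordIso_ordLeq_trans)
  qed
  ultimately show ?thesis by (rule ordLeq_transitive)
qed

end

text \<open>\<open>transport\<close> uses one \<open>e\<close> for all degrees, so the countable
  union of the components of the cofibre is embedded at once.\<close>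

lemma cofib_inj:
  fixes L :: "'u \<Rightarrow> ('k, 'a, 'u) tmod" and P :: "('k, 'a, 'u) tmod"
  assumes inf: "infinite (UNIV :: 'u set)" and L: "\<And>j. j \<in> J \<Longrightarrow> md (L j)"
  shows "\<exists>e :: 'u \<times> ('u \<Rightarrow> 'u) \<Rightarrow> 'u. \<forall>n. inj_on e (carrier (gr P n) \<times> carrier (gr (DS J L) (n + 1)))"
proof -
  let ?A = "\<lambda>n. carrier (gr P n) \<times> carrier (gr (DS J L) (n + 1))"
  have "|J| \<le>o |UNIV :: 'u set|" by (rule card_of_mono1) simp
  then have "|?A n| \<le>o |UNIV :: 'u set|" for n
    by (intro card_of_Times_ordLeq_infinite[OF inf] DS_card[OF L inf] card_of_mono1) simp_all
  moreover have "|UNIV :: int set| \<le>o |UNIV :: 'u set|"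
    using infinite_iff_card_of_countable[of "UNIV :: int set"] inf infinite_UNIV_int by auto
  ultimately have "|\<Union>n. ?A n| \<le>o |UNIV :: 'u set|"
    by (intro card_of_UNION_ordLeq_infinite[OF inf]) auto
  then have "\<exists>e :: 'u \<times> ('u \<Rightarrow> 'u) \<Rightarrow> 'u. inj_on e (\<Union>n. ?A n) \<and> e ` (\<Union>n. ?A n) \<subseteq> UNIV"
    unfolding card_of_ordLeq .
  then obtain e :: "'u \<times> ('u \<Rightarrow> 'u) \<Rightarrow> 'u" where e: "inj_on e (\<Union>n. ?A n)" by auto
  have "inj_on e (?A n)" for n by (rule inj_on_subset[OF e]) auto
  then show ?thesis by auto
qed

end

context tors
begin

section \<open>The modules \<open>\<Gamma>\<^sub>i\<close>\<close>

abbreviation "TI j n \<equiv> tideal k At j n"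

definition qc where "qc j n x = TI j n +>\<^bsub>gr At n\<^esub> x"

abbreviation "AQ j \<equiv> A_quot k At j"

lemma At_cl: "x \<in> carrier (gr At n) \<Longrightarrow> y \<in> carrier (gr At n) \<Longrightarrow> x \<oplus>\<^bsub>gr At n\<^esub> y \<in> carrier (gr At n)"
  "x \<in> carrier (gr At n) \<Longrightarrow> \<ominus>\<^bsub>gr At n\<^esub> x \<in> carrier (gr At n)"
  "\<zero>\<^bsub>gr At n\<^esub> \<in> carrier (gr At n)"
  "x \<in> carrier (gr At n) \<Longrightarrow> r \<in> carrier (pser k) \<Longrightarrow> r \<odot>\<^bsub>gr At n\<^esub> x \<in> carrier (gr At n)"
  using abelian_group.a_inv_closed[OF ab] abelian_monoid.a_closed[OF abelian_group.axioms(1)[OF ab]]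
    abelian_monoid.zero_closed[OF abelian_group.axioms(1)[OF ab]] module.smult_closed[OF gr_module] by blast+

lemma TI_subgroup: "additive_subgroup (TI j n) (gr At n)"
proof -
  interpret abelian_group "gr At n" by simp
  have h: "addhom (gr At n) (gr At n) (\<lambda>x. tpow k j \<odot>\<^bsub>gr At n\<^esub> x)" by (rule smult_hom) simp
  show ?thesis
    unfolding tideal_def
    by (intro additive_subgroup.intro add.subgroupI)
      (auto simp: At_cl addhom_neg[OF h, symmetric] addhom_add[OF h, symmetric] simp flip: a_inv_def)
qed

lemma TI_asub: "abelian_subgroup (TI j n) (gr At n)"
  by (rule abelian_subgroupI3[OF TI_subgroup]) simp

lemma TI_I: "x \<in> carrier (gr At n) \<Longrightarrow> tpow k j \<odot>\<^bsub>gr At n\<^esub> x \<in> TI j n"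
  by (simp add: tideal_def)

lemma qc_map:
  assumes "addhom (gr At n) (gr At m) \<phi>" "\<And>x. x \<in> carrier (gr At n) \<Longrightarrow> \<phi> (tpow k j \<odot>\<^bsub>gr At n\<^esub> x) \<in> TI l m" "x \<in> carrier (gr At n)"
  shows "coset_map (gr At m) (TI l m) \<phi> (qc j n x) = qc l m (\<phi> x)"
  unfolding qc_def by (rule coset_map_eq[OF assms(1) TI_subgroup TI_subgroup _ assms(3)]) (auto simp: tideal_def[of k At j] assms(2))

lemma AQ_simps:
  "carrier (gr (AQ j) n) = qc j n ` carrier (gr At n)"
  "\<zero>\<^bsub>gr (AQ j) n\<^esub> = qc j n \<zero>\<^bsub>gr At n\<^esub>"
  "\<lbrakk>x \<in> carrier (gr At n); y \<in> carrier (gr At n)\<rbrakk> \<Longrightarrow> qc j n x \<oplus>\<^bsub>gr (AQ j) n\<^esub> qc j n y = qc j n (x \<oplus>\<^bsub>gr At n\<^esub> y)"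
  "\<lbrakk>r \<in> carrier (pser k); x \<in> carrier (gr At n)\<rbrakk> \<Longrightarrow> r \<odot>\<^bsub>gr (AQ j) n\<^esub> qc j n x = qc j n (r \<odot>\<^bsub>gr At n\<^esub> x)"
  "\<lbrakk>a \<in> carrier (gr At p); x \<in> carrier (gr At q)\<rbrakk> \<Longrightarrow> act (AQ j) p q a (qc j q x) = qc j (p + q) (act At p q a x)"
  "x \<in> carrier (gr At n) \<Longrightarrow> dif (AQ j) n (qc j n x) = qc j (n + 1) (dif At n x)"
proof -
  interpret n: abelian_group "gr At n" by simp
  show "carrier (gr (AQ j) n) = qc j n ` carrier (gr At n)"
    by (auto simp: A_quot_def quot_def quot_module_def qc_def A_RCOSETS_def' cdgm.truncate_def)
  show "\<zero>\<^bsub>gr (AQ j) n\<^esub> = qc j n \<zero>\<^bsub>gr At n\<^esub>"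
    using n.a_coset_add_zero additive_subgroup.a_subset[OF TI_subgroup] by (simp add: A_quot_def quot_def quot_module_def qc_def)
  show "\<lbrakk>x \<in> carrier (gr At n); y \<in> carrier (gr At n)\<rbrakk> \<Longrightarrow> qc j n x \<oplus>\<^bsub>gr (AQ j) n\<^esub> qc j n y = qc j n (x \<oplus>\<^bsub>gr At n\<^esub> y)"
    using abelian_subgroup.a_rcos_sum[OF TI_asub] by (simp add: A_quot_def quot_def quot_module_def qc_def cdgm.truncate_def)
  have com: "s \<odot>\<^bsub>gr At m\<^esub> (r \<odot>\<^bsub>gr At m\<^esub> x) = r \<odot>\<^bsub>gr At m\<^esub> (s \<odot>\<^bsub>gr At m\<^esub> x)"
    if "r \<in> carrier (pser k)" "s \<in> carrier (pser k)" "x \<in> carrier (gr At m)" for r s x m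
    using that module.smult_assoc1[OF gr_module] m_comm by metis
  { assume r: "r \<in> carrier (pser k)" and x: "x \<in> carrier (gr At n)"
    have "coset_map (gr At n) (TI j n) (\<lambda>x. r \<odot>\<^bsub>gr At n\<^esub> x) (qc j n x) = qc j n (r \<odot>\<^bsub>gr At n\<^esub> x)"
      by (rule qc_map[OF smult_hom[OF r] _ x]) (simp add: com[OF tpow_closed r] TI_I[OF At_cl(4)] r)
    then show "r \<odot>\<^bsub>gr (AQ j) n\<^esub> qc j n x = qc j n (r \<odot>\<^bsub>gr At n\<^esub> x)"
      by (simp add: A_quot_def quot_def quot_module_def cdgm.truncate_def) }
  { assume a: "a \<in> carrier (gr At p)" and x: "x \<in> carrier (gr At q)"
    have "coset_map (gr At (p + q)) (TI j (p + q)) (act At p q a) (qc j q x) = qc j (p + q) (act At p q a x)"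
      by (rule qc_map[OF act_hom[OF a refl] _ x])
        (simp add: act_smult[OF a _ tpow_closed refl] TI_I[OF act_closed[OF a _ refl]])
    then show "act (AQ j) p q a (qc j q x) = qc j (p + q) (act At p q a x)"
      by (simp add: A_quot_def quot_def cdgm.truncate_def) }
  assume x: "x \<in> carrier (gr At n)"
  have "coset_map (gr At (n + 1)) (TI j (n + 1)) (dif At n) (qc j n x) = qc j (n + 1) (dif At n x)"
    by (rule qc_map[OF dif_hom[OF refl] _ x])
      (simp add: dif_smult[OF _ tpow_closed refl] TI_I[OF dif_closed[OF _ refl]])
  then show "dif (AQ j) n (qc j n x) = qc j (n + 1) (dif At n x)"
    by (simp add: A_quot_def quot_def cdgm.truncate_def)
qed

lemma gmd_AQ: "graded_module_derivation (pser k) At (AQ j)"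
  by (rule gmd_image(1)[OF graded_module_derivation_axioms graded_module_derivation_axioms, where \<pi>="qc j"])
    (simp_all add: AQ_simps)

lemma qc_hom: "addhom (gr At n) (gr (AQ j) n) (qc j n)"
  by (rule gmd_image(2)[OF graded_module_derivation_axioms graded_module_derivation_axioms, where \<pi>="qc j"])
    (simp_all add: AQ_simps)

lemma qc_zero_iff: "x \<in> carrier (gr At n) \<Longrightarrow> qc j n x = qc j n \<zero>\<^bsub>gr At n\<^esub> \<longleftrightarrow> x \<in> TI j n"
proof -
  assume x: "x \<in> carrier (gr At n)"
  interpret n: abelian_group "gr At n" by simp
  have "qc j n \<zero>\<^bsub>gr At n\<^esub> = TI j n"
    using n.a_coset_add_zero additive_subgroup.a_subset[OF TI_subgroup] by (simp add: qc_def)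
  then show ?thesis
    using abelian_subgroup.a_rcos_self[OF TI_asub x, of j] abelian_subgroup.a_rcos_const[OF TI_asub, of x j n] by (auto simp: qc_def)
qed

lemma qc_eq_iff:
  assumes "x \<in> carrier (gr At n)" "y \<in> carrier (gr At n)"
  shows "qc j n x = qc j n y \<longleftrightarrow> x \<ominus>\<^bsub>gr At n\<^esub> y \<in> TI j n"
proof -
  interpret q: abelian_group "gr (AQ j) n" by (rule graded_module_derivation.ab[OF gmd_AQ])
  interpret n: abelian_group "gr At n" by simp
  have "qc j n x = qc j n y \<longleftrightarrow> qc j n x \<ominus>\<^bsub>gr (AQ j) n\<^esub> qc j n y = \<zero>\<^bsub>gr (AQ j) n\<^esub>"
    using assms by (intro q.minus_eq_zero_iff[symmetric]) (auto simp: AQ_simps)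
  also have "\<dots> \<longleftrightarrow> qc j n (x \<ominus>\<^bsub>gr At n\<^esub> y) = qc j n \<zero>\<^bsub>gr At n\<^esub>"
    using addhom_minus[OF qc_hom] assms by (simp add: AQ_simps)
  also have "\<dots> \<longleftrightarrow> x \<ominus>\<^bsub>gr At n\<^esub> y \<in> TI j n" by (rule qc_zero_iff) (simp add: assms)
  finally show ?thesis .
qed

lemma qc_psgn: "x \<in> carrier (gr At n) \<Longrightarrow> psgn (gr (AQ j) n) p (qc j n x) = qc j n (psgn (gr At n) p x)"
  using addhom_psgn[OF qc_hom] by simp

context
  fixes i :: nat
begin

abbreviation "Gam \<equiv> Gamma k At ct i"

lemma t_map:
  assumes x: "x \<in> carrier (gr At n)"
  shows "coset_map (gr At n) (TI (i + 1) n) (\<lambda>x. tvar k \<odot>\<^bsub>gr At n\<^esub> x) (qc i n x) = qc (i + 1) n (tvar k \<odot>\<^bsub>gr At n\<^esub> x)"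
proof (rule qc_map[OF smult_hom[OF tvar_closed] _ x])
  fix x assume x: "x \<in> carrier (gr At n)"
  have "tvar k \<odot>\<^bsub>gr At n\<^esub> (tpow k i \<odot>\<^bsub>gr At n\<^esub> x) = tpow k (i + 1) \<odot>\<^bsub>gr At n\<^esub> x"
    using module.smult_assoc1[OF gr_module tvar_closed tpow_closed x, of i] m_comm[OF tvar_closed tpow_closed, of i] by (simp add: tpow_Suc)
  then show "tvar k \<odot>\<^bsub>gr At n\<^esub> (tpow k i \<odot>\<^bsub>gr At n\<^esub> x) \<in> TI (i + 1) n" using TI_I[OF x] by simp
qed

text \<open>\<open>t^(i+1) A_t\<close> lies in \<open>t^i A_t\<close>, so projection to the lower
  quotient and right multiplication by \<open>ct\<close> descend together.\<close>

lemma pi_ct: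
  assumes x: "x \<in> carrier (gr At n)"
  shows "coset_map (gr At (n + 2)) (TI i (n + 2)) (\<lambda>x. act At n 2 x ct) (qc (i + 1) n x) = qc i (n + 2) (act At n 2 x ct)"
proof (rule qc_map[OF act_hom_left[OF ab ct_closed refl] _ x])
  fix x assume x: "x \<in> carrier (gr At n)"
  have tx: "tvar k \<odot>\<^bsub>gr At n\<^esub> x \<in> carrier (gr At n)" by (rule At_cl(4)[OF x tvar_closed])
  have "act At n 2 (tpow k (i + 1) \<odot>\<^bsub>gr At n\<^esub> x) ct = tpow k i \<odot>\<^bsub>gr At (n + 2)\<^esub> act At n 2 (tvar k \<odot>\<^bsub>gr At n\<^esub> x) ct"
    using module.smult_assoc1[OF gr_module tpow_closed tvar_closed x, of i]
      act_smult_left[OF tx ct_closed tpow_closed refl, of i] by (simp add: tpow_Suc)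
  then show "act At n 2 (tpow k (i + 1) \<odot>\<^bsub>gr At n\<^esub> x) ct \<in> TI i (n + 2)"
    using TI_I[OF act_closed[OF tx ct_closed refl]] by simp
qed

lemma Gam_gr: "gr Gam n = dsum_module (gr (AQ (i + 1)) n) (gr (AQ i) (n + 1))"
  by (simp add: Gamma_def Let_def dsum_def shift_def)

lemma Gam_elem: "v \<in> carrier (gr Gam n) \<Longrightarrow> \<exists>x\<in>carrier (gr At n). \<exists>y\<in>carrier (gr At (n + 1)). v = (qc (i + 1) n x, qc i (n + 1) y)"
  unfolding Gam_gr by (auto simp: AQ_simps)

lemma Gam_cl: "x \<in> carrier (gr At n) \<Longrightarrow> y \<in> carrier (gr At (n + 1)) \<Longrightarrow> (qc (i + 1) n x, qc i (n + 1) y) \<in> carrier (gr Gam n)"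
  unfolding Gam_gr by (auto simp: AQ_simps)

lemma Gam_act:
  assumes a: "a \<in> carrier (gr At p)" and x: "x \<in> carrier (gr At n)" and y: "y \<in> carrier (gr At (n + 1))"
  shows "act Gam p n a (qc (i + 1) n x, qc i (n + 1) y) =
    (qc (i + 1) (p + n) (act At p n a x), qc i (p + n + 1) (psgn (gr At (p + n + 1)) p (act At p (n + 1) a y)))"
proof -
  have i: "p + (n + 1) = p + n + 1" by simp
  have "act At p (n + 1) a y \<in> carrier (gr At (p + n + 1))" by (rule act_closed[OF a y]) simp
  then show ?thesis
    using AQ_simps(5)[OF a x, of "i + 1"] AQ_simps(5)[OF a y, of i, unfolded i] qc_psgn
    by (simp add: Gamma_def Let_def dsum_def shift_def)
qed

lemma Gam_dif:
  assumes x: "x \<in> carrier (gr At n)" and y: "y \<in> carrier (gr At (n + 1))"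
  shows "dif Gam n (qc (i + 1) n x, qc i (n + 1) y) =
    (qc (i + 1) (n + 1) (dif At n x \<oplus>\<^bsub>gr At (n + 1)\<^esub> tvar k \<odot>\<^bsub>gr At (n + 1)\<^esub> y),
     qc i (n + 2) (\<ominus>\<^bsub>gr At (n + 2)\<^esub> dif At (n + 1) y \<oplus>\<^bsub>gr At (n + 2)\<^esub> act At n 2 x ct))"
proof -
  have c: "dif At n x \<in> carrier (gr At (n + 1))" "dif At (n + 1) y \<in> carrier (gr At (n + 2))" "act At n 2 x ct \<in> carrier (gr At (n + 2))"
    "tvar k \<odot>\<^bsub>gr At (n + 1)\<^esub> y \<in> carrier (gr At (n + 1))"
    by (rule dif_closed[OF x refl]) (rule dif_closed[OF y], simp, rule act_closed[OF x ct_closed refl], rule At_cl(4)[OF y tvar_closed])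
  have i: "n + 1 + 1 = n + 2" "2 + n = n + 2" "1 + n = n + 1" by simp_all
  have "dif (shift 1 (AQ i)) n (qc i (n + 1) y) = qc i (n + 2) (\<ominus>\<^bsub>gr At (n + 2)\<^esub> dif At (n + 1) y)"
    using AQ_simps(6)[OF y, of i] addhom_neg[OF qc_hom c(2)] by (simp add: shift_def psgn_def i)
  then show ?thesis
    using AQ_simps(6)[OF x, of "i + 1"] t_map[OF y] pi_ct[OF x] AQ_simps(3)[OF c(1,4), of "i + 1"] AQ_simps(3)[OF At_cl(2)[OF c(2)] c(3), of i]
    by (simp add: Gamma_def Let_def)
qed

text \<open>A twist of the direct sum by its two off-diagonal maps. Right multiplication by
  \<open>ct\<close> is linear for the left action, and the sign required of a twist is the one built
  into the action on the shifted summand.\<close>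

lemma gmd_Gam: "graded_module_derivation (pser k) At Gam"
proof -
  define \<theta> where "\<theta> = (\<lambda>n (\<alpha>, a). (coset_map (gr At (n + 1)) (TI (i + 1) (n + 1)) (\<lambda>x. tvar k \<odot>\<^bsub>gr At (n + 1)\<^esub> x) a,
     coset_map (gr At (n + 2)) (TI i (n + 2)) (\<lambda>x. act At n 2 x ct) \<alpha>))"
  have \<theta>: "\<theta> n (qc (i + 1) n x, qc i (n + 1) y) = (qc (i + 1) (n + 1) (tvar k \<odot>\<^bsub>gr At (n + 1)\<^esub> y), qc i (n + 2) (act At n 2 x ct))"
    if "x \<in> carrier (gr At n)" "y \<in> carrier (gr At (n + 1))" for n x y
    using t_map[OF that(2)] pi_ct[OF that(1)] by (simp add: \<theta>_def)
  have \<theta>': "\<theta> n (qc (Suc i) n x, qc i (n + 1) y) = (qc (Suc i) (n + 1) (tvar k \<odot>\<^bsub>gr At (n + 1)\<^esub> y), qc i (n + 2) (act At n 2 x ct))"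
    if "x \<in> carrier (gr At n)" "y \<in> carrier (gr At (n + 1))" for n x y
    using \<theta>[OF that] by simp
  let ?D = "dsum (AQ (i + 1)) (shift 1 (AQ i))"
  have D: "graded_module_derivation (pser k) At ?D"
    by (intro gmd_dsum gmd_shift gmd_AQ graded_module_derivation_axioms)
  have Dgr: "gr ?D n = gr Gam n" for n by (simp add: Gamma_def Let_def)
  have Dact: "act ?D = act Gam" by (simp add: Gamma_def Let_def)
  have j: "n + 1 + 1 = n + 2" for n :: int by simp
  have j2: "2 + n = n + 2" "1 + n = n + 1" for n :: int by simp_all
  have cl: "tvar k \<odot>\<^bsub>gr At (n + 1)\<^esub> y \<in> carrier (gr At (n + 1))" "act At n 2 x ct \<in> carrier (gr At (n + 2))"
    if "x \<in> carrier (gr At n)" "y \<in> carrier (gr At (n + 1))" for n x y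
    using At_cl(4)[OF that(2) tvar_closed] act_closed[OF that(1) ct_closed refl] by auto
  have "graded_module_derivation (pser k) At (?D\<lparr>dif := dif Gam\<rparr>)"
  proof (rule gmd_twist[OF D graded_module_derivation_axioms, where \<theta>=\<theta>])
    fix n show "\<theta> n \<in> lin_maps (pser k) (gr ?D n) (gr ?D (n + 1))"
    proof (rule lin_mapsI)
      fix v assume "v \<in> carrier (gr ?D n)"
      then obtain x y where v: "x \<in> carrier (gr At n)" "y \<in> carrier (gr At (n + 1))" "v = (qc (i + 1) n x, qc i (n + 1) y)"
        using Gam_elem unfolding Dgr by blast
      show "\<theta> n v \<in> carrier (gr ?D (n + 1))" unfolding Dgr v(3) \<theta>[OF v(1,2)]
        using Gam_cl[of _ "n + 1", unfolded j] cl[OF v(1,2)] by simp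
      { fix r assume r: "r \<in> carrier (pser k)"
        have "tvar k \<odot>\<^bsub>gr At (n + 1)\<^esub> (r \<odot>\<^bsub>gr At (n + 1)\<^esub> y) = r \<odot>\<^bsub>gr At (n + 1)\<^esub> (tvar k \<odot>\<^bsub>gr At (n + 1)\<^esub> y)"
          using r v(2) tvar_closed module.smult_assoc1[OF gr_module] m_comm by metis
        then show "\<theta> n (r \<odot>\<^bsub>gr ?D n\<^esub> v) = r \<odot>\<^bsub>gr ?D (n + 1)\<^esub> \<theta> n v"
          unfolding Dgr v(3) \<theta>[OF v(1,2)] unfolding Gam_gr j
          using v r cl[OF v(1,2)] by (simp add: AQ_simps \<theta>'[OF At_cl(4) At_cl(4)] act_smult_left[OF _ ct_closed _ refl]) }
      fix w assume "w \<in> carrier (gr ?D n)"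
      then obtain x' y' where w: "x' \<in> carrier (gr At n)" "y' \<in> carrier (gr At (n + 1))" "w = (qc (i + 1) n x', qc i (n + 1) y')"
        using Gam_elem unfolding Dgr by blast
      show "\<theta> n (v \<oplus>\<^bsub>gr ?D n\<^esub> w) = \<theta> n v \<oplus>\<^bsub>gr ?D (n + 1)\<^esub> \<theta> n w"
        unfolding Dgr v(3) w(3) \<theta>[OF v(1,2)] \<theta>[OF w(1,2)] unfolding Gam_gr j
        using v w cl[OF v(1,2)] cl[OF w(1,2)]
        by (simp add: AQ_simps \<theta>'[OF At_cl(1) At_cl(1)] addhom_add[OF act_hom_left[OF ab ct_closed refl]] addhom_add[OF smult_hom[OF tvar_closed]])
    qed
  next
    fix p q a v assume a: "a \<in> carrier (gr At p)" and "v \<in> carrier (gr ?D q)"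
    then obtain x y where v: "x \<in> carrier (gr At q)" "y \<in> carrier (gr At (q + 1))" "v = (qc (i + 1) q x, qc i (q + 1) y)"
      using Gam_elem unfolding Dgr by blast
    have ax: "act At p q a x \<in> carrier (gr At (p + q))" by (rule act_closed[OF a v(1) refl])
    have ay: "act At p (q + 1) a y \<in> carrier (gr At (p + q + 1))" by (rule act_closed[OF a v(2)]) simp
    have e2: "psgn (gr At m) p (psgn (gr At m) p u) = u" if "u \<in> carrier (gr At m)" for m u
      using that abelian_group.psgn_psgn[OF ab that] by (simp add: psgn_def)
    have k: "p + (q + 1) = p + q + 1" "q + 1 + 1 = q + 2" "p + q + 1 + 1 = p + q + 2" by simp_all
    have axc: "act At p (q + 2) a (act At q 2 x ct) = act At (p + q) 2 (act At p q a x) ct"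
      by (rule act_act[OF a v(1) ct_closed refl refl])
    have axc': "act At (p + q) 2 (act At p q a x) ct \<in> carrier (gr At (p + q + 2))" by (rule act_closed[OF ax ct_closed refl])
    have aty: "act At p (q + 1) a (tvar k \<odot>\<^bsub>gr At (q + 1)\<^esub> y) = tvar k \<odot>\<^bsub>gr At (p + q + 1)\<^esub> act At p (q + 1) a y"
      by (rule act_smult[OF a v(2) tvar_closed]) simp
    have L: "\<theta> (p + q) (act ?D p q a v) = (qc (i + 1) (p + q + 1) (tvar k \<odot>\<^bsub>gr At (p + q + 1)\<^esub> psgn (gr At (p + q + 1)) p (act At p (q + 1) a y)),
       qc i (p + q + 2) (act At (p + q) 2 (act At p q a x) ct))"
      unfolding v(3) Dact Gam_act[OF a v(1,2)] by (rule \<theta>[OF ax]) (simp add: ay abelian_group.psgn_closed[OF ab])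
    have "act ?D p (q + 1) a (\<theta> q v) = (qc (i + 1) (p + q + 1) (act At p (q + 1) a (tvar k \<odot>\<^bsub>gr At (q + 1)\<^esub> y)),
       qc i (p + q + 2) (psgn (gr At (p + q + 2)) p (act At p (q + 2) a (act At q 2 x ct))))"
      unfolding v(3) \<theta>[OF v(1,2)] Dact
      using Gam_act[OF a cl(1)[OF v(1,2)], of "act At q 2 x ct"] cl(2)[OF v(1,2)] by (simp add: k)
    moreover have "psgn (dsum_module (gr (AQ (i + 1)) (p + q + 1)) (gr (AQ i) (p + q + 2))) p
        (qc (i + 1) (p + q + 1) (tvar k \<odot>\<^bsub>gr At (p + q + 1)\<^esub> act At p (q + 1) a y),
         qc i (p + q + 2) (psgn (gr At (p + q + 2)) p (act At (p + q) 2 (act At p q a x) ct))) =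
       (qc (i + 1) (p + q + 1) (tvar k \<odot>\<^bsub>gr At (p + q + 1)\<^esub> psgn (gr At (p + q + 1)) p (act At p (q + 1) a y)),
       qc i (p + q + 2) (act At (p + q) 2 (act At p q a x) ct))"
      using axc' ay At_cl(4)[OF ay tvar_closed] addhom_psgn[OF smult_hom[OF tvar_closed] ay, of p]
      by (subst dsum_psgn[OF graded_module_derivation.gr_module[OF gmd_AQ] graded_module_derivation.gr_module[OF gmd_AQ]])
        (auto simp: AQ_simps qc_psgn abelian_group.psgn_closed[OF ab] e2)
    ultimately show "\<theta> (p + q) (act ?D p q a v) = psgn (gr ?D (p + q + 1)) p (act ?D p (q + 1) a (\<theta> q v))"
      unfolding L Dgr Gam_gr k aty axc by simp
  next
    fix n v assume "v \<in> carrier (gr ?D n)"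
    then obtain x y where v: "x \<in> carrier (gr At n)" "y \<in> carrier (gr At (n + 1))" "v = (qc (i + 1) n x, qc i (n + 1) y)"
      using Gam_elem unfolding Dgr by blast
    have c: "dif At n x \<in> carrier (gr At (n + 1))" "dif At (n + 1) y \<in> carrier (gr At (n + 2))"
      by (rule dif_closed[OF v(1) refl]) (rule dif_closed[OF v(2)], simp)
    have "dif ?D n v = (qc (i + 1) (n + 1) (dif At n x), qc i (n + 2) (\<ominus>\<^bsub>gr At (n + 2)\<^esub> dif At (n + 1) y))"
      unfolding v(3) using AQ_simps(6)[OF v(1), of "i + 1"] AQ_simps(6)[OF v(2), of i] addhom_neg[OF qc_hom c(2)]
      by (simp add: dsum_def shift_def psgn_def j j2)
    then show "dif Gam n v = dif ?D n v \<oplus>\<^bsub>gr ?D (n + 1)\<^esub> \<theta> n v"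
      unfolding Dgr v(3) \<theta>[OF v(1,2)] Gam_dif[OF v(1,2)] unfolding Gam_gr j
      using cl[OF v(1,2)] c At_cl(2) by (simp add: AQ_simps)
  qed
  moreover have "?D\<lparr>dif := dif Gam\<rparr> = Gam" by (simp add: Gamma_def Let_def)
  ultimately show ?thesis by simp
qed

end

end

section \<open>The two generators, and the linear maps they determine\<close>

context tors
begin

lemma At_neg_zero: "\<ominus>\<^bsub>gr At n\<^esub> \<zero>\<^bsub>gr At n\<^esub> = \<zero>\<^bsub>gr At n\<^esub>"
  by (rule abelian_group.neg_zero[OF ab])

definition gel where "gel i n x y = (qc (i + 1) n x, qc i (n + 1) y)"

text \<open>The generators have degrees \<open>0\<close> and \<open>-1\<close>, since the unit of
  \<open>A_(i-1)[1]\<close> sits in degree \<open>-1\<close>.\<close>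

definition g1 where "g1 i = gel i 0 (unit At) \<zero>\<^bsub>gr At 1\<^esub>"
definition g2 where "g2 i = gel i (- 1) \<zero>\<^bsub>gr At (- 1)\<^esub> (unit At)"

text \<open>The unit is idempotent, so the Leibniz rule reads
  \<open>d 1 = d 1 + d 1\<close>.\<close>

lemma dif_unit: "dif At 0 (unit At) = \<zero>\<^bsub>gr At 1\<^esub>"
proof -
  interpret a: abelian_group "gr At 1" by simp
  have d: "dif At 0 (unit At) \<in> carrier (gr At 1)" by (rule dif_closed[OF unit_closed]) simp
  have "dif At 0 (act At 0 0 (unit At) (unit At)) = act At 1 0 (dif At 0 (unit At)) (unit At) \<oplus>\<^bsub>gr At 1\<^esub> psgn (gr At 1) 0 (act At 0 1 (unit At) (dif At 0 (unit At)))"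
    by (rule dif_act'[OF unit_closed unit_closed]) simp_all
  then have "dif At 0 (unit At) = dif At 0 (unit At) \<oplus>\<^bsub>gr At 1\<^esub> dif At 0 (unit At)"
    using d by (simp add: act_unit unit_closed mult_unit psgn_def)
  then show ?thesis using d by (metis a.add.r_cancel_one)
qed

context
  fixes i :: nat
begin

lemma gel_elem: "v \<in> carrier (gr (Gam i) n) \<Longrightarrow> \<exists>x\<in>carrier (gr At n). \<exists>y\<in>carrier (gr At (n + 1)). v = gel i n x y"
  unfolding gel_def by (rule Gam_elem)

lemma gel_cl: "x \<in> carrier (gr At n) \<Longrightarrow> y \<in> carrier (gr At m) \<Longrightarrow> m = n + 1 \<Longrightarrow> gel i n x y \<in> carrier (gr (Gam i) n)"
  unfolding gel_def by (simp only: Gam_cl)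

lemma gel_act: "\<lbrakk>a \<in> carrier (gr At p); x \<in> carrier (gr At n); y \<in> carrier (gr At n'); n' = n + 1; m = p + n; m' = p + n + 1\<rbrakk> \<Longrightarrow>
    act (Gam i) p n a (gel i n x y) = gel i m (act At p n a x) (psgn (gr At m') p (act At p n' a y))"
  unfolding gel_def by (simp only: Gam_act)

lemma gel_dif: "\<lbrakk>x \<in> carrier (gr At n); y \<in> carrier (gr At m); m = n + 1; m' = n + 2\<rbrakk> \<Longrightarrow>
    dif (Gam i) n (gel i n x y) = gel i m (dif At n x \<oplus>\<^bsub>gr At m\<^esub> tvar k \<odot>\<^bsub>gr At m\<^esub> y)
      (\<ominus>\<^bsub>gr At m'\<^esub> dif At m y \<oplus>\<^bsub>gr At m'\<^esub> act At n 2 x ct)"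
  unfolding gel_def using Gam_dif[of x n y i] by (simp only: add.assoc one_add_one)

lemma gel_add: "\<lbrakk>x \<in> carrier (gr At n); y \<in> carrier (gr At m); x' \<in> carrier (gr At n); y' \<in> carrier (gr At m); m = n + 1\<rbrakk> \<Longrightarrow>
    gel i n x y \<oplus>\<^bsub>gr (Gam i) n\<^esub> gel i n x' y' = gel i n (x \<oplus>\<^bsub>gr At n\<^esub> x') (y \<oplus>\<^bsub>gr At m\<^esub> y')"
  unfolding gel_def Gam_gr by (simp only: AQ_simps dsum_module_simps)

lemma gel_smult: "\<lbrakk>x \<in> carrier (gr At n); y \<in> carrier (gr At m); r \<in> carrier (pser k); m = n + 1\<rbrakk> \<Longrightarrow>
    r \<odot>\<^bsub>gr (Gam i) n\<^esub> gel i n x y = gel i n (r \<odot>\<^bsub>gr At n\<^esub> x) (r \<odot>\<^bsub>gr At m\<^esub> y)"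
  unfolding gel_def Gam_gr by (simp only: AQ_simps dsum_module_simps)

lemma gel_zero: "\<zero>\<^bsub>gr (Gam i) n\<^esub> = gel i n \<zero>\<^bsub>gr At n\<^esub> \<zero>\<^bsub>gr At (n + 1)\<^esub>"
  unfolding gel_def Gam_gr by (simp only: AQ_simps dsum_module_simps)

lemma gel_eqD: "\<lbrakk>x \<in> carrier (gr At n); y \<in> carrier (gr At m); x' \<in> carrier (gr At n); y' \<in> carrier (gr At m); m = n + 1\<rbrakk> \<Longrightarrow>
    gel i n x y = gel i n x' y' \<Longrightarrow> x \<ominus>\<^bsub>gr At n\<^esub> x' \<in> TI (i + 1) n \<and> y \<ominus>\<^bsub>gr At m\<^esub> y' \<in> TI i m"
  unfolding gel_def by (simp only: qc_eq_iff prod.inject)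

lemma gel_zero_iff: "\<lbrakk>x \<in> carrier (gr At n); y \<in> carrier (gr At m); m = n + 1\<rbrakk> \<Longrightarrow>
    gel i n x y = \<zero>\<^bsub>gr (Gam i) n\<^esub> \<longleftrightarrow> x \<in> TI (i + 1) n \<and> y \<in> TI i m"
  unfolding gel_zero unfolding gel_def by (simp only: qc_zero_iff prod.inject)

text \<open>On \<open>A_t\<close> the square of \<open>d\<close> is \<open>c x - x c\<close>; the
  detour through the other summand adds \<open>t (x ct) = x c\<close>, which leaves
  \<open>c x\<close>. The same happens to \<open>y\<close>. The mixed terms cancel, those in
  \<open>x\<close> because \<open>ct\<close> is closed.\<close>

lemma md_Gam: "md (Gam i)"
proof (rule cdg_moduleI[OF cdg_algebra_axioms gmd_Gam])
  fix n v assume "v \<in> carrier (gr (Gam i) n)"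
  then obtain x y where v: "x \<in> carrier (gr At n)" "y \<in> carrier (gr At (n + 1))" "v = gel i n x y"
    using gel_elem by blast
  have ix: "1 + n = n + 1" "2 + n = n + 2" "3 + n = n + 3" "n + 1 + 1 = n + 2" "n + 1 + 2 = n + 3" "n + 2 + 1 = n + 3" by simp_all
  define dx where "dx = dif At n x"
  define dy where "dy = dif At (n + 1) y"
  define xc where "xc = act At n 2 x ct"
  define yc where "yc = act At (n + 1) 2 y ct"
  define dxc where "dxc = act At (n + 1) 2 dx ct"
  define cx where "cx = act At 2 n (curv At) x"
  define cy where "cy = act At 2 (n + 1) (curv At) y"
  note defs = dx_def dy_def xc_def yc_def dxc_def cx_def cy_def
  have c: "dx \<in> carrier (gr At (n + 1))" "dy \<in> carrier (gr At (n + 2))" "xc \<in> carrier (gr At (n + 2))"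
     "yc \<in> carrier (gr At (n + 3))" "dxc \<in> carrier (gr At (n + 3))" "cx \<in> carrier (gr At (n + 2))" "cy \<in> carrier (gr At (n + 3))"
    unfolding defs using v curv_closed ct_closed by (simp_all add: act_closed dif_closed)
  have ty: "tm At (n + 1) y \<in> carrier (gr At (n + 1))" "tm At (n + 2) dy \<in> carrier (gr At (n + 2))"
    "tm At (n + 2) xc \<in> carrier (gr At (n + 2))" "tm At (n + 3) yc \<in> carrier (gr At (n + 3))"
    using At_cl(4)[OF v(2) tvar_closed] At_cl(4)[OF c(2) tvar_closed] At_cl(4)[OF c(3) tvar_closed] At_cl(4)[OF c(4) tvar_closed] by simp_all
  have e1: "dif At (n + 1) dx = cx \<ominus>\<^bsub>gr At (n + 2)\<^esub> tm At (n + 2) xc"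
    using dif_dif[OF v(1)] act_smult[OF v(1) ct_closed tvar_closed, of "n + 2"] by (simp add: defs t_ct)
  have e2: "dif At (n + 2) dy = cy \<ominus>\<^bsub>gr At (n + 3)\<^esub> tm At (n + 3) yc"
    using dif_dif[OF v(2)] act_smult[OF v(2) ct_closed tvar_closed, of "n + 3"] by (simp add: defs t_ct ix)
  have e3: "dif At (n + 1) (tm At (n + 1) y) = tm At (n + 2) dy"
    unfolding dy_def by (rule dif_smult[OF v(2) tvar_closed]) simp
  have e4: "act At (n + 1) 2 (tm At (n + 1) y) ct = tm At (n + 3) yc"
    unfolding yc_def by (rule act_smult_left[OF v(2) ct_closed tvar_closed]) simp
  have "act At n 3 x \<zero>\<^bsub>gr At 3\<^esub> = \<zero>\<^bsub>gr At (n + 3)\<^esub>" using addhom_zero[OF act_hom[OF v(1) refl]] .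
  then have e5: "dif At (n + 2) xc = dxc \<oplus>\<^bsub>gr At (n + 3)\<^esub> psgn (gr At (n + 3)) n \<zero>\<^bsub>gr At (n + 3)\<^esub>"
    using dif_act'[OF v(1) ct_closed, of "n + 2" "n + 1" 3 "n + 3"] by (simp add: defs dif_ct)
  note hs = addhom_add[OF dif_hom[of "n + 2" "n + 1"]] addhom_add[OF dif_hom[of "n + 3" "n + 2"]] addhom_neg[OF dif_hom[of "n + 3" "n + 2"]]
    addhom_add[OF smult_hom[OF tvar_closed]] addhom_neg[OF smult_hom[OF tvar_closed]] addhom_add[OF act_hom_left[OF ab ct_closed, of "n + 3"]]
  have s1: "dif At (n + 1) (dx \<oplus>\<^bsub>gr At (n + 1)\<^esub> tm At (n + 1) y) \<oplus>\<^bsub>gr At (n + 2)\<^esub> tm At (n + 2) (\<ominus>\<^bsub>gr At (n + 2)\<^esub> dy \<oplus>\<^bsub>gr At (n + 2)\<^esub> xc) = cx"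
    using c ty apply (simp add: hs At_cl e1 e3)
    by (rule abelian_group.lincomb_unique[OF ab[of "n + 2"]], (rule abelian_group.lincomb_intros[OF ab] | assumption | simp; fail)+)
  have s2: "\<ominus>\<^bsub>gr At (n + 3)\<^esub> dif At (n + 2) (\<ominus>\<^bsub>gr At (n + 2)\<^esub> dy \<oplus>\<^bsub>gr At (n + 2)\<^esub> xc) \<oplus>\<^bsub>gr At (n + 3)\<^esub> act At (n + 1) 2 (dx \<oplus>\<^bsub>gr At (n + 1)\<^esub> tm At (n + 1) y) ct = cy"
    using c ty apply (simp add: hs At_cl e2 e4 e5 dxc_def[symmetric])
    by (rule abelian_group.lincomb_unique[OF ab[of "n + 3"]], (rule abelian_group.lincomb_intros[OF ab] | assumption | simp; fail)+)
  have "dif (Gam i) n v = gel i (n + 1) (dx \<oplus>\<^bsub>gr At (n + 1)\<^esub> tm At (n + 1) y) (\<ominus>\<^bsub>gr At (n + 2)\<^esub> dy \<oplus>\<^bsub>gr At (n + 2)\<^esub> xc)"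
    unfolding v(3) defs by (rule gel_dif[OF v(1,2)]) simp_all
  moreover have "dif (Gam i) (n + 1) \<dots> = gel i (n + 2) (dif At (n + 1) (dx \<oplus>\<^bsub>gr At (n + 1)\<^esub> tm At (n + 1) y) \<oplus>\<^bsub>gr At (n + 2)\<^esub> tm At (n + 2) (\<ominus>\<^bsub>gr At (n + 2)\<^esub> dy \<oplus>\<^bsub>gr At (n + 2)\<^esub> xc))
     (\<ominus>\<^bsub>gr At (n + 3)\<^esub> dif At (n + 2) (\<ominus>\<^bsub>gr At (n + 2)\<^esub> dy \<oplus>\<^bsub>gr At (n + 2)\<^esub> xc) \<oplus>\<^bsub>gr At (n + 3)\<^esub> act At (n + 1) 2 (dx \<oplus>\<^bsub>gr At (n + 1)\<^esub> tm At (n + 1) y) ct)"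
    by (rule gel_dif) (simp_all add: At_cl c ty)
  moreover have "act (Gam i) 2 n (curv At) v = gel i (n + 2) cx (psgn (gr At (n + 3)) 2 cy)"
    unfolding v(3) defs by (rule gel_act[OF curv_closed v(1,2)]) simp_all
  ultimately show "dif (Gam i) (n + 1) (dif (Gam i) n v) = act (Gam i) 2 n (curv At) v"
    unfolding s1 s2 by (simp add: psgn_def)
qed

lemma K_Gam:
  assumes x: "x \<in> carrier (gr At n)" and y: "y \<in> carrier (gr At m)" and m: "m = n + 1"
  shows "gel i n x y \<in> K (Gam i) (Suc i) n"
proof -
  have "tvar k \<odot>\<^bsub>gr At m\<^esub> y \<in> carrier (gr At m)" by (rule At_cl(4)[OF y tvar_closed])
  moreover have "tpow k (Suc i) \<odot>\<^bsub>gr At m\<^esub> y = tpow k i \<odot>\<^bsub>gr At m\<^esub> (tvar k \<odot>\<^bsub>gr At m\<^esub> y)"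
    unfolding tpow_Suc by (rule module.smult_assoc1[OF gr_module tpow_closed tvar_closed y])
  ultimately show ?thesis
    using gel_zero_iff[OF At_cl(4)[OF x tpow_closed] At_cl(4)[OF y tpow_closed] m, of "Suc i" "Suc i"] TI_I[OF x, of "Suc i"] TI_I[of "tvar k \<odot>\<^bsub>gr At m\<^esub> y" m i]
    by (simp add: K_in gel_cl[OF x y m] gel_smult[OF x y tpow_closed m])
qed

lemma torsion_Gam: "torsion k (Gam i)"
  unfolding torsion_def using gel_elem K_Gam by (fastforce simp: K_in)

lemma g_cl: "g1 i \<in> carrier (gr (Gam i) 0)" "g2 i \<in> carrier (gr (Gam i) (- 1))"
  unfolding g1_def g2_def by (rule gel_cl, simp_all add: unit_closed At_cl)+

text \<open>The universal pair: maps out of \<open>\<Gamma>_i\<close> will be determined by the pair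
  to which they send it.\<close>

lemma g_EZ: "(g1 i, g2 i) \<in> EZ i (- 1) (Gam i)"
proof -
  have "g1 i \<in> K (Gam i) (Suc i) 0" unfolding g1_def by (rule K_Gam) (simp_all add: unit_closed At_cl)
  moreover have z: "tpow k i \<odot>\<^bsub>gr At (- 1)\<^esub> \<zero>\<^bsub>gr At (- 1)\<^esub> = \<zero>\<^bsub>gr At (- 1)\<^esub>" "tvar k \<odot>\<^bsub>gr At 0\<^esub> \<zero>\<^bsub>gr At 0\<^esub> = \<zero>\<^bsub>gr At 0\<^esub>"
    "tvar k \<odot>\<^bsub>gr At 1\<^esub> \<zero>\<^bsub>gr At 1\<^esub> = \<zero>\<^bsub>gr At 1\<^esub>"
    using addhom_zero[OF smult_hom] tpow_closed tvar_closed by simp_all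
  have "g2 i \<in> K (Gam i) i (- 1)" unfolding g2_def K_in
    using gel_zero_iff[of "\<zero>\<^bsub>gr At (- 1)\<^esub>" "- 1" "tpow k i \<odot>\<^bsub>gr At 0\<^esub> unit At" 0] TI_I[OF unit_closed, of i] additive_subgroup.zero_closed[OF TI_subgroup]
     gel_smult[of "\<zero>\<^bsub>gr At (- 1)\<^esub>" "- 1" "unit At" 0 "tpow k i"] gel_cl[of "\<zero>\<^bsub>gr At (- 1)\<^esub>" "- 1" "unit At" 0]
    by (simp add: At_cl unit_closed z)
  moreover have "dif (Gam i) 0 (g1 i) = cta (Gam i) (- 1) (g2 i)"
  proof -
    have a: "dif At 1 \<zero>\<^bsub>gr At 1\<^esub> = \<zero>\<^bsub>gr At 2\<^esub>" using addhom_zero[OF dif_hom[of 2 1]] by simp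
    have b: "act At 2 (- 1) ct \<zero>\<^bsub>gr At (- 1)\<^esub> = \<zero>\<^bsub>gr At 1\<^esub>" using addhom_zero[OF act_hom[OF ct_closed, of 1 "- 1"]] by simp
    have "dif (Gam i) 0 (g1 i) = gel i 1 (dif At 0 (unit At) \<oplus>\<^bsub>gr At 1\<^esub> tm At 1 \<zero>\<^bsub>gr At 1\<^esub>) (\<ominus>\<^bsub>gr At 2\<^esub> dif At 1 \<zero>\<^bsub>gr At 1\<^esub> \<oplus>\<^bsub>gr At 2\<^esub> act At 0 2 (unit At) ct)"
      unfolding g1_def by (rule gel_dif) (simp_all add: unit_closed At_cl)
    also have "\<dots> = gel i 1 \<zero>\<^bsub>gr At 1\<^esub> ct"
      using ct_closed At_l_zero by (simp add: dif_unit z a act_unit At_neg_zero At_cl)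
    also have "\<dots> = gel i 1 (act At 2 (- 1) ct \<zero>\<^bsub>gr At (- 1)\<^esub>) (psgn (gr At 2) 2 (act At 2 0 ct (unit At)))"
      by (simp add: b mult_unit[OF ct_closed] psgn_def)
    also have "\<dots> = cta (Gam i) (- 1) (g2 i)"
      unfolding g2_def by (rule gel_act[symmetric, OF ct_closed]) (simp_all add: unit_closed At_cl)
    finally show ?thesis .
  qed
  moreover have "dif (Gam i) (- 1) (g2 i) = tm (Gam i) 0 (g1 i)"
  proof -
    have a: "dif At (- 1) \<zero>\<^bsub>gr At (- 1)\<^esub> = \<zero>\<^bsub>gr At 0\<^esub>" using addhom_zero[OF dif_hom[of 0 "- 1"]] by simp
    have b: "act At (- 1) 2 \<zero>\<^bsub>gr At (- 1)\<^esub> ct = \<zero>\<^bsub>gr At 1\<^esub>" using addhom_zero[OF act_hom_left[OF ab ct_closed, of 1 "- 1"]] by simp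
    have "dif (Gam i) (- 1) (g2 i) = gel i 0 (dif At (- 1) \<zero>\<^bsub>gr At (- 1)\<^esub> \<oplus>\<^bsub>gr At 0\<^esub> tm At 0 (unit At)) (\<ominus>\<^bsub>gr At 1\<^esub> dif At 0 (unit At) \<oplus>\<^bsub>gr At 1\<^esub> act At (- 1) 2 \<zero>\<^bsub>gr At (- 1)\<^esub> ct)"
      unfolding g2_def by (rule gel_dif) (simp_all add: unit_closed At_cl)
    also have "\<dots> = gel i 0 (tm At 0 (unit At)) (tm At 1 \<zero>\<^bsub>gr At 1\<^esub>)"
      using At_cl(4)[OF unit_closed tvar_closed] At_l_zero by (simp add: dif_unit z a b At_neg_zero At_cl)
    also have "\<dots> = tm (Gam i) 0 (g1 i)"
      unfolding g1_def by (rule gel_smult[symmetric]) (simp_all add: unit_closed At_cl tvar_closed)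
    finally show ?thesis .
  qed
  ultimately show ?thesis by (simp add: EZ_def cyc_def)
qed

text \<open>The only possible value, at the element with representatives \<open>x\<close> and
  \<open>y\<close>, of a degree \<open>p\<close> map sending the generators to \<open>u\<close> and
  \<open>v\<close>. The exponent \<open>(p + 1) * (n + 1)\<close> collects
  \<open>p * (n + 1)\<close> from graded linearity and \<open>n + 1\<close> from
  \<open>gel_gen\<close>.\<close>

definition uval where
  "uval N p u v n x y = psgn (gr N (n + p)) (p * n) (act N n p x u) \<oplus>\<^bsub>gr N (n + p)\<^esub>
     psgn (gr N (n + p)) ((p + 1) * (n + 1)) (act N (n + 1) (p - 1) y v)"

text \<open>Elements of \<open>\<Gamma>_i\<close> are pairs of cosets, so representatives are
  chosen; \<open>um_gel\<close> shows the value to be independent of them.\<close>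

definition um where
  "um N p u v n w = (case SOME (x, y). x \<in> carrier (gr At n) \<and> y \<in> carrier (gr At (n + 1)) \<and> w = gel i n x y of (x, y) \<Rightarrow> uval N p u v n x y)"

text \<open>The sign \<open>(-1)^(n+1)\<close> undoes the one in the action on the shifted summand,
  where \<open>y\<close> acts with degree \<open>n + 1\<close>.\<close>

lemma gel_gen:
  assumes x: "x \<in> carrier (gr At n)" and y: "y \<in> carrier (gr At (n + 1))"
  shows "gel i n x y = act (Gam i) n 0 x (g1 i) \<oplus>\<^bsub>gr (Gam i) n\<^esub> psgn (gr (Gam i) n) (n + 1) (act (Gam i) (n + 1) (- 1) y (g2 i))"
proof -
  have z: "act At n 1 x \<zero>\<^bsub>gr At 1\<^esub> = \<zero>\<^bsub>gr At (n + 1)\<^esub>" using addhom_zero[OF act_hom[OF x, of "n + 1" 1]] by simp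
  have z': "act At (n + 1) (- 1) y \<zero>\<^bsub>gr At (- 1)\<^esub> = \<zero>\<^bsub>gr At n\<^esub>" using addhom_zero[OF act_hom[OF y, of n "- 1"]] by simp
  have a1: "act (Gam i) n 0 x (g1 i) = gel i n (act At n 0 x (unit At)) (psgn (gr At (n + 1)) n (act At n 1 x \<zero>\<^bsub>gr At 1\<^esub>))"
    unfolding g1_def by (rule gel_act[OF x]) (simp_all add: unit_closed At_cl)
  have a2: "act (Gam i) (n + 1) (- 1) y (g2 i) = gel i n (act At (n + 1) (- 1) y \<zero>\<^bsub>gr At (- 1)\<^esub>) (psgn (gr At (n + 1)) (n + 1) (act At (n + 1) 0 y (unit At)))"
    unfolding g2_def by (rule gel_act[OF y]) (simp_all add: unit_closed At_cl)
  have m: "psgn (gr (Gam i) n) p (gel i n \<zero>\<^bsub>gr At n\<^esub> (psgn (gr At (n + 1)) p y)) = gel i n \<zero>\<^bsub>gr At n\<^esub> y" for p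
  proof (cases "even p")
    case False
    interpret g: abelian_group "gr (Gam i) n" by (rule md_ab[OF md_Gam])
    have "gel i n \<zero>\<^bsub>gr At n\<^esub> y \<oplus>\<^bsub>gr (Gam i) n\<^esub> gel i n \<zero>\<^bsub>gr At n\<^esub> (\<ominus>\<^bsub>gr At (n + 1)\<^esub> y) = gel i n (\<zero>\<^bsub>gr At n\<^esub> \<oplus>\<^bsub>gr At n\<^esub> \<zero>\<^bsub>gr At n\<^esub>) (y \<oplus>\<^bsub>gr At (n + 1)\<^esub> \<ominus>\<^bsub>gr At (n + 1)\<^esub> y)"
      by (rule gel_add) (simp_all add: At_cl y)
    also have "\<dots> = \<zero>\<^bsub>gr (Gam i) n\<^esub>"
      unfolding gel_zero using abelian_group.r_neg[OF ab y] At_l_zero by (simp add: At_cl)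
    finally have "\<ominus>\<^bsub>gr (Gam i) n\<^esub> gel i n \<zero>\<^bsub>gr At n\<^esub> (\<ominus>\<^bsub>gr At (n + 1)\<^esub> y) = gel i n \<zero>\<^bsub>gr At n\<^esub> y"
      by (rule g.minus_equality) (simp_all add: gel_cl[OF _ _ refl] At_cl y)
    then show ?thesis using False by (simp add: psgn_def)
  qed (simp add: psgn_def)
  have "act (Gam i) n 0 x (g1 i) \<oplus>\<^bsub>gr (Gam i) n\<^esub> psgn (gr (Gam i) n) (n + 1) (act (Gam i) (n + 1) (- 1) y (g2 i)) =
    gel i n x \<zero>\<^bsub>gr At (n + 1)\<^esub> \<oplus>\<^bsub>gr (Gam i) n\<^esub> gel i n \<zero>\<^bsub>gr At n\<^esub> y"
    unfolding a1 a2 z z' mult_unit[OF x] mult_unit[OF y] m by (simp add: psgn_def At_neg_zero)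
  also have "\<dots> = gel i n (x \<oplus>\<^bsub>gr At n\<^esub> \<zero>\<^bsub>gr At n\<^esub>) (\<zero>\<^bsub>gr At (n + 1)\<^esub> \<oplus>\<^bsub>gr At (n + 1)\<^esub> y)"
    by (rule gel_add) (simp_all add: At_cl x y)
  finally show ?thesis
    using At_l_zero[OF y] At_r_zero[OF x] by simp
qed

context
  fixes N :: "('k, 'a, 'm) tmod"
  assumes N: "md N"
begin

interpretation N: cdg_module "pser k" At N by (rule N)

text \<open>The generators span by \<open>gel_gen\<close>, so graded linearity forces the value;
  linear maps out of \<open>\<Gamma>_i\<close> are thus determined by two elements.\<close>

lemma lmap_gel:
  assumes f: "lmap p (Gam i) N f" and x: "x \<in> carrier (gr At n)" and y: "y \<in> carrier (gr At (n + 1))"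
  shows "f n (gel i n x y) = uval N p (f 0 (g1 i)) (f (- 1) (g2 i)) n x y"
proof -
  have c: "act (Gam i) n 0 x (g1 i) \<in> carrier (gr (Gam i) n)" "act (Gam i) (n + 1) (- 1) y (g2 i) \<in> carrier (gr (Gam i) n)"
    using graded_module_derivation.act_closed[OF gmd_Gam x g_cl(1), of n] graded_module_derivation.act_closed[OF gmd_Gam y g_cl(2), of n] by simp_all
  note h = lmapD(2)[OF md_Gam N f, of "n + p" n]
  have fc: "f 0 (g1 i) \<in> carrier (gr N p)" "f (- 1) (g2 i) \<in> carrier (gr N (p - 1))"
    using lmapD(1)[OF md_Gam N f g_cl(1), of p] lmapD(1)[OF md_Gam N f g_cl(2), of "p - 1"] by simp_all
  have "f n (gel i n x y) = f n (act (Gam i) n 0 x (g1 i)) \<oplus>\<^bsub>gr N (n + p)\<^esub> psgn (gr N (n + p)) (n + 1) (f n (act (Gam i) (n + 1) (- 1) y (g2 i)))"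
    unfolding gel_gen[OF x y] using addhom_add[OF h] addhom_psgn[OF h c(2)] c md_psgn_closed[OF md_Gam] by simp
  also have "f n (act (Gam i) n 0 x (g1 i)) = psgn (gr N (n + p)) (p * n) (act N n p x (f 0 (g1 i)))"
    by (rule lmapD(3)[OF md_Gam N f x g_cl(1)]) simp_all
  also have "f n (act (Gam i) (n + 1) (- 1) y (g2 i)) = psgn (gr N (n + p)) (p * (n + 1)) (act N (n + 1) (p - 1) y (f (- 1) (g2 i)))"
    by (rule lmapD(3)[OF md_Gam N f y g_cl(2)]) simp_all
  also have "psgn (gr N (n + p)) (n + 1) (psgn (gr N (n + p)) (p * (n + 1)) (act N (n + 1) (p - 1) y (f (- 1) (g2 i)))) =
     psgn (gr N (n + p)) ((p + 1) * (n + 1)) (act N (n + 1) (p - 1) y (f (- 1) (g2 i)))"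
    using N.M.act_closed[OF y fc(2), of "n + p"] by (simp add: md_psgn_psgn[OF N] algebra_simps)
  finally show ?thesis unfolding uval_def .
qed

lemma lmap_Gam_ext:
  assumes "lmap p (Gam i) N f" "lmap p (Gam i) N g" "f 0 (g1 i) = g 0 (g1 i)" "f (- 1) (g2 i) = g (- 1) (g2 i)" "w \<in> carrier (gr (Gam i) n)"
  shows "f n w = g n w"
  using gel_elem[OF assms(5)] lmap_gel[OF assms(1)] lmap_gel[OF assms(2)] assms(3,4) by auto

context
  fixes p u v
  assumes u: "u \<in> K N (Suc i) p" and v: "v \<in> K N i (p - 1)"
begin

lemma uval_cl:
  assumes "x \<in> carrier (gr At n)" "y \<in> carrier (gr At (n + 1))"
  shows "act N n p x u \<in> carrier (gr N (n + p))" "act N (n + 1) (p - 1) y v \<in> carrier (gr N (n + p))"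
    "uval N p u v n x y \<in> carrier (gr N (n + p))"
proof -
  show a: "act N n p x u \<in> carrier (gr N (n + p))" by (rule N.M.act_closed[OF assms(1) K_carr[OF u] refl])
  show b: "act N (n + 1) (p - 1) y v \<in> carrier (gr N (n + p))" by (rule N.M.act_closed[OF assms(2) K_carr[OF v]]) simp
  show "uval N p u v n x y \<in> carrier (gr N (n + p))" unfolding uval_def using a b by (simp add: module_cl[OF N])
qed

lemma uval_add:
  assumes "x \<in> carrier (gr At n)" "y \<in> carrier (gr At (n + 1))" "x' \<in> carrier (gr At n)" "y' \<in> carrier (gr At (n + 1))"
  shows "uval N p u v n (x \<oplus>\<^bsub>gr At n\<^esub> x') (y \<oplus>\<^bsub>gr At (n + 1)\<^esub> y') = uval N p u v n x y \<oplus>\<^bsub>gr N (n + p)\<^esub> uval N p u v n x' y'"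
proof -
  note c = uval_cl(1,2)[OF assms(1,2)] uval_cl(1,2)[OF assms(3,4)]
  have h1: "act N n p (x \<oplus>\<^bsub>gr At n\<^esub> x') u = act N n p x u \<oplus>\<^bsub>gr N (n + p)\<^esub> act N n p x' u"
    by (rule addhom_add[OF N.M.act_hom_left[OF ab K_carr[OF u] refl] assms(1,3)])
  have h2: "act N (n + 1) (p - 1) (y \<oplus>\<^bsub>gr At (n + 1)\<^esub> y') v = act N (n + 1) (p - 1) y v \<oplus>\<^bsub>gr N (n + p)\<^esub> act N (n + 1) (p - 1) y' v"
    by (rule addhom_add[OF N.M.act_hom_left[OF ab K_carr[OF v]] assms(2,4)]) simp
  define a b a' b' where "a = act N n p x u" "b = act N (n + 1) (p - 1) y v" "a' = act N n p x' u" "b' = act N (n + 1) (p - 1) y' v"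
  show ?thesis unfolding uval_def h1 h2 using c unfolding a_b_a'_b'_def[symmetric]
    by (intro lincomb_unique'[OF N, of "n + p"]) (rule md_lincomb_intros[OF N] | assumption | simp add: algebra_simps; fail)+
qed

text \<open>Here the kernel conditions on \<open>u\<close> and \<open>v\<close> enter: the powers
  \<open>t^(i+1)\<close> and \<open>t^i\<close> move from \<open>x\<close> and \<open>y\<close> over
  to \<open>u\<close> and \<open>v\<close>, which they kill.\<close>

lemma uval_zero:
  assumes "x \<in> TI (i + 1) n" "y \<in> TI i (n + 1)"
  shows "uval N p u v n x y = \<zero>\<^bsub>gr N (n + p)\<^esub>"
proof -
  obtain x' y' where x: "x' \<in> carrier (gr At n)" "x = tpow k (i + 1) \<odot>\<^bsub>gr At n\<^esub> x'" and y: "y' \<in> carrier (gr At (n + 1))" "y = tpow k i \<odot>\<^bsub>gr At (n + 1)\<^esub> y'"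
    using assms by (auto simp: tideal_def)
  have "act N n p x u = act N n p x' (tpow k (Suc i) \<odot>\<^bsub>gr N p\<^esub> u)"
    using N.M.act_smult_left[OF x(1) K_carr[OF u] tpow_closed refl, of "i + 1"] N.M.act_smult[OF x(1) K_carr[OF u] tpow_closed refl, of "Suc i"] x(2) by simp
  also have "\<dots> = \<zero>\<^bsub>gr N (n + p)\<^esub>" using u addhom_zero[OF N.M.act_hom[OF x(1) refl]] by (simp add: K_in)
  finally have a: "act N n p x u = \<zero>\<^bsub>gr N (n + p)\<^esub>" .
  have "act N (n + 1) (p - 1) y v = act N (n + 1) (p - 1) y' (tpow k i \<odot>\<^bsub>gr N (p - 1)\<^esub> v)"
    using N.M.act_smult_left[OF y(1) K_carr[OF v] tpow_closed, of "n + p" i] N.M.act_smult[OF y(1) K_carr[OF v] tpow_closed, of "n + p" i] y(2) by simp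
  also have "\<dots> = \<zero>\<^bsub>gr N (n + p)\<^esub>" using v addhom_zero[OF N.M.act_hom[OF y(1), of "n + p" "p - 1"]] by (simp add: K_in)
  finally show ?thesis unfolding uval_def a
    using md_neg_zero[OF N] md_l_zero[OF N] by (simp add: psgn_def zero_cl[OF N])
qed

text \<open>Two choices of representatives differ by elements of the ideals, on which
  \<open>uval\<close> vanishes, and \<open>uval\<close> is additive.\<close>

lemma um_gel:
  assumes x: "x \<in> carrier (gr At n)" and y: "y \<in> carrier (gr At (n + 1))"
  shows "um N p u v n (gel i n x y) = uval N p u v n x y"
proof -
  let ?P = "\<lambda>(x', y'). x' \<in> carrier (gr At n) \<and> y' \<in> carrier (gr At (n + 1)) \<and> gel i n x y = gel i n x' y'"
  obtain x' y' where s: "(SOME q. ?P q) = (x', y')" by (rule prod.exhaust)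
  have "?P (SOME q. ?P q)" by (rule someI[of ?P "(x, y)"]) (simp add: x y)
  then have p: "x' \<in> carrier (gr At n)" "y' \<in> carrier (gr At (n + 1))" "gel i n x y = gel i n x' y'" unfolding s by auto
  have d: "x \<ominus>\<^bsub>gr At n\<^esub> x' \<in> TI (i + 1) n" "y \<ominus>\<^bsub>gr At (n + 1)\<^esub> y' \<in> TI i (n + 1)"
    using gel_eqD[OF x y p(1,2) refl p(3)] by auto
  have dc: "x \<ominus>\<^bsub>gr At n\<^esub> x' \<in> carrier (gr At n)" "y \<ominus>\<^bsub>gr At (n + 1)\<^esub> y' \<in> carrier (gr At (n + 1))"
    using x y p abelian_group.minus_closed[OF ab] by auto
  have e': "z = (z \<ominus>\<^bsub>gr At m\<^esub> z') \<oplus>\<^bsub>gr At m\<^esub> z'" if "z \<in> carrier (gr At m)" "z' \<in> carrier (gr At m)" for z z' m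
    using that by (intro abelian_group.lincomb_unique[OF ab[of m]]) (rule abelian_group.lincomb_intros[OF ab] | assumption | simp; fail)+
  note e = e'[OF x p(1)] e'[OF y p(2)]
  have "uval N p u v n x y = uval N p u v n (x \<ominus>\<^bsub>gr At n\<^esub> x') (y \<ominus>\<^bsub>gr At (n + 1)\<^esub> y') \<oplus>\<^bsub>gr N (n + p)\<^esub> uval N p u v n x' y'"
    using uval_add[OF dc p(1,2)] unfolding e[symmetric] .
  also have "\<dots> = uval N p u v n x' y'"
    unfolding uval_zero[OF d] by (rule md_l_zero[OF N uval_cl(3)[OF p(1,2)]])
  finally show ?thesis unfolding um_def s by simp
qed

lemma um_lmap: "lmap p (Gam i) N (um N p u v)"
  unfolding lmap_def
proof (intro conjI allI ballI)
  fix n w assume "w \<in> carrier (gr (Gam i) n)"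
  then obtain x y where w: "x \<in> carrier (gr At n)" "y \<in> carrier (gr At (n + 1))" "w = gel i n x y" using gel_elem by blast
  show "um N p u v n w \<in> carrier (gr N (n + p))" unfolding w(3) um_gel[OF w(1,2)] by (rule uval_cl(3)[OF w(1,2)])
  { fix w' assume "w' \<in> carrier (gr (Gam i) n)"
    then obtain x' y' where w': "x' \<in> carrier (gr At n)" "y' \<in> carrier (gr At (n + 1))" "w' = gel i n x' y'" using gel_elem by blast
    show "um N p u v n (w \<oplus>\<^bsub>gr (Gam i) n\<^esub> w') = um N p u v n w \<oplus>\<^bsub>gr N (n + p)\<^esub> um N p u v n w'"
      unfolding w(3) w'(3) gel_add[OF w(1,2) w'(1,2) refl] um_gel[OF w(1,2)] um_gel[OF w'(1,2)] um_gel[OF At_cl(1)[OF w(1) w'(1)] At_cl(1)[OF w(2) w'(2)]]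
      by (rule uval_add[OF w(1,2) w'(1,2)]) }
  fix q a assume a: "a \<in> carrier (gr At q)"
  have ax: "act At q n a x \<in> carrier (gr At (q + n))" "psgn (gr At (q + n + 1)) q (act At q (n + 1) a y) \<in> carrier (gr At (q + n + 1))"
    "act At q (n + 1) a y \<in> carrier (gr At (q + n + 1))"
    using act_closed[OF a w(1) refl] act_closed[OF a w(2), of "q + n + 1"] abelian_group.psgn_closed[OF ab] by simp_all
  have e0: "act (Gam i) q n a w = gel i (q + n) (act At q n a x) (psgn (gr At (q + n + 1)) q (act At q (n + 1) a y))"
    unfolding w(3) by (rule gel_act[OF a w(1,2)]) simp_all
  have e1: "act N (q + n) p (act At q n a x) u = act N q (n + p) a (act N n p x u)"
    by (rule N.M.act_act[symmetric, OF a w(1) K_carr[OF u]]) simp_all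
  have e2: "act N (q + n + 1) (p - 1) (act At q (n + 1) a y) v = act N q (n + p) a (act N (n + 1) (p - 1) y v)"
    by (rule N.M.act_act[symmetric, OF a w(2) K_carr[OF v]]) simp_all
  have e3: "act N (q + n + 1) (p - 1) (psgn (gr At (q + n + 1)) q (act At q (n + 1) a y)) v =
     psgn (gr N (q + n + p)) q (act N (q + n + 1) (p - 1) (act At q (n + 1) a y) v)"
    by (rule addhom_psgn[OF N.M.act_hom_left[OF ab K_carr[OF v]] ax(3)]) simp
  note c = uval_cl(1,2)[OF w(1,2)]
  have i: "q + (n + p) = q + n + p" by simp
  have c': "act N q (n + p) a (act N n p x u) \<in> carrier (gr N (q + n + p))" "act N q (n + p) a (act N (n + 1) (p - 1) y v) \<in> carrier (gr N (q + n + p))"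
    using N.M.act_closed[OF a c(1) refl] N.M.act_closed[OF a c(2) refl] by (simp_all add: i)
  have h: "addhom (gr N (n + p)) (gr N (q + n + p)) (act N q (n + p) a)" by (rule N.M.act_hom[OF a]) simp
  have pc: "psgn (gr N (n + p)) r (act N n p x u) \<in> carrier (gr N (n + p))" "psgn (gr N (n + p)) r (act N (n + 1) (p - 1) y v) \<in> carrier (gr N (n + p))" for r
    using c by (simp_all add: module_cl[OF N])
  have R: "act N q (n + p) a (uval N p u v n x y) = psgn (gr N (q + n + p)) (p * n) (act N q (n + p) a (act N n p x u)) \<oplus>\<^bsub>gr N (q + n + p)\<^esub>
     psgn (gr N (q + n + p)) ((p + 1) * (n + 1)) (act N q (n + p) a (act N (n + 1) (p - 1) y v))"
    unfolding uval_def using addhom_add[OF h pc(1) pc(2)] addhom_psgn[OF h c(1)] addhom_psgn[OF h c(2)] by simp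
  have "um N p u v (q + n) (act (Gam i) q n a w) = uval N p u v (q + n) (act At q n a x) (psgn (gr At (q + n + 1)) q (act At q (n + 1) a y))"
    unfolding e0 by (rule um_gel[OF ax(1,2)])
  also have "\<dots> = psgn (gr N (q + n + p)) (p * (q + n)) (act N q (n + p) a (act N n p x u)) \<oplus>\<^bsub>gr N (q + n + p)\<^esub>
     psgn (gr N (q + n + p)) ((p + 1) * (q + n + 1)) (psgn (gr N (q + n + p)) q (act N q (n + p) a (act N (n + 1) (p - 1) y v)))"
    unfolding uval_def e1 e3 e2 ..
  also have "\<dots> = psgn (gr N (q + n + p)) (p * q) (act N q (n + p) a (uval N p u v n x y))"
  proof -
    define A B where "A = act N q (n + p) a (act N n p x u)" "B = act N q (n + p) a (act N (n + 1) (p - 1) y v)"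
    \<comment> \<open>For the second sign: modulo two, \<open>(p + 1) * (q + n + 1) + q\<close> is
      \<open>p * q + (p + 1) * (n + 1)\<close>, because \<open>(p + 1) * q + q\<close> is
      \<open>p * q + 2 * q\<close>.\<close>
    have sg': "sg (p * (q + n)) = sg (p * q) * sg (p * n)" "sg ((p + 1) * (q + n + 1)) * sg q = sg (p * q) * sg ((p + 1) * (n + 1))"
      by (auto simp: sg_def)
    have e: "s1 * X + s2 * (s3 * Y) = t * (r1 * X + r2 * Y)" if "s1 = t * r1" "s2 * s3 = t * r2" for s1 s2 s3 t r1 r2 X Y :: int
      using that by (simp add: distrib_left mult.assoc[symmetric])
    show ?thesis unfolding R using c' unfolding A_B_def[symmetric]
      apply (intro lincomb_unique'[OF N, of "q + n + p"])
        apply (rule md_lincomb_intros[OF N] | assumption)+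
      by (rule e[OF sg'])
  qed
  finally show "um N p u v (q + n) (act (Gam i) q n a w) = psgn (gr N (q + n + p)) (p * q) (act N q (n + p) a (um N p u v n w))"
    unfolding w(3) um_gel[OF w(1,2)] .
qed

lemma um_g1: "um N p u v 0 (g1 i) = u"
proof -
  have "um N p u v 0 (g1 i) = uval N p u v 0 (unit At) \<zero>\<^bsub>gr At (0 + 1)\<^esub>"
    unfolding g1_def using um_gel[of "unit At" 0 "\<zero>\<^bsub>gr At 1\<^esub>"] by (simp add: unit_closed At_cl)
  also have "\<dots> = u"
    unfolding uval_def using addhom_zero[OF N.M.act_hom_left[OF ab K_carr[OF v], of p 1]] md_neg_zero[OF N]
      md_r_zero[OF N K_carr[OF u]] by (simp add: psgn_def N.M.act_unit K_carr[OF u])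
  finally show ?thesis .
qed

lemma um_g2: "um N p u v (- 1) (g2 i) = v"
proof -
  have "um N p u v (- 1) (g2 i) = uval N p u v (- 1) \<zero>\<^bsub>gr At (- 1)\<^esub> (unit At)"
    unfolding g2_def using um_gel[of "\<zero>\<^bsub>gr At (- 1)\<^esub>" "- 1" "unit At"] by (simp add: unit_closed At_cl)
  also have "\<dots> = v"
    unfolding uval_def using addhom_zero[OF N.M.act_hom_left[OF ab K_carr[OF u], of "p - 1" "- 1"]] md_neg_zero[OF N]
      md_l_zero[OF N K_carr[OF v]] by (simp add: psgn_def N.M.act_unit K_carr[OF v])
  finally show ?thesis .
qed

end

end

end

end

section \<open>Maps out of the modules represent pairs modulo boundaries\<close>

context tors
begin

lemma Gam_eqs: "dif (Gam i) 0 (g1 i) = cta (Gam i) (- 1) (g2 i)" "dif (Gam i) (- 1) (g2 i) = tm (Gam i) 0 (g1 i)"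
  using g_EZ[of i] by (simp_all add: EZ_def cyc_def)

context
  fixes N :: "('k, 'a, 'n) tmod" and i :: nat
  assumes N: "md N"
begin

text \<open>The defect \<open>hom_d\<close> of the linear map given by \<open>z\<close> is again
  linear, so it vanishes as soon as it does on the two generators, where its vanishing is the pair
  of cycle equations.\<close>

lemma Gam_rep_ex:
  assumes z: "z \<in> EZ i (- 1) N"
  shows "\<exists>f. cmap (Gam i) N f \<and> Ef f (- 1) (g1 i, g2 i) = z"
proof -
  obtain u v where z': "z = (u, v)" by (cases z)
  have uv: "u \<in> K N (Suc i) 0" "v \<in> K N i (- 1)" "dif N 0 u = cta N (- 1) v" "dif N (- 1) v = tm N 0 u"
    using z by (simp_all add: z' EZ_def cyc_def)
  have v': "v \<in> K N i (0 - 1)" using uv(2) by simp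
  define f where "f = um i N 0 u v"
  have f: "lmap 0 (Gam i) N f" unfolding f_def by (rule um_lmap[OF N uv(1) v'])
  have fg: "f 0 (g1 i) = u" "f (- 1) (g2 i) = v" unfolding f_def by (rule um_g1[OF N uv(1) v'], rule um_g2[OF N uv(1) v'])
  have h: "lmap 1 (Gam i) N (hom_d 0 (Gam i) N f)" using lmap_hom_d[OF md_Gam N f] by simp
  have z0: "lmap 1 (Gam i) N (\<lambda>n x. \<zero>\<^bsub>gr N (n + 1)\<^esub>)" by (rule lmap_zero[OF md_Gam N])
  have f1: "f 1 (cta (Gam i) (- 1) (g2 i)) = cta N (- 1) v"
    using lmapD(3)[OF md_Gam N f ct_closed g_cl(2), of 1 "- 1" 1] by (simp add: fg psgn_def)
  have f2: "f 0 (tm (Gam i) 0 (g1 i)) = tm N 0 u"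
    using lmap_smult[OF md_Gam N f tvar_closed g_cl(1), of 0] by (simp add: fg)
  have c: "cta N (- 1) v \<in> carrier (gr N 1)" "tm N 0 u \<in> carrier (gr N 0)"
    by (rule cta_cl[OF N uv(2)[THEN K_carr]], simp, rule tm_cl[OF N uv(1)[THEN K_carr]])
  have mz: "x \<ominus>\<^bsub>gr N n\<^esub> x = \<zero>\<^bsub>gr N n\<^esub>" if "x \<in> carrier (gr N n)" for x n
    using md_minus_eq_zero_iff[OF N that that] by simp
  have "hom_d 0 (Gam i) N f 0 (g1 i) = \<zero>\<^bsub>gr N (0 + 1)\<^esub>"
    using mz[OF c(1)] by (simp add: hom_d_def fg psgn_def Gam_eqs f1 uv)
  moreover have "hom_d 0 (Gam i) N f (- 1) (g2 i) = \<zero>\<^bsub>gr N (- 1 + 1)\<^esub>"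
    using mz[OF c(2)] by (simp add: hom_d_def fg psgn_def Gam_eqs f2 uv)
  ultimately have hz: "hom_d 0 (Gam i) N f n w = \<zero>\<^bsub>gr N (n + 1)\<^esub>" if "w \<in> carrier (gr (Gam i) n)" for n w
    using lmap_Gam_ext[OF N h z0 _ _ that] by simp
  have "f (n + 1) (dif (Gam i) n w) = dif N n (f n w)" if w: "w \<in> carrier (gr (Gam i) n)" for n w
  proof -
    have "f (n + 1) (dif (Gam i) n w) \<in> carrier (gr N (n + 1))" "dif N n (f n w) \<in> carrier (gr N (n + 1))"
      using lmapD(1)[OF md_Gam N f dif_cl[OF md_Gam w refl], of "n + 1"] dif_cl[OF N lmapD(1)[OF md_Gam N f w, of n], of "n + 1"] by simp_all
    then show ?thesis
      using hz[OF w] md_minus_eq_zero_iff[OF N, of "dif N n (f n w)" "n + 1" "f (n + 1) (dif (Gam i) n w)"] by (simp add: hom_d_def psgn_def)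
  qed
  then have "cmap (Gam i) N f" using f lmap_0_cmap[OF md_Gam N] by blast
  then show ?thesis using fg by (auto simp: z' Ef_def)
qed

text \<open>The boundary witnesses \<open>u\<close> and \<open>v\<close> define a linear map
  \<open>h\<close> of degree \<open>-1\<close>. Then \<open>f\<close> agrees on the generators with
  \<open>g\<close> plus the null-homotopic map of \<open>h\<close>, hence everywhere.\<close>

lemma Gam_rep_homotopic:
  assumes f: "cmap (Gam i) N f" and g: "cmap (Gam i) N g"
    and d: "Ef f (- 1) (g1 i, g2 i) \<ominus>\<^bsub>EG N (- 1)\<^esub> Ef g (- 1) (g1 i, g2 i) \<in> EB i (- 1) N"
  shows "homotopic (Gam i) N f g"
proof -
  have lf: "lmap 0 (Gam i) N f" and lg: "lmap 0 (Gam i) N g" using f g lmap_0_cmap[OF md_Gam N] by blast+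
  have c: "f 0 (g1 i) \<in> carrier (gr N 0)" "g 0 (g1 i) \<in> carrier (gr N 0)" "f (- 1) (g2 i) \<in> carrier (gr N (- 1))" "g (- 1) (g2 i) \<in> carrier (gr N (- 1))"
    using lmapD(1)[OF md_Gam N lf g_cl(1), of 0] lmapD(1)[OF md_Gam N lg g_cl(1), of 0]
      lmapD(1)[OF md_Gam N lf g_cl(2), of "- 1"] lmapD(1)[OF md_Gam N lg g_cl(2), of "- 1"] by simp_all
  have "(f 0 (g1 i) \<ominus>\<^bsub>gr N 0\<^esub> g 0 (g1 i), f (- 1) (g2 i) \<ominus>\<^bsub>gr N (- 1)\<^esub> g (- 1) (g2 i)) \<in> EB i (- 1) N"
    using d EG_minus[OF N, of "f 0 (g1 i)" "- 1" "f (- 1) (g2 i)" "g 0 (g1 i)" "g (- 1) (g2 i)"] c by (simp add: Ef_def)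
  then obtain u v where uv: "u \<in> K N (Suc i) (- 1)" "v \<in> K N i (- 2)"
    "f 0 (g1 i) \<ominus>\<^bsub>gr N 0\<^esub> g 0 (g1 i) = dif N (- 1) u \<oplus>\<^bsub>gr N 0\<^esub> cta N (- 2) v"
    "f (- 1) (g2 i) \<ominus>\<^bsub>gr N (- 1)\<^esub> g (- 1) (g2 i) = dif N (- 2) v \<oplus>\<^bsub>gr N (- 1)\<^esub> tm N (- 1) u"
    by (auto simp: EB_def bdr_def)
  have v': "v \<in> K N i (- 1 - 1)" using uv(2) by simp
  define h where "h = um i N (- 1) u v"
  have h: "lmap (- 1) (Gam i) N h" unfolding h_def by (rule um_lmap[OF N uv(1) v'])
  have hg: "h 0 (g1 i) = u" "h (- 1) (g2 i) = v" unfolding h_def by (rule um_g1[OF N uv(1) v'], rule um_g2[OF N uv(1) v'])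
  have h1: "h 1 (cta (Gam i) (- 1) (g2 i)) = cta N (- 2) v"
    using lmapD(3)[OF md_Gam N h ct_closed g_cl(2), of 1 "- 2" 0] by (simp add: hg psgn_def)
  have h2: "h 0 (tm (Gam i) 0 (g1 i)) = tm N (- 1) u"
    using lmap_smult[OF md_Gam N h tvar_closed g_cl(1), of "- 1"] by (simp add: hg)
  have hc: "cmap (Gam i) N (null_map (Gam i) N h)" by (rule null_map_cmap[OF md_Gam N h])
  define g' where "g' = (\<lambda>n x. g n x \<oplus>\<^bsub>gr N n\<^esub> null_map (Gam i) N h n x)"
  have g': "lmap 0 (Gam i) N g'"
    using cmap_add[OF md_Gam N g hc] lmap_0_cmap[OF md_Gam N] unfolding g'_def by blast
  have sub: "x = y \<oplus>\<^bsub>gr N n\<^esub> (x \<ominus>\<^bsub>gr N n\<^esub> y)" if "x \<in> carrier (gr N n)" "y \<in> carrier (gr N n)" for x y n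
    using that by (intro lincomb_unique'[OF N, of n]) (rule md_lincomb_intros[OF N] | assumption | simp; fail)+
  have e1: "f 0 (g1 i) = g' 0 (g1 i)"
    using sub[OF c(1,2)] by (simp add: g'_def null_map_def Gam_eqs hg h1 uv)
  have e2: "f (- 1) (g2 i) = g' (- 1) (g2 i)"
    using sub[OF c(3,4)] by (simp add: g'_def null_map_def Gam_eqs hg h2 uv)
  have "f n w = g' n w" if "w \<in> carrier (gr (Gam i) n)" for n w
    by (rule lmap_Gam_ext[OF N lf g' e1 e2 that])
  then show ?thesis unfolding homotopic_def using h by (auto simp: g'_def)
qed

end

context
  fixes e :: "(nat \<Rightarrow> 'a) set \<times> (nat \<Rightarrow> 'a) set \<Rightarrow> 'u" and i :: nat
  assumes inj: "\<And>n. inj_on e (carrier (gr (Gam i) n))"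
begin

abbreviation "Gp \<equiv> transport e (Gam i)"
definition "gp = Ef (\<lambda>n. e) (- 1) (g1 i, g2 i)"

lemmas Gp_iso = transport_iso[OF md_Gam inj]

lemma Gp_EZ: "gp \<in> EZ i (- 1) Gp"
  unfolding gp_def by (rule Ef_EZ[OF md_Gam Gp_iso(1,2) g_EZ])

lemma inv_gp: "Ef (\<lambda>n. inv_into (carrier (gr (Gam i) n)) e) (- 1) gp = (g1 i, g2 i)"
  using g_cl[of i] by (simp add: gp_def Ef_def inv_into_f_f[OF inj])

context
  fixes N :: "('k, 'a, 'n) tmod"
  assumes N: "md N"
begin

lemma Gp_rep_ex:
  assumes z: "z \<in> EZ i (- 1) N"
  shows "\<exists>f. cmap Gp N f \<and> Ef f (- 1) gp = z"
proof -
  obtain f where f: "cmap (Gam i) N f" "Ef f (- 1) (g1 i, g2 i) = z" using Gam_rep_ex[OF N z] by blast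
  have "Ef (\<lambda>n x. f n (inv_into (carrier (gr (Gam i) n)) e x)) (- 1) gp = z"
    using f(2) by (simp add: Ef_comp[OF Gp_iso(1) md_Gam N Gp_iso(3) f(1)] inv_gp)
  then show ?thesis using cmap_comp[OF Gp_iso(1) md_Gam N Gp_iso(3) f(1)] by blast
qed

lemma Gp_rep_homotopic:
  assumes f: "cmap Gp N f" and g: "cmap Gp N g"
    and d: "Ef f (- 1) gp \<ominus>\<^bsub>EG N (- 1)\<^esub> Ef g (- 1) gp \<in> EB i (- 1) N"
  shows "homotopic Gp N f g"
proof -
  let ?r = "\<lambda>n. inv_into (carrier (gr (Gam i) n)) e"
  note G = Gp_iso(1) and G2 = Gp_iso(2) and G3 = Gp_iso(3)
  have fe: "cmap (Gam i) N (\<lambda>n x. f n (e x))" "cmap (Gam i) N (\<lambda>n x. g n (e x))"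
    by (rule cmap_comp[OF md_Gam G N G2 f], rule cmap_comp[OF md_Gam G N G2 g])
  have "homotopic (Gam i) N (\<lambda>n x. f n (e x)) (\<lambda>n x. g n (e x))"
    by (rule Gam_rep_homotopic[OF N fe]) (use d in \<open>simp add: gp_def Ef_def\<close>)
  then have h: "homotopic Gp N (\<lambda>n x. f n (e (?r n x))) (\<lambda>n x. g n (e (?r n x)))"
    by (rule homotopic_pre[OF G md_Gam N G3 fe])
  have er: "e (?r n x) = x" if "x \<in> carrier (gr Gp n)" for n x
    using that Gp_iso(5)[of n] f_inv_into_f[of x e "carrier (gr (Gam i) n)"] by simp
  show ?thesis using h unfolding homotopic_def by (simp add: er)
qed

text \<open>Together with \<open>Gp_rep_ex\<close> this identifies homotopy classes of maps from
  \<open>Gp\<close> to \<open>N\<close> with \<open>EZ\<close> modulo \<open>EB\<close> in degree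
  \<open>-1\<close>.\<close>

lemma Gp_homotopic_iff:
  assumes f: "cmap Gp N f" and g: "cmap Gp N g"
  shows "homotopic Gp N f g \<longleftrightarrow> Ef f (- 1) gp \<ominus>\<^bsub>EG N (- 1)\<^esub> Ef g (- 1) gp \<in> EB i (- 1) N"
  using Gp_rep_homotopic[OF f g] homotopic_EB[OF Gp_iso(1) N f g _ Gp_EZ] by blast

lemma Gp_null_iff:
  assumes f: "cmap Gp N f"
  shows "homotopic Gp N f (\<lambda>n x. \<zero>\<^bsub>gr N n\<^esub>) \<longleftrightarrow> Ef f (- 1) gp \<in> EB i (- 1) N"
proof -
  note z = cmap_zero[OF Gp_iso(1) N]
  have "Ef (\<lambda>n x. \<zero>\<^bsub>gr N n\<^esub>) (- 1) gp \<in> EB i (- 1) N"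
    using EB_zero[OF N, of "- 1" i] by (simp add: Ef_def EG_simps split: prod.split)
  then show ?thesis unfolding Gp_homotopic_iff[OF f z]
    using EB_diff[OF N _ Ef_EZ[OF Gp_iso(1) N f Gp_EZ] Ef_EZ[OF Gp_iso(1) N z Gp_EZ]]
      EB_minus[OF N, of "Ef f (- 1) gp" i "- 1" "Ef (\<lambda>n x. \<zero>\<^bsub>gr N n\<^esub>) (- 1) gp"] by blast
qed

end

end

end

section \<open>Shifts, and right fractions in the homotopy category\<close>

context tors
begin

context
  fixes M :: "('k, 'a, 'm) tmod" and l :: int
  assumes M: "md M"
begin

lemma shift_simps:
  "gr (shift l M) n = gr M (n + l)" "K (shift l M) i n = K M i (n + l)"
  "dif (shift l M) n x = psgn (gr M (n + l + 1)) l (dif M (n + l) x)"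
  "cta (shift l M) n x = cta M (n + l) x"
  by (simp_all add: shift_def ker_t_def psgn_def)

text \<open>The shift puts \<open>(-1)^l\<close> on the differential but leaves \<open>t\<close> and
  the action of the even element \<open>ct\<close> alone; rescaling \<open>x\<close> restores both
  cycle equations.\<close>

lemma EZ_shift:
  assumes x: "x \<in> carrier (gr M l)" and y: "y \<in> carrier (gr M (l - 1))"
  shows "(x, y) \<in> EZ i (- 1) (shift l M) \<longleftrightarrow> (psgn (gr M l) l x, y) \<in> EZ i (l - 1) M"
proof (cases "even l")
  case True
  then show ?thesis by (simp add: EZ_def cyc_def shift_simps psgn_def)
next
  case False
  interpret g: abelian_group "gr M l" by (rule md_ab[OF M])
  have c: "dif M (l - 1) y \<in> carrier (gr M l)" "tm M l x \<in> carrier (gr M l)" using dif_cl[OF M y] tm_cl[OF M x] by simp_all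
  have "\<ominus>\<^bsub>gr M l\<^esub> x \<in> K M (Suc i) l \<longleftrightarrow> x \<in> K M (Suc i) l"
    using K_neg[OF M, of x "Suc i" l] K_neg[OF M, of "\<ominus>\<^bsub>gr M l\<^esub> x" "Suc i" l] x by auto
  moreover have "dif M l (\<ominus>\<^bsub>gr M l\<^esub> x) = \<ominus>\<^bsub>gr M (l + 1)\<^esub> dif M l x" by (rule dif_lin'(2)[OF M refl x])
  moreover have "\<ominus>\<^bsub>gr M l\<^esub> dif M (l - 1) y = tm M l x \<longleftrightarrow> dif M (l - 1) y = tm M l (\<ominus>\<^bsub>gr M l\<^esub> x)"
    unfolding tm_lin(2)[OF M x] using g.minus_minus[OF c(1)] g.minus_minus[OF c(2)] by auto
  ultimately show ?thesis using False by (simp add: EZ_def cyc_def shift_simps psgn_def add.commute)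
qed

lemma EB_shift:
  assumes x: "x \<in> carrier (gr M l)" and y: "y \<in> carrier (gr M (l - 1))"
  shows "(x, y) \<in> EB i (- 1) (shift l M) \<longleftrightarrow> (psgn (gr M l) l x, y) \<in> EB i (l - 1) M"
proof (cases "even l")
  case True
  have ix: "- 1 + l = l - 1" "- 1 - 1 + l = l - 2" "l - 1 - 1 = l - 2" "- 2 + l = l - 2" "- 2 + l + 1 = l - 1" by simp_all
  show ?thesis using True by (simp add: EB_def bdr_def shift_simps psgn_def ix)
next
  case False
  interpret g: abelian_group "gr M l" by (rule md_ab[OF M])
  interpret g': abelian_group "gr M (l - 1)" by (rule md_ab[OF M])
  interpret g'': abelian_group "gr M (l - 2)" by (rule md_ab[OF M])
  have ix: "- 1 + l = l - 1" "- 1 - 1 + l = l - 2" "l - 1 - 1 = l - 2" "- 2 + l = l - 2" "- 2 + l + 1 = l - 1" by simp_all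
  have L: "(x, y) \<in> EB i (- 1) (shift l M) \<longleftrightarrow> (\<exists>u\<in>K M (Suc i) (l - 1). \<exists>v\<in>K M i (l - 2).
     x = \<ominus>\<^bsub>gr M l\<^esub> dif M (l - 1) u \<oplus>\<^bsub>gr M l\<^esub> cta M (l - 2) v \<and> y = \<ominus>\<^bsub>gr M (l - 1)\<^esub> dif M (l - 2) v \<oplus>\<^bsub>gr M (l - 1)\<^esub> tm M (l - 1) u)"
    using False by (simp add: EB_def bdr_def shift_simps psgn_def ix)
  have R: "(psgn (gr M l) l x, y) \<in> EB i (l - 1) M \<longleftrightarrow> (\<exists>u\<in>K M (Suc i) (l - 1). \<exists>v\<in>K M i (l - 2).
     \<ominus>\<^bsub>gr M l\<^esub> x = dif M (l - 1) u \<oplus>\<^bsub>gr M l\<^esub> cta M (l - 2) v \<and> y = dif M (l - 2) v \<oplus>\<^bsub>gr M (l - 1)\<^esub> tm M (l - 1) u)"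
    using False by (simp add: EB_def bdr_def psgn_def ix)
  \<comment> \<open>For odd \<open>l\<close> the witnesses on the two sides correspond by negating
    \<open>v\<close> and keeping \<open>u\<close>.\<close>
  have e: "x = \<ominus>\<^bsub>gr M l\<^esub> dif M (l - 1) u \<oplus>\<^bsub>gr M l\<^esub> cta M (l - 2) v \<longleftrightarrow> \<ominus>\<^bsub>gr M l\<^esub> x = dif M (l - 1) u \<oplus>\<^bsub>gr M l\<^esub> cta M (l - 2) (\<ominus>\<^bsub>gr M (l - 2)\<^esub> v)"
    "\<ominus>\<^bsub>gr M (l - 1)\<^esub> dif M (l - 2) v = dif M (l - 2) (\<ominus>\<^bsub>gr M (l - 2)\<^esub> v)"
    if "u \<in> K M (Suc i) (l - 1)" "v \<in> K M i (l - 2)" for u v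
  proof -
    have c: "dif M (l - 1) u \<in> carrier (gr M l)" "cta M (l - 2) v \<in> carrier (gr M l)"
      using dif_cl[OF M that(1)[THEN K_carr]] cta_cl[OF M that(2)[THEN K_carr]] by simp_all
    have n: "cta M (l - 2) (\<ominus>\<^bsub>gr M (l - 2)\<^esub> v) = \<ominus>\<^bsub>gr M l\<^esub> cta M (l - 2) v"
      by (rule cta_lin(2)[OF M _ that(2)[THEN K_carr]]) simp
    have m: "\<ominus>\<^bsub>gr M l\<^esub> (\<ominus>\<^bsub>gr M l\<^esub> dif M (l - 1) u \<oplus>\<^bsub>gr M l\<^esub> cta M (l - 2) v) = dif M (l - 1) u \<oplus>\<^bsub>gr M l\<^esub> \<ominus>\<^bsub>gr M l\<^esub> cta M (l - 2) v"
      using c by (intro lincomb_unique'[OF M, of l]) (rule md_lincomb_intros[OF M] | assumption | simp; fail)+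
    have "\<ominus>\<^bsub>gr M l\<^esub> x = \<ominus>\<^bsub>gr M l\<^esub> z \<longleftrightarrow> x = z" if "z \<in> carrier (gr M l)" for z
      using that x g.minus_minus by metis
    then show "x = \<ominus>\<^bsub>gr M l\<^esub> dif M (l - 1) u \<oplus>\<^bsub>gr M l\<^esub> cta M (l - 2) v \<longleftrightarrow> \<ominus>\<^bsub>gr M l\<^esub> x = dif M (l - 1) u \<oplus>\<^bsub>gr M l\<^esub> cta M (l - 2) (\<ominus>\<^bsub>gr M (l - 2)\<^esub> v)"
      unfolding n m[symmetric] using c by simp
    show "\<ominus>\<^bsub>gr M (l - 1)\<^esub> dif M (l - 2) v = dif M (l - 2) (\<ominus>\<^bsub>gr M (l - 2)\<^esub> v)"
      by (rule dif_lin'(2)[OF M _ that(2)[THEN K_carr], symmetric]) simp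
  qed
  show ?thesis unfolding L R
  proof (rule bex_cong[OF refl], rule iffI)
    fix u assume u: "u \<in> K M (Suc i) (l - 1)"
    { assume "\<exists>v\<in>K M i (l - 2). x = \<ominus>\<^bsub>gr M l\<^esub> dif M (l - 1) u \<oplus>\<^bsub>gr M l\<^esub> cta M (l - 2) v \<and> y = \<ominus>\<^bsub>gr M (l - 1)\<^esub> dif M (l - 2) v \<oplus>\<^bsub>gr M (l - 1)\<^esub> tm M (l - 1) u"
      then obtain v where v: "v \<in> K M i (l - 2)" "x = \<ominus>\<^bsub>gr M l\<^esub> dif M (l - 1) u \<oplus>\<^bsub>gr M l\<^esub> cta M (l - 2) v"
         "y = \<ominus>\<^bsub>gr M (l - 1)\<^esub> dif M (l - 2) v \<oplus>\<^bsub>gr M (l - 1)\<^esub> tm M (l - 1) u" by blast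
      show "\<exists>v\<in>K M i (l - 2). \<ominus>\<^bsub>gr M l\<^esub> x = dif M (l - 1) u \<oplus>\<^bsub>gr M l\<^esub> cta M (l - 2) v \<and> y = dif M (l - 2) v \<oplus>\<^bsub>gr M (l - 1)\<^esub> tm M (l - 1) u"
        using e(1)[OF u v(1)] v(2) v(3)[unfolded e(2)[OF u v(1)]] K_neg[OF M v(1)] by blast }
    { assume "\<exists>v\<in>K M i (l - 2). \<ominus>\<^bsub>gr M l\<^esub> x = dif M (l - 1) u \<oplus>\<^bsub>gr M l\<^esub> cta M (l - 2) v \<and> y = dif M (l - 2) v \<oplus>\<^bsub>gr M (l - 1)\<^esub> tm M (l - 1) u"
      then obtain v where v: "v \<in> K M i (l - 2)" "\<ominus>\<^bsub>gr M l\<^esub> x = dif M (l - 1) u \<oplus>\<^bsub>gr M l\<^esub> cta M (l - 2) v"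
         "y = dif M (l - 2) v \<oplus>\<^bsub>gr M (l - 1)\<^esub> tm M (l - 1) u" by blast
      note nv = K_neg[OF M v(1)]
      have nn: "\<ominus>\<^bsub>gr M (l - 2)\<^esub> (\<ominus>\<^bsub>gr M (l - 2)\<^esub> v) = v" using v(1)[THEN K_carr] by simp
      show "\<exists>v\<in>K M i (l - 2). x = \<ominus>\<^bsub>gr M l\<^esub> dif M (l - 1) u \<oplus>\<^bsub>gr M l\<^esub> cta M (l - 2) v \<and> y = \<ominus>\<^bsub>gr M (l - 1)\<^esub> dif M (l - 2) v \<oplus>\<^bsub>gr M (l - 1)\<^esub> tm M (l - 1) u"
        using e[OF u nv] v nv unfolding nn by auto }
  qed
qed

lemma exact_shift_iff: "EZ i (- 1) (shift l M) \<subseteq> EB i (- 1) (shift l M) \<longleftrightarrow> EZ i (l - 1) M \<subseteq> EB i (l - 1) M"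
proof -
  interpret g: abelian_group "gr M l" by (rule md_ab[OF M])
  have c1: "x \<in> carrier (gr M l) \<and> y \<in> carrier (gr M (l - 1))" if "(x, y) \<in> EZ i (- 1) (shift l M)" for x y
    using that by (simp add: EZ_def cyc_def shift_simps K_in)
  have c2: "x \<in> carrier (gr M l) \<and> y \<in> carrier (gr M (l - 1))" if "(x, y) \<in> EZ i (l - 1) M" for x y
    using that by (simp add: EZ_def cyc_def K_in)
  have p: "psgn (gr M l) l (psgn (gr M l) l x) = x" if "x \<in> carrier (gr M l)" for x using that by (simp add: psgn_def)
  show ?thesis
  proof (intro iffI subsetI)
    fix z assume h: "EZ i (- 1) (shift l M) \<subseteq> EB i (- 1) (shift l M)" and z: "z \<in> EZ i (l - 1) M"
    obtain x y where xy: "z = (x, y)" by (cases z)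
    have c: "x \<in> carrier (gr M l)" "y \<in> carrier (gr M (l - 1))" using c2 z xy by auto
    show "z \<in> EB i (l - 1) M"
      using h z EZ_shift[OF g.psgn_closed[OF c(1)] c(2), of l i] EB_shift[OF g.psgn_closed[OF c(1)] c(2), of l i] unfolding xy p[OF c(1)] by blast
  next
    fix z assume h: "EZ i (l - 1) M \<subseteq> EB i (l - 1) M" and z: "z \<in> EZ i (- 1) (shift l M)"
    obtain x y where xy: "z = (x, y)" by (cases z)
    have c: "x \<in> carrier (gr M l)" "y \<in> carrier (gr M (l - 1))" using c1 z xy by auto
    show "z \<in> EB i (- 1) (shift l M)"
      using h z EZ_shift[OF c, of i] EB_shift[OF c, of i] unfolding xy by blast
  qed
qed

end

lemma exactE_shift:
  assumes "md M"
  shows "exactE M \<longleftrightarrow> (\<forall>i l. EZ i (- 1) (shift l M) \<subseteq> EB i (- 1) (shift l M))"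
  unfolding exactE_iff exact_shift_iff[OF assms] by (metis add_diff_cancel_right')

abbreviation "Hot \<equiv> (Hot_tor k At :: (('k, 'a, 'u) tmod, (int \<Rightarrow> 'u \<Rightarrow> 'u) set) acat)"

lemma Hot_Ob: "M \<in> Ob Hot \<longleftrightarrow> md M \<and> torsion k M"
  by (simp add: Hot_tor_def)

lemma Hot_Hom: "Hom Hot M N = closed_maps At M N Mod exact_maps At M N"
  by (simp add: Hot_tor_def)

lemma Hot_id: "Idm Hot M = hclass M M (\<lambda>n x. x)"
  by (simp add: Hot_tor_def hclass_def rs_def restrict_def)

lemma Hot_elem: "\<lbrakk>md M; md N\<rbrakk> \<Longrightarrow> F \<in> carrier (Hom Hot M N) \<longleftrightarrow> (\<exists>f. cmap M N f \<and> F = hclass M N f)"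
  unfolding Hot_Hom Mod_carrier by auto

lemma Hot_zero: "\<lbrakk>md M; md N\<rbrakk> \<Longrightarrow> \<one>\<^bsub>Hom Hot M N\<^esub> = hclass M N (\<lambda>n x. \<zero>\<^bsub>gr N n\<^esub>)"
  unfolding Hot_Hom by (rule Mod_one)

lemma Hot_mult: "\<lbrakk>md M; md N; cmap M N f; cmap M N g\<rbrakk> \<Longrightarrow>
    hclass M N f \<otimes>\<^bsub>Hom Hot M N\<^esub> hclass M N g = hclass M N (\<lambda>n x. f n x \<oplus>\<^bsub>gr N n\<^esub> g n x)"
  unfolding Hot_Hom by (rule Mod_mult)

lemma Hot_W: "\<lbrakk>md M; md N; S \<in> t_isos k At M N\<rbrakk> \<Longrightarrow> \<exists>s. cmap M N s \<and> qi M N s \<and> S = hclass M N s"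
  using Hot_elem[of M N S] t_isos_iff[of M N] by (auto simp: t_isos_def)

lemma transport_qi':
  assumes "md M" "\<And>n. inj_on e (carrier (gr M n))" "md N" "cmap M N f" "qi M N f"
  shows "qi (transport e M) N (\<lambda>n x. f n (inv_into (carrier (gr M n)) e x))"
  by (rule qi_comp[OF transport_iso(1)[OF assms(1,2)] assms(1,3) transport_iso(3)[OF assms(1,2)] assms(4) transport_qi[OF assms(1,2)] assms(5)])

text \<open>Two-out-of-three is inherited from \<open>qi\<close>. The Ore condition is where an
  infinite universe enters: the fibre completing a fraction lives on triples over \<open>'u\<close>
  and has to be moved back into \<open>'u\<close>.\<close>

theorem Hot_frac_cat:
  assumes inf: "infinite (UNIV :: 'u set)"
  shows "frac_cat Hot (t_isos k At :: ('k, 'a, 'u) tmod \<Rightarrow> ('k, 'a, 'u) tmod \<Rightarrow> (int \<Rightarrow> 'u \<Rightarrow> 'u) set set)"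
proof (rule frac_cat.intro)
  fix X Y :: "('k, 'a, 'u) tmod"
  assume "X \<in> Ob Hot" "Y \<in> Ob Hot"
  then have X: "md X" "torsion k X" and Y: "md Y" "torsion k Y" by (auto simp: Hot_Ob)
  show "comm_group (Hom Hot X Y)" unfolding Hot_Hom by (rule Mod_group[OF X(1) Y(1)])
  { fix F assume "F \<in> carrier (Hom Hot X Y)"
    then obtain f where f: "cmap X Y f" "F = hclass X Y f" using X Y Hot_elem by blast
    show "Comp Hot X Y Y (Idm Hot Y) F = F" unfolding f(2) Hot_id Hot_Comp[OF X(1) Y(1) Y(1) f(1) cmap_id] ..
    show "Comp Hot X X Y F (Idm Hot X) = F" unfolding f(2) Hot_id Hot_Comp[OF X(1) X(1) Y(1) cmap_id f(1)] .. }
  { fix S assume "S \<in> t_isos k At X Y" then show "S \<in> carrier (Hom Hot X Y)" by (simp add: t_isos_def) }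
next
  fix X :: "('k, 'a, 'u) tmod"
  assume "X \<in> Ob Hot"
  then have X: "md X" by (auto simp: Hot_Ob)
  show "Idm Hot X \<in> carrier (Hom Hot X X)" unfolding Hot_id using Hot_elem[OF X X] cmap_id by blast
  show "Idm Hot X \<in> t_isos k At X X" unfolding Hot_id t_isos_iff[OF X X cmap_id] by (rule qi_id[OF X])
next
  fix X Y Z :: "('k, 'a, 'u) tmod" and F G
  assume "X \<in> Ob Hot" "Y \<in> Ob Hot" "Z \<in> Ob Hot" and F: "F \<in> carrier (Hom Hot X Y)" and G: "G \<in> carrier (Hom Hot Y Z)"
  then have X: "md X" and Y: "md Y" and Z: "md Z" by (auto simp: Hot_Ob)
  obtain f where f: "cmap X Y f" "F = hclass X Y f" using F X Y Hot_elem by blast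
  obtain g where g: "cmap Y Z g" "G = hclass Y Z g" using G Y Z Hot_elem by blast
  show "Comp Hot X Y Z G F \<in> carrier (Hom Hot X Z)"
    unfolding f(2) g(2) Hot_Comp[OF X Y Z f(1) g(1)] using Hot_elem[OF X Z] cmap_comp[OF X Y Z f(1) g(1)] by blast
  { fix V :: "('k, 'a, 'u) tmod" and H assume "V \<in> Ob Hot" and H: "H \<in> carrier (Hom Hot Z V)"
    then have V: "md V" by (simp add: Hot_Ob)
    obtain h where h: "cmap Z V h" "H = hclass Z V h" using H Z V Hot_elem by blast
    show "Comp Hot X Y V (Comp Hot Y Z V H G) F = Comp Hot X Z V H (Comp Hot X Y Z G F)"
      unfolding f(2) g(2) h(2) Hot_Comp[OF X Y Z f(1) g(1)] Hot_Comp[OF Y Z V g(1) h(1)]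
        Hot_Comp[OF X Z V cmap_comp[OF X Y Z f(1) g(1)] h(1)] Hot_Comp[OF X Y V f(1) cmap_comp[OF Y Z V g(1) h(1)]] .. }
  { fix G' assume "G' \<in> carrier (Hom Hot Y Z)"
    then obtain g' where g': "cmap Y Z g'" "G' = hclass Y Z g'" using Y Z Hot_elem by blast
    show "Comp Hot X Y Z (G \<otimes>\<^bsub>Hom Hot Y Z\<^esub> G') F = Comp Hot X Y Z G F \<otimes>\<^bsub>Hom Hot X Z\<^esub> Comp Hot X Y Z G' F"
      unfolding f(2) g(2) g'(2) Hot_mult[OF Y Z g(1) g'(1)] Hot_Comp[OF X Y Z f(1) cmap_add[OF Y Z g(1) g'(1)]]
        Hot_Comp[OF X Y Z f(1) g(1)] Hot_Comp[OF X Y Z f(1) g'(1)] Hot_mult[OF X Z cmap_comp[OF X Y Z f(1) g(1)] cmap_comp[OF X Y Z f(1) g'(1)]] .. }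
  { fix F' assume "F' \<in> carrier (Hom Hot X Y)"
    then obtain f' where f': "cmap X Y f'" "F' = hclass X Y f'" using X Y Hot_elem by blast
    have s: "cmap X Z (\<lambda>n x. g n (f n x) \<oplus>\<^bsub>gr Z n\<^esub> g n (f' n x))"
      by (rule cmap_add[OF X Z cmap_comp[OF X Y Z f(1) g(1)] cmap_comp[OF X Y Z f'(1) g(1)]])
    show "Comp Hot X Y Z G (F \<otimes>\<^bsub>Hom Hot X Y\<^esub> F') = Comp Hot X Y Z G F \<otimes>\<^bsub>Hom Hot X Z\<^esub> Comp Hot X Y Z G F'"
      unfolding f(2) g(2) f'(2) Hot_mult[OF X Y f(1) f'(1)] Hot_Comp[OF X Y Z cmap_add[OF X Y f(1) f'(1)] g(1)]
        Hot_Comp[OF X Y Z f(1) g(1)] Hot_Comp[OF X Y Z f'(1) g(1)] Hot_mult[OF X Z cmap_comp[OF X Y Z f(1) g(1)] cmap_comp[OF X Y Z f'(1) g(1)]]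
      by (rule hclass_cong[OF X Z s]) (use g(1) f(1) f'(1) in \<open>simp add: cmap_def\<close>) }
next
  fix X Y Z :: "('k, 'a, 'u) tmod" and S F
  assume "X \<in> Ob Hot" "Y \<in> Ob Hot" "Z \<in> Ob Hot"
  then have X: "md X" and Y: "md Y" and Z: "md Z" by (auto simp: Hot_Ob)
  { assume S: "S \<in> t_isos k At Y Z" and F: "F \<in> carrier (Hom Hot X Y)" and c: "Comp Hot X Y Z S F \<in> t_isos k At X Z"
    obtain s where s: "cmap Y Z s" "qi Y Z s" "S = hclass Y Z s" using Hot_W[OF Y Z S] by blast
    obtain f where f: "cmap X Y f" "F = hclass X Y f" using F X Y Hot_elem by blast
    show "F \<in> t_isos k At X Y"
      using c qi_cancel_left[OF X Y Z f(1) s(1,2)]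
      unfolding f(2) s(3) Hot_Comp[OF X Y Z f(1) s(1)] t_isos_iff[OF X Y f(1)] t_isos_iff[OF X Z cmap_comp[OF X Y Z f(1) s(1)]] by blast }
  { assume S: "S \<in> t_isos k At X Y" and F: "F \<in> carrier (Hom Hot Y Z)" and c: "Comp Hot X Y Z F S \<in> t_isos k At X Z"
    obtain s where s: "cmap X Y s" "qi X Y s" "S = hclass X Y s" using Hot_W[OF X Y S] by blast
    obtain f where f: "cmap Y Z f" "F = hclass Y Z f" using F Y Z Hot_elem by blast
    show "F \<in> t_isos k At Y Z"
      using c qi_cancel_right[OF X Y Z s(1) f(1) s(2)]
      unfolding f(2) s(3) Hot_Comp[OF X Y Z s(1) f(1)] t_isos_iff[OF Y Z f(1)] t_isos_iff[OF X Z cmap_comp[OF X Y Z s(1) f(1)]] by blast }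
next
  fix X Y Z :: "('k, 'a, 'u) tmod" and S U
  assume "X \<in> Ob Hot" "Y \<in> Ob Hot" "Z \<in> Ob Hot" and S: "S \<in> t_isos k At X Y" and U: "U \<in> t_isos k At Y Z"
  then have X: "md X" and Y: "md Y" and Z: "md Z" by (auto simp: Hot_Ob)
  obtain s where s: "cmap X Y s" "qi X Y s" "S = hclass X Y s" using Hot_W[OF X Y S] by blast
  obtain u where u: "cmap Y Z u" "qi Y Z u" "U = hclass Y Z u" using Hot_W[OF Y Z U] by blast
  show "Comp Hot X Y Z U S \<in> t_isos k At X Z"
    unfolding s(3) u(3) Hot_Comp[OF X Y Z s(1) u(1)] t_isos_iff[OF X Z cmap_comp[OF X Y Z s(1) u(1)]]
    by (rule qi_comp[OF X Y Z s(1) u(1) s(2) u(2)])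
next
  fix X Y L :: "('k, 'a, 'u) tmod" and F S
  assume "X \<in> Ob Hot" "Y \<in> Ob Hot" "L \<in> Ob Hot" and F: "F \<in> carrier (Hom Hot X Y)" and S: "S \<in> t_isos k At L Y"
  then have X: "md X" "torsion k X" and Y: "md Y" "torsion k Y" and L: "md L" "torsion k L" by (auto simp: Hot_Ob)
  obtain f where f: "cmap X Y f" "F = hclass X Y f" using F X Y Hot_elem by blast
  obtain s where s: "cmap L Y s" "qi L Y s" "S = hclass L Y s" using Hot_W[OF L(1) Y(1) S] by blast
  obtain P :: "(nat \<Rightarrow> 'k, nat \<Rightarrow> 'a, ('u \<times> 'u) \<times> 'u) cdgm" and w h where P: "md P" "torsion k P" "cmap P X w" "qi P X w" "cmap P L h"
    "homotopic P Y (\<lambda>n v. f n (w n v)) (\<lambda>n v. s n (h n v))"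
    using ore_chain[OF X Y L f(1) s(1,2)] by blast
  have "|UNIV :: (('u \<times> 'u) \<times> 'u) set| \<le>o |UNIV :: 'u set|"
    unfolding UNIV_Times_UNIV[symmetric]
    by (intro card_of_Times_ordLeq_infinite[OF inf] ordLeq_refl card_of_Card_order)
  then obtain e :: "('u \<times> 'u) \<times> 'u \<Rightarrow> 'u" where "inj e" unfolding card_of_ordLeq[symmetric] by blast
  then have inj: "inj_on e (carrier (gr P n))" for n by (rule inj_on_subset) simp
  let ?r = "\<lambda>n. inv_into (carrier (gr P n)) e"
  note T = transport_iso[OF P(1) inj]
  note wr = cmap_comp[OF T(1) P(1) X(1) T(3) P(3)] and hr = cmap_comp[OF T(1) P(1) L(1) T(3) P(5)]
  have fw: "cmap P Y (\<lambda>n v. f n (w n v))" by (rule cmap_comp[OF P(1) X(1) Y(1) P(3) f(1)])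
  have sh: "cmap P Y (\<lambda>n v. s n (h n v))" by (rule cmap_comp[OF P(1) L(1) Y(1) P(5) s(1)])
  have "homotopic (transport e P) Y (\<lambda>n v. f n (w n (?r n v))) (\<lambda>n v. s n (h n (?r n v)))"
    by (rule homotopic_pre[OF T(1) P(1) Y(1) T(3) fw sh P(6)])
  then have eq: "Comp Hot (transport e P) X Y F (hclass (transport e P) X (\<lambda>n v. w n (?r n v))) =
      Comp Hot (transport e P) L Y S (hclass (transport e P) L (\<lambda>n v. h n (?r n v)))"
    unfolding f(2) s(3) Hot_Comp[OF T(1) X(1) Y(1) wr f(1)] Hot_Comp[OF T(1) L(1) Y(1) hr s(1)]
    by (simp only: hclass_eq_iff[OF T(1) Y(1) cmap_comp[OF T(1) X(1) Y(1) wr f(1)] cmap_comp[OF T(1) L(1) Y(1) hr s(1)]])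
  show "\<exists>K\<in>Ob Hot. \<exists>w\<in>t_isos k At K X. \<exists>h\<in>carrier (Hom Hot K L). Comp Hot K X Y F w = Comp Hot K L Y S h"
  proof (rule bexI, rule bexI, rule bexI, rule eq)
    show "hclass (transport e P) L (\<lambda>n v. h n (?r n v)) \<in> carrier (Hom Hot (transport e P) L)" using Hot_elem[OF T(1) L(1)] hr by blast
    show "hclass (transport e P) X (\<lambda>n v. w n (?r n v)) \<in> t_isos k At (transport e P) X"
      unfolding t_isos_iff[OF T(1) X(1) wr] by (rule transport_qi'[OF P(1) inj X(1) P(3,4)])
    show "transport e P \<in> Ob Hot" using T(1,4) P(2) by (simp add: Hot_Ob)
  qed
qed

end

section \<open>Homotopy projectivity, compactness and generation\<close>

lemma transport_zero: "\<zero>\<^bsub>gr (transport e M) n\<^esub> = e \<zero>\<^bsub>gr M n\<^esub>"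
  by (simp add: transport_def Let_def)

context tors
begin

context
  fixes e :: "(nat \<Rightarrow> 'a) set \<times> (nat \<Rightarrow> 'a) set \<Rightarrow> 'u" and i :: nat
  assumes inj: "\<And>n. inj_on e (carrier (gr (Gam i) n))" and inf: "infinite (UNIV :: 'u set)"
begin

abbreviation "G \<equiv> transport e (Gam i)"
abbreviation "g \<equiv> gp e i"

interpretation H: frac_cat Hot "t_isos k At :: ('k, 'a, 'u) tmod \<Rightarrow> ('k, 'a, 'u) tmod \<Rightarrow> (int \<Rightarrow> 'u \<Rightarrow> 'u) set set"
  by (rule Hot_frac_cat[OF inf])

lemma Gp_md: "md G" and Gp_torsion: "torsion k G"
  using transport_iso[OF md_Gam inj] torsion_Gam by auto

lemma Gp_Ob: "G \<in> Ob Hot"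
  by (simp add: Hot_Ob Gp_md Gp_torsion)

text \<open>Every pair is the image of the universal one under some map, and a map is null-homotopic
  exactly if that image bounds.\<close>

lemma Hom_Gp_trivial_iff:
  fixes N :: "('k, 'a, 'u) tmod"
  assumes N: "md N"
  shows "carrier (Hom Hot G N) = {\<one>\<^bsub>Hom Hot G N\<^esub>} \<longleftrightarrow> EZ i (- 1) N \<subseteq> EB i (- 1) N"
proof -
  note z = cmap_zero[OF Gp_md N]
  have "carrier (Hom Hot G N) = hclass G N ` {f. cmap G N f}" using Hot_elem[OF Gp_md N] by auto
  then have "carrier (Hom Hot G N) = {\<one>\<^bsub>Hom Hot G N\<^esub>} \<longleftrightarrow> (\<forall>f. cmap G N f \<longrightarrow> hclass G N f = hclass G N (\<lambda>n x. \<zero>\<^bsub>gr N n\<^esub>))"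
    using z unfolding Hot_zero[OF Gp_md N] by auto
  also have "\<dots> \<longleftrightarrow> (\<forall>f. cmap G N f \<longrightarrow> Ef f (- 1) g \<in> EB i (- 1) N)"
    using hclass_eq_iff[OF Gp_md N _ z] Gp_null_iff[OF inj N] by simp
  also have "\<dots> \<longleftrightarrow> EZ i (- 1) N \<subseteq> EB i (- 1) N"
  proof (intro iffI allI impI subsetI)
    fix w assume h: "\<forall>f. cmap G N f \<longrightarrow> Ef f (- 1) g \<in> EB i (- 1) N" and w: "w \<in> EZ i (- 1) N"
    obtain f where "cmap G N f" "Ef f (- 1) g = w" using Gp_rep_ex[OF inj N w] by blast
    then show "w \<in> EB i (- 1) N" using h by blast
  next
    fix f assume "EZ i (- 1) N \<subseteq> EB i (- 1) N" "cmap G N f"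
    then show "Ef f (- 1) g \<in> EB i (- 1) N" using Ef_EZ[OF Gp_md N _ Gp_EZ[OF inj]] by blast
  qed
  finally show ?thesis .
qed

text \<open>Through representability, the two clauses of \<open>qi\<close> in degree
  \<open>-1\<close> are the existence and the uniqueness of lifts along a morphism with
  \<open>t\<close>-acyclic cone.\<close>

lemma Gp_homotopy_projective: "H.homotopy_projective G"
  unfolding H.homotopy_projective_def
proof (intro conjI ballI Gp_Ob)
  fix X Y :: "('k, 'a, 'u) tmod" and S F
  assume "X \<in> Ob Hot" "Y \<in> Ob Hot" and S: "S \<in> t_isos k At X Y" and F: "F \<in> carrier (Hom Hot G Y)"
  then have X: "md X" and Y: "md Y" by (auto simp: Hot_Ob)
  note P = Gp_md
  obtain s where s: "cmap X Y s" "qi X Y s" "S = hclass X Y s" using Hot_W[OF X Y S] by blast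
  obtain f where f: "cmap G Y f" "F = hclass G Y f" using F Hot_elem[OF P Y] by blast
  have EZ: "Ef h (- 1) g \<in> EZ i (- 1) N" if "md N" "cmap G N h" for N :: "('k, 'a, 'u) tmod" and h
    by (rule Ef_EZ[OF P that Gp_EZ[OF inj]])
  have sl: "cmap G Y (\<lambda>n x. s n (l n x))" "Ef (\<lambda>n x. s n (l n x)) (- 1) g = Ef s (- 1) (Ef l (- 1) g)" if "cmap G X l" for l
    by (rule cmap_comp[OF P X Y that s(1)]) (rule Ef_comp[OF P X Y that s(1)])
  from s(2) have q: "\<And>z. z \<in> EZ i (- 1) Y \<Longrightarrow> \<exists>w\<in>EZ i (- 1) X. z \<ominus>\<^bsub>EG Y (- 1)\<^esub> Ef s (- 1) w \<in> EB i (- 1) Y"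
    "\<And>z. z \<in> EZ i (- 1) X \<Longrightarrow> Ef s (- 1) z \<in> EB i (- 1) Y \<Longrightarrow> z \<in> EB i (- 1) X"
    unfolding qi_iff[OF X Y s(1)] by blast+
  show "\<exists>!l. l \<in> carrier (Hom Hot G X) \<and> Comp Hot G X Y S l = F"
  proof (rule ex_ex1I)
    obtain w where w: "w \<in> EZ i (- 1) X" "Ef f (- 1) g \<ominus>\<^bsub>EG Y (- 1)\<^esub> Ef s (- 1) w \<in> EB i (- 1) Y"
      using q(1)[OF EZ[OF Y f(1)]] by blast
    obtain l where l: "cmap G X l" "Ef l (- 1) g = w" using Gp_rep_ex[OF inj X w(1)] by blast
    have "homotopic G Y f (\<lambda>n x. s n (l n x))"
      using w(2) unfolding Gp_homotopic_iff[OF inj Y f(1) sl(1)[OF l(1)]] sl(2)[OF l(1)] l(2) .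
    then have "Comp Hot G X Y S (hclass G X l) = F"
      unfolding s(3) f(2) Hot_Comp[OF P X Y l(1) s(1)] using hclass_eq_iff[OF P Y f(1) sl(1)[OF l(1)]] by simp
    then show "\<exists>l. l \<in> carrier (Hom Hot G X) \<and> Comp Hot G X Y S l = F" using Hot_elem[OF P X] l(1) by blast
  next
    fix L L' assume "L \<in> carrier (Hom Hot G X) \<and> Comp Hot G X Y S L = F" "L' \<in> carrier (Hom Hot G X) \<and> Comp Hot G X Y S L' = F"
    then obtain l l' where l: "cmap G X l" "L = hclass G X l" and l': "cmap G X l'" "L' = hclass G X l'"
      and e: "Comp Hot G X Y S L = Comp Hot G X Y S L'" using Hot_elem[OF P X] by metis
    have "homotopic G Y (\<lambda>n x. s n (l n x)) (\<lambda>n x. s n (l' n x))"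
      using e unfolding s(3) l(2) l'(2) Hot_Comp[OF P X Y l(1) s(1)] Hot_Comp[OF P X Y l'(1) s(1)] hclass_eq_iff[OF P Y sl(1)[OF l(1)] sl(1)[OF l'(1)]] .
    then have "Ef s (- 1) (Ef l (- 1) g) \<ominus>\<^bsub>EG Y (- 1)\<^esub> Ef s (- 1) (Ef l' (- 1) g) \<in> EB i (- 1) Y"
      unfolding Gp_homotopic_iff[OF inj Y sl(1)[OF l(1)] sl(1)[OF l'(1)]] sl(2)[OF l(1)] sl(2)[OF l'(1)] .
    then have "Ef s (- 1) (Ef l (- 1) g \<ominus>\<^bsub>EG X (- 1)\<^esub> Ef l' (- 1) g) \<in> EB i (- 1) Y"
      using addhom_minus[OF Ef_hom[OF X Y s(1), of "- 1"] EZ_carr[OF EZ[OF X l(1)]] EZ_carr[OF EZ[OF X l'(1)]]] by simp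
    then have "Ef l (- 1) g \<ominus>\<^bsub>EG X (- 1)\<^esub> Ef l' (- 1) g \<in> EB i (- 1) X"
      by (rule q(2)[OF EZ_minus[OF X EZ[OF X l(1)] EZ[OF X l'(1)]]])
    then show "L = L'"
      unfolding l(2) l'(2) hclass_eq_iff[OF P X l(1) l'(1)] Gp_homotopic_iff[OF inj X l(1) l'(1)] .
  qed
qed

text \<open>Each cycle of \<open>L j\<close> is represented by a map from \<open>G\<close>, so a
  finite sum of images in \<open>P\<close> is represented by a sum of maps that factor through the
  \<open>f j\<close>.\<close>

lemma Gp_sum:
  fixes L :: "'u \<Rightarrow> ('k, 'a, 'u) tmod" and P :: "('k, 'a, 'u) tmod"
  assumes P: "md P" and L: "\<And>j. j \<in> J \<Longrightarrow> md (L j)" and f: "\<And>j. j \<in> J \<Longrightarrow> cmap (L j) P (f j)"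
    and "finite S" "S \<subseteq> J" "\<And>j. j \<in> S \<Longrightarrow> w j \<in> EZ i (- 1) (L j)"
  shows "\<exists>\<chi>. cmap G P \<chi> \<and> Ef \<chi> (- 1) g = finsum (EG P (- 1)) (\<lambda>j. Ef (f j) (- 1) (w j)) S \<and>
    hclass G P \<chi> \<in> generate (Hom Hot G P) (\<Union>j\<in>J. Comp Hot G (L j) P (hclass (L j) P (f j)) ` carrier (Hom Hot G (L j)))"
  (is "\<exists>\<chi>. ?Q S \<chi>")
  using assms(4-)
proof (induction S)
  case empty
  interpret E: abelian_group "EG P (- 1)" by (rule EG_ab[OF P])
  have "?Q {} (\<lambda>n x. \<zero>\<^bsub>gr P n\<^esub>)"
    using cmap_zero[OF Gp_md P] generate.one[of "Hom Hot G P"] Hot_zero[OF Gp_md P] by (auto simp: Ef_def EG_simps split: prod.split)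
  then show ?case by blast
next
  case (insert j S)
  interpret E: abelian_group "EG P (- 1)" by (rule EG_ab[OF P])
  obtain \<chi> where \<chi>: "?Q S \<chi>" using insert by blast
  have j: "j \<in> J" "w j \<in> EZ i (- 1) (L j)" using insert by auto
  obtain \<psi> where \<psi>: "cmap G (L j) \<psi>" "Ef \<psi> (- 1) g = w j" using Gp_rep_ex[OF inj L[OF j(1)] j(2)] by blast
  have fp: "cmap G P (\<lambda>n x. f j n (\<psi> n x))" "Ef (\<lambda>n x. f j n (\<psi> n x)) (- 1) g = Ef (f j) (- 1) (w j)"
    using cmap_comp[OF Gp_md L[OF j(1)] P \<psi>(1) f[OF j(1)]] Ef_comp[OF Gp_md L[OF j(1)] P \<psi>(1) f[OF j(1)]] \<psi>(2) by auto
  have c: "Ef (f j') (- 1) (w j') \<in> carrier (EG P (- 1))" if "j' \<in> insert j S" for j'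
    using insert.prems that by (intro EZ_carr Ef_EZ[OF L P f]) auto
  have "Ef (\<lambda>n x. f j n (\<psi> n x) \<oplus>\<^bsub>gr P n\<^esub> \<chi> n x) (- 1) g = Ef (\<lambda>n x. f j n (\<psi> n x)) (- 1) g \<oplus>\<^bsub>EG P (- 1)\<^esub> Ef \<chi> (- 1) g"
    by (simp add: Ef_def EG_simps split: prod.split)
  also have "\<dots> = finsum (EG P (- 1)) (\<lambda>j. Ef (f j) (- 1) (w j)) (insert j S)"
    using \<chi> fp(2) c insert.hyps by (simp add: Pi_def)
  finally have "Ef (\<lambda>n x. f j n (\<psi> n x) \<oplus>\<^bsub>gr P n\<^esub> \<chi> n x) (- 1) g = finsum (EG P (- 1)) (\<lambda>j. Ef (f j) (- 1) (w j)) (insert j S)" .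
  moreover have "hclass G P (\<lambda>n x. f j n (\<psi> n x) \<oplus>\<^bsub>gr P n\<^esub> \<chi> n x) \<in>
      generate (Hom Hot G P) (\<Union>j\<in>J. Comp Hot G (L j) P (hclass (L j) P (f j)) ` carrier (Hom Hot G (L j)))"
  proof -
    have "hclass G P (\<lambda>n x. f j n (\<psi> n x)) = Comp Hot G (L j) P (hclass (L j) P (f j)) (hclass G (L j) \<psi>)"
      by (rule Hot_Comp[symmetric, OF Gp_md L[OF j(1)] P \<psi>(1) f[OF j(1)]])
    moreover have "hclass G (L j) \<psi> \<in> carrier (Hom Hot G (L j))" using Hot_elem[OF Gp_md L[OF j(1)]] \<psi>(1) by blast
    ultimately have "hclass G P (\<lambda>n x. f j n (\<psi> n x)) \<in> (\<Union>j\<in>J. Comp Hot G (L j) P (hclass (L j) P (f j)) ` carrier (Hom Hot G (L j)))"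
      using j(1) by blast
    from generate.incl[OF this] have "hclass G P (\<lambda>n x. f j n (\<psi> n x)) \<otimes>\<^bsub>Hom Hot G P\<^esub> hclass G P \<chi> \<in>
        generate (Hom Hot G P) (\<Union>j\<in>J. Comp Hot G (L j) P (hclass (L j) P (f j)) ` carrier (Hom Hot G (L j)))"
      by (rule generate.eng) (use \<chi> in blast)
    moreover have "cmap G P \<chi>" using \<chi> by blast
    ultimately show ?thesis using Hot_mult[OF Gp_md P fp(1)] by simp
  qed
  ultimately show ?case using cmap_add[OF Gp_md P fp(1), of \<chi>] \<chi> by blast
qed

text \<open>The cone of the sum map, moved into the universe, serves as cofibre: the
  \<open>F j\<close> die in it by an explicit homotopy, and what dies in it comes from finitely many
  \<open>L j\<close> by \<open>cofib_exact\<close>.\<close>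

lemma Gp_compact: "compact_object TYPE('u) (Dt_tor k At) G"
  unfolding Dt_tor_def
proof (rule H.compact_objectI[OF Gp_homotopy_projective])
  fix J and L :: "'u \<Rightarrow> ('k, 'a, 'u) tmod" and F P
  assume P': "P \<in> Ob Hot" and LF: "\<And>j. j \<in> J \<Longrightarrow> L j \<in> Ob Hot \<and> F j \<in> carrier (Hom Hot (L j) P)"
  have P: "md P" "torsion k P" using P' by (auto simp: Hot_Ob)
  have L: "md (L j)" "torsion k (L j)" if "j \<in> J" for j using LF[OF that] by (auto simp: Hot_Ob)
  have "\<forall>j. \<exists>f. j \<in> J \<longrightarrow> cmap (L j) P f \<and> F j = hclass (L j) P f" using LF Hot_elem[OF L(1) P(1)] by blast
  then obtain f where f: "\<And>j. j \<in> J \<Longrightarrow> cmap (L j) P (f j)" "\<And>j. j \<in> J \<Longrightarrow> F j = hclass (L j) P (f j)" by metis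
  let ?C = "cofib J L P f"
  let ?c = "cofib_map J L"
  have C: "md ?C" "torsion k ?C" by (rule md_cofib[OF L(1) P(1) f(1)], assumption+) (rule torsion_cofib[OF L(1) P(1) f(1) P(2) L(2)], assumption+)
  have cm: "cmap P ?C ?c" by (rule cofib_cmap[OF L(1) P(1) f(1)])
  obtain \<epsilon> :: "'u \<times> ('u \<Rightarrow> 'u) \<Rightarrow> 'u" where "\<And>n. inj_on \<epsilon> (carrier (gr P n) \<times> carrier (gr (DS J L) (n + 1)))"
    using cofib_inj[OF inf, of J L P] L(1) by blast
  then have \<epsilon>: "inj_on \<epsilon> (carrier (gr ?C n))" for n
    by (subst cofib_simps(1)[OF L(1) P(1) f(1)]) assumption
  let ?Z = "transport \<epsilon> ?C"
  note T = transport_iso[OF C(1) \<epsilon>]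
  let ?q = "\<lambda>n x. \<epsilon> (?c n x)"
  have q: "cmap P ?Z ?q" by (rule cmap_comp[OF P(1) C(1) T(1) cm T(2)])
  show "\<exists>Z\<in>Ob Hot. \<exists>q\<in>carrier (Hom Hot P Z). (\<forall>j\<in>J. Comp Hot (L j) P Z q (F j) = \<one>\<^bsub>Hom Hot (L j) Z\<^esub>) \<and>
        (\<forall>\<phi>\<in>carrier (Hom Hot G P). Comp Hot G P Z q \<phi> = \<one>\<^bsub>Hom Hot G Z\<^esub> \<longrightarrow>
          \<phi> \<in> generate (Hom Hot G P) (\<Union>j\<in>J. Comp Hot G (L j) P (F j) ` carrier (Hom Hot G (L j))))"
  proof (rule bexI, rule bexI, rule conjI)
    show "?Z \<in> Ob Hot" using T(1) T(4)[OF C(2)] by (simp add: Hot_Ob)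
    show "hclass P ?Z ?q \<in> carrier (Hom Hot P ?Z)" using Hot_elem[OF P(1) T(1)] q by blast
    show "\<forall>j\<in>J. Comp Hot (L j) P ?Z (hclass P ?Z ?q) (F j) = \<one>\<^bsub>Hom Hot (L j) ?Z\<^esub>"
    proof
      fix j assume j: "j \<in> J"
      note cf = cmap_comp[OF L(1)[OF j] P(1) C(1) f(1)[OF j] cm]
      have "homotopic (L j) ?Z (\<lambda>n x. \<epsilon> (?c n (f j n x))) (\<lambda>n x. \<epsilon> \<zero>\<^bsub>gr ?C n\<^esub>)"
        by (rule homotopic_post[OF L(1)[OF j] C(1) T(1) cf cmap_zero[OF L(1)[OF j] C(1)] T(2) cofib_null[OF L(1) P(1) f(1) j]])
      then have "homotopic (L j) ?Z (\<lambda>n x. \<epsilon> (?c n (f j n x))) (\<lambda>n x. \<zero>\<^bsub>gr ?Z n\<^esub>)" by (simp only: transport_zero)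
      then show "Comp Hot (L j) P ?Z (hclass P ?Z ?q) (F j) = \<one>\<^bsub>Hom Hot (L j) ?Z\<^esub>"
        unfolding f(2)[OF j] Hot_Comp[OF L(1)[OF j] P(1) T(1) f(1)[OF j] q] Hot_zero[OF L(1)[OF j] T(1)]
          hclass_eq_iff[OF L(1)[OF j] T(1) cmap_comp[OF L(1)[OF j] P(1) T(1) f(1)[OF j] q] cmap_zero[OF L(1)[OF j] T(1)]] .
    qed
    show "\<forall>\<phi>\<in>carrier (Hom Hot G P). Comp Hot G P ?Z (hclass P ?Z ?q) \<phi> = \<one>\<^bsub>Hom Hot G ?Z\<^esub> \<longrightarrow>
          \<phi> \<in> generate (Hom Hot G P) (\<Union>j\<in>J. Comp Hot G (L j) P (F j) ` carrier (Hom Hot G (L j)))"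
    proof (intro ballI impI)
      fix \<Phi> assume "\<Phi> \<in> carrier (Hom Hot G P)" and n: "Comp Hot G P ?Z (hclass P ?Z ?q) \<Phi> = \<one>\<^bsub>Hom Hot G ?Z\<^esub>"
      then obtain \<phi> where \<phi>: "cmap G P \<phi>" "\<Phi> = hclass G P \<phi>" using Hot_elem[OF Gp_md P(1)] by blast
      note qp = cmap_comp[OF Gp_md P(1) T(1) \<phi>(1) q]
      have z: "Ef \<phi> (- 1) g \<in> EZ i (- 1) P" by (rule Ef_EZ[OF Gp_md P(1) \<phi>(1) Gp_EZ[OF inj]])
      have "homotopic G ?Z (\<lambda>n x. \<epsilon> (?c n (\<phi> n x))) (\<lambda>n x. \<zero>\<^bsub>gr ?Z n\<^esub>)"
        using n unfolding \<phi>(2) Hot_Comp[OF Gp_md P(1) T(1) \<phi>(1) q] Hot_zero[OF Gp_md T(1)] hclass_eq_iff[OF Gp_md T(1) qp cmap_zero[OF Gp_md T(1)]] .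
      then have b: "Ef (\<lambda>n x. \<epsilon> (?c n (\<phi> n x))) (- 1) g \<in> EB i (- 1) ?Z"
        unfolding Gp_null_iff[OF inj T(1) qp] .
      let ?r = "\<lambda>n. inv_into (carrier (gr ?C n)) \<epsilon>"
      \<comment> \<open>The inverse of the transport carries the boundary back to the cone in its
        natural type, to which \<open>cofib_exact\<close> applies.\<close>
      have "Ef ?r (- 1) (Ef (\<lambda>n x. \<epsilon> (?c n (\<phi> n x))) (- 1) g) \<in> EB i (- 1) ?C" by (rule Ef_EB[OF T(1) C(1) T(3) b])
      also have "Ef ?r (- 1) (Ef (\<lambda>n x. \<epsilon> (?c n (\<phi> n x))) (- 1) g) = Ef ?c (- 1) (Ef \<phi> (- 1) g)"
      proof -
        obtain x y where xy: "Ef \<phi> (- 1) g = (x, y)" by (cases "Ef \<phi> (- 1) g")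
        have xyc: "x \<in> carrier (gr P 0)" "y \<in> carrier (gr P (- 1))" using EZ_carr[OF z] by (auto simp: xy EG_simps)
        have e: "Ef (\<lambda>n x. \<epsilon> (?c n (\<phi> n x))) (- 1) g = Ef (\<lambda>n. \<epsilon>) (- 1) (Ef ?c (- 1) (x, y))"
          unfolding xy[symmetric] by (simp add: Ef_def split: prod.split)
        have "Ef ?r (- 1) (Ef (\<lambda>n. \<epsilon>) (- 1) (Ef ?c (- 1) (x, y))) = Ef ?c (- 1) (x, y)"
          using xyc cm by (simp add: Ef_def inv_into_f_f[OF \<epsilon>] cmap_def)
        then show ?thesis unfolding e unfolding xy .
      qed
      finally have "Ef ?c (- 1) (Ef \<phi> (- 1) g) \<in> EB i (- 1) ?C" .
      from z this have "\<exists>S w. finite S \<and> S \<subseteq> J \<and> (\<forall>j\<in>S. w j \<in> EZ i (- 1) (L j)) \<and>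
        Ef \<phi> (- 1) g \<ominus>\<^bsub>EG P (- 1)\<^esub> finsum (EG P (- 1)) (\<lambda>j. Ef (f j) (- 1) (w j)) S \<in> EB i (- 1) P"
        by (rule cofib_exact[OF L(1) P(1) f(1), rotated -2])
      then obtain S w where S0: "finite S \<and> S \<subseteq> J \<and> (\<forall>j\<in>S. w j \<in> EZ i (- 1) (L j)) \<and>
        Ef \<phi> (- 1) g \<ominus>\<^bsub>EG P (- 1)\<^esub> finsum (EG P (- 1)) (\<lambda>j. Ef (f j) (- 1) (w j)) S \<in> EB i (- 1) P"
        by (elim exE)
      then have S: "finite S" "S \<subseteq> J" "\<And>j. j \<in> S \<Longrightarrow> w j \<in> EZ i (- 1) (L j)"
        "Ef \<phi> (- 1) g \<ominus>\<^bsub>EG P (- 1)\<^esub> finsum (EG P (- 1)) (\<lambda>j. Ef (f j) (- 1) (w j)) S \<in> EB i (- 1) P"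
        by (simp_all only: simp_thms)
      have "\<exists>\<chi>. cmap G P \<chi> \<and> Ef \<chi> (- 1) g = finsum (EG P (- 1)) (\<lambda>j. Ef (f j) (- 1) (w j)) S \<and>
        hclass G P \<chi> \<in> generate (Hom Hot G P) (\<Union>j\<in>J. Comp Hot G (L j) P (hclass (L j) P (f j)) ` carrier (Hom Hot G (L j)))"
        by (rule Gp_sum[OF P(1) L(1) f(1) S(1,2,3)])
      then obtain \<chi> where "cmap G P \<chi> \<and> Ef \<chi> (- 1) g = finsum (EG P (- 1)) (\<lambda>j. Ef (f j) (- 1) (w j)) S \<and>
        hclass G P \<chi> \<in> generate (Hom Hot G P) (\<Union>j\<in>J. Comp Hot G (L j) P (hclass (L j) P (f j)) ` carrier (Hom Hot G (L j)))"
        by (elim exE)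
      then have \<chi>: "cmap G P \<chi>" "Ef \<chi> (- 1) g = finsum (EG P (- 1)) (\<lambda>j. Ef (f j) (- 1) (w j)) S"
        "hclass G P \<chi> \<in> generate (Hom Hot G P) (\<Union>j\<in>J. Comp Hot G (L j) P (hclass (L j) P (f j)) ` carrier (Hom Hot G (L j)))"
        by (simp_all only: simp_thms)
      have "hclass G P \<phi> = hclass G P \<chi>"
        unfolding hclass_eq_iff[OF Gp_md P(1) \<phi>(1) \<chi>(1)] Gp_homotopic_iff[OF inj P(1) \<phi>(1) \<chi>(1)] \<chi>(2) by (rule S(4))
      moreover have "(\<Union>j\<in>J. Comp Hot G (L j) P (F j) ` carrier (Hom Hot G (L j))) = (\<Union>j\<in>J. Comp Hot G (L j) P (hclass (L j) P (f j)) ` carrier (Hom Hot G (L j)))"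
        using f(2) by (intro SUP_cong) simp_all
      ultimately show "\<Phi> \<in> generate (Hom Hot G P) (\<Union>j\<in>J. Comp Hot G (L j) P (F j) ` carrier (Hom Hot G (L j)))"
        using \<chi>(3) unfolding \<phi>(2) by simp
    qed
  qed
qed

lemma Hom_Dt_Gp_trivial_iff:
  fixes N :: "('k, 'a, 'u) tmod"
  assumes "md N" "torsion k N"
  shows "carrier (Hom (Dt_tor k At) G N) = {\<one>\<^bsub>Hom (Dt_tor k At) G N\<^esub>} \<longleftrightarrow> EZ i (- 1) N \<subseteq> EB i (- 1) N"
proof -
  have "N \<in> Ob Hot" using assms by (simp add: Hot_Ob)
  from H.Hom_D_trivial_iff[OF Gp_homotopy_projective this] show ?thesis
    unfolding Dt_tor_def Hom_Gp_trivial_iff[OF assms(1)] .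
qed

end

text \<open>An object vanishes in the quotient exactly if its zero endomorphism is inverted, and
  that endomorphism is bijective on pairs modulo boundaries exactly if every pair bounds.\<close>

lemma zero_object_Dt_iff:
  fixes M :: "('k, 'a, 'u) tmod"
  assumes inf: "infinite (UNIV :: 'u set)" and M: "md M" "torsion k M"
  shows "zero_object (Dt_tor k At) M \<longleftrightarrow> exactE M"
proof -
  interpret H: frac_cat Hot "t_isos k At :: ('k, 'a, 'u) tmod \<Rightarrow> ('k, 'a, 'u) tmod \<Rightarrow> (int \<Rightarrow> 'u \<Rightarrow> 'u) set set"
    by (rule Hot_frac_cat[OF inf])
  have "M \<in> Ob Hot" using M by (simp add: Hot_Ob)
  from H.zero_object_iff[OF this] show ?thesis
    unfolding Dt_tor_def Hot_zero[OF M(1) M(1)] t_isos_iff[OF M(1) M(1) cmap_zero[OF M(1) M(1)]] qi_zero_iff[OF M(1)] .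
qed

end

text \<open>In the convolution only the term with index \<open>1\<close> survives. This shows that
  \<open>t\<close> acts injectively on power series.\<close>

lemma pser_module_tvar:
  assumes V: "module k V" and f: "f \<in> carrier (pser_module V)"
  shows "(tvar k \<odot>\<^bsub>pser_module V\<^esub> f) n = (if n = 0 then \<zero>\<^bsub>V\<^esub> else f (n - 1))"
proof -
  interpret V: module k V by (rule V)
  have fc: "f m \<in> carrier V" for m using f by (simp add: pser_module_def)
  have "(tvar k \<odot>\<^bsub>pser_module V\<^esub> f) n = (\<Oplus>\<^bsub>V\<^esub>i\<in>{..n}. if 1 = i then f (n - 1) else \<zero>\<^bsub>V\<^esub>)"
    unfolding pser_module_def tvar_def by (auto intro!: V.M.finsum_cong simp: fc V.smult_l_null simp_implies_def)
  also have "\<dots> = (if n = 0 then \<zero>\<^bsub>V\<^esub> else f (n - 1))"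
  proof (cases "n = 0")
    case True
    then show ?thesis by (simp add: fc)
  next
    case False
    then show ?thesis using V.M.finsum_singleton[of 1 "{..n}" "\<lambda>_. f (n - 1)"] by (simp add: fc)
  qed
  finally show ?thesis .
qed

text \<open>The point is that \<open>ct\<close> is closed: \<open>t\<close> times its differential
  is the differential of the curvature, hence zero, and \<open>t\<close> acts injectively on power
  series.\<close>

lemma cdg_deformation_tors:
  fixes k :: "'k ring"
  assumes d: "cdg_deformation k A At" and ct: "ct \<in> carrier (gr At 2)" "tvar k \<odot>\<^bsub>gr At 2\<^esub> ct = curv At"
  shows "tors k At ct"
proof -
  interpret cdg_deformation k A At by (rule d)
  have t: "tvar k \<in> carrier (pser k)" by (simp add: tvar_def pser_def)
  have c: "dif At 2 ct \<in> carrier (gr At 3)" by (rule At.dif_closed[OF ct(1)]) simp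
  have "tvar k \<odot>\<^bsub>gr At 3\<^esub> dif At 2 ct = dif At 2 (tvar k \<odot>\<^bsub>gr At 2\<^esub> ct)"
    by (rule At.dif_smult[OF ct(1) t, symmetric]) simp
  also have "\<dots> = \<zero>\<^bsub>gr At 3\<^esub>" unfolding ct(2) by (rule At.dif_curv)
  finally have z: "(tvar k \<odot>\<^bsub>pser_module (gr A 3)\<^esub> dif At 2 ct) (Suc n) = \<zero>\<^bsub>gr A 3\<^esub>" for n
    unfolding gr_deformation by (simp add: pser_module_def)
  \<comment> \<open>Coefficient \<open>n\<close> of a series is coefficient \<open>n + 1\<close> of
    its product with \<open>t\<close>.\<close>
  have "dif At 2 ct n = \<zero>\<^bsub>gr A 3\<^esub>" for n
    using z[of n] pser_module_tvar[OF gr_module, of "dif At 2 ct" 3 "Suc n"] c unfolding gr_deformation by simp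
  then have "dif At 2 ct = \<zero>\<^bsub>gr At 3\<^esub>" unfolding gr_deformation by (simp add: pser_module_def fun_eq_iff)
  then show ?thesis using At.cdg_algebra_axioms t ct by (simp add: tors_def tors_axioms_def)
qed

text \<open>The modules \<open>\<Gamma>_i\<close> are built on pairs of cosets, so \<open>e\<close>
  carries them into the universe \<open>'u\<close> on which the homotopy category lives. Infinity of
  \<open>'u\<close> leaves room for the fibres and cofibres of the argument.\<close>

theorem proposition9p5:
  fixes k :: "'k ring"
    and A :: "('k, 'a) cdga"
    and At :: "(nat \<Rightarrow> 'k, nat \<Rightarrow> 'a) cdga"
    and ct :: "nat \<Rightarrow> 'a"
    and e :: "(nat \<Rightarrow> 'a) set \<times> (nat \<Rightarrow> 'a) set \<Rightarrow> 'u"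
    and \<Gamma> :: "nat \<Rightarrow> (nat \<Rightarrow> 'k, nat \<Rightarrow> 'a, 'u) cdgm"
  assumes deformation: "cdg_deformation k A At"
    and ct: "ct \<in> carrier (gr At 2)" "tvar k \<odot>\<^bsub>gr At 2\<^esub> ct = curv At"
    and universe: "infinite (UNIV :: 'u set)" "\<And>i n. inj_on e (carrier (gr (Gamma k At ct i) n))"
  defines "\<Gamma> \<equiv> (\<lambda>i. transport e (Gamma k At ct i))"
  shows "(\<forall>i. \<forall>N\<in>Ob (Hot_tor k At). t_acyclic k N \<longrightarrow>
             carrier (Hom (Hot_tor k At) (\<Gamma> i) N) = {\<one>\<^bsub>Hom (Hot_tor k At) (\<Gamma> i) N\<^esub>})
       \<and> (\<forall>i. compact_object TYPE('u) (Dt_tor k At) (\<Gamma> i))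
       \<and> (\<forall>M\<in>Ob (Dt_tor k At :: (_, ((nat \<Rightarrow> 'k, nat \<Rightarrow> 'a, 'u) cdgm, _) roof set) acat).
            zero_object (Dt_tor k At) M \<longleftrightarrow>
            (\<forall>i l. carrier (Hom (Dt_tor k At) (\<Gamma> i) (shift l M)) =
                     {\<one>\<^bsub>Hom (Dt_tor k At) (\<Gamma> i) (shift l M)\<^esub>}))"
proof -
  interpret tors k At ct by (rule cdg_deformation_tors[OF deformation ct])
  show ?thesis
  proof (intro conjI allI ballI impI)
    fix i and N :: "(nat \<Rightarrow> 'k, nat \<Rightarrow> 'a, 'u) cdgm" assume "N \<in> Ob (Hot_tor k At)" and a: "t_acyclic k N"
    then have N: "md N" by (simp add: Hot_Ob)
    show "carrier (Hom (Hot_tor k At) (\<Gamma> i) N) = {\<one>\<^bsub>Hom (Hot_tor k At) (\<Gamma> i) N\<^esub>}"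
      unfolding \<Gamma>_def Hom_Gp_trivial_iff[OF universe(2,1) N] using a t_acyclic_iff_exact[OF N] exactE_iff by blast
  next
    fix i show "compact_object TYPE('u) (Dt_tor k At) (\<Gamma> i)"
      unfolding \<Gamma>_def by (rule Gp_compact[OF universe(2,1)])
  next
    fix M :: "(nat \<Rightarrow> 'k, nat \<Rightarrow> 'a, 'u) cdgm"
    assume "M \<in> Ob (Dt_tor k At :: (_, ((nat \<Rightarrow> 'k, nat \<Rightarrow> 'a, 'u) cdgm, _) roof set) acat)"
    then have M: "md M" "torsion k M" by (simp_all add: Dt_tor_def localisation_def Hot_Ob)
    show "zero_object (Dt_tor k At) M \<longleftrightarrow> (\<forall>i l. carrier (Hom (Dt_tor k At) (\<Gamma> i) (shift l M)) =
                     {\<one>\<^bsub>Hom (Dt_tor k At) (\<Gamma> i) (shift l M)\<^esub>})"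
      \<comment> \<open>Both sides turn into statements about pairs: being zero means that all pairs
        bound, and the shifts of \<open>M\<close> run through all degrees of pairs.\<close>
      unfolding \<Gamma>_def Hom_Dt_Gp_trivial_iff[OF universe(2,1) md_shift[OF M(1)] torsion_shift[OF M(2)]]
        zero_object_Dt_iff[OF universe(1) M] by (rule exactE_shift[OF M(1)])
  qed
qed

end
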